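(* Let $G$ be a finite group and $V$ a finite dimensional $\mathbb{C}G$-module. Suppose $\alpha$ and $\beta$ in $H^{\bullet}$ are constant. Then $[\alpha,\beta]=0$.
   Context: $S(V)$ is the symmetric algebra and $A=S(V)\#G$ the skew group algebra: the vector space $S(V)\otimes\mathbb{C}G$ (write $s\overline g$ for $s\otimes g$) with $(r\overline g)(s\overline h)=r({}^gs)\overline{gh}$. $G$ acts on $A$ by conjugation by the elements $\overline g$. Fix a $G$-invariant Hermitian inner product on $V$; for $g\in G$, $V^g=\{v:{}^gv=v\}$ and $(V^g)^\perp=\mathrm{im}(1-g)$. Via $V=V^g\oplus(V^g)^\perp$ regard $(V^g)^*$ and $((V^g)^\perp)^*$ as subspaces of $V^*$. Cochains: $C^p=\bigoplus_{g\in G}C^p_g$, $C^p_g=S(V)\overline g\otimes\bigwedge^pV^*\cong\mathrm{Hom}_{\mathbb C}(\bigwedge^pV,S(V)\overline g)$; these are the cochains computing $\mathrm{HH}^\bullet(S(V),A)$ from the Koszul resolution $S(V)^e\otimes\bigwedge^\bullet V$ of $S(V)$, whose differential is $d(1\otimes1\otimes v_{1}\wedge\cdots\wedge v_{p})=\sum_i(-1)^{i+1}(v_{i}\otimes1-1\otimes v_{i})\otimes(v_{1}\wedge\cdots\widehat{v_{i}}\cdots\wedge v_{p})$. Set $$H^p_g=S(V^g)\overline g\otimes\textstyle\bigwedge^{p-\mathrm{codim} V^g}(V^g)^*\otimes\bigwedge^{\mathrm{codim} V^g}((V^g)^\perp)^*\subseteq C^p_g,\qquad H^\bullet=\bigoplus_{g\in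 G}H^\bullet_g$$ (negative exterior powers are $0$). The inclusion $H^\bullet\subseteq C^\bullet$ induces $H^\bullet\cong\mathrm{HH}^\bullet(S(V),A)$. An element of $C^\bullet$ is constant if it lies in $\bigoplus_{g\in G}\mathbb{C}\overline g\otimes\bigwedge^\bullet V^*$. Bracket: $\mathrm{HH}^\bullet(A)=\mathrm{Ext}^\bullet_{A\otimes A^{op}}(A,A)$ is computed by bar cochains $\mathrm{Hom}_{\mathbb C}(A^{\otimes p},A)$ and carries the Gerstenhaber bracket $[f,f']=f\,\overline\circ\, f'-(-1)^{(p-1)(q-1)}f'\,\overline\circ\, f$ for $f,f'$ of degrees $p,q$, where $(f\,\overline\circ\, f')(a_1\otimes\cdots\otimes a_{p+q-1})=\sum_{k=1}^p(-1)^{(q-1)(k-1)}f(a_1\otimes\cdots\otimes a_{k-1}\otimes f'(a_k\otimes\cdots\otimes a_{k+q-1})\otimes a_{k+q}\otimes\cdots\otimes a_{p+q-1})$. There is an isomorphism $\mathrm{HH}^\bullet(A)\cong(H^\bullet)^G$ sending the class of a cocycle $f\in\mathrm{Hom}_{\mathbb C}(A^{\otimes p},A)$ to the element of $H^p$ representing the class of the Koszul cocycle $v_1\wedge\cdots\wedge v_p\mapsto\sum_{\pi\in\mathrm{Sym}_p}\mathrm{sgn}(\pi)f(v_{\pi(1)}\otimes\cdots\otimes v_{\pi(p)})$, $v_i\in V$. The bracket on $(H^\bullet)^G$ is the one transported from $\mathrm{HH}^\bullet(A)$; it is extended to all of $H^\bullet$ by $[\alpha,\beta]:=[\mathcal R(\alpha),\mathcal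 R(\beta)]$ where $\mathcal R=\frac1{|G|}\sum_{g\in G}{}^g(\cdot)$ is the averaging operator. *)

theory Defs
  imports
    Complex_Main
    "HOL-Library.Poly_Mapping"
    "HOL-Combinatorics.Permutations"
    "HOL-Algebra.Group_Action"
begin

text \<open>
  Polynomials over the complex numbers whose indeterminates are named by vectors. Only vectors of a
  fixed basis of \<open>V\<close> are used as indeterminates, so that \<open>S(V)\<close> is the polynomial ring on that basis.
\<close>

type_synonym 'v sym = "('v \<Rightarrow>\<^sub>0 nat) \<Rightarrow>\<^sub>0 complex"

text \<open>
  Elements of \<open>S(V) # G\<close>: the summand \<open>s g\<close> (a polynomial \<open>s\<close> times the group element \<open>g\<close>) is
  \<open>Poly_Mapping.single g s\<close>.
\<close>

type_synonym ('g, 'v) skew = "'g \<Rightarrow>\<^sub>0 'v sym"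

definition sconst :: "complex \<Rightarrow> 'v sym"
  where "sconst c = Poly_Mapping.single 0 c"

definition ascale :: "complex \<Rightarrow> ('g, 'v) skew \<Rightarrow> ('g, 'v) skew"
  where "ascale c a = Poly_Mapping.map (\<lambda>s. sconst c * s) a"

text \<open>
  A linear map out of a \<open>p\<close>-th tensor power is represented by a multilinear function of lists of
  length \<open>p\<close> with entries in the subspace \<open>X\<close>; its values on other lists are irrelevant.
\<close>

definition multilinear_on ::
  "'a::plus set \<Rightarrow> (complex \<Rightarrow> 'a \<Rightarrow> 'a) \<Rightarrow> (complex \<Rightarrow> 'b::plus \<Rightarrow> 'b) \<Rightarrow> nat \<Rightarrow> ('a list \<Rightarrow> 'b) \<Rightarrow> bool"
  where "multilinear_on X scX scY p f \<longleftrightarrow>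
    (\<forall>xs i. length xs = p \<and> set xs \<subseteq> X \<and> i < p \<longrightarrow>
      (\<forall>x\<in>X. \<forall>y\<in>X. f (xs[i := x + y]) = f (xs[i := x]) + f (xs[i := y])) \<and>
      (\<forall>c. \<forall>x\<in>X. f (xs[i := scX c x]) = scY c (f (xs[i := x]))))"

text \<open>
  The wedge product of functionals, as an alternating form: its value on \<open>(v\<^sub>1, \<dots>, v\<^sub>p)\<close> is the
  determinant of the matrix of all \<open>\<zeta>\<^sub>i (v\<^sub>j)\<close>.
\<close>

definition wedge :: "('v \<Rightarrow> complex) list \<Rightarrow> 'v list \<Rightarrow> complex"
  where "wedge \<zeta>s vs =
    (\<Sum>\<pi> | \<pi> permutes {..<length \<zeta>s}.
       of_int (sign \<pi>) * (\<Prod>i<length \<zeta>s. (\<zeta>s ! i) (vs ! \<pi> i)))"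

locale finite_group_module =
  group_action G "UNIV :: 'v set" \<rho> + finite_dimensional_vector_space scale Basis
  for G :: "('g, 'm) monoid_scheme" (structure)
    and scale :: "complex \<Rightarrow> 'v::ab_group_add \<Rightarrow> 'v" (infixr \<open>*s\<close> 75)
    and Basis :: "'v set"
    and \<rho> :: "'g \<Rightarrow> 'v \<Rightarrow> 'v" +
  assumes finite_carrier: "finite (carrier G)"
    and linear_action: "g \<in> carrier G \<Longrightarrow> Vector_Spaces.linear scale scale (\<rho> g)"
begin

subsection \<open>The symmetric algebra and the skew group algebra\<close>

definition vec :: "'v \<Rightarrow> 'v sym"
  where "vec v =
    (\<Sum>b\<in>Basis. Poly_Mapping.single (Poly_Mapping.single b 1) (representation Basis v b))"

text \<open>\<open>S(W)\<close> for a subspace \<open>W\<close> of \<open>V\<close>: the subalgebra of polynomials generated by \<open>W\<close>.\<close>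

inductive_set Sym :: "'v set \<Rightarrow> 'v sym set" for W :: "'v set" where
  const: "sconst c \<in> Sym W"
| vec: "v \<in> W \<Longrightarrow> vec v \<in> Sym W"
| add: "s \<in> Sym W \<Longrightarrow> t \<in> Sym W \<Longrightarrow> s + t \<in> Sym W"
| mult: "s \<in> Sym W \<Longrightarrow> t \<in> Sym W \<Longrightarrow> s * t \<in> Sym W"

text \<open>
  The action of \<open>G\<close> on \<open>S(V)\<close> by algebra automorphisms: \<open>g\<close> substitutes \<open>\<rho> g b\<close> for each
  indeterminate \<open>b\<close>.
\<close>

definition act :: "'g \<Rightarrow> 'v sym \<Rightarrow> 'v sym"
  where "act g s =
    (\<Sum>m\<in>Poly_Mapping.keys s. sconst (Poly_Mapping.lookup s m) * (\<Prod>b\<in>Poly_Mapping.keys m. vec (\<rho> g b) ^ Poly_Mapping.lookup m b))"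

definition skew_algebra :: "('g, 'v) skew set"
  where "skew_algebra = {a. Poly_Mapping.keys a \<subseteq> carrier G \<and> (\<forall>g. Poly_Mapping.lookup a g \<in> Sym UNIV)}"

definition amult :: "('g, 'v) skew \<Rightarrow> ('g, 'v) skew \<Rightarrow> ('g, 'v) skew"  (infixl \<open>\<bullet>\<close> 70)
  where "a \<bullet> b =
    (\<Sum>g\<in>Poly_Mapping.keys a. \<Sum>h\<in>Poly_Mapping.keys b. Poly_Mapping.single (g \<otimes> h) (Poly_Mapping.lookup a g * act g (Poly_Mapping.lookup b h)))"

definition avec :: "'v \<Rightarrow> ('g, 'v) skew"
  where "avec v = Poly_Mapping.single \<one> (vec v)"

definition conjugate :: "'g \<Rightarrow> ('g, 'v) skew \<Rightarrow> ('g, 'v) skew"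
  where "conjugate g a = Poly_Mapping.single g 1 \<bullet> a \<bullet> Poly_Mapping.single (inv g) 1"

subsection \<open>Koszul cochains\<close>

text \<open>
  The whole complex: a function on lists of vectors whose restriction to lists of length \<open>p\<close> is, for
  each \<open>p\<close>, an alternating \<open>p\<close>-linear map into the skew group algebra, namely its component of
  degree \<open>p\<close>. Alternating maps vanish in degrees above \<open>dim V\<close>, so this is the direct sum over \<open>p\<close>.
\<close>

definition Koszul :: "('v list \<Rightarrow> ('g, 'v) skew) set"
  where "Koszul = {F.
    (\<forall>vs. F vs \<in> skew_algebra) \<and>
    (\<forall>p. multilinear_on UNIV scale ascale p F) \<and>
    (\<forall>vs i j. i < j \<and> j < length vs \<and> vs ! i = vs ! j \<longrightarrow> F vs = 0)}"

text \<open>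
  Transpose of the differential of the Koszul resolution; \<open>u \<otimes> w\<close> in the enveloping algebra acts
  on the skew group algebra by \<open>a \<mapsto> u a w\<close>. The index \<open>i\<close> starts at 0.
\<close>

definition koszul_d ::
  "('v list \<Rightarrow> ('g, 'v) skew) \<Rightarrow> 'v list \<Rightarrow> ('g, 'v) skew"
  where "koszul_d F vs =
    (\<Sum>i<length vs. ascale ((-1) ^ i)
       (let a = F (take i vs @ drop (Suc i) vs) in avec (vs ! i) \<bullet> a - a \<bullet> avec (vs ! i)))"

definition degree_part ::
  "nat \<Rightarrow> ('v list \<Rightarrow> ('g, 'v) skew) \<Rightarrow> 'v list \<Rightarrow> ('g, 'v) skew"
  where "degree_part p F vs = (if length vs = p then F vs else 0)"

definition group_part ::
  "'g \<Rightarrow> ('v list \<Rightarrow> ('g, 'v) skew) \<Rightarrow> 'v list \<Rightarrow> ('g, 'v) skew"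
  where "group_part g F vs = Poly_Mapping.single g (Poly_Mapping.lookup (F vs) g)"

definition is_constant :: "('v list \<Rightarrow> ('g, 'v) skew) \<Rightarrow> bool"
  where "is_constant F \<longleftrightarrow> F \<in> Koszul \<and> (\<forall>vs g. \<exists>c. Poly_Mapping.lookup (F vs) g = sconst c)"

subsection \<open>The space representing the cohomology\<close>

definition fixed :: "'g \<Rightarrow> 'v set"
  where "fixed g = {v. \<rho> g v = v}"

text \<open>
  The image of \<open>1 - g\<close>, which is the orthogonal complement of \<open>fixed g\<close> for every \<open>G\<close>-invariant
  Hermitian inner product on \<open>V\<close>.
\<close>

definition fixed_perp :: "'g \<Rightarrow> 'v set"
  where "fixed_perp g = range (\<lambda>v. v - \<rho> g v)"

definition codim_fixed :: "'g \<Rightarrow> nat"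
  where "codim_fixed g = dim (UNIV :: 'v set) - dim (fixed g)"

text \<open>
  For \<open>V = W \<oplus> W'\<close>, the dual of \<open>W\<close> is the space of functionals on \<open>V\<close> that vanish on \<open>W'\<close>.
\<close>

definition annihilator :: "'v set \<Rightarrow> ('v \<Rightarrow> complex) set"
  where "annihilator W = {\<zeta>. Vector_Spaces.linear scale (*) \<zeta> \<and> (\<forall>w\<in>W. \<zeta> w = 0)}"

definition decomposable ::
  "nat \<Rightarrow> 'g \<Rightarrow> 'v sym \<Rightarrow> ('v \<Rightarrow> complex) list \<Rightarrow> 'v list \<Rightarrow> ('g, 'v) skew"
  where "decomposable p g s \<zeta>s vs =
    (if length vs = p then Poly_Mapping.single g (sconst (wedge \<zeta>s vs) * s) else 0)"

text \<open>
  The span of the decomposable cochains in the degree \<open>p\<close>, group element \<open>g\<close> summand. For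
  \<open>p < codim_fixed g\<close> there are none, and the set is zero.
\<close>

inductive_set H_summand :: "nat \<Rightarrow> 'g \<Rightarrow> ('v list \<Rightarrow> ('g, 'v) skew) set"
  for p :: nat and g :: 'g where
  zero: "(\<lambda>_. 0) \<in> H_summand p g"
| add: "F \<in> H_summand p g \<Longrightarrow> s \<in> Sym (fixed g) \<Longrightarrow>
    length \<xi>s + codim_fixed g = p \<Longrightarrow> set \<xi>s \<subseteq> annihilator (fixed_perp g) \<Longrightarrow>
    length \<eta>s = codim_fixed g \<Longrightarrow> set \<eta>s \<subseteq> annihilator (fixed g) \<Longrightarrow>
    (\<lambda>vs. F vs + decomposable p g s (\<xi>s @ \<eta>s) vs) \<in> H_summand p g"

definition H :: "('v list \<Rightarrow> ('g, 'v) skew) set"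
  where "H = {F \<in> Koszul. \<forall>p. \<forall>g\<in>carrier G. degree_part p (group_part g F) \<in> H_summand p g}"

definition H_degree :: "nat \<Rightarrow> ('v list \<Rightarrow> ('g, 'v) skew) set"
  where "H_degree p = {F \<in> H. degree_part p F = F}"

definition average :: "('v list \<Rightarrow> ('g, 'v) skew) \<Rightarrow> 'v list \<Rightarrow> ('g, 'v) skew"
  where "average F vs = ascale (1 / of_nat (card (carrier G)))
    (\<Sum>g\<in>carrier G. conjugate g (F (map (\<rho> (inv g)) vs)))"

subsection \<open>Hochschild cohomology of the skew group algebra\<close>

definition bar_cochain :: "nat \<Rightarrow> (('g, 'v) skew list \<Rightarrow> ('g, 'v) skew) \<Rightarrow> bool"
  where "bar_cochain p f \<longleftrightarrow>
    (\<forall>as. length as = p \<and> set as \<subseteq> skew_algebra \<longrightarrow> f as \<in> skew_algebra) \<and>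
    multilinear_on skew_algebra ascale ascale p f"

definition bar_d ::
  "nat \<Rightarrow> (('g, 'v) skew list \<Rightarrow> ('g, 'v) skew) \<Rightarrow> ('g, 'v) skew list \<Rightarrow> ('g, 'v) skew"
  where "bar_d p f as =
    hd as \<bullet> f (tl as)
    + (\<Sum>i<p. ascale ((-1) ^ Suc i)
        (f (take i as @ [as ! i \<bullet> as ! Suc i] @ drop (i + 2) as)))
    + ascale ((-1) ^ Suc p) (f (butlast as) \<bullet> last as)"

definition bar_cocycle :: "nat \<Rightarrow> (('g, 'v) skew list \<Rightarrow> ('g, 'v) skew) \<Rightarrow> bool"
  where "bar_cocycle p f \<longleftrightarrow> bar_cochain p f \<and>
    (\<forall>as. length as = Suc p \<and> set as \<subseteq> skew_algebra \<longrightarrow> bar_d p f as = 0)"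

text \<open>
  In the next two definitions the exponents \<open>(q - 1) (k - 1)\<close> and \<open>(p - 1) (q - 1)\<close> are replaced by
  natural numbers of the same parity, with \<open>i = k - 1\<close>, so that degree 0 needs no special treatment.
\<close>

definition circle_product ::
  "nat \<Rightarrow> nat \<Rightarrow> (('g, 'v) skew list \<Rightarrow> ('g, 'v) skew) \<Rightarrow>
   (('g, 'v) skew list \<Rightarrow> ('g, 'v) skew) \<Rightarrow> ('g, 'v) skew list \<Rightarrow> ('g, 'v) skew"
  where "circle_product p q f f' as =
    (\<Sum>i<p. ascale ((-1) ^ ((q + 1) * i))
       (f (take i as @ [f' (take q (drop i as))] @ drop (i + q) as)))"

definition bar_bracket ::
  "nat \<Rightarrow> nat \<Rightarrow> (('g, 'v) skew list \<Rightarrow> ('g, 'v) skew) \<Rightarrow>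
   (('g, 'v) skew list \<Rightarrow> ('g, 'v) skew) \<Rightarrow> ('g, 'v) skew list \<Rightarrow> ('g, 'v) skew"
  where "bar_bracket p q f f' as =
    circle_product p q f f' as - ascale ((-1) ^ ((p + 1) * (q + 1))) (circle_product q p f' f as)"

definition to_koszul ::
  "nat \<Rightarrow> (('g, 'v) skew list \<Rightarrow> ('g, 'v) skew) \<Rightarrow> 'v list \<Rightarrow> ('g, 'v) skew"
  where "to_koszul p f vs = (if length vs = p
    then \<Sum>\<pi> | \<pi> permutes {..<p}.
      ascale (of_int (sign \<pi>)) (f (map (\<lambda>i. avec (vs ! \<pi> i)) [0..<p]))
    else 0)"

text \<open>
  The isomorphism from Hochschild cohomology to the \<open>G\<close>-invariants of \<open>H\<close>, evaluated on the class of
  a cocycle, and a choice of cocycle in the class corresponding to an invariant element of \<open>H\<close>.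
\<close>

definition HH_to_H ::
  "nat \<Rightarrow> (('g, 'v) skew list \<Rightarrow> ('g, 'v) skew) \<Rightarrow> 'v list \<Rightarrow> ('g, 'v) skew"
  where "HH_to_H p f =
    (THE \<gamma>. \<gamma> \<in> H_degree p \<and> (\<lambda>vs. to_koszul p f vs - \<gamma> vs) \<in> koszul_d ` Koszul)"

definition H_to_HH ::
  "nat \<Rightarrow> ('v list \<Rightarrow> ('g, 'v) skew) \<Rightarrow> ('g, 'v) skew list \<Rightarrow> ('g, 'v) skew"
  where "H_to_HH p \<alpha> = (SOME f. bar_cocycle p f \<and> HH_to_H p f = \<alpha>)"

text \<open>
  The transported bracket on homogeneous invariant elements of degrees \<open>p\<close> and \<open>q\<close>. If \<open>p = q = 0\<close>,
  the bracket of the cocycles is an empty sum, so the truncated subtraction does no harm.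
\<close>

definition bracket_degree ::
  "nat \<Rightarrow> nat \<Rightarrow> ('v list \<Rightarrow> ('g, 'v) skew) \<Rightarrow> ('v list \<Rightarrow> ('g, 'v) skew) \<Rightarrow>
   'v list \<Rightarrow> ('g, 'v) skew"
  where "bracket_degree p q \<alpha> \<beta> =
    HH_to_H (p + q - 1) (bar_bracket p q (H_to_HH p \<alpha>) (H_to_HH q \<beta>))"

definition bracket ::
  "('v list \<Rightarrow> ('g, 'v) skew) \<Rightarrow> ('v list \<Rightarrow> ('g, 'v) skew) \<Rightarrow> 'v list \<Rightarrow> ('g, 'v) skew"
  where "bracket \<alpha> \<beta> vs =
    (\<Sum>p\<le>dimension. \<Sum>q\<le>dimension.
       bracket_degree p q (degree_part p (average \<alpha>)) (degree_part q (average \<beta>)) vs)"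

end

end

theory Submission
  imports Defs "HOL-Library.Function_Algebras" "HOL-Algebra.Multiplicative_Group"
begin

text \<open>
  The automorphism \<open>v \<mapsto> 2 v\<close>, \<open>g \<mapsto> g\<close> of \<open>A = S(V) # G\<close> acts on Hochschild cohomology compatibly with the
  Gerstenhaber bracket. It multiplies a constant class of degree \<open>p\<close> by \<open>2\<^sup>-\<^sup>p\<close>, hence the bracket of
  constant classes of degrees \<open>p\<close> and \<open>q\<close> by \<open>2\<^sup>-\<^sup>p\<^sup>-\<^sup>q\<close>. On elements of \<open>H\<close> of degree \<open>p + q - 1\<close> with
  coefficients homogeneous of degree \<open>k\<close> it acts as \<open>2\<close> to the power \<open>k - (p + q - 1)\<close>, which is never
  \<open>2\<^sup>-\<^sup>p\<^sup>-\<^sup>q\<close>; so the bracket is zero.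

  That antisymmetrisation identifies classes of bar cocycles with classes of invariant Koszul cocycles
  is shown for all bimodules \<open>M\<close> at once, by dimension shifting along \<open>M \<rightarrow> Hom(A, M)\<close>, whose target is
  acyclic for both complexes. That every class of Koszul cocycles contains exactly one element of \<open>H\<close>
  follows, for each group element, from a Laplacian whose kernel is the corresponding part of \<open>H\<close>.
\<close>

subsection \<open>Koszul and bar cochains of a bimodule\<close>

text \<open>The scaling argument needs neither an explicit bar cocycle for a constant class nor a
  bracket formula on Koszul cochains. It needs that the comparison of the two complexes is an
  isomorphism in both senses: surjectivity supplies the cocycle that the definition of the bracket
  chooses, and injectivity shows that the twisted cocycle and its scalar multiple differ by a bar
  coboundary. As the chosen cocycle is known only up to coboundaries, the bracket must respect them,
  and this is the graded Jacobi identity with the multiplication as third cochain. Bar cochains take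
  arguments in all of \<open>A\<close>, Koszul cochains only in \<open>V\<close>; the group is
  absorbed by averaging, and invariance is what makes cocycles of degree 0 central. In place of 2
  any nonzero scalar that is not a root of unity would do: the two powers agree only if
  \<open>k - (p + q - 1) = - p - q\<close>, that is for \<open>k = -1\<close>, and no polynomial has
  that degree.\<close>

definition multilin :: "(complex \<Rightarrow> 'x::ab_group_add \<Rightarrow> 'x) \<Rightarrow> (complex \<Rightarrow> 'y::ab_group_add \<Rightarrow> 'y) \<Rightarrow> ('x list \<Rightarrow> 'y) \<Rightarrow> bool"
  where "multilin sx sy f \<longleftrightarrow>
    (\<forall>as bs x y. f (as @ (x + y) # bs) = f (as @ x # bs) + f (as @ y # bs)) \<and>
    (\<forall>as bs c x. f (as @ sx c x # bs) = sy c (f (as @ x # bs)))"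

lemma multilin_add: "multilin sx sy f \<Longrightarrow> f (as @ (x + y) # bs) = f (as @ x # bs) + f (as @ y # bs)"
  by (simp add: multilin_def)

lemma multilin_scale: "multilin sx sy f \<Longrightarrow> f (as @ sx c x # bs) = sy c (f (as @ x # bs))"
  by (simp add: multilin_def)

lemma multilin_Cons_add: "multilin sx sy f \<Longrightarrow> f ((x + y) # bs) = f (x # bs) + f (y # bs)"
  using multilin_add[of sx sy f "[]"] by simp

lemma multilin_Cons_scale: "multilin sx sy f \<Longrightarrow> f (sx c x # bs) = sy c (f (x # bs))"
  using multilin_scale[of sx sy f "[]"] by simp

lemma multilin_Cons: "multilin sx sy f \<Longrightarrow> multilin sx sy (\<lambda>xs. f (a # xs))"
  unfolding multilin_def by (metis append_Cons)

text \<open>The signed sum over all positions at which \<open>a\<close> can enter the argument list.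
  Iterated, it antisymmetrises one argument at a time, so that chain map properties follow by
  induction on lists and not from manipulations of permutations.\<close>

primrec insert_alt :: "'a \<Rightarrow> ('a list \<Rightarrow> 'b::ab_group_add) \<Rightarrow> 'a list \<Rightarrow> 'b"
  where
    "insert_alt a f [] = f [a]"
  | "insert_alt a f (b # l) = f (a # b # l) - insert_alt a (\<lambda>m. f (b # m)) l"

primrec alternate :: "('v \<Rightarrow> 'a) \<Rightarrow> ('a list \<Rightarrow> 'b::ab_group_add) \<Rightarrow> 'v list \<Rightarrow> 'b"
  where
    "alternate av f [] = f []"
  | "alternate av f (v # vs) = alternate av (insert_alt (av v) f) vs"

text \<open>The Koszul complex as an iterated cone: the first argument \<open>v\<close> contributes
  the commutator with \<open>v\<close>, minus the differential of the cochain in which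
  \<open>v\<close> is held in place.\<close>

primrec kdiff :: "('v \<Rightarrow> 'b \<Rightarrow> 'b) \<Rightarrow> ('v list \<Rightarrow> 'b::ab_group_add) \<Rightarrow> 'v list \<Rightarrow> 'b"
  where
    "kdiff ad F [] = 0"
  | "kdiff ad F (v # vs) = ad v (F vs) - kdiff ad (\<lambda>ws. F (v # ws)) vs"

text \<open>With no argument left to multiply, the product turns into the right action. Thus the
  inner faces and the last face of the bar differential become cases of one operation.\<close>

definition merge_head :: "('a \<Rightarrow> 'a \<Rightarrow> 'a) \<Rightarrow> ('a \<Rightarrow> 'b \<Rightarrow> 'b) \<Rightarrow> 'a \<Rightarrow> ('a list \<Rightarrow> 'b) \<Rightarrow> 'a list \<Rightarrow> 'b"
  where "merge_head mul R a f l = (case l of [] \<Rightarrow> R a (f []) | b # m \<Rightarrow> f (mul a b # m))"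

lemma merge_head_simps [simp]:
  "merge_head mul R a f [] = R a (f [])"
  "merge_head mul R a f (b # m) = f (mul a b # m)"
  by (simp_all add: merge_head_def)

text \<open>All faces of the bar differential except the left multiplication. Separated in this way,
  fixing the first argument reproduces the same operation up to sign, which the left face would
  spoil.\<close>

primrec tail_diff :: "('a \<Rightarrow> 'a \<Rightarrow> 'a) \<Rightarrow> ('a \<Rightarrow> 'b \<Rightarrow> 'b) \<Rightarrow> ('a list \<Rightarrow> 'b::ab_group_add) \<Rightarrow> 'a list \<Rightarrow> 'b"
  where
    "tail_diff mul R f [] = 0"
  | "tail_diff mul R f (a # l) = - merge_head mul R a f l - tail_diff mul R (\<lambda>m. f (a # m)) l"

definition head_mult :: "('a \<Rightarrow> 'b \<Rightarrow> 'b) \<Rightarrow> ('a list \<Rightarrow> 'b::ab_group_add) \<Rightarrow> 'a list \<Rightarrow> 'b"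
  where "head_mult L f l = (case l of [] \<Rightarrow> 0 | a # m \<Rightarrow> L a (f m))"

lemma head_mult_simps [simp]:
  "head_mult L f [] = 0"
  "head_mult L f (a # m) = L a (f m)"
  by (simp_all add: head_mult_def)

definition bdiff :: "('a \<Rightarrow> 'a \<Rightarrow> 'a) \<Rightarrow> ('a \<Rightarrow> 'b \<Rightarrow> 'b) \<Rightarrow> ('a \<Rightarrow> 'b \<Rightarrow> 'b) \<Rightarrow> ('a list \<Rightarrow> 'b::ab_group_add) \<Rightarrow> 'a list \<Rightarrow> 'b"
  where "bdiff mul L R f l = head_mult L f l + tail_diff mul R f l"

section \<open>Formal rules for the recursive operations on cochains\<close>

lemma insert_alt_add:
  "insert_alt a (\<lambda>m. f m + h m) l = insert_alt a f l + insert_alt a h l"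
  by (induction l arbitrary: f h) auto

lemma insert_alt_diff:
  "insert_alt a (\<lambda>m. f m - h m) l = insert_alt a f l - insert_alt a h l"
  by (induction l arbitrary: f h) auto

lemma insert_alt_zero [simp]: "insert_alt a (\<lambda>m. 0) l = 0"
  by (induction l) auto

lemma insert_alt_hom:
  assumes "\<And>x y. \<phi> (x - y) = \<phi> x - \<phi> y"
  shows "insert_alt a (\<lambda>m. \<phi> (f m)) l = \<phi> (insert_alt a f l)"
  using assms by (induction l arbitrary: f) auto

text \<open>Terms in which the two copies of \<open>a\<close> trade places carry opposite signs.
  This is why antisymmetrised cochains vanish on repeated arguments.\<close>

lemma insert_alt_insert_alt: "insert_alt a (insert_alt a f) l = 0"
proof (induction l arbitrary: f)
  case (Cons b l)
  show ?case by (simp add: insert_alt_diff Cons)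
qed simp

lemma insert_alt_cong:
  assumes "\<And>m. length m = Suc (length l) \<Longrightarrow> set m \<subseteq> insert a (set l) \<Longrightarrow> f m = h m"
  shows "insert_alt a f l = insert_alt a h l"
  using assms
proof (induction l arbitrary: f h)
  case (Cons b l)
  have "insert_alt a (\<lambda>m. f (b # m)) l = insert_alt a (\<lambda>m. h (b # m)) l"
    by (rule Cons.IH) (rule Cons.prems, auto)
  then show ?case using Cons.prems[of "a # b # l"] by auto
qed simp

lemma alternate_cong:
  assumes "\<And>m. length m = length vs \<Longrightarrow> set m \<subseteq> range av \<Longrightarrow> f m = h m"
  shows "alternate av f vs = alternate av h vs"
  using assms
proof (induction vs arbitrary: f h)
  case (Cons v vs)
  have "alternate av (insert_alt (av v) f) vs = alternate av (insert_alt (av v) h) vs"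
    by (rule Cons.IH, rule insert_alt_cong, rule Cons.prems) auto
  then show ?case by simp
qed simp

lemma alternate_zero [simp]: "alternate av (\<lambda>m. 0 :: 'b::ab_group_add) vs = 0"
proof (induction vs)
  case (Cons v vs)
  have "insert_alt (av v) (\<lambda>m. 0 :: 'b) = (\<lambda>m. 0)" by (rule ext) simp
  then show ?case using Cons by simp
qed simp

lemma alternate_add: "alternate av (\<lambda>m. f m + h m) vs = alternate av f vs + alternate av h vs"
proof (induction vs arbitrary: f h)
  case (Cons v vs)
  have "insert_alt (av v) (\<lambda>m. f m + h m) = (\<lambda>m. insert_alt (av v) f m + insert_alt (av v) h m)"
    by (rule ext) (rule insert_alt_add)
  then show ?case by (simp add: Cons)
qed simp

lemma alternate_hom:
  assumes "\<And>x y. \<phi> (x - y) = \<phi> x - \<phi> y"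
  shows "alternate av (\<lambda>m. \<phi> (f m)) vs = \<phi> (alternate av f vs)"
proof (induction vs arbitrary: f)
  case (Cons v vs)
  have "insert_alt (av v) (\<lambda>m. \<phi> (f m)) = (\<lambda>m. \<phi> (insert_alt (av v) f m))"
    by (rule ext) (rule insert_alt_hom[OF assms])
  then show ?case by (simp add: Cons)
qed simp

lemma alternate_diff: "alternate av (\<lambda>m. f m - h m) vs = alternate av f vs - alternate av h vs"
  using alternate_add[of av "\<lambda>m. f m - h m" h vs] by simp

lemma kdiff_add:
  assumes "\<And>v x y. ad v (x + y) = ad v x + ad v y"
  shows "kdiff ad (\<lambda>ws. F ws + H ws) vs = kdiff ad F vs + kdiff ad H vs"
  using assms by (induction vs arbitrary: F H) (auto simp: algebra_simps)

lemma kdiff_hom: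
  assumes "\<And>x y. \<phi> (x - y) = \<phi> x - \<phi> y" and "\<And>v ws. ad' v (\<phi> (F ws)) = \<phi> (ad v (F ws))"
  shows "kdiff ad' (\<lambda>ws. \<phi> (F ws)) vs = \<phi> (kdiff ad F vs)"
proof -
  have z: "\<phi> 0 = 0" using assms(1)[of 0 0] by simp
  show ?thesis using assms(2)
  proof (induction vs arbitrary: F)
    case (Cons v vs)
    have "kdiff ad' (\<lambda>ws. \<phi> (F (v # ws))) vs = \<phi> (kdiff ad (\<lambda>ws. F (v # ws)) vs)"
      by (rule Cons.IH) (rule Cons.prems)
    then show ?case using Cons.prems[of v vs] by (simp add: assms(1))
  qed (simp add: z)
qed

lemma kdiff_cong:
  assumes "\<And>ws. Suc (length ws) = length vs \<Longrightarrow> F ws = H ws"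
  shows "kdiff ad F vs = kdiff ad H vs"
  using assms
proof (induction vs arbitrary: F H)
  case (Cons v vs)
  have "kdiff ad (\<lambda>ws. F (v # ws)) vs = kdiff ad (\<lambda>ws. H (v # ws)) vs"
    by (rule Cons.IH) (rule Cons.prems, simp)
  then show ?case using Cons.prems[of vs] by simp
qed simp

lemma kdiff_zero:
  assumes "\<And>v. ad v 0 = 0" and "\<And>ws. Suc (length ws) = length vs \<Longrightarrow> F ws = 0"
  shows "kdiff ad F vs = 0"
  using assms(2) by (induction vs arbitrary: F) (auto simp: assms(1))

lemma tail_diff_hom:
  assumes "\<And>x y. \<phi> (x - y) = \<phi> x - \<phi> y" and "\<And>a m. R' a (\<phi> (f m)) = \<phi> (R a (f m))"
  shows "tail_diff mul R' (\<lambda>m. \<phi> (f m)) l = \<phi> (tail_diff mul R f l)"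
proof -
  have z: "\<phi> 0 = 0" using assms(1)[of 0 0] by simp
  have n: "\<phi> (- x) = - \<phi> x" for x using assms(1)[of 0 x] z by simp
  show ?thesis using assms(2)
  proof (induction l arbitrary: f)
    case (Cons a l)
    have "tail_diff mul R' (\<lambda>m. \<phi> (f (a # m))) l = \<phi> (tail_diff mul R (\<lambda>m. f (a # m)) l)"
      by (rule Cons.IH) (rule Cons.prems)
    then show ?case using Cons.prems[of a "[]"] by (cases l) (simp_all add: assms(1) n)
  qed (simp add: z)
qed

lemma tail_diff_cong:
  assumes "\<And>m. Suc (length m) = length l \<Longrightarrow> f m = h m"
  shows "tail_diff mul R f l = tail_diff mul R h l"
  using assms
proof (induction l arbitrary: f h)
  case (Cons a l)
  have "tail_diff mul R (\<lambda>m. f (a # m)) l = tail_diff mul R (\<lambda>m. h (a # m)) l"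
    by (rule Cons.IH) (rule Cons.prems, simp)
  moreover have "merge_head mul R a f l = merge_head mul R a h l"
    using Cons.prems by (cases l) auto
  ultimately show ?case by simp
qed simp

lemma tail_diff_add:
  assumes "\<And>a x y. R a (x + y) = R a x + R a y"
  shows "tail_diff mul R (\<lambda>m. f m + h m) l = tail_diff mul R f l + tail_diff mul R h l"
proof (induction l arbitrary: f h)
  case (Cons a l)
  have "merge_head mul R a (\<lambda>m. f m + h m) l = merge_head mul R a f l + merge_head mul R a h l"
    by (cases l) (simp_all add: assms)
  then show ?case by (simp add: Cons)
qed simp

lemma head_mult_cong:
  assumes "\<And>m. Suc (length m) = length l \<Longrightarrow> f m = h m"
  shows "head_mult L f l = head_mult L h l"
  using assms by (cases l) auto

lemma bdiff_cong:
  assumes "\<And>m. Suc (length m) = length l \<Longrightarrow> f m = h m"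
  shows "bdiff mul L R f l = bdiff mul L R h l"
proof -
  have "tail_diff mul R f l = tail_diff mul R h l"
    by (rule tail_diff_cong) (rule assms)
  moreover have "head_mult L f l = head_mult L h l"
    by (rule head_mult_cong) (rule assms)
  ultimately show ?thesis by (simp add: bdiff_def)
qed

text \<open>What the comparison uses of \<open>S(V) # G\<close>: \<open>av\<close> and
  \<open>ug\<close> embed \<open>V\<close> and the group, \<open>D j\<close> differentiates
  coefficients in the direction \<open>j\<close>, and \<open>comp k\<close> takes their homogeneous
  part of degree \<open>k\<close>. The intended type contains values outside the algebra, so
  \<open>e\<close> is a unit only on products; in general multiplication by \<open>e\<close> is the
  projection onto the algebra.\<close>

locale koszul_algebra = G?: group G + alg: vector_space sc + vsp: vector_space vsc
  for G :: "('g, 'm) monoid_scheme" (structure)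
    and sc :: "complex \<Rightarrow> 'a::ab_group_add \<Rightarrow> 'a"
    and vsc :: "complex \<Rightarrow> 'v::ab_group_add \<Rightarrow> 'v" +
  fixes mul :: "'a \<Rightarrow> 'a \<Rightarrow> 'a" (infixl \<open>\<odot>\<close> 70)
    and e :: 'a
    and av :: "'v \<Rightarrow> 'a"
    and ug :: "'g \<Rightarrow> 'a"
    and \<rho> :: "'g \<Rightarrow> 'v \<Rightarrow> 'v"
    and J :: "'v set"
    and co :: "'v \<Rightarrow> 'v \<Rightarrow> complex"
    and D :: "'v \<Rightarrow> 'a \<Rightarrow> 'a"
    and comp :: "nat \<Rightarrow> 'a \<Rightarrow> 'a"
  assumes mul_add_left: "(a + b) \<odot> a' = a \<odot> a' + b \<odot> a'"
    and mul_add_right: "a \<odot> (b + a') = a \<odot> b + a \<odot> a'"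
    and mul_sc_left: "sc c a \<odot> b = sc c (a \<odot> b)"
    and mul_sc_right: "a \<odot> sc c b = sc c (a \<odot> b)"
    and mul_assoc: "a \<odot> b \<odot> a' = a \<odot> (b \<odot> a')"
    and e_comm: "e \<odot> a = a \<odot> e"
    and e_mul: "e \<odot> (a \<odot> b) = a \<odot> b"
    and av_add: "av (v + w) = av v + av w"
    and av_sc: "av (vsc c v) = sc c (av v)"
    and av_comm: "av v \<odot> av w = av w \<odot> av v"
    and finite_G: "finite (carrier G)"
    and ug_mul: "g \<in> carrier G \<Longrightarrow> h \<in> carrier G \<Longrightarrow> ug g \<odot> ug h = ug (g \<otimes> h)"
    and ug_one: "ug \<one> = e"
    and rho_add: "g \<in> carrier G \<Longrightarrow> \<rho> g (v + w) = \<rho> g v + \<rho> g w"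
    and rho_sc: "g \<in> carrier G \<Longrightarrow> \<rho> g (vsc c v) = vsc c (\<rho> g v)"
    and rho_mul: "g \<in> carrier G \<Longrightarrow> h \<in> carrier G \<Longrightarrow> \<rho> g (\<rho> h v) = \<rho> (g \<otimes> h) v"
    and rho_one: "\<rho> \<one> v = v"
    and ug_av: "g \<in> carrier G \<Longrightarrow> ug g \<odot> av v = av (\<rho> g v) \<odot> ug g"
    and generated: "(\<forall>a b. Q a \<longrightarrow> Q b \<longrightarrow> Q (a + b)) \<Longrightarrow> (\<forall>a b. Q a \<longrightarrow> Q b \<longrightarrow> Q (a \<odot> b)) \<Longrightarrow>
        (\<forall>c a. Q a \<longrightarrow> Q (sc c a)) \<Longrightarrow> (\<forall>v. Q (av v)) \<Longrightarrow> (\<forall>g\<in>carrier G. Q (ug g)) \<Longrightarrow> Q (e \<odot> a)"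
    and finite_J: "finite J"
    and co_sum: "(\<Sum>j\<in>J. vsc (co j v) j) = v"
    and D_add: "D j (a + b) = D j a + D j b"
    and D_sc: "D j (sc c a) = sc c (D j a)"
    and D_e: "D j (e \<odot> a) = e \<odot> D j a"
    and D_av: "j \<in> J \<Longrightarrow> D j (av v \<odot> a) = sc (co j v) (e \<odot> a) + av v \<odot> D j a"
    and comp_add: "comp k (a + b) = comp k a + comp k b"
    and comp_sc: "comp k (sc c a) = sc c (comp k a)"
    and comp_e: "comp k (e \<odot> a) = comp k a"
    and comp_D: "comp k (D j a) = D j (comp (Suc k) a)"
    and comp_D0: "D j (comp 0 a) = 0"
    and euler_comp: "(\<Sum>j\<in>J. av j \<odot> D j (comp k a)) = sc (of_nat k) (comp k a)"
    and comp_euler: "comp k (\<Sum>j\<in>J. av j \<odot> D j a) = sc (of_nat k) (comp k a)"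
    and comp_bound: "\<exists>n. \<forall>k>n. comp k a = 0"
    and comp_sum: "(\<forall>k>n. comp k a = 0) \<Longrightarrow> (\<Sum>k\<le>n. comp k a) = e \<odot> a"
begin

lemma mul_zero [simp]: "0 \<odot> a = 0" "a \<odot> 0 = 0"
  using mul_add_left[of 0 0 a] mul_add_right[of a 0 0] by auto

end

text \<open>The bimodule is a subset \<open>M\<close> of a type. Additivity and homogeneity in the
  module argument are required on the whole type, which lets sums and scalars pass through
  \<open>L\<close> and \<open>R\<close> without membership conditions; the laws that involve the
  algebra are required on \<open>M\<close>.\<close>

locale koszul_bimodule = koszul_algebra G sc vsc mul e av ug \<rho> J co D comp + mod: vector_space scb
  for G :: "('g, 'm) monoid_scheme" (structure)
    and sc :: "complex \<Rightarrow> 'a::ab_group_add \<Rightarrow> 'a"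
    and vsc :: "complex \<Rightarrow> 'v::ab_group_add \<Rightarrow> 'v"
    and mul (infixl \<open>\<odot>\<close> 70) and e av ug \<rho> J co D comp
    and scb :: "complex \<Rightarrow> 'b::ab_group_add \<Rightarrow> 'b" +
  fixes M :: "'b set"
    and L R :: "'a \<Rightarrow> 'b \<Rightarrow> 'b"
  assumes M_zero: "0 \<in> M"
    and M_add: "m \<in> M \<Longrightarrow> n \<in> M \<Longrightarrow> m + n \<in> M"
    and M_sc: "m \<in> M \<Longrightarrow> scb c m \<in> M"
    and L_closed: "m \<in> M \<Longrightarrow> L a m \<in> M"
    and R_closed: "m \<in> M \<Longrightarrow> R a m \<in> M"
    and L_add: "L a (m + n) = L a m + L a n"
    and R_add: "R a (m + n) = R a m + R a n"
    and L_sc: "L a (scb c m) = scb c (L a m)"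
    and R_sc: "R a (scb c m) = scb c (R a m)"
    and L_add_left: "m \<in> M \<Longrightarrow> L (a + b) m = L a m + L b m"
    and R_add_left: "m \<in> M \<Longrightarrow> R (a + b) m = R a m + R b m"
    and L_sc_left: "m \<in> M \<Longrightarrow> L (sc c a) m = scb c (L a m)"
    and R_sc_left: "m \<in> M \<Longrightarrow> R (sc c a) m = scb c (R a m)"
    and L_mul: "m \<in> M \<Longrightarrow> L a (L b m) = L (a \<odot> b) m"
    and R_mul: "m \<in> M \<Longrightarrow> R b (R a m) = R (a \<odot> b) m"
    and L_R: "m \<in> M \<Longrightarrow> L a (R b m) = R b (L a m)"
    and L_e: "m \<in> M \<Longrightarrow> L e m = m"
    and R_e: "m \<in> M \<Longrightarrow> R e m = m"
begin

lemma M_minus: "m \<in> M \<Longrightarrow> - m \<in> M"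
  using M_sc[of m "-1"] by simp

lemma M_diff: "m \<in> M \<Longrightarrow> n \<in> M \<Longrightarrow> m - n \<in> M"
  using M_add[of m "- n"] M_minus[of n] by simp

lemma M_sum: "(\<And>i. i \<in> I \<Longrightarrow> f i \<in> M) \<Longrightarrow> sum f I \<in> M"
  by (induction I rule: infinite_finite_induct) (auto intro: M_zero M_add)

lemma L_zero [simp]: "L a 0 = 0" and R_zero [simp]: "R a 0 = 0"
  using L_add[of a 0 0] R_add[of a 0 0] by auto

lemma L_minus: "L a (- m) = - L a m" and R_minus: "R a (- m) = - R a m"
  using L_add[of a m "- m"] R_add[of a m "- m"] by (auto simp: minus_unique)

lemma L_diff: "L a (m - n) = L a m - L a n" and R_diff: "R a (m - n) = R a m - R a n"
  using L_add[of a m "- n"] R_add[of a m "- n"] by (auto simp: L_minus R_minus)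

lemma L_sum: "L a (sum f I) = (\<Sum>i\<in>I. L a (f i))"
  by (induction I rule: infinite_finite_induct) (auto simp: L_add)

lemma R_sum: "R a (sum f I) = (\<Sum>i\<in>I. R a (f i))"
  by (induction I rule: infinite_finite_induct) (auto simp: R_add)

definition ad :: "'v \<Rightarrow> 'b \<Rightarrow> 'b"
  where "ad v m = L (av v) m - R (av v) m"

definition kcoch :: "('v list \<Rightarrow> 'b) set"
  where "kcoch = {F. (\<forall>vs. F vs \<in> M) \<and> multilin vsc scb F \<and> (\<forall>as v bs. F (as @ v # v # bs) = 0)}"

text \<open>The last condition says that only the projections of the arguments to the algebra
  matter. It is not the usual normalisation by vanishing on the unit.\<close>

definition hcoch :: "('a list \<Rightarrow> 'b) set"
  where "hcoch = {f. (\<forall>as. f as \<in> M) \<and> multilin sc scb f \<and> (\<forall>as a bs. f (as @ (e \<odot> a) # bs) = f (as @ a # bs))}"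

abbreviation "kd \<equiv> kdiff ad"
abbreviation "bd \<equiv> bdiff mul L R"
abbreviation "alt \<equiv> alternate av"

lemma ad_closed: "m \<in> M \<Longrightarrow> ad v m \<in> M"
  by (simp add: ad_def M_diff L_closed R_closed)

lemma ad_add: "ad v (m + n) = ad v m + ad v n"
  by (simp add: ad_def L_add R_add)

lemma ad_zero [simp]: "ad v 0 = 0"
  by (simp add: ad_def)

lemma ad_diff: "ad v (m - n) = ad v m - ad v n"
  by (simp add: ad_def L_diff R_diff)

lemma ad_sc: "ad v (scb c m) = scb c (ad v m)"
  by (simp add: ad_def L_sc R_sc mod.scale_right_diff_distrib)

lemma ad_add_left: "m \<in> M \<Longrightarrow> ad (v + w) m = ad v m + ad w m"
  by (simp add: ad_def av_add L_add_left R_add_left)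

lemma ad_sc_left: "m \<in> M \<Longrightarrow> ad (vsc c v) m = scb c (ad v m)"
  by (simp add: ad_def av_sc L_sc_left R_sc_left mod.scale_right_diff_distrib)

lemma ad_comm: "m \<in> M \<Longrightarrow> ad v (ad w m) = ad w (ad v m)"
  by (simp add: ad_def L_diff R_diff L_mul R_mul L_R L_closed R_closed av_comm)

lemma kcochD:
  assumes "F \<in> kcoch"
  shows "F vs \<in> M" "multilin vsc scb F" "F (as @ v # v # bs) = 0" "F (v # v # bs) = 0"
    "(\<lambda>ws. F (v # ws)) \<in> kcoch"
proof -
  show "F vs \<in> M" and m: "multilin vsc scb F" and a: "F (as @ v # v # bs) = 0" for as v bs vs
    using assms by (auto simp: kcoch_def)
  show "F (v # v # bs) = 0" using a[of "[]"] by simp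
  have "F (v # as @ w # w # bs) = 0" for as w bs
    using a[of "v # as"] by simp
  then show "(\<lambda>ws. F (v # ws)) \<in> kcoch"
    using assms multilin_Cons[OF m] by (auto simp: kcoch_def)
qed

lemma kcoch_swap: 
  assumes F: "F \<in> kcoch" shows "F (v # w # bs) = - F (w # v # bs)"
proof -
  have "F ((v + w) # (v + w) # bs) = 0" by (rule kcochD(4)[OF F])
  also have "F ((v + w) # (v + w) # bs) = F (v # (v + w) # bs) + F (w # (v + w) # bs)"
    by (rule multilin_Cons_add[OF kcochD(2)[OF F]])
  also have "F (v # (v + w) # bs) = F (v # v # bs) + F (v # w # bs)"
    by (rule multilin_Cons_add[OF kcochD(2)[OF kcochD(5)[OF F]]])
  also have "F (w # (v + w) # bs) = F (w # v # bs) + F (w # w # bs)"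
    by (rule multilin_Cons_add[OF kcochD(2)[OF kcochD(5)[OF F]]])
  finally show ?thesis by (simp add: eq_neg_iff_add_eq_0 kcochD(4)[OF F])
qed

lemma kcoch_add: "F \<in> kcoch \<Longrightarrow> H \<in> kcoch \<Longrightarrow> (\<lambda>ws. F ws + H ws) \<in> kcoch"
  by (auto simp: kcoch_def multilin_def M_add mod.scale_right_distrib)

lemma kcoch_zero: "(\<lambda>ws. 0) \<in> kcoch"
  by (auto simp: kcoch_def multilin_def M_zero)

lemma kcoch_scale: "F \<in> kcoch \<Longrightarrow> (\<lambda>ws. scb c (F ws)) \<in> kcoch"
  by (auto simp: kcoch_def multilin_def M_sc mod.scale_right_distrib mult.commute)

lemma kcoch_minus: "F \<in> kcoch \<Longrightarrow> (\<lambda>ws. - F ws) \<in> kcoch"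
  using kcoch_scale[of F "-1"] by simp

lemma kcoch_diff: "F \<in> kcoch \<Longrightarrow> H \<in> kcoch \<Longrightarrow> (\<lambda>ws. F ws - H ws) \<in> kcoch"
  using kcoch_add[of F "\<lambda>ws. - H ws"] kcoch_minus[of H] by simp

lemma kcoch_sum: "(\<And>i. i \<in> I \<Longrightarrow> F i \<in> kcoch) \<Longrightarrow> (\<lambda>ws. \<Sum>i\<in>I. F i ws) \<in> kcoch"
  by (induction I rule: infinite_finite_induct) (auto intro: kcoch_zero kcoch_add)

lemma kcoch_degree: "F \<in> kcoch \<Longrightarrow> (\<lambda>ws. if length ws = n then F ws else 0) \<in> kcoch"
  by (auto simp: kcoch_def multilin_def M_zero)

lemma kd_add: "kd (\<lambda>ws. F ws + H ws) vs = kd F vs + kd H vs"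
  by (rule kdiff_add) (rule ad_add)

lemma kd_diff: "kd (\<lambda>ws. F ws - H ws) vs = kd F vs - kd H vs"
  using kd_add[of "\<lambda>ws. F ws - H ws" H vs] by simp

lemma kd_scale: "kd (\<lambda>ws. scb c (F ws)) vs = scb c (kd F vs)"
  by (rule kdiff_hom) (simp_all add: mod.scale_right_diff_distrib ad_sc)

lemma kd_zero [simp]: "kd (\<lambda>ws. 0) vs = 0"
  by (rule kdiff_zero) simp_all

lemma kd_sum: "kd (\<lambda>ws. \<Sum>i\<in>I. F i ws) vs = (\<Sum>i\<in>I. kd (F i) vs)"
  by (induction I rule: infinite_finite_induct) (auto simp: kd_add)

lemma kd_closed: "F \<in> kcoch \<Longrightarrow> kd F vs \<in> M"
  by (induction vs arbitrary: F) (simp_all add: M_zero M_diff ad_closed kcochD)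

lemma kd_kcoch: 
  assumes "F \<in> kcoch" shows "kd F \<in> kcoch"
proof -
  have add: "kd F (as @ (x + y) # bs) = kd F (as @ x # bs) + kd F (as @ y # bs)" if "F \<in> kcoch" for F as x y bs
    using that
  proof (induction as arbitrary: F)
    case Nil
    note m = kcochD(1,2)[OF Nil]
    show ?case by (simp add: ad_add_left m multilin_Cons_add[OF m(2)] kd_add)
  next
    case (Cons a as)
    note m = kcochD(1,2,5)[OF Cons.prems]
    show ?case by (simp add: ad_add multilin_add[OF m(2)] Cons.IH[OF m(3)])
  qed
  have sc: "kd F (as @ vsc c x # bs) = scb c (kd F (as @ x # bs))" if "F \<in> kcoch" for F as x c bs
    using that
  proof (induction as arbitrary: F)
    case Nil
    note m = kcochD(1,2)[OF Nil]
    show ?case by (simp add: ad_sc_left m multilin_Cons_scale[OF m(2)] kd_scale mod.scale_right_diff_distrib)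
  next
    case (Cons a as)
    note m = kcochD(1,2,5)[OF Cons.prems]
    show ?case by (simp add: ad_sc multilin_scale[OF m(2)] Cons.IH[OF m(3)] mod.scale_right_diff_distrib)
  qed
  have "kd F (as @ v # v # bs) = 0" if "F \<in> kcoch" for F as v bs
    using that
  proof (induction as arbitrary: F)
    case Nil
    note m = kcochD(4)[OF Nil]
    show ?case by (simp add: m)
  next
    case (Cons a as)
    note m = kcochD(3,5)[OF Cons.prems]
    show ?case by (simp add: m(1) Cons.IH[OF m(2)])
  qed
  then show ?thesis using add sc kd_closed assms by (auto simp: kcoch_def multilin_def)
qed

text \<open>Commutators with vectors commute, by \<open>ad_comm\<close>, so the two terms in which
  the commutator with the first argument stands outside cancel.\<close>

lemma kd_kd: "F \<in> kcoch \<Longrightarrow> kd (kd F) vs = 0"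
proof (induction vs arbitrary: F)
  case (Cons v vs)
  have a: "kd (\<lambda>ws. ad v (F ws)) vs = ad v (kd F vs)"
    by (rule kdiff_hom) (auto simp: ad_diff ad_comm kcochD Cons.prems)
  show ?case using Cons.IH[OF kcochD(5)[OF Cons.prems]] by (simp add: kd_diff a)
qed simp

section \<open>Bar cochains, and antisymmetrisation as a chain map\<close>

lemma hcochD:
  assumes "f \<in> hcoch"
  shows "f as \<in> M" "multilin sc scb f" "f (as @ (e \<odot> a) # bs) = f (as @ a # bs)" "f ((e \<odot> a) # bs) = f (a # bs)"
    "(\<lambda>m. f (a # m)) \<in> hcoch"
proof -
  show "f as \<in> M" and m: "multilin sc scb f" and a: "f (as @ (e \<odot> a) # bs) = f (as @ a # bs)" for as a bs
    using assms by (auto simp: hcoch_def)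
  show "f ((e \<odot> a) # bs) = f (a # bs)" using a[of "[]"] by simp
  have "f (b # as @ (e \<odot> a) # bs) = f (b # as @ a # bs)" for as a b bs
    using a[of "b # as"] by simp
  then show "(\<lambda>m. f (a # m)) \<in> hcoch"
    using assms multilin_Cons[OF m] by (auto simp: hcoch_def)
qed

lemma hcoch_add: "f \<in> hcoch \<Longrightarrow> h \<in> hcoch \<Longrightarrow> (\<lambda>m. f m + h m) \<in> hcoch"
  by (auto simp: hcoch_def multilin_def M_add mod.scale_right_distrib)

lemma hcoch_scale: "f \<in> hcoch \<Longrightarrow> (\<lambda>ws. scb c (f ws)) \<in> hcoch"
  by (auto simp: hcoch_def multilin_def M_sc mod.scale_right_distrib mult.commute)

lemma hcoch_diff: "f \<in> hcoch \<Longrightarrow> h \<in> hcoch \<Longrightarrow> (\<lambda>m. f m - h m) \<in> hcoch"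
  using hcoch_add[of f "\<lambda>ws. - h ws"] hcoch_scale[of h "-1"] by simp

lemma hcoch_degree: "f \<in> hcoch \<Longrightarrow> (\<lambda>ws. if length ws = n then f ws else 0) \<in> hcoch"
  by (auto simp: hcoch_def multilin_def M_zero)

lemma insert_alt_closed: "f \<in> hcoch \<Longrightarrow> insert_alt a f l \<in> M"
  by (induction l arbitrary: f) (simp_all add: M_diff hcochD)

lemma insert_alt_scale: "insert_alt a (\<lambda>m. scb c (f m)) l = scb c (insert_alt a f l)"
  by (rule insert_alt_hom) (rule mod.scale_right_diff_distrib)

lemma insert_alt_head_add: "f \<in> hcoch \<Longrightarrow> insert_alt (a + b) f l = insert_alt a f l + insert_alt b f l"
  by (induction l arbitrary: f) (simp_all add: hcochD multilin_Cons_add[OF hcochD(2)])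

lemma insert_alt_head_scale: "f \<in> hcoch \<Longrightarrow> insert_alt (sc c a) f l = scb c (insert_alt a f l)"
  by (induction l arbitrary: f)
    (simp_all add: hcochD multilin_Cons_scale[OF hcochD(2)] mod.scale_right_diff_distrib)

lemma insert_alt_hcoch:
  assumes "f \<in> hcoch" shows "insert_alt a f \<in> hcoch"
proof -
  have add: "insert_alt a f (as @ (x + y) # bs) = insert_alt a f (as @ x # bs) + insert_alt a f (as @ y # bs)"
    if "f \<in> hcoch" for f as x y bs using that
  proof (induction as arbitrary: f)
    case Nil
    show ?case 
      using multilin_Cons_add[OF hcochD(2)[OF Nil], of x y]
        multilin_Cons_add[OF hcochD(2)[OF hcochD(5)[OF Nil, of a]], of x y bs] 
      by (simp add: insert_alt_add)
  next
    case (Cons b as)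
    note m = hcochD(1,2,5)[OF Cons.prems]
    show ?case using multilin_add[OF m(2), of "a # b # as"] by (simp add: Cons.IH[OF m(3)])
  qed
  have scl: "insert_alt a f (as @ sc c x # bs) = scb c (insert_alt a f (as @ x # bs))"
    if "f \<in> hcoch" for f as x c bs using that
  proof (induction as arbitrary: f)
    case Nil
    show ?case 
      using multilin_Cons_scale[OF hcochD(2)[OF Nil], of c x]
        multilin_Cons_scale[OF hcochD(2)[OF hcochD(5)[OF Nil, of a]], of c x bs] 
      by (simp add: insert_alt_scale mod.scale_right_diff_distrib)
  next
    case (Cons b as)
    note m = hcochD(1,2,5)[OF Cons.prems]
    show ?case using multilin_scale[OF m(2), of "a # b # as"] 
      by (simp add: Cons.IH[OF m(3)] mod.scale_right_diff_distrib)
  qed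
  have "insert_alt a f (as @ (e \<odot> x) # bs) = insert_alt a f (as @ x # bs)"
    if "f \<in> hcoch" for f as x bs using that
  proof (induction as arbitrary: f)
    case Nil
    show ?case 
      using hcochD(4)[OF Nil, of x] hcochD(3)[OF Nil, of "[a]" x bs] by simp
  next
    case (Cons b as)
    show ?case using hcochD(3)[OF Cons.prems, of "a # b # as" x bs] by (simp add: Cons.IH hcochD(5) Cons.prems)
  qed
  with add scl show ?thesis using assms insert_alt_closed by (auto simp: hcoch_def multilin_def)
qed

lemma alt_closed: "f \<in> hcoch \<Longrightarrow> alt f vs \<in> M"
  by (induction vs arbitrary: f) (auto intro: hcochD insert_alt_hcoch)

lemma alt_scale: "alt (\<lambda>m. scb c (f m)) vs = scb c (alt f vs)"
  by (rule alternate_hom) (rule mod.scale_right_diff_distrib)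

lemma alt_kcoch:
  assumes "f \<in> hcoch" shows "alt f \<in> kcoch"
proof -
  have add: "alt f (as @ (x + y) # bs) = alt f (as @ x # bs) + alt f (as @ y # bs)" if "f \<in> hcoch" for f as x y bs
    using that
  proof (induction as arbitrary: f)
    case Nil
    have "insert_alt (av (x + y)) f = (\<lambda>m. insert_alt (av x) f m + insert_alt (av y) f m)"
      by (rule ext) (simp add: av_add insert_alt_head_add Nil)
    then show ?case by (simp add: alternate_add)
  qed (simp add: insert_alt_hcoch)
  have scl: "alt f (as @ vsc c x # bs) = scb c (alt f (as @ x # bs))" if "f \<in> hcoch" for f as x c bs
    using that
  proof (induction as arbitrary: f)
    case Nil
    have "insert_alt (av (vsc c x)) f = (\<lambda>m. scb c (insert_alt (av x) f m))"
      by (rule ext) (simp add: av_sc insert_alt_head_scale Nil)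
    then show ?case by (simp add: alt_scale)
  qed (simp add: insert_alt_hcoch)
  have "alt f (as @ v # v # bs) = 0" for f :: "'a list \<Rightarrow> 'b" and as v bs
  proof (induction as arbitrary: f)
    case Nil
    have "insert_alt (av v) (insert_alt (av v) f) = (\<lambda>m. 0 :: 'b)" by (rule ext) (rule insert_alt_insert_alt)
    then show ?case by simp
  qed simp
  then show ?thesis using add scl alt_closed assms by (auto simp: kcoch_def multilin_def)
qed

lemma td_add: "tail_diff mul R (\<lambda>m. f m + h m) l = tail_diff mul R f l + tail_diff mul R h l"
  by (rule tail_diff_add) (rule R_add)

lemma td_diff: "tail_diff mul R (\<lambda>m. f m - h m) l = tail_diff mul R f l - tail_diff mul R h l"
  using td_add[of "\<lambda>m. f m - h m" h l] by simp

lemma td_minus: "tail_diff mul R (\<lambda>m. - f m) l = - tail_diff mul R f l"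
  by (rule tail_diff_hom) (simp_all add: R_minus)

lemma insert_alt_head_mult:
  "insert_alt a (head_mult L f) l + head_mult L (insert_alt a f) l = L a (f l)"
proof (induction l arbitrary: f)
  case (Cons b l)
  show ?case 
    using insert_alt_hom[of "L b" a f l] by (simp add: L_diff)
qed simp

text \<open>The products of \<open>a\<close> with its right and with its left neighbour occur with
  opposite signs and cancel, because \<open>a\<close> commutes with the arguments. Only the right
  action of \<open>a\<close> standing behind all arguments survives.\<close>

lemma insert_alt_tail_diff:
  assumes "\<forall>b\<in>set l. a \<odot> b = b \<odot> a"
  shows "insert_alt a (tail_diff mul R f) l + tail_diff mul R (insert_alt a f) l = - R a (f l)"
  using assms
proof (induction l arbitrary: f)
  case (Cons b l)
  have IH: "insert_alt a (tail_diff mul R (\<lambda>m. f (b # m))) l =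
      - R a (f (b # l)) - tail_diff mul R (insert_alt a (\<lambda>m. f (b # m))) l"
    using Cons.IH[of "\<lambda>m. f (b # m)"] Cons.prems by (simp add: algebra_simps eq_diff_eq)
  have 1: "insert_alt a (\<lambda>m. - merge_head mul R b f m - tail_diff mul R (\<lambda>m. f (b # m)) m) l
    = - insert_alt a (merge_head mul R b f) l - insert_alt a (tail_diff mul R (\<lambda>m. f (b # m))) l"
    using insert_alt_diff[of a "\<lambda>m. - merge_head mul R b f m"] insert_alt_hom[of uminus a "merge_head mul R b f" l] 
    by simp
  have 2: "tail_diff mul R (\<lambda>m. f (a # b # m) - insert_alt a (\<lambda>m. f (b # m)) m) l
    = tail_diff mul R (\<lambda>m. f (a # b # m)) l - tail_diff mul R (insert_alt a (\<lambda>m. f (b # m))) l"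
    by (rule td_diff)
  have 3: "- f ((a \<odot> b) # l) + merge_head mul R b (\<lambda>m. f (a # m)) l
    + insert_alt a (merge_head mul R b f) l - merge_head mul R b (insert_alt a f) l = 0"
    using Cons.prems by (cases l) (simp_all add: R_diff mul_assoc[symmetric])
  show ?case using 3 IH by (simp add: 1 2 algebra_simps)
qed simp

text \<open>A Cartan formula: insertion of a letter anticommutes with the bar differential up to the
  commutator with that letter.\<close>

lemma insert_alt_bd:
  assumes "\<forall>b\<in>set l. a \<odot> b = b \<odot> a"
  shows "insert_alt a (bd f) l = L a (f l) - R a (f l) - bd (insert_alt a f) l"
proof -
  have "insert_alt a (bd f) l = insert_alt a (head_mult L f) l + insert_alt a (tail_diff mul R f) l"
    unfolding bdiff_def by (rule insert_alt_add)
  then show ?thesis using insert_alt_head_mult[of a f l] insert_alt_tail_diff[OF assms, of f]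
    unfolding bdiff_def by (simp add: algebra_simps eq_diff_eq)
qed

text \<open>Iterating the Cartan formula is exactly the recursion of \<open>kdiff\<close>; it
  applies because the images of vectors commute.\<close>

lemma alt_bd: "f \<in> hcoch \<Longrightarrow> alt (bd f) vs = kd (alt f) vs"
proof (induction vs arbitrary: f)
  case Nil
  then show ?case by (simp add: bdiff_def)
next
  case (Cons v vs)
  have "alt (insert_alt (av v) (bd f)) vs = alt (\<lambda>l. (L (av v) (f l) - R (av v) (f l)) - bd (insert_alt (av v) f) l) vs"
    by (rule alternate_cong, rule insert_alt_bd) (auto simp: av_comm)
  also have "\<dots> = alt (\<lambda>l. ad v (f l)) vs - alt (bd (insert_alt (av v) f)) vs"
    by (simp add: alternate_diff ad_def)
  also have "alt (\<lambda>l. ad v (f l)) vs = ad v (alt f vs)"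
    by (rule alternate_hom) (rule ad_diff)
  finally show ?case using Cons.IH[OF insert_alt_hcoch[OF Cons.prems]] by simp
qed

text \<open>Associativity of the product, in the form that the induction for
  \<open>tail_diff_tail_diff\<close> consumes.\<close>

lemma tail_diff_merge:
  assumes "\<And>m. f m \<in> M"
  shows "tail_diff mul R (merge_head mul R a f) l = merge_head mul R a (tail_diff mul R f) l"
proof (cases l)
  case (Cons b m)
  have "merge_head mul R b (merge_head mul R a f) m = merge_head mul R (a \<odot> b) f m"
    by (cases m) (simp_all add: R_mul assms mul_assoc)
  then show ?thesis by (simp add: Cons)
qed simp

lemma tail_diff_tail_diff:
  assumes "\<And>m. f m \<in> M"
  shows "tail_diff mul R (tail_diff mul R f) l = 0"
  using assms
proof (induction l arbitrary: f)
  case (Cons a l)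
  have "tail_diff mul R (\<lambda>m. - merge_head mul R a f m + - tail_diff mul R (\<lambda>m. f (a # m)) m) l
   = - tail_diff mul R (merge_head mul R a f) l - tail_diff mul R (tail_diff mul R (\<lambda>m. f (a # m))) l"
    by (simp only: td_add td_minus) simp
  then show ?case using Cons.IH[of "\<lambda>m. f (a # m)"] Cons.prems by (simp add: tail_diff_merge)
qed simp

lemma bd_bd:
  assumes f: "\<And>m. f m \<in> M"
  shows "bd (bd f) l = 0"
proof -
  have "bd (bd f) l = head_mult L (head_mult L f) l + (head_mult L (tail_diff mul R f) l + tail_diff mul R (head_mult L f) l)"
  proof -
    have "head_mult L (bd f) l = head_mult L (head_mult L f) l + head_mult L (tail_diff mul R f) l"
      by (cases l) (simp_all add: bdiff_def L_add)
    moreover have "tail_diff mul R (bd f) l = tail_diff mul R (head_mult L f) l"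
      unfolding bdiff_def by (simp only: td_add tail_diff_tail_diff[OF f]) simp
    ultimately show ?thesis unfolding bdiff_def[of mul L R "bd f"] by (simp add: add.assoc)
  qed
  moreover have "head_mult L (head_mult L f) l + (head_mult L (tail_diff mul R f) l + tail_diff mul R (head_mult L f) l) = 0"
  proof (cases l)
    case (Cons a m)
    show ?thesis
    proof (cases m)
      case (Cons b k)
      have "tail_diff mul R (\<lambda>k. L a (f k)) m = L a (tail_diff mul R f m)"
        by (rule tail_diff_hom) (simp_all add: L_diff L_R f)
      then show ?thesis by (simp add: \<open>l = a # m\<close> Cons L_mul f)
    qed (simp add: Cons)
  qed simp
  ultimately show ?thesis by simp
qed

lemma bd_add: "bd (\<lambda>m. f m + h m) l = bd f l + bd h l"
proof -
  have "head_mult L (\<lambda>m. f m + h m) l = head_mult L f l + head_mult L h l"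
    by (cases l) (simp_all add: L_add)
  then show ?thesis by (simp add: bdiff_def td_add)
qed

lemma bd_diff: "bd (\<lambda>m. f m - h m) l = bd f l - bd h l"
  using bd_add[of "\<lambda>m. f m - h m" h] by simp

lemma bd_scale: "bd (\<lambda>m. scb c (f m)) l = scb c (bd f l)"
proof -
  have "tail_diff mul R (\<lambda>m. scb c (f m)) l = scb c (tail_diff mul R f l)"
    by (rule tail_diff_hom) (simp_all add: mod.scale_right_diff_distrib R_sc)
  then show ?thesis unfolding bdiff_def by (cases l) (simp_all add: L_sc mod.scale_right_distrib)
qed

end

lemma sum_fun_apply: "(sum f I) x = (\<Sum>i\<in>I. f i x)"
  by (induction I rule: infinite_finite_induct) simp_all

context koszul_algebra
begin

lemma D_zero [simp]: "D j 0 = 0"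
  using D_add[of j 0 0] by simp

end

context koszul_bimodule
begin

lemma bd_hcoch:
  assumes "f \<in> hcoch" shows "bd f \<in> hcoch"
proof -
  have closed: "tail_diff mul R f l \<in> M" if "f \<in> hcoch" for f l
    using that
  proof (induction l arbitrary: f)
    case (Cons a l)
    have "merge_head mul R a f l \<in> M"
      by (cases l) (simp_all add: R_closed hcochD Cons.prems)
    then show ?case using Cons by (simp add: M_diff M_minus hcochD)
  qed (simp add: M_zero)
  have merge_add: "merge_head mul R (x + y) f l = merge_head mul R x f l + merge_head mul R y f l" 
    if "f \<in> hcoch" for f l x y
    by (cases l) (simp_all add: R_add_left hcochD[OF that] mul_add_left multilin_Cons_add[OF hcochD(2)[OF that]])
  have add: "tail_diff mul R f (as @ (x + y) # bs) = tail_diff mul R f (as @ x # bs) + tail_diff mul R f (as @ y # bs)"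
    if "f \<in> hcoch" for f as x y bs using that
  proof (induction as arbitrary: f)
    case Nil
    have "tail_diff mul R (\<lambda>m. f ((x + y) # m)) bs = tail_diff mul R (\<lambda>m. f (x # m)) bs + tail_diff mul R (\<lambda>m. f (y # m)) bs"
      by (simp add: multilin_Cons_add[OF hcochD(2)[OF Nil]] td_add)
    then show ?case by (simp add: merge_add[OF Nil])
  next
    case (Cons a as)
    note f = hcochD(2)[OF Cons.prems]
    have "merge_head mul R a f (as @ (x + y) # bs) = merge_head mul R a f (as @ x # bs) + merge_head mul R a f (as @ y # bs)"
    proof (cases as)
      case Nil
      then show ?thesis by (simp add: mul_add_right multilin_Cons_add[OF f])
    next
      case (Cons b as')
      then show ?thesis using multilin_add[OF f, of "a \<odot> b # as'"] by simp
    qed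
    then show ?case by (simp add: Cons.IH[OF hcochD(5)[OF Cons.prems]])
  qed
  have merge_scale: "merge_head mul R (sc c x) f l = scb c (merge_head mul R x f l)" 
    if "f \<in> hcoch" for f l x c
    by (cases l) (simp_all add: R_sc_left hcochD[OF that] mul_sc_left multilin_Cons_scale[OF hcochD(2)[OF that]])
  have td_scale: "tail_diff mul R (\<lambda>m. scb c (f m)) l = scb c (tail_diff mul R f l)" for c f l
    by (rule tail_diff_hom) (simp_all add: mod.scale_right_diff_distrib R_sc)
  have scl: "tail_diff mul R f (as @ sc c x # bs) = scb c (tail_diff mul R f (as @ x # bs))"
    if "f \<in> hcoch" for f as x c bs using that
  proof (induction as arbitrary: f)
    case Nil
    have "tail_diff mul R (\<lambda>m. f (sc c x # m)) bs = scb c (tail_diff mul R (\<lambda>m. f (x # m)) bs)"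
      by (simp add: multilin_Cons_scale[OF hcochD(2)[OF Nil]] td_scale)
    then show ?case by (simp add: merge_scale[OF Nil] mod.scale_right_diff_distrib)
  next
    case (Cons a as)
    note f = hcochD(2)[OF Cons.prems]
    have "merge_head mul R a f (as @ sc c x # bs) = scb c (merge_head mul R a f (as @ x # bs))"
    proof (cases as)
      case Nil
      then show ?thesis by (simp add: mul_sc_right multilin_Cons_scale[OF f])
    next
      case (Cons b as')
      then show ?thesis using multilin_scale[OF f, of "a \<odot> b # as'"] by simp
    qed
    then show ?case by (simp add: Cons.IH[OF hcochD(5)[OF Cons.prems]] mod.scale_right_diff_distrib)
  qed
  have merge_e: "merge_head mul R (e \<odot> x) f l = merge_head mul R x f l" if "f \<in> hcoch" for f l x
  proof (cases l)
    case Nil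
    then show ?thesis by (simp add: R_e hcochD[OF that] R_mul[symmetric])
  next
    case (Cons b m)
    then show ?thesis by (simp add: mul_assoc e_mul)
  qed
  have ee: "tail_diff mul R f (as @ (e \<odot> x) # bs) = tail_diff mul R f (as @ x # bs)"
    if "f \<in> hcoch" for f as x bs using that
  proof (induction as arbitrary: f)
    case Nil
    have "tail_diff mul R (\<lambda>m. f ((e \<odot> x) # m)) bs = tail_diff mul R (\<lambda>m. f (x # m)) bs"
      by (simp add: hcochD(4)[OF Nil])
    then show ?case by (simp add: merge_e[OF Nil])
  next
    case (Cons a as)
    have "merge_head mul R a f (as @ (e \<odot> x) # bs) = merge_head mul R a f (as @ x # bs)"
    proof (cases as)
      case Nil
      have "a \<odot> (e \<odot> x) = e \<odot> (a \<odot> x)" by (simp add: mul_assoc[symmetric] e_comm[of a])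
      with Nil show ?thesis by (simp add: hcochD(4)[OF Cons.prems])
    next
      case (Cons b as')
      then show ?thesis using hcochD(3)[OF \<open>f \<in> hcoch\<close>, of "a \<odot> b # as'"] by simp
    qed
    then show ?case by (simp add: Cons.IH[OF hcochD(5)[OF Cons.prems]])
  qed
  note f = assms
  have "bd f l \<in> M" for l
    by (cases l) (simp_all add: bdiff_def M_add L_closed closed[OF f] hcochD[OF f] M_zero del: tail_diff.simps(2))
  moreover have "bd f (as @ (x + y) # bs) = bd f (as @ x # bs) + bd f (as @ y # bs)" for as x y bs
  proof (cases as)
    case Nil
    then show ?thesis using add[OF f, of "[]" x y bs] 
      by (simp add: bdiff_def L_add_left hcochD[OF f] del: tail_diff.simps(2))
  next
    case (Cons a as')
    then show ?thesis using add[OF f, of "a # as'" x y bs] 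
      by (simp add: bdiff_def L_add multilin_add[OF hcochD(2)[OF f]] del: tail_diff.simps(2))
  qed
  moreover have "bd f (as @ sc c x # bs) = scb c (bd f (as @ x # bs))" for as x c bs
  proof (cases as)
    case Nil
    then show ?thesis using scl[OF f, of "[]" c x bs] 
      by (simp add: bdiff_def L_sc_left hcochD[OF f] mod.scale_right_distrib del: tail_diff.simps(2))
  next
    case (Cons a as')
    then show ?thesis using scl[OF f, of "a # as'" c x bs] 
      by (simp add: bdiff_def L_sc multilin_scale[OF hcochD(2)[OF f]] mod.scale_right_distrib del: tail_diff.simps(2))
  qed
  moreover have "bd f (as @ (e \<odot> x) # bs) = bd f (as @ x # bs)" for as x bs
  proof (cases as)
    case Nil
    then show ?thesis using ee[OF f, of "[]" x bs] 
      by (simp add: bdiff_def L_e L_closed hcochD[OF f] L_mul[symmetric] del: tail_diff.simps(2))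
  next
    case (Cons a as')
    then show ?thesis using ee[OF f, of "a # as'" x bs] 
      by (simp add: bdiff_def hcochD(3)[OF f] del: tail_diff.simps(2))
  qed
  ultimately show ?thesis by (simp add: hcoch_def multilin_def)
qed

lemma hcoch_zero: "(\<lambda>m. 0) \<in> hcoch"
  by (simp add: hcoch_def multilin_def M_zero)

lemma bd_zero_degree:
  assumes "\<And>m. length m \<noteq> n \<Longrightarrow> f m = 0" and "length l \<noteq> Suc n"
  shows "bd f l = 0"
proof -
  have "bd f l = bd (\<lambda>m. 0) l"
    by (rule bdiff_cong) (use assms in auto)
  also have "\<dots> = 0" using bd_scale[of 0 "\<lambda>m. 0"] by simp
  finally show ?thesis .
qed

lemma kd_zero_degree:
  assumes "\<And>m. length m \<noteq> n \<Longrightarrow> f m = 0" and "length l \<noteq> Suc n"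
  shows "kd f l = 0"
  by (rule kdiff_zero) (use assms in auto)

subsection \<open>Averaging over the group\<close>

definition conjugation :: "'g \<Rightarrow> 'b \<Rightarrow> 'b"
  where "conjugation g m = L (ug g) (R (ug (inv g)) m)"

definition conj_coch :: "'g \<Rightarrow> ('v list \<Rightarrow> 'b) \<Rightarrow> 'v list \<Rightarrow> 'b"
  where "conj_coch g F vs = conjugation g (F (map (\<rho> (inv g)) vs))"

definition avg :: "('v list \<Rightarrow> 'b) \<Rightarrow> 'v list \<Rightarrow> 'b"
  where "avg F vs = scb (1 / of_nat (card (carrier G))) (\<Sum>g\<in>carrier G. conj_coch g F vs)"

lemma conjugation_closed: "m \<in> M \<Longrightarrow> conjugation g m \<in> M"
  by (simp add: conjugation_def L_closed R_closed)

lemma conjugation_add: "conjugation g (m + n) = conjugation g m + conjugation g n"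
  by (simp add: conjugation_def L_add R_add)

lemma conjugation_diff: "conjugation g (m - n) = conjugation g m - conjugation g n"
  by (simp add: conjugation_def L_diff R_diff)

lemma conjugation_sc: "conjugation g (scb c m) = scb c (conjugation g m)"
  by (simp add: conjugation_def L_sc R_sc)

lemma conjugation_sum: "conjugation g (sum f I) = (\<Sum>i\<in>I. conjugation g (f i))"
  by (simp add: conjugation_def L_sum R_sum)

lemma conjugation_zero [simp]: "conjugation g 0 = 0"
  by (simp add: conjugation_def)

lemma conjugation_mult:
  assumes "g \<in> carrier G" "h \<in> carrier G" "m \<in> M"
  shows "conjugation h (conjugation g m) = conjugation (h \<otimes> g) m"
  using assms by (simp add: conjugation_def L_R[symmetric] L_mul R_mul L_closed R_closed ug_mul inv_mult_group)

lemma rho_inv [simp]: 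
  assumes "g \<in> carrier G" 
  shows "\<rho> g (\<rho> (inv g) v) = v" "\<rho> (inv g) (\<rho> g v) = v"
  using assms by (simp_all add: rho_mul rho_one)

lemma ug_av_inv: "g \<in> carrier G \<Longrightarrow> av (\<rho> (inv g) v) \<odot> ug (inv g) = ug (inv g) \<odot> av v"
  by (simp add: ug_av)

lemma conjugation_ad:
  assumes g: "g \<in> carrier G" and m: "m \<in> M"
  shows "conjugation g (ad (\<rho> (inv g) v) m) = ad v (conjugation g m)"
proof -
  have 1: "L (ug g) (L (av (\<rho> (inv g) v)) x) = L (av v) (L (ug g) x)" if "x \<in> M" for x
    using ug_av[OF g, of "\<rho> (inv g) v"] g that by (simp add: L_mul)
  have 2: "R (ug (inv g)) (R (av (\<rho> (inv g) v)) m) = R (av v) (R (ug (inv g)) m)"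
    using ug_av_inv[OF g, of v] m by (simp add: R_mul)
  show ?thesis
    by (simp add: conjugation_def ad_def L_diff R_diff 2 L_R[symmetric] R_closed m 1)
qed

lemma conj_coch_kcoch:
  assumes g: "g \<in> carrier G" and F: "F \<in> kcoch"
  shows "conj_coch g F \<in> kcoch"
proof -
  have i: "inv g \<in> carrier G" using g by simp
  show ?thesis
    using multilin_add[OF kcochD(2)[OF F]] multilin_scale[OF kcochD(2)[OF F]]
    unfolding kcoch_def multilin_def conj_coch_def
    by (auto simp: rho_add[OF i] rho_sc[OF i] conjugation_add conjugation_sc kcochD[OF F] conjugation_closed)
qed

lemma conj_coch_mult:
  assumes "g \<in> carrier G" "h \<in> carrier G" "\<And>vs. F vs \<in> M"
  shows "conj_coch h (conj_coch g F) vs = conj_coch (h \<otimes> g) F vs"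
  using assms by (simp add: conj_coch_def conjugation_mult inv_mult_group rho_mul o_def)

lemma kd_conj_coch:
  assumes "g \<in> carrier G" "\<And>vs. F vs \<in> M"
  shows "kd (conj_coch g F) vs = conj_coch g (kd F) vs"
  using assms(2)
proof (induction vs arbitrary: F)
  case (Cons v vs)
  have "(\<lambda>ws. conj_coch g F (v # ws)) = conj_coch g (\<lambda>ws. F (\<rho> (inv g) v # ws))"
    by (rule ext) (simp add: conj_coch_def)
  then show ?case using Cons.IH[of "\<lambda>ws. F (\<rho> (inv g) v # ws)"] Cons.prems 
    by (simp add: conj_coch_def conjugation_diff conjugation_ad[OF assms(1)])
qed (simp add: conj_coch_def)

lemma avg_kcoch: "F \<in> kcoch \<Longrightarrow> avg F \<in> kcoch"
  unfolding avg_def[abs_def] by (intro kcoch_scale kcoch_sum conj_coch_kcoch)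

lemma kd_avg: "F \<in> kcoch \<Longrightarrow> kd (avg F) vs = avg (kd F) vs"
  by (simp add: avg_def[abs_def] kd_scale kd_sum kd_conj_coch kcochD)

lemma card_nonzero: "of_nat (card (carrier G)) \<noteq> (0::complex)"
  using finite_G by (auto simp: card_eq_0_iff)

lemma avg_invariant: 
  assumes "\<And>g. g \<in> carrier G \<Longrightarrow> conj_coch g F vs = F vs"
  shows "avg F vs = F vs"
proof -
  have "(\<Sum>g\<in>carrier G. conj_coch g F vs) = (\<Sum>g\<in>carrier G. F vs)"
    by (intro sum.cong refl assms)
  also have "\<dots> = scb (of_nat (card (carrier G))) (F vs)"
    by (rule mod.sum_constant_scale)
  finally show ?thesis using card_nonzero by (simp add: avg_def)
qed

lemma conj_coch_avg:
  assumes h: "h \<in> carrier G" and F: "\<And>vs. F vs \<in> M"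
  shows "conj_coch h (avg F) vs = avg F vs"
proof -
  have "conj_coch h (avg F) vs = scb (1 / of_nat (card (carrier G))) (\<Sum>g\<in>carrier G. conj_coch h (conj_coch g F) vs)"
    by (simp add: conj_coch_def avg_def conjugation_sc conjugation_sum)
  also have "(\<Sum>g\<in>carrier G. conj_coch h (conj_coch g F) vs) = (\<Sum>g\<in>carrier G. conj_coch (h \<otimes> g) F vs)"
    by (intro sum.cong refl conj_coch_mult h F)
  also have "\<dots> = (\<Sum>g\<in>carrier G. conj_coch g F vs)"
    by (rule sum.reindex_bij_witness[of _ "\<lambda>g. inv h \<otimes> g" "\<lambda>g. h \<otimes> g"])
      (use h in \<open>auto simp: m_assoc[symmetric]\<close>)
  finally show ?thesis unfolding avg_def[of F vs] .
qed

definition central :: "'b \<Rightarrow> bool"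
  where "central m \<longleftrightarrow> (\<forall>a. L a m = R a m)"

text \<open>The algebra elements that act on \<open>m\<close> equally from both sides are closed
  under the operations in \<open>generated\<close>, and they include the generators: vectors because
  their commutators with \<open>m\<close> vanish, group elements by invariance.\<close>

lemma central_if_generators:
  assumes m: "m \<in> M" and v: "\<And>v. ad v m = 0" and g: "\<And>g. g \<in> carrier G \<Longrightarrow> conjugation g m = m"
  shows "central m"
proof -
  have ug: "L (ug g) m = R (ug g) m" if "g \<in> carrier G" for g
  proof -
    have "R (ug g) m = R (ug g) (R (ug (inv g)) (L (ug g) m))"
      using g[OF that] m by (simp add: conjugation_def L_R)
    also have "\<dots> = L (ug g) m"
      using that m by (simp add: R_mul L_closed ug_mul ug_one R_e)
    finally show ?thesis by simp
  qed
  have "L (e \<odot> a) m = R (e \<odot> a) m" for a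
  proof (rule generated[of "\<lambda>a. L a m = R a m"])
    show "\<forall>a b. L a m = R a m \<longrightarrow> L b m = R b m \<longrightarrow> L (a \<odot> b) m = R (a \<odot> b) m"
    proof (intro allI impI)
      fix a b assume *: "L a m = R a m" "L b m = R b m"
      show "L (a \<odot> b) m = R (a \<odot> b) m"
        using m * by (simp add: L_mul[symmetric] R_mul[symmetric] L_R)
    qed
  qed (use m v ug in \<open>auto simp: L_add_left R_add_left L_sc_left R_sc_left ad_def\<close>)
  then show ?thesis using m by (simp add: central_def L_mul[symmetric] R_mul[symmetric] L_e R_e L_closed)
qed

end

subsection \<open>Linear maps out of the algebra form an acyclic bimodule\<close>

context koszul_bimodule
begin

definition homs :: "('a \<Rightarrow> 'b) set"
  where "homs = {u. (\<forall>x. u x \<in> M) \<and> (\<forall>x y. u (x + y) = u x + u y) \<and>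
    (\<forall>c x. u (sc c x) = scb c (u x)) \<and> (\<forall>x. u (e \<odot> x) = u x)}"

lemma homsD:
  assumes "u \<in> homs"
  shows "u x \<in> M" "u (x + y) = u x + u y" "u (sc c x) = scb c (u x)" "u (e \<odot> x) = u x" "u 0 = 0" "u (sum f I) = (\<Sum>i\<in>I. u (f i))"
proof -
  show a: "u x \<in> M" "u (x + y) = u x + u y" "u (sc c x) = scb c (u x)" "u (e \<odot> x) = u x" for x y c
    using assms by (simp_all add: homs_def)
  show z: "u 0 = 0" using a(2)[of 0 0] by simp
  show "u (sum f I) = (\<Sum>i\<in>I. u (f i))"
    by (induction I rule: infinite_finite_induct) (simp_all add: a z)
qed

definition hom_scale :: "complex \<Rightarrow> ('a \<Rightarrow> 'b) \<Rightarrow> 'a \<Rightarrow> 'b"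
  where "hom_scale c u x = scb c (u x)"

definition hom_L :: "'a \<Rightarrow> ('a \<Rightarrow> 'b) \<Rightarrow> 'a \<Rightarrow> 'b"
  where "hom_L a u x = L a (u x)"

text \<open>Precomposition with left multiplication is a right action, and it is the one for which
  \<open>iota\<close> respects both actions. Cochains with these coefficients carry an extra
  argument in the algebra, and that argument can be differentiated.\<close>

definition hom_R :: "'a \<Rightarrow> ('a \<Rightarrow> 'b) \<Rightarrow> 'a \<Rightarrow> 'b"
  where "hom_R b u x = u (b \<odot> x)"

text \<open>Right multiplication embeds the bimodule. Evaluation at \<open>e\<close> is a linear
  left inverse, but in general it does not respect the right action.\<close>

definition iota :: "'b \<Rightarrow> 'a \<Rightarrow> 'b"
  where "iota m x = R x m"

lemma homs_bimodule: 
  "koszul_bimodule G sc vsc mul e av ug \<rho> J co D comp hom_scale homs hom_L hom_R"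
proof unfold_locales
  fix a b :: 'a and m :: "'a \<Rightarrow> 'b" assume m: "m \<in> homs"
  note h = homsD[OF m]
  show "hom_R b (hom_R a m) = hom_R (a \<odot> b) m"
    by (rule ext) (simp add: hom_R_def mul_assoc)
  show "hom_R a m \<in> homs"
  proof -
    have "a \<odot> (e \<odot> x) = e \<odot> (a \<odot> x)" for x by (simp add: mul_assoc[symmetric] e_comm[of a])
    then show ?thesis using h by (auto simp: homs_def hom_R_def mul_add_right mul_sc_right)
  qed
qed (auto simp: homs_def hom_scale_def hom_L_def hom_R_def fun_eq_iff mod.scale_right_distrib mod.scale_left_distrib
    M_zero M_add M_sc L_closed L_add L_sc L_add_left L_sc_left L_mul mul_add_left mul_sc_left L_e mult.commute)

interpretation N: koszul_bimodule G sc vsc mul e av ug \<rho> J co D comp hom_scale homs hom_L hom_R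
  by (rule homs_bimodule)

lemma iota_homs: "m \<in> M \<Longrightarrow> iota m \<in> homs"
  by (auto simp: homs_def iota_def R_closed R_add_left R_sc_left R_mul[symmetric] R_e)

lemma iota_diff: "iota (m - n) = iota m - iota n"
  by (rule ext) (simp add: iota_def R_diff)

lemma iota_ad: "m \<in> M \<Longrightarrow> N.ad v (iota m) = iota (ad v m)"
  by (rule ext) (simp add: N.ad_def ad_def hom_L_def hom_R_def iota_def R_diff L_R R_mul)

lemma N_kd_Cons:
  "N.kd E (v # vs) x = L (av v) (E vs x) - E vs (av v \<odot> x) - N.kd (\<lambda>ws. E (v # ws)) vs x"
  by (simp add: N.ad_def hom_L_def hom_R_def)

text \<open>A Koszul homotopy: it trades the inserted direction \<open>j\<close> for a derivative of
  the extra argument in the direction \<open>j\<close>.\<close>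

definition contract :: "('v list \<Rightarrow> 'a \<Rightarrow> 'b) \<Rightarrow> 'v list \<Rightarrow> 'a \<Rightarrow> 'b"
  where "contract E vs x = (\<Sum>j\<in>J. E (j # vs) (D j x))"

lemma N_kcoch_coordinates:
  assumes "E \<in> N.kcoch"
  shows "(\<Sum>j\<in>J. scb (co j v) (E (j # vs) x)) = E (v # vs) x"
proof -
  have z: "E (0 # vs) x = 0"
    using multilin_Cons_add[OF N.kcochD(2)[OF assms], of 0 0 vs] by (simp add: fun_eq_iff)
  have "E (sum f I # vs) x = (\<Sum>i\<in>I. E (f i # vs) x)" for f :: "'v \<Rightarrow> 'v" and I
    by (induction I rule: infinite_finite_induct)
       (simp_all add: multilin_Cons_add[OF N.kcochD(2)[OF assms]] z)
  from this[of "\<lambda>j. vsc (co j v) j" J] show ?thesis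
    by (simp add: co_sum multilin_Cons_scale[OF N.kcochD(2)[OF assms]] hom_scale_def)
qed

text \<open>By the Leibniz rule \<open>D_av\<close>, differentiating past \<open>av v\<close> leaves
  the coefficient \<open>co j v\<close>; summed over \<open>j\<close>, this puts \<open>v\<close> in
  the place of \<open>j\<close>. Each position of \<open>vs\<close> contributes one such term,
  whence the factor \<open>length vs\<close>.\<close>

lemma kd_derivation_commutator:
  assumes "E \<in> N.kcoch"
  shows "(\<Sum>j\<in>J. N.kd (\<lambda>ws x. E (j # ws) (D j x)) vs x - N.kd (\<lambda>ws. E (j # ws)) vs (D j x))
    = - scb (of_nat (length vs)) (E vs x)"
  using assms
proof (induction vs arbitrary: E)
  case (Cons v vs)
  \<comment> \<open>Exchanging \<open>v\<close> with the contracted direction costs a sign; absorbed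
    in \<open>E'\<close>, it leaves the induction hypothesis in its original form.\<close>
  define E' where "E' = (\<lambda>ws. - E (v # ws))"
  have E': "E' \<in> N.kcoch" unfolding E'_def by (intro N.kcoch_minus N.kcochD(5) Cons.prems)
  have sw: "E (j # v # ws) = E' (j # ws)" for j ws
    unfolding E'_def by (rule N.kcoch_swap[OF Cons.prems])
  have "E (j # vs) (D j (av v \<odot> x)) = scb (co j v) (E (j # vs) x) + E (j # vs) (av v \<odot> D j x)" if "j \<in> J" for j
    using that homsD[OF N.kcochD(1)[OF Cons.prems]] by (simp add: D_av)
  then have "(\<Sum>j\<in>J. N.kd (\<lambda>ws x. E (j # ws) (D j x)) (v # vs) x - N.kd (\<lambda>ws. E (j # ws)) (v # vs) (D j x))
    = (\<Sum>j\<in>J. - scb (co j v) (E (j # vs) x) - (N.kd (\<lambda>ws x. E' (j # ws) (D j x)) vs x - N.kd (\<lambda>ws. E' (j # ws)) vs (D j x)))"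
    by (intro sum.cong refl) (simp only: N_kd_Cons sw, simp add: algebra_simps)
  also have "\<dots> = - E (v # vs) x - (- scb (of_nat (length vs)) (E' vs x))"
    using Cons.IH[OF E'] N_kcoch_coordinates[OF Cons.prems, of v vs x]
    by (simp add: sum_subtractf sum_negf)
  also have "\<dots> = - scb (of_nat (length (v # vs))) (E (v # vs) x)"
    by (simp add: E'_def mod.scale_left_distrib)
  finally show ?case .
qed simp

text \<open>The last two terms act on the part of degree \<open>k\<close> of the extra argument as
  minus \<open>k + length vs\<close>; the first evaluates the cochain one degree lower. So the
  operator is triangular in the degree, with nonzero diagonal unless \<open>k = 0\<close> and
  \<open>vs = []\<close>.\<close>

lemma laplacian:
  assumes "E \<in> N.kcoch"
  shows "N.kd (contract E) vs x + contract (N.kd E) vs x =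
    (\<Sum>j\<in>J. L (av j) (E vs (D j x))) - E vs (\<Sum>j\<in>J. av j \<odot> D j x) - scb (of_nat (length vs)) (E vs x)"
proof -
  have *: "contract E = (\<lambda>ws. \<Sum>j\<in>J. (\<lambda>x. E (j # ws) (D j x)))"
    by (intro ext) (simp add: contract_def sum_fun_apply)
  have "N.kd (contract E) vs x = (\<Sum>j\<in>J. N.kd (\<lambda>ws x. E (j # ws) (D j x)) vs x)"
    by (simp add: * N.kd_sum sum_fun_apply)
  moreover have "contract (N.kd E) vs x = (\<Sum>j\<in>J. L (av j) (E vs (D j x)) - E vs (av j \<odot> D j x) - N.kd (\<lambda>ws. E (j # ws)) vs (D j x))"
    by (simp add: contract_def N_kd_Cons del: kdiff.simps)
  moreover have "E vs (\<Sum>j\<in>J. av j \<odot> D j x) = (\<Sum>j\<in>J. E vs (av j \<odot> D j x))"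
    by (rule homsD(6)[OF N.kcochD(1)[OF assms]])
  ultimately have "N.kd (contract E) vs x + contract (N.kd E) vs x
    = (\<Sum>j\<in>J. L (av j) (E vs (D j x))) - E vs (\<Sum>j\<in>J. av j \<odot> D j x) +
      (\<Sum>j\<in>J. N.kd (\<lambda>ws x. E (j # ws) (D j x)) vs x - N.kd (\<lambda>ws. E (j # ws)) vs (D j x))"
    by (simp add: sum_subtractf)
  then show ?thesis unfolding kd_derivation_commutator[OF assms] by simp
qed

lemma contract_kcoch:
  assumes E: "E \<in> N.kcoch" shows "contract E \<in> N.kcoch"
proof -
  have "(\<lambda>x. u (D j x)) \<in> homs" if "u \<in> homs" for u j
    using homsD[OF that] by (simp add: homs_def D_add D_sc D_e)
  then have "(\<lambda>ws x. E (j # ws) (D j x)) \<in> N.kcoch" for j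
    using N.kcochD(1,2,3)[OF N.kcochD(5)[OF E, of j]]
    by (auto simp: N.kcoch_def multilin_def hom_scale_def fun_eq_iff)
  then have "(\<lambda>ws. \<Sum>j\<in>J. (\<lambda>x. E (j # ws) (D j x))) \<in> N.kcoch"
    by (intro N.kcoch_sum)
  moreover have "contract E = (\<lambda>ws. \<Sum>j\<in>J. (\<lambda>x. E (j # ws) (D j x)))"
    by (intro ext) (simp add: contract_def sum_fun_apply)
  ultimately show ?thesis by simp
qed

text \<open>Solves the triangular system degree by degree. The divisor vanishes only for
  \<open>k = 0\<close> and \<open>vs = []\<close>, where the value is 0 because division by zero
  gives 0.\<close>

primrec laplacian_inv :: "('v list \<Rightarrow> 'a \<Rightarrow> 'b) \<Rightarrow> nat \<Rightarrow> 'v list \<Rightarrow> 'a \<Rightarrow> 'b"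
  where
    "laplacian_inv E 0 vs x = scb (- (1 / of_nat (length vs))) (E vs x)"
  | "laplacian_inv E (Suc k) vs x = scb (1 / of_nat (Suc k + length vs))
       ((\<Sum>j\<in>J. L (av j) (laplacian_inv E k vs (D j x))) - E vs x)"

lemma kcoch_length_scale:
  assumes "F \<in> N.kcoch" shows "(\<lambda>vs x. scb (w (length vs)) (F vs x)) \<in> N.kcoch"
proof -
  have "(\<lambda>x. scb c (u x)) \<in> homs" if "u \<in> homs" for c u
    using homsD[OF that] by (simp add: homs_def mod.scale_right_distrib M_sc mult.commute)
  then show ?thesis
    using N.kcochD(1,2,3)[OF assms]
    by (auto simp: N.kcoch_def multilin_def hom_scale_def fun_eq_iff mod.scale_right_distrib mult.commute)
qed

lemma laplacian_inv_kcoch: "E \<in> N.kcoch \<Longrightarrow> laplacian_inv E k \<in> N.kcoch"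
proof (induction k)
  case 0
  then have "(\<lambda>vs x. scb (- (1 / of_nat (length vs))) (E vs x)) \<in> N.kcoch"
    by (rule kcoch_length_scale)
  then show ?case by (simp add: laplacian_inv.simps(1)[abs_def] cong: if_cong)
next
  case (Suc k)
  note q = Suc.IH[OF Suc.prems]
  have "(\<lambda>x. L a (u (D j x))) \<in> homs" if "u \<in> homs" for u j a
    using homsD[OF that] by (simp add: homs_def D_add D_sc D_e L_add L_sc L_closed)
  then have "(\<lambda>ws x. L (av j) (laplacian_inv E k ws (D j x))) \<in> N.kcoch" for j
    using N.kcochD(1,2,3)[OF q]
    by (auto simp: N.kcoch_def multilin_def hom_scale_def fun_eq_iff L_add L_sc)
  then have "(\<lambda>ws. (\<Sum>j\<in>J. (\<lambda>x. L (av j) (laplacian_inv E k ws (D j x)))) - E ws) \<in> N.kcoch"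
    by (intro N.kcoch_diff N.kcoch_sum Suc.prems)
  from kcoch_length_scale[OF this, of "\<lambda>n. 1 / of_nat (Suc k + n)"] 
  have "(\<lambda>vs x. scb (1 / of_nat (Suc k + length vs))
       ((\<Sum>j\<in>J. L (av j) (laplacian_inv E k vs (D j x))) - E vs x)) \<in> N.kcoch"
    by (simp add: sum_fun_apply)
  moreover have "laplacian_inv E (Suc k) = (\<lambda>vs x. scb (1 / of_nat (Suc k + length vs))
       ((\<Sum>j\<in>J. L (av j) (laplacian_inv E k vs (D j x))) - E vs x))"
    by (intro ext) simp
  ultimately show ?case by simp
qed

definition degree_bound :: "'a \<Rightarrow> nat"
  where "degree_bound x = (LEAST n. \<forall>k>n. comp k x = 0)"

lemma degree_bound: "degree_bound x < k \<Longrightarrow> comp k x = 0"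
  using LeastI_ex[OF comp_bound[of x]] unfolding degree_bound_def by blast

text \<open>Each homogeneous part of \<open>x\<close> gets the inverse for its own degree. The bound
  makes the sum finite, and by \<open>solve_eq\<close> any larger bound gives the same value, which
  is what additivity in \<open>x\<close> rests on.\<close>

definition solve :: "('v list \<Rightarrow> 'a \<Rightarrow> 'b) \<Rightarrow> 'v list \<Rightarrow> 'a \<Rightarrow> 'b"
  where "solve E vs x = (\<Sum>k\<le>degree_bound x. laplacian_inv E k vs (comp k x))"

lemma solve_eq:
  assumes "E \<in> N.kcoch" "degree_bound x \<le> n"
  shows "solve E vs x = (\<Sum>k\<le>n. laplacian_inv E k vs (comp k x))"
  unfolding solve_def
  by (rule sum.mono_neutral_left)
    (use assms(2) in \<open>auto simp: degree_bound homsD(5)[OF N.kcochD(1)[OF laplacian_inv_kcoch[OF assms(1)]]]\<close>)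

lemma solve_kcoch:
  assumes E: "E \<in> N.kcoch"
  shows "solve E \<in> N.kcoch"
proof -
  note q = N.kcochD(1,2,3)[OF laplacian_inv_kcoch[OF E]]
  note h = homsD[OF q(1)]
  have "solve E vs \<in> homs" for vs
    unfolding homs_def
  proof (intro CollectI conjI allI)
    fix x y c
    show "solve E vs x \<in> M" by (simp add: solve_def M_sum h)
    let ?n = "max (degree_bound x) (max (degree_bound y) (degree_bound (x + y)))"
    show "solve E vs (x + y) = solve E vs x + solve E vs y"
      using solve_eq[OF E, of x ?n vs] solve_eq[OF E, of y ?n vs] solve_eq[OF E, of "x + y" ?n vs]
      by (simp add: comp_add h sum.distrib)
    let ?n = "max (degree_bound x) (degree_bound (sc c x))"
    show "solve E vs (sc c x) = scb c (solve E vs x)"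
      using solve_eq[OF E, of x ?n vs] solve_eq[OF E, of "sc c x" ?n vs]
      by (simp add: comp_sc h mod.scale_sum_right)
    show "solve E vs (e \<odot> x) = solve E vs x"
      by (simp add: solve_def degree_bound_def comp_e)
  qed
  then show ?thesis
    using q(2,3)
    by (auto simp: N.kcoch_def multilin_def fun_eq_iff solve_def sum.distrib hom_scale_def mod.scale_sum_right)
qed

lemma laplacian_solve:
  assumes E: "E \<in> N.kcoch" and E0: "E [] = 0"
  shows "N.kd (contract (solve E)) vs x + contract (N.kd (solve E)) vs x = E vs x"
proof -
  let ?q = "laplacian_inv E"
  note h = homsD[OF N.kcochD(1)[OF laplacian_inv_kcoch[OF E]]]
  note hE = homsD[OF N.kcochD(1)[OF E]]
  let ?Eu = "\<Sum>j\<in>J. av j \<odot> D j x"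
  \<comment> \<open>A common bound for \<open>x\<close>, its image under the Euler operator and all
    its derivatives, so that the three values of \<open>solve\<close> below are sums of the same
    length.\<close>
  define n where "n = degree_bound x + degree_bound ?Eu + (\<Sum>j\<in>J. degree_bound (D j x))"
  have n: "degree_bound x \<le> n" "degree_bound ?Eu \<le> n" "\<And>j. j \<in> J \<Longrightarrow> degree_bound (D j x) \<le> n"
    unfolding n_def using finite_J by (auto intro: trans_le_add2 member_le_sum)
  let ?l = "of_nat (length vs) :: complex"
  let ?T = "\<lambda>k. \<Sum>j\<in>J. L (av j) (?q k vs (D j (comp (Suc k) x)))"
  have 1: "(\<Sum>j\<in>J. L (av j) (solve E vs (D j x))) = (\<Sum>k\<le>n. ?T k)"
    by (subst sum.swap) (intro sum.cong refl, simp add: solve_eq[OF E n(3)] L_sum comp_D)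
  have 2: "solve E vs ?Eu = (\<Sum>k\<le>n. scb (of_nat k) (?q k vs (comp k x)))"
    by (simp add: solve_eq[OF E n(2)] comp_euler h)
  have 3: "scb ?l (solve E vs x) = (\<Sum>k\<le>n. scb ?l (?q k vs (comp k x)))"
    by (simp add: solve_eq[OF E n(1)] mod.scale_sum_right)
  have nil: "?q k [] y = 0" for k y
    by (induction k arbitrary: y) (simp_all add: E0)
  \<comment> \<open>The recursion of \<open>laplacian_inv\<close> with the division undone. For the
    empty list, where the divisor can be 0, both sides vanish by \<open>E0\<close>.\<close>
  have 4: "scb (of_nat k + ?l) (?q k vs (comp k x)) = (case k of 0 \<Rightarrow> 0 | Suc i \<Rightarrow> ?T i) - E vs (comp k x)" for k
  proof (cases "vs = []")
    case True
    then show ?thesis by (cases k) (simp_all add: nil E0)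
  next
    case False
    then have "of_nat k + ?l \<noteq> 0" 
      by (metis add_is_0 length_0_conv of_nat_add of_nat_eq_0_iff)
    then show ?thesis using False by (cases k) (simp_all add: add.commute add.left_commute)
  qed
  \<comment> \<open>A derivative of the part of degree \<open>k + 1\<close> has degree
    \<open>k\<close>, so the sum is reindexed by one; its top term drops because \<open>x\<close>
    has no part of degree \<open>n + 1\<close>.\<close>
  have shift: "(\<Sum>k\<le>n. case k of 0 \<Rightarrow> 0 | Suc i \<Rightarrow> t i) = (\<Sum>i<n. t i)" for t :: "nat \<Rightarrow> 'b" and n
    by (induction n) simp_all
  have "?T n = 0" using degree_bound[of x "Suc n"] n(1) by (simp add: h)
  then have "(\<Sum>k\<le>n. ?T k) = (\<Sum>k<n. ?T k)"
    by (simp only: lessThan_Suc_atMost[symmetric] sum.lessThan_Suc add_0_right)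
  then have 5: "(\<Sum>k\<le>n. ?T k) = (\<Sum>k\<le>n. case k of 0 \<Rightarrow> 0 | Suc i \<Rightarrow> ?T i)"
    by (simp only: shift)
  have "(\<Sum>k\<le>n. ?T k) - (\<Sum>k\<le>n. scb (of_nat k) (?q k vs (comp k x))) - (\<Sum>k\<le>n. scb ?l (?q k vs (comp k x)))
    = (\<Sum>k\<le>n. (case k of 0 \<Rightarrow> 0 | Suc i \<Rightarrow> ?T i) - scb (of_nat k + ?l) (?q k vs (comp k x)))"
    unfolding 5 by (simp add: sum_subtractf mod.scale_left_distrib sum.distrib algebra_simps)
  also have "\<dots> = (\<Sum>k\<le>n. E vs (comp k x))"
    unfolding 4 by simp
  also have "\<dots> = E vs x"
    using comp_sum[of n x] degree_bound[of x] n(1) by (simp add: hE(6)[symmetric] hE(4))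
  finally show ?thesis
    unfolding laplacian[OF solve_kcoch[OF E]] 1 2 3 .
qed

text \<open>On the part of degree \<open>k\<close> the diagonal factor is nonzero, and the other
  term evaluates \<open>W\<close> in degree \<open>k - 1\<close> only, so induction on
  \<open>k\<close> applies.\<close>

lemma laplacian_injective:
  assumes W: "W \<in> N.kcoch" and W0: "W [] = 0"
    and lap: "\<And>vs x. N.kd (contract W) vs x + contract (N.kd W) vs x = 0"
  shows "W vs x = 0"
proof (cases "vs = []")
  case False
  note h = homsD[OF N.kcochD(1)[OF W]]
  let ?l = "of_nat (length vs) :: complex"
  have *: "scb (of_nat k + ?l) (W vs (comp k y)) = (\<Sum>j\<in>J. L (av j) (W vs (D j (comp k y))))" for k y
    using lap[of vs "comp k y"] unfolding laplacian[OF W] 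
    by (simp add: euler_comp h mod.scale_left_distrib algebra_simps)
  have nz: "of_nat k + ?l \<noteq> 0" for k
    using False by (metis add_is_0 length_0_conv of_nat_add of_nat_eq_0_iff)
  have z: "W vs (comp k y) = 0" for k y
  proof (induction k arbitrary: y)
    case 0
    have "scb (of_nat 0 + ?l) (W vs (comp 0 y)) = 0" unfolding * by (simp add: comp_D0 h)
    then show ?case using nz[of 0] by simp
  next
    case (Suc k)
    have "scb (of_nat (Suc k) + ?l) (W vs (comp (Suc k) y)) = 0" unfolding * by (simp add: comp_D[symmetric] Suc)
    then show ?case using nz[of "Suc k"] by (simp del: of_nat_Suc)
  qed
  have "W vs x = W vs (\<Sum>k\<le>degree_bound x. comp k x)"
    using comp_sum[of "degree_bound x" x] degree_bound[of x] by (simp add: h)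
  then show ?thesis by (simp add: h(6) z)
qed (simp add: W0)

text \<open>Let \<open>Q\<close> be a cochain with Laplacian \<open>E\<close>. The Laplacian
  commutes with the differential, so the differential of \<open>Q\<close> has Laplacian 0 and
  vanishes by injectivity; the equation then reads \<open>E = d (contract Q)\<close>. In degree 0
  the diagonal of the Laplacian has a zero, hence the condition on \<open>E []\<close>.\<close>

lemma homs_acyclic:
  assumes E: "E \<in> N.kcoch" and E0: "E [] = 0" and d: "\<And>vs. N.kd E vs = 0"
  shows "\<exists>Y\<in>N.kcoch. N.kd Y = E"
proof -
  let ?Q = "solve E"
  note Q = solve_kcoch[OF E] N.kd_kcoch[OF solve_kcoch[OF E]]
  have lap: "(\<lambda>vs. N.kd (contract ?Q) vs + contract (N.kd ?Q) vs) = E"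
    by (intro ext) (simp add: laplacian_solve[OF E E0])
  have c: "contract ?Q \<in> N.kcoch" "contract (N.kd ?Q) \<in> N.kcoch"
    by (intro contract_kcoch Q)+
  have "N.kd (contract (N.kd ?Q)) vs = N.kd E vs" for vs
    by (subst (2) lap[symmetric]) (simp add: N.kd_add N.kd_kd[OF c(1)])
  then have "N.kd (contract (N.kd ?Q)) vs x + contract (N.kd (N.kd ?Q)) vs x = 0" for vs x
    using N.kd_kd[OF Q(1)] d by (simp add: contract_def del: kdiff.simps)
  then have z: "N.kd ?Q vs x = 0" for vs x
    by (intro laplacian_injective[OF Q(2)]) simp_all
  have "N.kd (contract ?Q) = E"
    using lap by (simp add: contract_def z fun_eq_iff del: kdiff.simps)
  then show ?thesis using c by blast
qed

end

lemma bdiff_hom: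
  assumes "\<And>x y. \<phi> (x - y) = \<phi> x - \<phi> y" "\<And>a m. R' a (\<phi> (f m)) = \<phi> (R a (f m))" "\<And>a m. L' a (\<phi> (f m)) = \<phi> (L a (f m))"
  shows "bdiff mul L' R' (\<lambda>m. \<phi> (f m)) l = \<phi> (bdiff mul L R f l)"
proof -
  have z: "\<phi> 0 = 0" using assms(1)[of 0 0] by simp
  have p: "\<phi> (x + y) = \<phi> x + \<phi> y" for x y using assms(1)[of "x + y" y] by (simp add: algebra_simps)
  have "head_mult L' (\<lambda>m. \<phi> (f m)) l = \<phi> (head_mult L f l)"
    by (cases l) (simp_all add: z assms)
  moreover have "tail_diff mul R' (\<lambda>m. \<phi> (f m)) l = \<phi> (tail_diff mul R f l)"
    by (rule tail_diff_hom[where \<phi> = \<phi> and f = f]) (rule assms)+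
  ultimately show ?thesis by (simp add: bdiff_def p)
qed

subsection \<open>Dimension shifting\<close>

context koszul_bimodule
begin

text \<open>Surjectivity, in degree \<open>n\<close>, of antisymmetrisation onto the classes of
  invariant Koszul cocycles.\<close>

definition lifts :: "nat \<Rightarrow> bool"
  where "lifts n \<longleftrightarrow> (\<forall>F\<in>kcoch. (\<forall>vs. length vs \<noteq> n \<longrightarrow> F vs = 0) \<longrightarrow> (\<forall>vs. kd F vs = 0) \<longrightarrow>
    (\<forall>g\<in>carrier G. \<forall>vs. conj_coch g F vs = F vs) \<longrightarrow>
    (\<exists>f\<in>hcoch. (\<forall>as. length as \<noteq> n \<longrightarrow> f as = 0) \<and> (\<forall>as. bd f as = 0) \<and>
      (\<exists>Z\<in>kcoch. \<forall>vs. alt f vs = F vs + kd Z vs)))"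

text \<open>Injectivity of antisymmetrisation on cohomology in degree \<open>n\<close>. Equalities
  are asked on lists of length \<open>n\<close> only, so that primitives may have parts in several
  degrees.\<close>

definition detects :: "nat \<Rightarrow> bool"
  where "detects n \<longleftrightarrow> (\<forall>f\<in>hcoch. (\<forall>as. length as \<noteq> n \<longrightarrow> f as = 0) \<longrightarrow> (\<forall>as. bd f as = 0) \<longrightarrow>
    (\<exists>Z\<in>kcoch. \<forall>vs. length vs = n \<longrightarrow> alt f vs = kd Z vs) \<longrightarrow>
    (\<exists>h\<in>hcoch. \<forall>as. length as = n \<longrightarrow> f as = bd h as))"

lemma detects_0: "detects 0"
  unfolding detects_def
proof (intro ballI impI)
  fix f assume "\<exists>Z\<in>kcoch. \<forall>vs. length vs = 0 \<longrightarrow> alt f vs = kd Z vs"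
  then have "f [] = 0" by auto
  then have "\<forall>as. length as = 0 \<longrightarrow> f as = bd (\<lambda>m. 0) as"
    by (simp add: bdiff_def)
  then show "\<exists>h\<in>hcoch. \<forall>as. length as = 0 \<longrightarrow> f as = bd h as"
    using hcoch_zero by blast
qed

text \<open>In degree 0 a closed cochain commutes with the vectors and an invariant one with the
  group elements. So it is central, which is the bar cocycle condition.\<close>

lemma lifts_0: "lifts 0"
  unfolding lifts_def
proof (intro ballI impI)
  fix F assume F: "F \<in> kcoch" and s: "\<forall>vs. length vs \<noteq> 0 \<longrightarrow> F vs = 0" and d: "\<forall>vs. kd F vs = 0"
    and inv: "\<forall>g\<in>carrier G. \<forall>vs. conj_coch g F vs = F vs"
  define f where "f = (\<lambda>as :: 'a list. if as = [] then F [] else 0)"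
  have "central (F [])"
  proof (rule central_if_generators)
    show "ad v (F []) = 0" for v using d[rule_format, of "[v]"] by simp
    show "conjugation g (F []) = F []" if "g \<in> carrier G" for g
      using inv[rule_format, OF that, of "[]"] by (simp add: conj_coch_def)
  qed (rule kcochD[OF F])
  then have "bd f [a] = 0" for a by (simp add: bdiff_def f_def central_def)
  then have b: "bd f as = 0" for as
    using bd_zero_degree[of 0 f as] by (cases as rule: list.exhaust; cases "tl as") (auto simp: f_def bdiff_def)
  have h: "f \<in> hcoch"
    by (auto simp: hcoch_def multilin_def f_def M_zero kcochD[OF F])
  have "alt f vs = F vs + kd (\<lambda>ws. 0) vs" for vs
  proof (cases "vs = []")
    case False
    have "alt f vs = alt (\<lambda>m. 0) vs"
      by (rule alternate_cong) (use False in \<open>auto simp: f_def\<close>)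
    then show ?thesis using s False by simp
  qed (simp add: f_def)
  then show "\<exists>f\<in>hcoch. (\<forall>as. length as \<noteq> 0 \<longrightarrow> f as = 0) \<and> (\<forall>as. bd f as = 0) \<and>
      (\<exists>Z\<in>kcoch. \<forall>vs. alt f vs = F vs + kd Z vs)"
    using h b by (intro bexI[OF _ h] conjI bexI[OF _ kcoch_zero]) (auto simp: f_def)
qed

interpretation N: koszul_bimodule G sc vsc mul e av ug \<rho> J co D comp hom_scale homs hom_L hom_R
  by (rule homs_bimodule)

lemma iota_e: "m \<in> M \<Longrightarrow> iota m e = m"
  by (simp add: iota_def R_e)

lemma iota_zero [simp]: "iota 0 = 0"
  using iota_diff[of 0 0] by simp

lemma iota_add: "iota (m + n) = iota m + iota n"
  by (rule ext) (simp add: iota_def R_add)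

lemma eval_kcoch:
  assumes "E \<in> N.kcoch" shows "(\<lambda>vs. E vs e) \<in> kcoch"
  using N.kcochD(1,2,3)[OF assms]
  by (auto simp: kcoch_def multilin_def homs_def hom_scale_def)

lemma eval_hcoch:
  assumes "E \<in> N.hcoch" shows "(\<lambda>vs. E vs e) \<in> hcoch"
  using N.hcochD(1,2,3)[OF assms]
  by (auto simp: hcoch_def multilin_def homs_def hom_scale_def)

lemma iota_kcoch:
  assumes "F \<in> kcoch" shows "(\<lambda>vs. iota (F vs)) \<in> N.kcoch"
proof -
  have "iota (scb c m) = hom_scale c (iota m)" for c m
    by (rule ext) (simp add: iota_def hom_scale_def R_sc)
  then show ?thesis using kcochD(1,2,3)[OF assms]
    by (auto simp: N.kcoch_def multilin_def iota_homs iota_add)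
qed

lemma kd_iota: "(\<And>vs. F vs \<in> M) \<Longrightarrow> N.kd (\<lambda>vs. iota (F vs)) vs = iota (kd F vs)"
  by (rule kdiff_hom[where \<phi> = iota and F = F]) (simp_all add: iota_diff iota_ad)

lemma bd_iota: 
  assumes "\<And>m. f m \<in> M"
  shows "N.bd (\<lambda>m. iota (f m)) l = iota (bd f l)"
proof (rule bdiff_hom[where \<phi> = iota and f = f])
  show "hom_R a (iota (f m)) = iota (R a (f m))" for a m
    by (rule ext) (simp add: hom_R_def iota_def R_mul assms)
  show "hom_L a (iota (f m)) = iota (L a (f m))" for a m
    by (rule ext) (simp add: hom_L_def iota_def L_R assms)
qed (rule iota_diff)

lemma conjugation_iota:
  assumes "m \<in> M" shows "N.conjugation g (iota m) = iota (conjugation g m)"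
  by (rule ext) (simp add: N.conjugation_def conjugation_def hom_L_def hom_R_def iota_def assms R_mul[symmetric] L_R R_closed)

text \<open>The differential raises the degree by one, so restricting a primitive to degree
  \<open>n\<close> leaves its differential in degree \<open>n + 1\<close> untouched and removes
  everything else.\<close>

lemma kd_truncate: 
  assumes "\<And>vs. length vs = Suc n \<Longrightarrow> kd E vs = F vs" "\<And>vs. length vs \<noteq> Suc n \<Longrightarrow> F vs = 0"
  shows "kd (\<lambda>ws. if length ws = n then E ws else 0) vs = F vs"
proof (cases "length vs = Suc n")
  case True
  have "kd (\<lambda>ws. if length ws = n then E ws else 0) vs = kd E vs"
    by (rule kdiff_cong) (use True in simp)
  then show ?thesis using assms(1)[OF True] by simp
next
  case False
  have "kd (\<lambda>ws. if length ws = n then E ws else 0) vs = 0"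
    by (rule kd_zero_degree[of n]) (use False in auto)
  then show ?thesis using assms(2)[OF False] by simp
qed

definition curry_last :: "('a list \<Rightarrow> 'b) \<Rightarrow> 'a list \<Rightarrow> 'a \<Rightarrow> 'b"
  where "curry_last f l x = f (l @ [x])"

lemma curry_last_hcoch:
  assumes "f \<in> hcoch" shows "curry_last f \<in> N.hcoch"
proof -
  note h = multilin_add[OF hcochD(2)[OF assms]] multilin_scale[OF hcochD(2)[OF assms]] hcochD(3)[OF assms] hcochD(1)[OF assms]
  have "f (l @ [x + y]) = f (l @ [x]) + f (l @ [y])" "f (l @ [sc c x]) = scb c (f (l @ [x]))" "f (l @ [e \<odot> x]) = f (l @ [x])" for l x y c
    using h(1)[of l x y "[]"] h(2)[of l c x "[]"] h(3)[of l x "[]"] by auto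
  then have "curry_last f l \<in> homs" for l
    by (simp add: homs_def curry_last_def h(4))
  then show ?thesis
    using h by (auto simp: N.hcoch_def multilin_def curry_last_def hom_scale_def fun_eq_iff)
qed

text \<open>Only the last face, the right multiplication by \<open>x\<close>, distinguishes the two
  differentials. For a cocycle \<open>f\<close> this exhibits \<open>iota\<close> of
  \<open>f\<close> as a coboundary up to sign: the bar counterpart of
  \<open>homs_acyclic\<close>.\<close>

lemma bd_curry_last:
  assumes "l \<noteq> []"
  shows "N.bd (curry_last f) l x = bd f (l @ [x]) + (if even (length l) then R x (f l) else - R x (f l))"
proof -
  have "tail_diff mul hom_R (curry_last f) (a # l) x = tail_diff mul R f (a # l @ [x]) + (if odd (length l) then R x (f (a # l)) else - R x (f (a # l)))" for a l
  proof (induction l arbitrary: a f)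
    case Nil
    show ?case by (simp add: curry_last_def hom_R_def)
  next
    case (Cons b l)
    have *: "(\<lambda>m. curry_last f (a # m)) = curry_last (\<lambda>m. f (a # m))"
      by (intro ext) (simp add: curry_last_def)
    have "tail_diff mul hom_R (curry_last f) (a # b # l) x = - curry_last f (a \<odot> b # l) x - tail_diff mul hom_R (curry_last (\<lambda>m. f (a # m))) (b # l) x"
      unfolding tail_diff.simps(2)[of mul hom_R _ a] * by simp
    moreover have "tail_diff mul R f (a # b # l @ [x]) = - f (a \<odot> b # l @ [x]) - tail_diff mul R (\<lambda>m. f (a # m)) (b # l @ [x])"
      unfolding tail_diff.simps(2)[of mul R _ a] by simp
    ultimately show ?case
      using Cons.IH[of "\<lambda>m. f (a # m)" b] by (simp add: curry_last_def)
  qed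
  then show ?thesis
    using assms by (cases l) (auto simp: bdiff_def hom_L_def curry_last_def simp del: tail_diff.simps)
qed

end

lemma split_sum: "x = y + z + (x - y - z)" for x y z :: "'z::ab_group_add"
  by simp

text \<open>
  Coefficients are kept in one type of functions on lists, so that the bimodule of normalised linear
  maps from the algebra to a bimodule lives in the same type and induction on the degree is possible.
\<close>

locale koszul_bimodule_lists =
  koszul_bimodule G sc vsc mul e av ug \<rho> J co D comp "\<lambda>c u l. scy c (u l)" M L R + vy: vector_space scy
  for G :: "('g, 'm) monoid_scheme" (structure)
    and sc :: "complex \<Rightarrow> 'a::ab_group_add \<Rightarrow> 'a"
    and vsc :: "complex \<Rightarrow> 'v::ab_group_add \<Rightarrow> 'v"
    and mul (infixl \<open>\<odot>\<close> 70) and e av ug \<rho> J co D comp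
    and scy :: "complex \<Rightarrow> 'c::ab_group_add \<Rightarrow> 'c"
    and M :: "('a list \<Rightarrow> 'c) set" and L R
begin

definition pack :: "('a \<Rightarrow> 'a list \<Rightarrow> 'c) \<Rightarrow> 'a list \<Rightarrow> 'c"
  where "pack \<phi> l = (case l of [] \<Rightarrow> 0 | x # m \<Rightarrow> \<phi> x m)"

definition unpack :: "('a list \<Rightarrow> 'c) \<Rightarrow> 'a \<Rightarrow> 'a list \<Rightarrow> 'c"
  where "unpack u x l = u (x # l)"

lemma unpack_pack [simp]: "unpack (pack \<phi>) = \<phi>"
  by (intro ext) (simp add: pack_def unpack_def)

lemma pack_diff: "pack (\<phi> - \<psi>) = pack \<phi> - pack \<psi>"
  by (intro ext) (simp add: pack_def split: list.split)

lemma pack_eq_iff: "pack \<phi> = pack \<psi> \<longleftrightarrow> \<phi> = \<psi>"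
  by (metis unpack_pack)

lemma unpack_simps: "unpack (u + w) x = unpack u x + unpack w x" "unpack (\<lambda>l. scy c (u l)) x = (\<lambda>l. scy c (unpack u x l))" "unpack 0 x = 0"
  by (auto simp: unpack_def fun_eq_iff)

text \<open>A complement of the image of \<open>iota\<close>, standing for the quotient of
  \<open>homs\<close> by it: each \<open>\<phi>\<close> differs from exactly one map vanishing at
  \<open>e\<close> by an element of that image, namely \<open>iota (\<phi> e)\<close>.\<close>

definition normal_homs :: "('a list \<Rightarrow> 'c) set"
  where "normal_homs = {pack \<phi> | \<phi>. \<phi> \<in> homs \<and> \<phi> e = 0}"

definition normal_L :: "'a \<Rightarrow> ('a list \<Rightarrow> 'c) \<Rightarrow> 'a list \<Rightarrow> 'c"
  where "normal_L a u = pack (\<lambda>x. L a (unpack u x))"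

text \<open>Precomposition leaves the complement; the correction term projects back along the image
  of \<open>iota\<close>.\<close>

definition normal_R :: "'a \<Rightarrow> ('a list \<Rightarrow> 'c) \<Rightarrow> 'a list \<Rightarrow> 'c"
  where "normal_R b u = pack (\<lambda>x. unpack u (b \<odot> x) - R x (unpack u b))"

definition normalise :: "('a \<Rightarrow> 'a list \<Rightarrow> 'c) \<Rightarrow> 'a list \<Rightarrow> 'c"
  where "normalise \<phi> = pack (\<lambda>x. \<phi> x - R x (\<phi> e))"

lemma normal_homsE:
  assumes "u \<in> normal_homs"
  obtains \<phi> where "u = pack \<phi>" "\<phi> \<in> homs" "\<phi> e = 0"
  using assms by (auto simp: normal_homs_def)

lemma pack_add: "pack (\<lambda>x. \<phi> x + \<psi> x) = pack \<phi> + pack \<psi>"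
  by (intro ext) (simp add: pack_def split: list.split)

lemma pack_scale: "pack (\<lambda>x l. scy c (\<phi> x l)) = (\<lambda>l. scy c (pack \<phi> l))"
  by (intro ext) (simp add: pack_def split: list.split)

lemma e_right: "\<phi> \<in> homs \<Longrightarrow> \<phi> (x \<odot> e) = \<phi> x"
  by (simp add: e_comm[symmetric] homsD)

lemma normal_homs_bimodule: 
  "koszul_bimodule G sc vsc mul e av ug \<rho> J co D comp (\<lambda>c u l. scy c (u l)) normal_homs normal_L normal_R"
proof unfold_locales
  fix a b :: 'a and c :: complex and m n :: "'a list \<Rightarrow> 'c"
  show "normal_L a (m + n) = normal_L a m + normal_L a n"
    by (simp add: normal_L_def unpack_simps L_add pack_add)
  show "normal_R a (m + n) = normal_R a m + normal_R a n"
    unfolding normal_R_def pack_add[symmetric] by (simp add: unpack_simps R_add algebra_simps)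
  show "normal_L a (\<lambda>l. scy c (m l)) = (\<lambda>l. scy c (normal_L a m l))"
    by (simp add: normal_L_def unpack_simps L_sc pack_scale)
  show "normal_R a (\<lambda>l. scy c (m l)) = (\<lambda>l. scy c (normal_R a m l))"
    unfolding normal_R_def pack_scale[symmetric] 
    by (rule arg_cong[of _ _ pack]) (auto simp: unpack_simps R_sc vy.scale_right_diff_distrib fun_eq_iff)
  show "0 \<in> normal_homs"
  proof -
    have "(\<lambda>x. 0) \<in> homs" by (auto simp: homs_def M_zero fun_eq_iff)
    moreover have "0 = pack (\<lambda>x. 0)" by (auto simp: pack_def fun_eq_iff split: list.split)
    ultimately show ?thesis unfolding normal_homs_def by blast
  qed
  assume "m \<in> normal_homs"
  then obtain \<phi> where m: "m = pack \<phi>" and \<phi>: "\<phi> \<in> homs" and \<phi>e: "\<phi> e = 0" by (rule normal_homsE)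
  note h = homsD[OF \<phi>]
  show "(\<lambda>l. scy c (m l)) \<in> normal_homs"
    unfolding m pack_scale[symmetric] normal_homs_def using h \<phi>e
    by (auto simp: homs_def M_sc fun_eq_iff vy.scale_right_distrib vy.scale_scale mult.commute intro!: exI[of _ "\<lambda>x l. scy c (\<phi> x l)"])
  show "normal_L a m \<in> normal_homs"
    unfolding normal_L_def normal_homs_def m using h \<phi>e
    by (auto simp: homs_def L_closed L_add L_sc intro!: exI[of _ "\<lambda>x. L a (\<phi> x)"])
  show "normal_R a m \<in> normal_homs"
  proof -
    have "a \<odot> (e \<odot> x) = e \<odot> (a \<odot> x)" for x by (simp add: mul_assoc[symmetric] e_comm[of a])
    then have "(\<lambda>x. \<phi> (a \<odot> x) - R x (\<phi> a)) \<in> homs"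
      using h by (auto simp: homs_def M_diff R_closed mul_add_right mul_sc_right R_add_left R_sc_left 
          vy.scale_right_diff_distrib fun_eq_iff R_mul[symmetric] R_e)
    moreover have "\<phi> (a \<odot> e) - R e (\<phi> a) = 0" by (simp add: e_right \<phi> R_e h)
    ultimately show ?thesis unfolding normal_R_def normal_homs_def m by auto
  qed
  show "normal_L (a + b) m = normal_L a m + normal_L b m"
    by (simp add: normal_L_def m L_add_left h pack_add)
  show "normal_R (a + b) m = normal_R a m + normal_R b m"
    unfolding normal_R_def m pack_add[symmetric] by (simp add: mul_add_left h R_add algebra_simps)
  show "normal_L (sc c a) m = (\<lambda>l. scy c (normal_L a m l))"
    by (simp add: normal_L_def m L_sc_left h pack_scale)
  show "normal_R (sc c a) m = (\<lambda>l. scy c (normal_R a m l))"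
    unfolding normal_R_def m pack_scale[symmetric] 
    by (rule arg_cong[of _ _ pack]) (auto simp: mul_sc_left h R_sc vy.scale_right_diff_distrib fun_eq_iff)
  show "normal_L a (normal_L b m) = normal_L (a \<odot> b) m"
    by (simp add: normal_L_def m L_mul h)
  show "normal_R b (normal_R a m) = normal_R (a \<odot> b) m"
    by (simp add: normal_R_def m R_diff R_mul h mul_assoc)
  show "normal_L a (normal_R b m) = normal_R b (normal_L a m)"
    by (simp add: normal_L_def normal_R_def m L_diff L_R h)
  show "normal_L e m = m"
    by (simp add: normal_L_def m L_e h)
  show "normal_R e m = m"
    by (simp add: normal_R_def m h \<phi>e)
  assume "n \<in> normal_homs"
  then obtain \<psi> where n: "n = pack \<psi>" and \<psi>: "\<psi> \<in> homs" and \<psi>e: "\<psi> e = 0" by (rule normal_homsE)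
  show "m + n \<in> normal_homs"
    unfolding m n pack_add[symmetric] normal_homs_def using h \<phi>e homsD[OF \<psi>] \<psi>e
    by (auto simp: homs_def M_add fun_eq_iff vy.scale_right_distrib intro!: exI[of _ "\<lambda>x. \<phi> x + \<psi> x"])
qed

sublocale N: koszul_bimodule G sc vsc mul e av ug \<rho> J co D comp hom_scale homs hom_L hom_R
  by (rule homs_bimodule)

sublocale Z: koszul_bimodule G sc vsc mul e av ug \<rho> J co D comp "\<lambda>c u l. scy c (u l)" normal_homs normal_L normal_R
  by (rule normal_homs_bimodule)

lemma normalise_closed: "\<phi> \<in> homs \<Longrightarrow> normalise \<phi> \<in> normal_homs"
  unfolding normalise_def normal_homs_def
  by (auto simp: homs_def M_diff R_closed R_add_left R_sc_left vy.scale_right_diff_distrib fun_eq_iff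
      R_mul[symmetric] R_e intro!: exI[of _ "\<lambda>x. \<phi> x - R x (\<phi> e)"])

lemma normalise_diff: "normalise (\<phi> - \<psi>) = normalise \<phi> - normalise \<psi>"
  unfolding normalise_def pack_diff[symmetric] by (rule arg_cong[of _ _ pack], rule ext) (simp add: R_diff)

lemma normalise_zero [simp]: "normalise 0 = 0"
  using normalise_diff[of 0 0] by simp

lemma normalise_add: "normalise (\<phi> + \<psi>) = normalise \<phi> + normalise \<psi>"
  using normalise_diff[of "\<phi> + \<psi>" \<psi>] by (simp add: algebra_simps)

lemma normalise_scale: "normalise (hom_scale c \<phi>) = (\<lambda>l. scy c (normalise \<phi> l))"
  unfolding normalise_def pack_scale[symmetric]
  by (rule arg_cong[of _ _ pack]) (auto simp: hom_scale_def R_sc vy.scale_right_diff_distrib fun_eq_iff)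

lemma normalise_L: "\<phi> \<in> homs \<Longrightarrow> normalise (hom_L a \<phi>) = normal_L a (normalise \<phi>)"
  by (simp add: normalise_def normal_L_def hom_L_def L_diff L_R homsD)

lemma normalise_R: "\<phi> \<in> homs \<Longrightarrow> normalise (hom_R a \<phi>) = normal_R a (normalise \<phi>)"
  by (simp add: normalise_def normal_R_def hom_R_def R_diff R_mul homsD e_right)

lemma normalise_unpack: "u \<in> normal_homs \<Longrightarrow> normalise (unpack u) = u"
  by (erule normal_homsE) (simp add: normalise_def)

lemma unpack_hom_scale: "unpack (\<lambda>l. scy c (u l)) = hom_scale c (unpack u)"
  by (rule ext) (simp add: hom_scale_def unpack_simps)

lemma unpack_add: "unpack (u + w) = unpack u + unpack w" and unpack_zero: "unpack 0 = 0"
  by (auto simp: unpack_def fun_eq_iff)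

lemma unpack_homs: "u \<in> normal_homs \<Longrightarrow> unpack u \<in> homs"
  by (erule normal_homsE) simp

text \<open>Exactness in the middle of the sequence \<open>M\<close>, \<open>homs\<close>,
  \<open>normal_homs\<close>.\<close>

lemma normalise_eq_0: 
  assumes "normalise \<phi> = 0" shows "\<phi> = iota (\<phi> e)"
proof -
  have "pack (\<lambda>x. \<phi> x - R x (\<phi> e)) = 0"
    using assms by (simp only: normalise_def)
  moreover have "(0 :: 'a list \<Rightarrow> 'c) = pack (\<lambda>x. 0)"
    by (rule ext) (simp add: pack_def split: list.split)
  ultimately have "pack (\<lambda>x. \<phi> x - R x (\<phi> e)) = pack (\<lambda>x. 0)"
    by (rule trans)
  then have *: "(\<lambda>x. \<phi> x - R x (\<phi> e)) = (\<lambda>x. 0)"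
    by (rule pack_eq_iff[THEN iffD1])
  have "\<phi> x = iota (\<phi> e) x" for x
    using fun_cong[OF *, of x] by (simp only: iota_def right_minus_eq)
  then show ?thesis by (rule ext)
qed

lemma normalise_iota: "m \<in> M \<Longrightarrow> normalise (iota m) = 0"
  by (auto simp: normalise_def iota_def R_e pack_def fun_eq_iff split: list.split)

lemma normalise_ad: "\<phi> \<in> homs \<Longrightarrow> normalise (N.ad v \<phi>) = Z.ad v (normalise \<phi>)"
  by (simp add: N.ad_def Z.ad_def normalise_diff normalise_L normalise_R)

lemma normalise_conjugation: "\<phi> \<in> homs \<Longrightarrow> normalise (N.conjugation g \<phi>) = Z.conjugation g (normalise \<phi>)"
  by (simp add: N.conjugation_def Z.conjugation_def normalise_L normalise_R N.R_closed)

lemma normalise_kcoch: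
  assumes "E \<in> N.kcoch" shows "(\<lambda>vs. normalise (E vs)) \<in> Z.kcoch"
  using N.kcochD(1,2,3)[OF assms]
  by (auto simp: Z.kcoch_def multilin_def normalise_closed normalise_add normalise_scale)

lemma unpack_kcoch:
  assumes "Y \<in> Z.kcoch" shows "(\<lambda>vs. unpack (Y vs)) \<in> N.kcoch"
  using Z.kcochD(1,2,3)[OF assms]
  by (auto simp: N.kcoch_def multilin_def unpack_homs unpack_add unpack_hom_scale unpack_zero)

lemma normalise_hcoch:
  assumes "E \<in> N.hcoch" shows "(\<lambda>vs. normalise (E vs)) \<in> Z.hcoch"
  using N.hcochD(1,2,3)[OF assms]
  by (auto simp: Z.hcoch_def multilin_def normalise_closed normalise_add normalise_scale)

lemma unpack_hcoch:
  assumes "Y \<in> Z.hcoch" shows "(\<lambda>vs. unpack (Y vs)) \<in> N.hcoch"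
  using Z.hcochD(1,2,3)[OF assms]
  by (auto simp: N.hcoch_def multilin_def unpack_homs unpack_add unpack_hom_scale unpack_zero)

lemma kd_normalise: "(\<And>vs. E vs \<in> homs) \<Longrightarrow> Z.kd (\<lambda>vs. normalise (E vs)) vs = normalise (N.kd E vs)"
  by (rule kdiff_hom[where \<phi> = normalise and F = E]) (simp_all add: normalise_diff normalise_ad)

lemma bd_normalise: "(\<And>m. f m \<in> homs) \<Longrightarrow> Z.bd (\<lambda>m. normalise (f m)) l = normalise (N.bd f l)"
  by (rule bdiff_hom[where \<phi> = normalise and f = f]) (simp_all add: normalise_diff normalise_L normalise_R)

text \<open>A step along the connecting map. \<open>iota\<close> of \<open>F\<close> bounds an
  invariant cochain \<open>E\<close> of degree \<open>n\<close>; its class in the quotient lifts to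
  a bar cocycle by induction, and the bar differential of a representative in \<open>homs\<close> is
  \<open>iota\<close> of the required \<open>f\<close>.\<close>

lemma lifts_Suc:
  assumes IH: "Z.lifts n" shows "lifts (Suc n)"
  unfolding lifts_def
proof (intro ballI impI)
  fix F assume F: "F \<in> kcoch" and s: "\<forall>vs. length vs \<noteq> Suc n \<longrightarrow> F vs = 0" and d: "\<forall>vs. kd F vs = 0"
    and inv: "\<forall>g\<in>carrier G. \<forall>vs. conj_coch g F vs = F vs"
  let ?F = "\<lambda>vs. iota (F vs)"
  have "\<exists>Y\<in>N.kcoch. N.kd Y = ?F"
  proof (rule homs_acyclic[OF iota_kcoch[OF F]])
    show "iota (F []) = 0" using s iota_zero by (metis list.size(3) nat.distinct(1))
    show "N.kd ?F vs = 0" for vs using kd_iota[where F = F, OF kcochD(1)[OF F]] d by (simp only: iota_zero)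
  qed
  then obtain Y where Y: "Y \<in> N.kcoch" and dY: "N.kd Y = ?F" by blast
  have ci: "N.conj_coch g ?F vs = ?F vs" if "g \<in> carrier G" for g vs
  proof -
    have "N.conj_coch g ?F vs = iota (conj_coch g F vs)"
      by (simp add: N.conj_coch_def conj_coch_def conjugation_iota kcochD[OF F])
    then show ?thesis using inv that by simp
  qed
  \<comment> \<open>Averaging makes the primitive invariant, and restriction to degree
    \<open>n\<close> makes it homogeneous. Neither changes its differential, because
    \<open>F\<close> is invariant and lives in degree \<open>n + 1\<close>.\<close>
  define E where "E = (\<lambda>ws. if length ws = n then N.avg Y ws else 0)"
  have aY: "N.avg Y \<in> N.kcoch" by (rule N.avg_kcoch[OF Y])
  have E: "E \<in> N.kcoch" unfolding E_def by (rule N.kcoch_degree[OF aY])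
  have kdE: "N.kd E vs = ?F vs" for vs
    unfolding E_def
  proof (rule N.kd_truncate)
    show "N.kd (N.avg Y) vs = ?F vs" for vs by (simp add: N.kd_avg[OF Y] dY N.avg_invariant ci)
    show "?F vs = 0" if "length vs \<noteq> Suc n" for vs using s that iota_zero by metis
  qed
  have Einv: "N.conj_coch g E vs = E vs" if "g \<in> carrier G" for g vs
    using N.conj_coch_avg[where F = Y and vs = vs, OF that N.kcochD(1)[OF Y]] by (simp add: E_def N.conj_coch_def)
  let ?En = "\<lambda>vs. normalise (E vs)"
  have Ec: "E vs \<in> homs" for vs by (rule N.kcochD(1)[OF E])
  have A1: "?En \<in> Z.kcoch" by (rule normalise_kcoch[OF E])
  have A2: "\<forall>vs. length vs \<noteq> n \<longrightarrow> ?En vs = 0" by (simp add: E_def)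
  have A3: "\<forall>vs. Z.kd ?En vs = 0" by (simp add: kd_normalise Ec kdE normalise_iota kcochD[OF F])
  have A4: "\<forall>g\<in>carrier G. \<forall>vs. Z.conj_coch g ?En vs = ?En vs"
    using Einv by (simp add: Z.conj_coch_def N.conj_coch_def normalise_conjugation[symmetric] Ec)
  obtain e0 X where e0: "e0 \<in> Z.hcoch" "\<And>as. length as \<noteq> n \<Longrightarrow> e0 as = 0" "\<And>as. Z.bd e0 as = 0"
    and X: "X \<in> Z.kcoch" "\<And>vs. Z.alt e0 vs = ?En vs + Z.kd X vs"
    using IH[unfolded Z.lifts_def, THEN bspec, OF A1, THEN mp, OF A2, THEN mp, OF A3, THEN mp, OF A4] by blast
  let ?e = "\<lambda>as. unpack (e0 as)" and ?X = "\<lambda>vs. unpack (X vs)"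
  have e: "?e \<in> N.hcoch" and X': "?X \<in> N.kcoch" by (rule unpack_hcoch[OF e0(1)], rule unpack_kcoch[OF X(1)])
  have ne: "normalise (?e as) = e0 as" for as by (rule normalise_unpack[OF Z.hcochD(1)[OF e0(1)]])
  have nX: "normalise (?X as) = X as" for as by (rule normalise_unpack[OF Z.kcochD(1)[OF X(1)]])
  \<comment> \<open>The connecting map: the coboundary of a lift of a cocycle of the quotient takes
    values in the image of \<open>iota\<close>, and evaluation at \<open>e\<close> recovers
    them.\<close>
  define f where "f = (\<lambda>as. N.bd ?e as e)"
  have f: "f \<in> hcoch" unfolding f_def by (rule eval_hcoch[OF N.bd_hcoch[OF e]])
  have "normalise (N.bd ?e as) = 0" for as
    using bd_normalise[of ?e as] N.hcochD(1)[OF e] e0(3)[of as] by (simp add: ne)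
  then have fi: "N.bd ?e as = iota (f as)" for as
    unfolding f_def by (rule normalise_eq_0)
  have fz: "f as = 0" if "length as \<noteq> Suc n" for as
    using N.bd_zero_degree[of n ?e as] e0(2) that by (simp add: f_def fun_eq_iff unpack_simps)
  have bf: "bd f as = 0" for as
  proof -
    have "iota (bd f as) = N.bd (N.bd ?e) as"
      by (simp add: bd_iota[OF hcochD(1)[OF f], symmetric] fi[symmetric])
    also have "\<dots> = 0" by (rule N.bd_bd[OF N.hcochD(1)[OF e]])
    finally have "iota (bd f as) e = 0" by simp
    then show ?thesis by (simp add: iota_e hcochD(1)[OF bd_hcoch[OF f]])
  qed
  \<comment> \<open>The lift of \<open>e0\<close> antisymmetrises to \<open>E\<close> plus a
    coboundary, up to a cochain that dies in the quotient. That cochain comes from some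
    \<open>w\<close> with values in \<open>M\<close>, and the differential of \<open>w\<close>
    accounts for the difference between the antisymmetrised \<open>f\<close> and
    \<open>F\<close>.\<close>
  let ?W = "\<lambda>vs. N.alt ?e vs - E vs - N.kd ?X vs"
  have W: "?W \<in> N.kcoch"
    by (intro N.kcoch_diff N.alt_kcoch e E N.kd_kcoch X')
  have "normalise (N.alt ?e vs) = Z.alt e0 vs" for vs
    using alternate_hom[of normalise av ?e vs] by (simp add: normalise_diff ne)
  moreover have "normalise (N.kd ?X vs) = Z.kd X vs" for vs
    using kd_normalise[of ?X vs] N.kcochD(1)[OF X'] by (simp add: nX)
  ultimately have "normalise (?W vs) = 0" for vs
    by (simp add: normalise_diff X(2))
  then have Wi: "?W vs = iota (?W vs e)" for vs by (rule normalise_eq_0)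
  define w where "w = (\<lambda>vs. ?W vs e)"
  have w: "w \<in> kcoch" unfolding w_def by (rule eval_kcoch[OF W])
  have "alt f vs = F vs + kd w vs" for vs
  proof -
    have "iota (alt f vs) = N.alt (\<lambda>as. iota (f as)) vs"
      by (rule alternate_hom[where \<phi> = iota and f = f, symmetric]) (rule iota_diff)
    also have "\<dots> = N.kd (N.alt ?e) vs" unfolding fi[symmetric] by (rule N.alt_bd[OF e])
    also have "N.alt ?e = (\<lambda>vs. E vs + N.kd ?X vs + iota (w vs))"
      by (rule ext) (simp only: w_def Wi[symmetric], rule split_sum)
    also have "N.kd \<dots> vs = iota (F vs) + iota (kd w vs)"
      by (simp add: N.kd_add kdE N.kd_kd[OF X'] kd_iota kcochD[OF w])
    finally have "iota (alt f vs) e = iota (F vs) e + iota (kd w vs) e" by simp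
    then show ?thesis by (simp add: iota_e alt_closed[OF f] kcochD[OF F] kd_closed[OF w])
  qed
  then show "\<exists>f\<in>hcoch. (\<forall>as. length as \<noteq> Suc n \<longrightarrow> f as = 0) \<and> (\<forall>as. bd f as = 0) \<and>
      (\<exists>Z\<in>kcoch. \<forall>vs. alt f vs = F vs + kd Z vs)"
    using f w fz bf by blast
qed

text \<open>A diagram chase with \<open>curry_last f\<close> as primitive of \<open>iota\<close> of
  \<open>f\<close>. Comparison with the given primitive \<open>Y\<close> on the Koszul side yields a
  cocycle in \<open>homs\<close>; where this is a coboundary, the induction hypothesis corrects the
  primitive by a coboundary until it comes from \<open>M\<close>. Acyclicity says nothing in degree
  0, so \<open>n = 0\<close> is treated by averaging.\<close>

lemma detects_Suc:
  assumes IH: "Z.detects n" shows "detects (Suc n)"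
  unfolding detects_def
proof (intro ballI impI)
  fix f assume f: "f \<in> hcoch" and s: "\<forall>as. length as \<noteq> Suc n \<longrightarrow> f as = 0" and d: "\<forall>as. bd f as = 0"
    and "\<exists>Z\<in>kcoch. \<forall>vs. length vs = Suc n \<longrightarrow> alt f vs = kd Z vs"
  then obtain Y where Y: "Y \<in> kcoch" and fY: "\<And>vs. length vs = Suc n \<Longrightarrow> alt f vs = kd Y vs" by blast
  \<comment> \<open>The sign of the last face in \<open>bd_curry_last\<close> for lists of length
    \<open>n + 1\<close>; it is its own inverse.\<close>
  define \<epsilon> :: complex where "\<epsilon> = (if even (Suc n) then 1 else -1)"
  have \<epsilon>2: "scy \<epsilon> (scy \<epsilon> y) = y" for y by (simp add: \<epsilon>_def)
  have \<epsilon>3: "hom_scale \<epsilon> (hom_scale \<epsilon> y) = y" for y by (intro ext) (simp only: hom_scale_def \<epsilon>2)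
  have nsi: "normalise (hom_scale c (iota m)) = 0" if "m \<in> M" for c m
    by (rule ext) (simp add: normalise_scale normalise_iota[OF that])
  let ?h = "curry_last f"
  have h: "?h \<in> N.hcoch" by (rule curry_last_hcoch[OF f])
  have bh: "N.bd ?h l = hom_scale \<epsilon> (iota (f l))" for l
  proof (cases "length l = Suc n")
    case True
    then have "l \<noteq> []" by auto
    then show ?thesis using bd_curry_last[of l f] d True
      by (auto simp: fun_eq_iff iota_def hom_scale_def \<epsilon>_def)
  next
    case False
    then have fl: "f l = 0" using s by blast
    have "N.bd ?h l x = 0" for x
    proof (cases "l = []")
      case True
      then show ?thesis by (simp add: bdiff_def)
    next
      case False
      then show ?thesis using bd_curry_last[OF False, of f x] d by (simp only: fl R_zero) simp
    qed
    then have "N.bd ?h l = 0" by (intro ext) simp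
    then show ?thesis by (simp only: fl iota_zero N.mod.scale_zero_right)
  qed
  let ?X = "\<lambda>vs. hom_scale \<epsilon> (N.alt ?h vs) - iota (Y vs)"
  have X: "?X \<in> N.kcoch"
    by (intro N.kcoch_diff N.kcoch_scale N.alt_kcoch h iota_kcoch Y)
  have kX: "N.kd ?X vs = 0" if "length vs = Suc n" for vs
  proof -
    have "N.kd ?X vs = hom_scale \<epsilon> (N.alt (N.bd ?h) vs) - iota (kd Y vs)"
      by (simp add: N.kd_diff N.kd_scale N.alt_bd[OF h] kd_iota kcochD[OF Y])
    also have "N.alt (N.bd ?h) vs = hom_scale \<epsilon> (iota (alt f vs))"
      unfolding bh using alternate_hom[of "\<lambda>m. hom_scale \<epsilon> (iota m)" av f vs]
      by (simp add: iota_diff N.mod.scale_right_diff_distrib)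
    finally show ?thesis by (simp only: \<epsilon>3 fY[OF that] diff_self)
  qed
  \<comment> \<open>It suffices to subtract from \<open>h\<close> a cochain \<open>k\<close> that
    has the same class in the quotient and whose coboundary is \<open>iota\<close> of a coboundary:
    the difference is \<open>iota\<close> of some \<open>m\<close>, and its coboundary yields
    \<open>f\<close>.\<close>
  have reduce: "\<exists>h\<in>hcoch. \<forall>as. length as = Suc n \<longrightarrow> f as = bd h as"
    if k: "k \<in> N.hcoch" and hk: "\<And>as. length as = n \<Longrightarrow> normalise (?h as - k as) = 0" and bk: "\<And>as. length as = Suc n \<Longrightarrow> N.bd k as = iota (bd k' as)"
    and k': "k' \<in> hcoch" for k k'
  proof -
    define m where "m = (\<lambda>as. (?h as - k as) e)"
    have m: "m \<in> hcoch" unfolding m_def by (rule eval_hcoch[OF N.hcoch_diff[OF h k]])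
    have hm: "?h as - k as = iota (m as)" if "length as = n" for as
      unfolding m_def by (rule normalise_eq_0[OF hk[OF that]])
    have "f as = scb' \<epsilon> (bd m as + bd k' as)" if scb': "scb' = (\<lambda>c u l. scy c (u l))" and l: "length as = Suc n" for as scb'
    proof -
      have "iota (bd m as) = N.bd (\<lambda>as. iota (m as)) as" by (simp add: bd_iota hcochD[OF m])
      also have "\<dots> = N.bd (\<lambda>as. ?h as - k as) as"
        by (rule bdiff_cong) (simp add: hm l)
      also have "\<dots> = hom_scale \<epsilon> (iota (f as)) - iota (bd k' as)"
        by (simp add: N.bd_diff bh bk l)
      finally have "hom_scale \<epsilon> (iota (f as)) = iota (bd m as) + iota (bd k' as)" by (simp add: algebra_simps)
      then have "iota (f as) = hom_scale \<epsilon> (iota (bd m as) + iota (bd k' as))" by (metis \<epsilon>3)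
      then have "iota (f as) e = hom_scale \<epsilon> (iota (bd m as + bd k' as)) e" by (simp add: iota_add)
      then show ?thesis by (simp add: iota_e hcochD(1)[OF f] hom_scale_def M_add hcochD(1)[OF bd_hcoch[OF m]] hcochD(1)[OF bd_hcoch[OF k']] that(1))
    qed
    then have "\<forall>as. length as = Suc n \<longrightarrow> f as = bd (\<lambda>as l. scy \<epsilon> (m as l + k' as l)) as"
      using bd_scale[of \<epsilon> "\<lambda>as. m as + k' as"] by (simp add: bd_add)
    moreover have "(\<lambda>as l. scy \<epsilon> (m as l + k' as l)) \<in> hcoch"
      using hcoch_scale[OF hcoch_add[OF m k'], of \<epsilon>] by simp
    ultimately show ?thesis by blast
  qed
  show "\<exists>h\<in>hcoch. \<forall>as. length as = Suc n \<longrightarrow> f as = bd h as"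
  proof (cases "n = 0")
    case True
    \<comment> \<open>For \<open>n = 0\<close> the cocycle is a single map \<open>u\<close>
      commuting with the vectors. Its average also commutes with the group elements, hence is
      central, and gives a \<open>k\<close> with coboundary 0.\<close>
    define u where "u = ?X []"
    have u: "u \<in> homs" unfolding u_def by (rule N.kcochD(1)[OF X])
    let ?U = "\<lambda>vs. if length vs = 0 then u else 0"
    have U: "?U \<in> N.kcoch"
      by (auto simp: N.kcoch_def multilin_def u N.M_zero)
    define w where "w = N.avg ?U []"
    have wM: "w \<in> homs" unfolding w_def by (rule N.kcochD(1)[OF N.avg_kcoch[OF U]])
    have adu: "N.ad v u = 0" for v using kX[of "[v]"] True by (simp add: u_def)
    have "N.central w"
    proof (rule N.central_if_generators[OF wM])
      fix v
      have "N.kd ?U [x] = 0" for x using adu by simp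
      then have "N.avg (N.kd ?U) [v] = 0" by (simp add: N.avg_def N.conj_coch_def)
      then show "N.ad v w = 0" using N.kd_avg[OF U, of "[v]"] by (simp add: w_def)
    next
      fix g assume "g \<in> carrier G"
      from N.conj_coch_avg[where F = ?U and vs = "[]", OF this N.kcochD(1)[OF U]]
      show "N.conjugation g w = w" by (simp add: w_def N.conj_coch_def)
    qed
    have nh: "normalise (?h []) = normalise (hom_scale \<epsilon> u)"
    proof -
      have "hom_scale \<epsilon> u = ?h [] - hom_scale \<epsilon> (iota (Y []))"
        by (simp only: u_def N.mod.scale_right_diff_distrib \<epsilon>3 alternate.simps)
      then show ?thesis by (simp only: normalise_diff nsi[OF kcochD(1)[OF Y]] diff_zero)
    qed
    have nu: "normalise u = (\<lambda>l. scy \<epsilon> (normalise (?h []) l))"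
      by (simp only: nh normalise_scale \<epsilon>2)
    \<comment> \<open>The class of \<open>u\<close> in the quotient is already central, because that
      of \<open>h\<close> is closed. So conjugation fixes it, and averaging \<open>u\<close> does
      not alter its class.\<close>
    have "Z.central (normalise (?h []))"
    proof -
      have "Z.bd (\<lambda>m. normalise (?h m)) [a] = 0" for a
        using bd_normalise[of ?h "[a]"] N.hcochD(1)[OF h] by (simp add: bh nsi[OF hcochD(1)[OF f]])
      then show ?thesis by (simp add: Z.central_def bdiff_def)
    qed
    then have cu: "Z.central (normalise u)"
      unfolding nu by (simp add: Z.central_def Z.L_sc Z.R_sc)
    have nuM: "normalise u \<in> normal_homs" by (rule normalise_closed[OF u])
    have "Z.conjugation g (normalise u) = normalise u" if "g \<in> carrier G" for g
      using cu nuM that by (simp add: Z.conjugation_def Z.central_def[THEN iffD1, rule_format, symmetric] Z.L_mul ug_mul ug_one Z.L_e)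
    then have ci: "Z.avg (\<lambda>vs. if length vs = 0 then normalise u else 0) [] = normalise u"
      by (subst Z.avg_invariant) (simp_all add: Z.conj_coch_def)
    have nsum: "normalise (\<Sum>g\<in>I. p g) = (\<Sum>g\<in>I. normalise (p g))" for I :: "'g set" and p
    proof (cases "finite I")
      case True
      then show ?thesis
        by (rule finite_induct) (simp_all only: sum.empty sum.insert normalise_add normalise_zero not_False_eq_True)
    next
      case False
      then show ?thesis using normalise_zero by (simp only: sum.infinite[OF False])
    qed
    let ?c = "1 / complex_of_nat (card (carrier G))"
    have "w = hom_scale ?c (\<Sum>g\<in>carrier G. N.conjugation g u)"
      by (simp only: w_def N.avg_def N.conj_coch_def list.map list.size if_True simp_thms)
    then have "normalise w = (\<lambda>l. scy ?c ((\<Sum>g\<in>carrier G. Z.conjugation g (normalise u)) l))"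
      by (simp only: normalise_scale nsum normalise_conjugation[OF u])
    also have "\<dots> = normalise u"
      using ci by (simp only: Z.avg_def Z.conj_coch_def list.map list.size if_True simp_thms)
    finally have nw: "normalise w = normalise u" .
    let ?k = "\<lambda>as :: 'a list. if length as = 0 then hom_scale \<epsilon> w else 0"
    show ?thesis
    proof (rule reduce)
      show "?k \<in> N.hcoch" by (auto simp: N.hcoch_def multilin_def N.M_zero wM N.M_sc)
      show "normalise (?h as - ?k as) = 0" if "length as = n" for as
        using that True by (simp add: normalise_diff nh normalise_scale nw)
      show "(\<lambda>as. 0) \<in> hcoch" by (rule hcoch_zero)
      show "N.bd ?k as = iota (bd (\<lambda>as. 0) as)" if l: "length as = Suc n" for as
      proof -
        obtain a where a: "as = [a]" using l True by (auto simp: length_Suc_conv)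
        have "N.bd ?k as = 0" using \<open>N.central w\<close> by (simp add: a bdiff_def N.central_def N.L_sc N.R_sc)
        moreover have "bd (\<lambda>as. 0) as = 0" by (simp add: a bdiff_def)
        ultimately show ?thesis by simp
      qed
    qed
  next
    case False
    let ?X' = "\<lambda>ws. if length ws = n then ?X ws else 0"
    have X': "?X' \<in> N.kcoch" by (rule N.kcoch_degree[OF X])
    have "\<exists>W\<in>N.kcoch. N.kd W = ?X'"
      by (rule homs_acyclic[OF X']) (use False kX N.kd_truncate[of n ?X "\<lambda>_. 0"] in auto)
    then obtain W where W: "W \<in> N.kcoch" "N.kd W = ?X'" by blast
    let ?hn = "\<lambda>as. normalise (?h as)"
    have A1: "?hn \<in> Z.hcoch" by (rule normalise_hcoch[OF h])
    have A2: "\<forall>as. length as \<noteq> n \<longrightarrow> ?hn as = 0"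
    proof (intro allI impI)
      fix as :: "'a list" assume "length as \<noteq> n"
      then have "?h as x = 0" for x unfolding curry_last_def using s by simp
      then have "?h as = 0" by (intro ext) (simp only: zero_fun_apply)
      then show "?hn as = 0" by (rule ssubst) (rule normalise_zero)
    qed
    have A3: "\<forall>as. Z.bd ?hn as = 0"
      using N.hcochD(1)[OF h] by (simp add: bd_normalise bh nsi[OF hcochD(1)[OF f]])
    have A4: "\<exists>V\<in>Z.kcoch. \<forall>vs. length vs = n \<longrightarrow> Z.alt ?hn vs = Z.kd V vs"
    proof (intro bexI allI impI)
      let ?V = "\<lambda>vs. normalise (hom_scale \<epsilon> (W vs))"
      have sW: "(\<lambda>vs. hom_scale \<epsilon> (W vs)) \<in> N.kcoch" by (rule N.kcoch_scale[OF W(1)])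
      show "?V \<in> Z.kcoch" by (rule normalise_kcoch[OF sW])
      fix vs :: "'v list" assume l: "length vs = n"
      have "Z.alt ?hn vs = normalise (N.alt ?h vs)" by (rule alternate_hom[where \<phi> = normalise and f = ?h]) (rule normalise_diff)
      also have "N.alt ?h vs = hom_scale \<epsilon> (?X vs) + hom_scale \<epsilon> (iota (Y vs))"
        by (simp only: N.mod.scale_right_diff_distrib \<epsilon>3 diff_add_cancel)
      also have "normalise \<dots> = normalise (hom_scale \<epsilon> (N.kd W vs))"
        by (simp only: W(2) l normalise_add nsi[OF kcochD(1)[OF Y]] if_True add_0_right simp_thms)
      also have "\<dots> = Z.kd ?V vs"
        using kd_normalise[of "\<lambda>vs. hom_scale \<epsilon> (W vs)" vs] N.kcochD(1)[OF sW] by (simp add: N.kd_scale)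
      finally show "Z.alt ?hn vs = Z.kd ?V vs" .
    qed
    obtain k where k: "k \<in> Z.hcoch" "\<And>as. length as = n \<Longrightarrow> ?hn as = Z.bd k as"
      using IH[unfolded Z.detects_def, THEN bspec, OF A1, THEN mp, OF A2, THEN mp, OF A3, THEN mp, OF A4] by blast
    let ?k = "\<lambda>as. unpack (k as)"
    have k': "?k \<in> N.hcoch" by (rule unpack_hcoch[OF k(1)])
    have nk: "normalise (?k as) = k as" for as by (rule normalise_unpack[OF Z.hcochD(1)[OF k(1)]])
    show ?thesis
    proof (rule reduce)
      show "N.bd ?k \<in> N.hcoch" by (rule N.bd_hcoch[OF k'])
      show "normalise (?h as - N.bd ?k as) = 0" if "length as = n" for as
        using bd_normalise[of ?k as] N.hcochD(1)[OF k'] k(2)[OF that] by (simp add: normalise_diff nk)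
      show "(\<lambda>as. 0) \<in> hcoch" by (rule hcoch_zero)
      show "N.bd (N.bd ?k) as = iota (bd (\<lambda>as. 0) as)" for as
        using N.bd_bd[OF N.hcochD(1)[OF k']] bd_scale[of 0 "\<lambda>as. 0" as] by (simp add: zero_fun_def[symmetric])
    qed
  qed
qed

end

context koszul_algebra
begin

text \<open>All bimodules in the type are treated at once, because degree \<open>n + 1\<close> for
  \<open>M\<close> rests on degree \<open>n\<close> for the quotient formed from
  \<open>M\<close>.\<close>

theorem lifts_and_detects:
  fixes scy :: "complex \<Rightarrow> 'c::ab_group_add \<Rightarrow> 'c" and M :: "('a list \<Rightarrow> 'c) set"
  assumes "vector_space scy"
    and "koszul_bimodule G sc vsc mul e av ug \<rho> J co D comp (\<lambda>c u l. scy c (u l)) M L R"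
  shows "koszul_bimodule.lifts G sc vsc mul e av ug \<rho> (\<lambda>c u l. scy c (u l)) M L R n \<and>
    koszul_bimodule.detects sc vsc mul e av (\<lambda>c u l. scy c (u l)) M L R n"
  using assms(2)
proof (induction n arbitrary: M L R)
  case 0
  then interpret koszul_bimodule G sc vsc mul e av ug \<rho> J co D comp "\<lambda>c u l. scy c (u l)" M L R .
  show ?case using lifts_0 detects_0 by simp
next
  case (Suc n)
  then interpret koszul_bimodule_lists G sc vsc mul e av ug \<rho> J co D comp scy M L R
    using assms(1) by (simp add: koszul_bimodule_lists_def)
  show ?case using Suc.IH[OF normal_homs_bimodule] lifts_Suc detects_Suc by simp
qed

end

subsection \<open>The Gerstenhaber bracket\<close>

text \<open>Signs in an arbitrary abelian group, so that the identities for insertions can be stated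
  without scalars.\<close>

definition sg :: "nat \<Rightarrow> 'b::ab_group_add \<Rightarrow> 'b"
  where "sg n x = (if even n then x else - x)"

lemma sg_zero [simp]: "sg n 0 = 0" and sg_zero_exp [simp]: "sg 0 x = x"
  by (simp_all add: sg_def)

lemma sg_sg: "sg m (sg n x) = sg (m + n) x"
  by (simp add: sg_def)

lemma sg_add: "sg n (x + y) = sg n x + sg n y" and sg_diff: "sg n (x - y) = sg n x - sg n y"
  by (simp_all add: sg_def)

lemma sg_cong: "even m = even n \<Longrightarrow> sg m x = sg n x"
  by (simp add: sg_def)

definition supported :: "nat \<Rightarrow> ('a list \<Rightarrow> 'b::zero) \<Rightarrow> bool"
  where "supported n f \<longleftrightarrow> (\<forall>m. length m \<noteq> n \<longrightarrow> f m = 0)"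

lemma supportedD: "supported n f \<Longrightarrow> length m \<noteq> n \<Longrightarrow> f m = 0"
  by (simp add: supported_def)

definition slot_additive :: "('a::ab_group_add list \<Rightarrow> 'b::ab_group_add) \<Rightarrow> bool"
  where "slot_additive F \<longleftrightarrow> (\<forall>as bs x y. F (as @ (x + y) # bs) = F (as @ x # bs) + F (as @ y # bs))"

lemma slot_additive_Cons: "slot_additive F \<Longrightarrow> slot_additive (\<lambda>m. F (a # m))"
  unfolding slot_additive_def by (metis append_Cons)

lemma slot_additive_head: "slot_additive F \<Longrightarrow> F ((x + y) # bs) = F (x # bs) + F (y # bs)"
  unfolding slot_additive_def by (metis append_Nil)

lemma slot_additive_head_zero: "slot_additive F \<Longrightarrow> F (0 # bs) = 0"
  using slot_additive_head[of F 0 0 bs] by simp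

lemma slot_additive_head_diff: "slot_additive F \<Longrightarrow> F ((x - y) # bs) = F (x # bs) - F (y # bs)"
  using slot_additive_head[of F "x - y" y bs] by simp

lemma slot_additive_head_sg: "slot_additive F \<Longrightarrow> F (sg n x # bs) = sg n (F (x # bs))"
  using slot_additive_head_diff[of F 0 x bs] by (simp add: sg_def slot_additive_head_zero)

lemma multilin_slot_additive: "multilin sx sy f \<Longrightarrow> slot_additive f"
  by (simp add: multilin_def slot_additive_def)

text \<open>The circle product with \<open>g\<close> inserted into \<open>F\<close>; the outer
  cochain is written last because the recursion fixes its first argument. Each argument passed on
  the left contributes \<open>(-1)^(q + 1)\<close>, which has the parity of the shifted degree
  \<open>q - 1\<close> of \<open>g\<close>.\<close>

primrec circ :: "nat \<Rightarrow> ('a list \<Rightarrow> 'a) \<Rightarrow> ('a list \<Rightarrow> 'b::ab_group_add) \<Rightarrow> 'a list \<Rightarrow> 'b"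
  where
    "circ q g F [] = (if q = 0 then F [g []] else 0)"
  | "circ q g F (a # l) = (if q \<le> Suc (length l) then F (g (take q (a # l)) # drop q (a # l)) else 0)
      + sg (Suc q) (circ q g (\<lambda>m. F (a # m)) l)"

text \<open>The terms of a twofold insertion in which \<open>f\<close> and \<open>g\<close> occupy
  different arguments of \<open>F\<close>, with \<open>f\<close> to the left of
  \<open>g\<close>.\<close>

primrec circ2 :: "nat \<Rightarrow> ('a list \<Rightarrow> 'a) \<Rightarrow> nat \<Rightarrow> ('a list \<Rightarrow> 'a) \<Rightarrow> ('a list \<Rightarrow> 'b::ab_group_add) \<Rightarrow> 'a list \<Rightarrow> 'b"
  where
    "circ2 p f q g F [] = (if p = 0 then circ q g (\<lambda>m. F (f [] # m)) [] else 0)"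
  | "circ2 p f q g F (a # l) = (if p \<le> Suc (length l) then
        sg (Suc q * p) (circ q g (\<lambda>m. F (f (take p (a # l)) # m)) (drop p (a # l))) else 0)
      + sg (p + q) (circ2 p f q g (\<lambda>m. F (a # m)) l)"

definition brk :: "nat \<Rightarrow> nat \<Rightarrow> ('a list \<Rightarrow> 'a) \<Rightarrow> ('a list \<Rightarrow> 'a) \<Rightarrow> 'a list \<Rightarrow> 'a::ab_group_add"
  where "brk p q f g l = circ q g f l - sg ((p + 1) * (q + 1)) (circ p f g l)"

lemma circ_add: "circ q g (\<lambda>m. F m + H m) l = circ q g F l + circ q g H l"
  by (induction l arbitrary: F H) (simp_all add: sg_add)

lemma circ_diff: "circ q g (\<lambda>m. F m - H m) l = circ q g F l - circ q g H l"
  using circ_add[of q g "\<lambda>m. F m - H m" H l] by simp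

lemma circ_zero [simp]: "circ q g (\<lambda>m. 0) l = 0"
  by (induction l) simp_all

lemma circ_sg: "circ q g (\<lambda>m. sg n (F m)) l = sg n (circ q g F l)"
  using circ_diff[of q g "\<lambda>m. 0" F l] by (simp add: sg_def)

lemma circ_short: "length l < q \<Longrightarrow> circ q g F l = 0"
  by (induction l arbitrary: F) simp_all

lemma circ_additive: 
  assumes "\<And>x y. \<phi> (x + y) = \<phi> x + \<phi> y"
  shows "circ q g (\<lambda>m. \<phi> (F m)) l = \<phi> (circ q g F l)"
proof -
  have z: "\<phi> 0 = 0" using assms[of 0 0] by simp
  have n: "\<phi> (- x) = - \<phi> x" for x using assms[of x "- x"] z by (simp add: minus_unique)
  show ?thesis by (induction l arbitrary: F) (simp_all add: z n sg_def assms)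
qed

lemma circ_degree: 
  assumes "supported n F" "length l + 1 \<noteq> n + q"
  shows "circ q g F l = 0"
  using assms
proof (induction l arbitrary: F n)
  case (Cons a l)
  have "circ q g (\<lambda>m. F (a # m)) l = 0"
  proof (cases n)
    case 0
    have "(\<lambda>m. F (a # m)) = (\<lambda>m. 0)" by (rule ext) (use Cons.prems(1) 0 in \<open>simp add: supported_def\<close>)
    then show ?thesis by simp
  next
    case (Suc k)
    show ?thesis by (rule Cons.IH[of k]) (use Cons.prems Suc in \<open>auto simp: supported_def\<close>)
  qed
  moreover have "F (g (take q (a # l)) # drop q (a # l)) = 0" if "q \<le> Suc (length l)"
    by (rule supportedD[OF Cons.prems(1)]) (use Cons.prems(2) that in auto)
  ultimately show ?case by simp
qed (auto simp: supported_def)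

lemma circ_inner_zero:
  assumes "\<And>m. length m = q \<Longrightarrow> g m = 0" "slot_additive F"
  shows "circ q g F l = 0"
  using assms(2)
  by (induction l arbitrary: F) (simp_all add: assms(1) slot_additive_head_zero slot_additive_Cons)

lemma circ_inner_diff:
  assumes "slot_additive F"
  shows "circ q (\<lambda>m. g m - h m) F l = circ q g F l - circ q h F l"
  using assms
  by (induction l arbitrary: F) (simp_all add: slot_additive_head_diff slot_additive_Cons sg_diff)

lemma circ_inner_sg:
  assumes "slot_additive F"
  shows "circ q (\<lambda>m. sg n (g m)) F l = sg n (circ q g F l)"
  using assms
  by (induction l arbitrary: F) 
    (simp_all add: slot_additive_head_sg slot_additive_Cons sg_add, simp_all add: sg_sg add.commute)

text \<open>If the first \<open>p\<close> letters form a block, \<open>g\<close> is inserted either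
  behind the block or inside it; in the second case the block absorbs \<open>p + q - 1\<close>
  letters of \<open>l\<close>. An empty block offers no place for \<open>g\<close>, hence the guard
  \<open>1 \<le> p\<close>.\<close>

lemma circ_head_block:
  fixes \<Theta> :: "'a list \<Rightarrow> 'a list \<Rightarrow> 'b::ab_group_add"
  shows "circ q g (\<lambda>m. if p \<le> length m then \<Theta> (take p m) (drop p m) else 0) l =
    (if p \<le> length l then sg (Suc q * p) (circ q g (\<Theta> (take p l)) (drop p l)) else 0) +
    (if 1 \<le> p \<and> p + q - 1 \<le> length l then circ q g (\<lambda>s. \<Theta> s (drop (p + q - 1) l)) (take (p + q - 1) l) else 0)"
proof (induction p arbitrary: \<Theta> l)
  case 0
  show ?case by simp
next
  case (Suc p)
  show ?case
  proof (cases l)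
    case Nil
    then show ?thesis by auto
  next
    case (Cons a m)
    have *: "circ q g (\<lambda>k. if p \<le> length k then \<Theta> (a # take p k) (drop p k) else 0) m =
      (if p \<le> length m then sg (Suc q * p) (circ q g (\<Theta> (a # take p m)) (drop p m)) else 0) +
      (if 1 \<le> p \<and> p + q - 1 \<le> length m then circ q g (\<lambda>s. \<Theta> (a # s) (drop (p + q - 1) m)) (take (p + q - 1) m) else 0)"
      by (rule Suc.IH[of "\<lambda>s. \<Theta> (a # s)"])
    have head: "(if q \<le> Suc (length m) then
        (\<lambda>k. if Suc p \<le> length k then \<Theta> (take (Suc p) k) (drop (Suc p) k) else 0) (g (take q (a # m)) # drop q (a # m)) else 0) +
        sg (Suc q) (if 1 \<le> p \<and> p + q - 1 \<le> length m then circ q g (\<lambda>s. \<Theta> (a # s) (drop (p + q - 1) m)) (take (p + q - 1) m) else 0)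
      = (if p + q \<le> Suc (length m) then circ q g (\<lambda>s. \<Theta> s (drop (p + q) (a # m))) (take (p + q) (a # m)) else 0)"
    proof (cases "p + q")
      case 0
      then show ?thesis by simp
    next
      case (Suc r)
      show ?thesis
      proof (cases "p = 0")
        case True
        then have "circ q g (\<lambda>s. \<Theta> (a # s) (drop r m)) (take r m) = 0"
          by (intro circ_short) (use Suc in simp)
        then show ?thesis using True Suc by simp
      next
        case False
        then obtain k where k: "p = Suc k" by (cases p) auto
        then have "r = k + q" using Suc by simp
        then show ?thesis using k
          by (auto simp: min_def drop_take take_Cons' drop_Cons' Suc_diff_le)
      qed
    qed
    have unf: "circ q g (\<lambda>k. if Suc p \<le> length k then \<Theta> (take (Suc p) k) (drop (Suc p) k) else 0) (a # m) =
      (if q \<le> Suc (length m) then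
        (\<lambda>k. if Suc p \<le> length k then \<Theta> (take (Suc p) k) (drop (Suc p) k) else 0) (g (take q (a # m)) # drop q (a # m)) else 0) +
      sg (Suc q) (circ q g (\<lambda>k. if p \<le> length k then \<Theta> (a # take p k) (drop p k) else 0) m)"
      unfolding circ.simps(2) by (simp cong: if_cong)
    have "sg (Suc q) (if p \<le> length m then sg (Suc q * p) x else 0) = (if Suc p \<le> length (a # m) then sg (Suc q * Suc p) x else 0)" for x :: 'b
      by (simp add: sg_sg)
    then show ?thesis
      unfolding Cons unf * sg_add using head by (simp add: algebra_simps)
  qed
qed

lemma circ_head_slot:
  assumes f: "supported p f" and F: "slot_additive F"
  shows "circ q g (\<lambda>m. if p \<le> length m then F (f (take p m) # drop p m) else 0) l =
    (if p \<le> length l then sg (Suc q * p) (circ q g (\<lambda>m. F (f (take p l) # m)) (drop p l)) else 0)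
    + (if p + q - 1 \<le> length l then F (circ q g f (take (p + q - 1) l) # drop (p + q - 1) l) else 0)"
proof (cases "p = 0")
  case True
  \<comment> \<open>For \<open>p = 0\<close> the second summand, now without the guard, is harmless:
    a cochain supported in degree 0 admits no insertion.\<close>
  have "circ q g f (take (q - 1) l) = 0" if "q - 1 \<le> length l"
  proof (cases "q = 0")
    case True
    then show ?thesis using supportedD[OF f] \<open>p = 0\<close> by simp
  next
    case False
    then show ?thesis using that by (intro circ_short) simp
  qed
  then show ?thesis using True circ_head_block[of q g p "\<lambda>s r. F (f s # r)" l]
    by (simp add: slot_additive_head_zero[OF F])
next
  case False
  have "circ q g (\<lambda>s. F (f s # r)) k = F (circ q g f k # r)" for r k
    by (rule circ_additive) (rule slot_additive_head[OF F])
  then show ?thesis using False circ_head_block[of q g p "\<lambda>s r. F (f s # r)" l] by simp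
qed

text \<open>The relation behind the pre-Lie identity: \<open>g\<close> enters \<open>F\<close>
  beside \<open>f\<close>, on either side, or it enters \<open>f\<close> itself. The side by side
  terms are symmetric in \<open>f\<close> and \<open>g\<close> up to sign and cancel in
  \<open>circ_bracket\<close>.\<close>

lemma circ_circ:
  fixes F :: "'a::ab_group_add list \<Rightarrow> 'b::ab_group_add"
  assumes f: "supported p f" and F: "slot_additive F"
  shows "circ q g (circ p f F) l = circ2 p f q g F l + sg ((p + 1) * (q + 1)) (circ2 q g p f F l)
    + circ (p + q - 1) (circ q g f) F l"
  using F
proof (induction l arbitrary: F)
  case Nil
  let ?H = "\<lambda>F m. if p \<le> length m then F (f (take p m) # drop p m) else 0"
  have "circ q g (circ p f F) [] = circ q g (?H F) [] + (if q = 0 then sg (Suc p) (circ p f (\<lambda>k. F (g [] # k)) []) else 0)"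
    by simp
  then show ?case unfolding circ_head_slot[where p = p and f = f and F = F, OF f Nil] by (auto simp: supportedD[OF f] slot_additive_head_zero[OF Nil] sg_cong[of "(p + 1) * (q + 1)" "Suc p"])
next
  case (Cons a l)
  let ?H = "\<lambda>F m. if p \<le> length m then F (f (take p m) # drop p m) else 0"
  let ?b = "g (take q (a # l))" and ?r = "drop q (a # l)" and ?Fa = "\<lambda>k. F (a # k)"
  have Fa: "slot_additive ?Fa" by (rule slot_additive_Cons[OF Cons.prems])
  have tail: "(\<lambda>m. circ p f F (a # m)) = (\<lambda>m. ?H F (a # m) + sg (Suc p) (circ p f ?Fa m))"
    by (rule ext) simp
  have "circ q g (circ p f F) (a # l) = (if q \<le> Suc (length l) then ?H F (?b # ?r) + sg (Suc p) (circ p f (\<lambda>k. F (?b # k)) ?r) else 0)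
    + sg (Suc q) (circ q g (\<lambda>m. ?H F (a # m)) l + sg (Suc p) (circ q g (circ p f ?Fa) l))"
    unfolding circ.simps(2)[of q g "circ p f F"] tail circ_add circ_sg 
    by simp
  also have "\<dots> = circ q g (?H F) (a # l) + (if q \<le> Suc (length l) then sg (Suc p) (circ p f (\<lambda>k. F (?b # k)) ?r) else 0)
    + sg (p + q) (circ q g (circ p f ?Fa) l)"
    unfolding circ.simps(2)[of q g "?H F"]
    by (simp add: sg_add sg_sg) (simp add: sg_def)
  also have "\<dots> = (if p \<le> Suc (length l) then sg (Suc q * p) (circ q g (\<lambda>m. F (f (take p (a # l)) # m)) (drop p (a # l))) else 0)
    + (if p + q - 1 \<le> Suc (length l) then F (circ q g f (take (p + q - 1) (a # l)) # drop (p + q - 1) (a # l)) else 0)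
    + (if q \<le> Suc (length l) then sg (Suc p) (circ p f (\<lambda>k. F (?b # k)) ?r) else 0)
    + sg (p + q) (circ2 p f q g ?Fa l + sg ((p + 1) * (q + 1)) (circ2 q g p f ?Fa l)
       + circ (p + q - 1) (circ q g f) ?Fa l)"
    using circ_head_slot[where p = p and f = f and F = F and q = q and g = g and l = "a # l", OF f Cons.prems]
    by (simp only: Cons.IH[OF Fa] length_Cons)
  also have "\<dots> = circ2 p f q g F (a # l) + sg ((p + 1) * (q + 1)) (circ2 q g p f F (a # l))
    + circ (p + q - 1) (circ q g f) F (a # l)"
  proof -
    have 1: "sg ((p + 1) * (q + 1)) (sg (Suc p * q) x) = sg (Suc p) x" for x :: 'b
      unfolding sg_sg by (rule sg_cong) (auto simp: algebra_simps)
    \<comment> \<open>When both degrees are 0, truncation makes \<open>p + q - 1\<close> equal to 0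
      and its parity wrong, but then the nested cochain vanishes on the empty list.\<close>
    have 2: "sg (p + q) (circ (p + q - 1) (circ q g f) ?Fa l) = sg (Suc (p + q - 1)) (circ (p + q - 1) (circ q g f) ?Fa l)"
    proof (cases "p + q = 0")
      case True
      have "circ (p + q - 1) (circ q g f) ?Fa l = 0"
        by (rule circ_inner_zero[OF _ Fa]) (use True supportedD[OF f] in auto)
      then show ?thesis by simp
    qed simp
    show ?thesis
      unfolding circ2.simps(2) circ.simps(2)[of "p + q - 1"] sg_add 2
      by (auto simp: 1 sg_sg ac_simps simp del: circ.simps circ2.simps intro!: sg_cong)
  qed
  finally show ?case .
qed

lemma circ_bracket:
  assumes f: "supported p f" and g: "supported q g" and F: "slot_additive F"
  shows "circ (p + q - 1) (brk p q f g) F l = circ q g (circ p f F) l - sg ((p + 1) * (q + 1)) (circ p f (circ q g F) l)"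
proof -
  have "circ (p + q - 1) (brk p q f g) F l = circ (p + q - 1) (circ q g f) F l - sg ((p + 1) * (q + 1)) (circ (p + q - 1) (circ p f g) F l)"
    unfolding brk_def[abs_def] circ_inner_diff[OF F] circ_inner_sg[OF F] ..
  then show ?thesis
    unfolding circ_circ[of p f F q g l, OF f F] circ_circ[of q g F p f l, OF g F]
    by (simp add: sg_add sg_sg algebra_simps) (simp add: sg_def)
qed

context koszul_algebra
begin

section \<open>The algebra as its own bimodule, and the bar differential as a bracket\<close>

definition A :: "'a set" where "A = {a. e \<odot> a = a}"

sublocale A: koszul_bimodule G sc vsc mul e av ug \<rho> J co D comp sc A mul "\<lambda>b a. a \<odot> b"
proof unfold_locales
qed (auto simp: A_def mul_add_left mul_add_right mul_sc_left mul_sc_right mul_assoc e_mul, 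
    auto simp: mul_assoc[symmetric] e_comm[symmetric])

definition prod2 :: "'a list \<Rightarrow> 'a"
  where "prod2 l = (if length l = 2 then l ! 0 \<odot> l ! 1 else 0)"

lemma prod2_additive: "slot_additive prod2"
  unfolding slot_additive_def
proof (intro allI)
  fix as bs :: "'a list" and x y
  show "prod2 (as @ (x + y) # bs) = prod2 (as @ x # bs) + prod2 (as @ y # bs)"
    by (cases as; cases bs) (auto simp: prod2_def mul_add_left mul_add_right nth_append)
qed

lemma tail_diff_circ:
  fixes f :: "'a list \<Rightarrow> 'a"
  shows "tail_diff mul (\<lambda>b a. a \<odot> b) f l = (if l = [] then 0 else sg (length l) (f (butlast l) \<odot> last l)) - circ 2 prod2 f l"
proof (induction l arbitrary: f)
  case (Cons a l)
  show ?case
  proof (cases l)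
    case Nil
    then show ?thesis by (simp add: sg_def)
  next
    case (Cons b m)
    have "circ 2 prod2 f (a # l) = f ((a \<odot> b) # m) - circ 2 prod2 (\<lambda>m. f (a # m)) l"
    proof -
      have "prod2 (take 2 (a # l)) = a \<odot> b" "drop 2 (a # l) = m" "2 \<le> Suc (length l)"
        by (simp_all add: Cons prod2_def numeral_2_eq_2)
      moreover have "sg (Suc 2) x = - x" for x :: 'a by (simp add: sg_def)
      ultimately show ?thesis unfolding circ.simps(2)[of 2 prod2 f a l] by simp
    qed
    then show ?thesis using Cons Cons.IH[of "\<lambda>m. f (a # m)"] 
      by (simp add: sg_def del: circ.simps tail_diff.simps(2)) (simp add: circ_short del: circ.simps)
  qed
qed simp

lemma circ_prod2:
  assumes "length l = p + 1"
  shows "circ p f prod2 l = f (butlast l) \<odot> last l + sg (p + 1) (hd l \<odot> f (tl l))"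
proof -
  obtain a m where l: "l = a # m" "length m = p" using assms by (cases l) auto
  obtain xs x where "a # m = xs @ [x]" by (metis list.distinct(1) rev_exhaust)
  then have "take p (a # m) = butlast (a # m)" "drop p (a # m) = [last (a # m)]"
    using l(2) by (auto dest: arg_cong[of _ _ length])
  then have 1: "prod2 (f (take p (a # m)) # drop p (a # m)) = f (butlast l) \<odot> last l"
    using l(1) by (simp add: prod2_def)
  have 2: "circ p f (\<lambda>k. prod2 (a # k)) m = a \<odot> f m"
  proof (cases m)
    case Nil
    then show ?thesis using l by (simp add: prod2_def)
  next
    case (Cons b k)
    have "circ p f (\<lambda>k. prod2 (a # b # k)) k = 0" by (rule circ_short) (use l Cons in simp)
    then show ?thesis using l Cons by (simp add: prod2_def)
  qed
  show ?thesis using 1 2 l by simp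
qed

text \<open>Inserting the product into \<open>f\<close> gives the inner faces, by
  \<open>tail_diff_circ\<close>; inserting \<open>f\<close> into the product gives the two outer
  ones, by \<open>circ_prod2\<close>.\<close>

lemma bd_bracket:
  assumes f: "supported p f"
  shows "A.bd f l = - brk p 2 f prod2 l"
proof (cases "length l = p + 1")
  case True
  then have "l \<noteq> []" by auto
  then have "A.bd f l = hd l \<odot> f (tl l) + (sg (p + 1) (f (butlast l) \<odot> last l) - circ 2 prod2 f l)"
    using True unfolding bdiff_def tail_diff_circ by (cases l) simp_all
  moreover have "sg ((p + 1) * (2 + 1)) x = sg (p + 1) x" for x :: 'a
    by (rule sg_cong) simp
  ultimately show ?thesis
    unfolding brk_def circ_prod2[OF True] by (simp add: sg_add sg_sg) (simp add: sg_def)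
next
  case False
  have "circ 2 prod2 f l = 0" by (rule circ_degree[OF f]) (use False in auto)
  moreover have "circ p f prod2 l = 0" by (rule circ_degree[of 2]) (use False in \<open>auto simp: prod2_def supported_def\<close>)
  ultimately show ?thesis using A.bd_zero_degree[of p f l] supportedD[OF f] False by (simp add: brk_def)
qed

text \<open>The graded Jacobi identity for \<open>f\<close>, \<open>g\<close> and the product, read
  through \<open>bd_bracket\<close>. It turns brackets of cocycles into cocycles, and brackets of a
  cocycle with a coboundary into coboundaries.\<close>

lemma bd_brk:
  assumes f: "supported p f" "slot_additive f" and g: "supported q g" "slot_additive g"
  shows "A.bd (brk p q f g) l = brk p (q + 1) f (A.bd g) l + sg (q + 1) (brk (p + 1) q (A.bd f) g l)"
proof -
  let ?m = prod2 and ?c = "p + q - 1"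
  have m: "supported 2 ?m" by (simp add: prod2_def supported_def)
  have deg: "supported ?c (brk p q f g)"
    unfolding supported_def
  proof (intro allI impI)
    fix k :: "'a list" assume that: "length k \<noteq> ?c"
    show "brk p q f g k = 0"
  proof (cases "length k + 1 = p + q")
    case True
    then show ?thesis using that by simp
  next
    case False
    have "circ q g f k = 0" by (rule circ_degree[OF f(1)]) (use False in auto)
    moreover have "circ p f g k = 0" by (rule circ_degree[OF g(1)]) (use False in auto)
    ultimately show ?thesis by (simp add: brk_def)
  qed
  qed
  have 1: "A.bd (brk p q f g) l = - circ 2 ?m (brk p q f g) l + sg (p + q) (circ ?c (brk p q f g) ?m l)"
  proof -
    \<comment> \<open>For \<open>p = q = 0\<close> the truncated degree has the wrong parity, but
      then the bracket vanishes on the empty list by support.\<close>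
    have "sg ((?c + 1) * (2 + 1)) (circ ?c (brk p q f g) ?m l) = sg (p + q) (circ ?c (brk p q f g) ?m l)"
    proof (cases "p + q = 0")
      case True
      have "circ ?c (brk p q f g) ?m l = 0"
        by (rule circ_inner_zero[OF _ prod2_additive]) (use True supportedD[OF f(1)] supportedD[OF g(1)] in \<open>auto simp: brk_def\<close>)
      then show ?thesis by simp
    next
      case False
      then show ?thesis by (intro sg_cong) auto
    qed
    then show ?thesis unfolding bd_bracket[OF deg] brk_def[of ?c 2 "brk p q f g"] by (simp only:) simp
  qed
  have 2: "circ 2 ?m (brk p q f g) l = circ 2 ?m (circ q g f) l - sg ((p + 1) * (q + 1)) (circ 2 ?m (circ p f g) l)"
    unfolding brk_def[of p q f g, abs_def] circ_diff circ_sg ..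
  have s3: "sg ((n + 1) * (2 + 1)) x = sg (n + 1) x" for n and x :: 'a
    by (rule sg_cong) simp
  have 3: "circ 2 ?m (circ q g f) l = circ (q + 1) (brk q 2 g ?m) f l + sg (q + 1) (circ q g (circ 2 ?m f) l)"
    using circ_bracket[of q g 2 ?m f l, OF g(1) m f(2)] by (simp add: s3[simplified])
  have 4: "circ 2 ?m (circ p f g) l = circ (p + 1) (brk p 2 f ?m) g l + sg (p + 1) (circ p f (circ 2 ?m g) l)"
    using circ_bracket[of p f 2 ?m g l, OF f(1) m g(2)] by (simp add: s3[simplified])
  have 5: "circ ?c (brk p q f g) ?m l = circ q g (circ p f ?m) l - sg ((p + 1) * (q + 1)) (circ p f (circ q g ?m) l)"
    by (rule circ_bracket[OF f(1) g(1) prod2_additive])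
  have bg: "A.bd g = (\<lambda>l. sg 1 (brk q 2 g ?m l))" and bf: "A.bd f = (\<lambda>l. sg 1 (brk p 2 f ?m l))"
    by (rule ext, simp add: bd_bracket[OF g(1)] bd_bracket[OF f(1)] sg_def)+
  have 6: "circ p f (brk q 2 g ?m) l = circ p f (circ 2 ?m g) l - sg (q + 1) (circ p f (circ q g ?m) l)"
    unfolding brk_def[of q 2 g, abs_def] s3 circ_diff circ_sg ..
  have 7: "circ q g (brk p 2 f ?m) l = circ q g (circ 2 ?m f) l - sg (p + 1) (circ q g (circ p f ?m) l)"
    unfolding brk_def[of p 2 f, abs_def] s3 circ_diff circ_sg ..
  show ?thesis
    unfolding brk_def[of p "q + 1"] brk_def[of "p + 1" q] bg bf circ_inner_sg[OF f(2)] circ_inner_sg[OF g(2)] circ_sg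
      1 2 3 4 5 6 7
    by (cases "even p"; cases "even q") (simp_all add: sg_def)
qed

lemma multilin_linear_combination:
  assumes "multilin sc sc f"
  shows "f (as @ (sc c y + sc d z) # bs) = sc c (f (as @ y # bs)) + sc d (f (as @ z # bs))"
  using assms by (simp add: multilin_def)

text \<open>With suitable \<open>c\<close>, \<open>d\<close>, \<open>y\<close>, \<open>z\<close>
  this gives additivity, homogeneity and independence of the part outside the algebra in one
  induction.\<close>

lemma circ_slot:
  assumes g: "\<And>as bs. g (as @ x # bs) = sc c (g (as @ y # bs)) + sc d (g (as @ z # bs))"
    and F: "\<And>as bs. F (as @ x # bs) = sc c (F (as @ y # bs)) + sc d (F (as @ z # bs))"
    and lin: "multilin sc sc F"
  shows "circ q g F (as @ x # bs) = sc c (circ q g F (as @ y # bs)) + sc d (circ q g F (as @ z # bs))"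
  using F lin
proof (induction as arbitrary: F)
  case Nil
  have sgs: "sg n (sc c x) = sc c (sg n x)" for n c x by (simp add: sg_def)
  have sc_circ: "circ q g (\<lambda>m. sc c (F m)) l = sc c (circ q g F l)" for F :: "'a list \<Rightarrow> 'a" and c l
    by (rule circ_additive) (rule alg.scale_right_distrib)
  note F = Nil.prems(1)[of "[]", simplified]
  have t: "circ q g (\<lambda>m. F (x # m)) bs = sc c (circ q g (\<lambda>m. F (y # m)) bs) + sc d (circ q g (\<lambda>m. F (z # m)) bs)"
    unfolding F circ_add sc_circ ..
  have h: "F (g (take q (x # bs)) # drop q (x # bs)) = sc c (F (g (take q (y # bs)) # drop q (y # bs))) + sc d (F (g (take q (z # bs)) # drop q (z # bs)))"
  proof (cases q)
    case 0
    then show ?thesis using Nil.prems(1)[of "[g []]" bs] by simp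
  next
    case (Suc k)
    then show ?thesis using g[of "[]" "take k bs"] multilin_linear_combination[OF Nil.prems(2), of "[]"] by simp
  qed
  show ?case using h t by (simp add: sg_add sgs alg.scale_right_distrib algebra_simps)
next
  case (Cons a as)
  have sgs: "sg n (sc c x) = sc c (sg n x)" for n c x by (simp add: sg_def)
  have t: "circ q g (\<lambda>m. F (a # m)) (as @ x # bs) = sc c (circ q g (\<lambda>m. F (a # m)) (as @ y # bs)) + sc d (circ q g (\<lambda>m. F (a # m)) (as @ z # bs))"
    by (rule Cons.IH) (use Cons.prems(1)[of "a # _"] multilin_Cons[OF Cons.prems(2)] in simp_all)
  have h: "F (g (take q (a # as @ x # bs)) # drop q (a # as @ x # bs)) = 
    sc c (F (g (take q (a # as @ y # bs)) # drop q (a # as @ y # bs))) + sc d (F (g (take q (a # as @ z # bs)) # drop q (a # as @ z # bs)))"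
  proof (cases "q \<le> length (a # as)")
    case True
    have "take q (a # as @ w # bs) = take q (a # as)" "drop q (a # as @ w # bs) = drop q (a # as) @ w # bs" for w
      using True take_append[of q "a # as" "w # bs"] drop_append[of q "a # as" "w # bs"] by simp_all
    then show ?thesis using Cons.prems(1)[of "g (take q (a # as)) # drop q (a # as)"] by simp
  next
    case False
    then obtain k where k: "q - length (a # as) = Suc k" by (metis Suc_diff_Suc not_le)
    have "take q (a # as @ w # bs) = (a # as) @ w # take k bs" "drop q (a # as @ w # bs) = drop k bs" for w
      using False k take_append[of q "a # as" "w # bs"] drop_append[of q "a # as" "w # bs"] by simp_all
    then show ?thesis using g[of "a # as" "take k bs"] multilin_linear_combination[OF Cons.prems(2), of "[]"] by simp
  qed
  show ?case using h t by (simp add: sg_add sgs alg.scale_right_distrib algebra_simps)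
qed

lemma circ_hcoch:
  assumes g: "g \<in> A.hcoch" and f: "f \<in> A.hcoch"
  shows "circ q g f \<in> A.hcoch"
proof -
  note gl = A.hcochD(2)[OF g] and fl = A.hcochD(2)[OF f]
  have "circ q g F l \<in> A" if "\<And>m. F m \<in> A" for F l
    using that
  proof (induction l arbitrary: F)
    case (Cons a l)
    have "circ q g (\<lambda>m. F (a # m)) l \<in> A" by (rule Cons.IH) (rule Cons.prems)
    then show ?case using Cons.prems by (simp add: A.M_add A.M_minus A.M_zero sg_def)
  qed (simp add: A.M_zero)
  then have "circ q g f l \<in> A" for l using A.hcochD(1)[OF f] by simp
  moreover have "circ q g f (as @ (x + y) # bs) = circ q g f (as @ x # bs) + circ q g f (as @ y # bs)" for as x y bs
    using circ_slot[of g "x + y" 1 x 1 y f q as bs] multilin_add[OF gl] multilin_add[OF fl] fl by simp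
  moreover have "circ q g f (as @ sc c x # bs) = sc c (circ q g f (as @ x # bs))" for as c x bs
    using circ_slot[of g "sc c x" c x 0 x f q as bs] multilin_scale[OF gl] multilin_scale[OF fl] fl by simp
  moreover have "circ q g f (as @ (e \<odot> x) # bs) = circ q g f (as @ x # bs)" for as x bs
    using circ_slot[of g "e \<odot> x" 1 x 0 x f q as bs] A.hcochD(3)[OF g] A.hcochD(3)[OF f] fl by simp
  ultimately show ?thesis by (simp add: A.hcoch_def multilin_def)
qed

lemma brk_hcoch:
  assumes "f \<in> A.hcoch" "g \<in> A.hcoch" shows "brk p q f g \<in> A.hcoch"
proof -
  have "(\<lambda>l. circ q g f l - sc (if even ((p + 1) * (q + 1)) then 1 else -1) (circ p f g l)) \<in> A.hcoch"
    by (intro A.hcoch_diff A.hcoch_scale circ_hcoch assms)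
  moreover have "brk p q f g = (\<lambda>l. circ q g f l - sc (if even ((p + 1) * (q + 1)) then 1 else -1) (circ p f g l))"
    by (rule ext, cases "even ((p + 1) * (q + 1))")
      (simp_all only: brk_def sg_def if_True if_False alg.scale_one alg.scale_minus_left)
  ultimately show ?thesis by simp
qed

end

subsection \<open>Polynomials\<close>

lemma lookup_sconst_mult: "Poly_Mapping.lookup (sconst c * s) m = c * Poly_Mapping.lookup s m"
  unfolding sconst_def mult_map_scale_conv_mult[symmetric] by (simp add: Poly_Mapping.map.rep_eq when_def)

lemma sconst_simps [simp]: "sconst 0 = 0" "sconst 1 = 1"
  by (simp_all add: sconst_def)

lemma sconst_add: "sconst (c + d) = sconst c + sconst d" and sconst_mult: "sconst (c * d) = sconst c * sconst d"
  and sconst_uminus: "sconst (- c) = - sconst c"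
  by (simp_all add: sconst_def single_add mult_single single_uminus)

lemma sconst_mult_single: "sconst c * Poly_Mapping.single m d = Poly_Mapping.single m (c * d)"
  by (simp add: sconst_def mult_single)

lemma poly_mapping_sum_singles: "s = (\<Sum>m\<in>Poly_Mapping.keys s. Poly_Mapping.single m (Poly_Mapping.lookup s m))"
  by (rule poly_mapping_eqI)
    (auto simp: lookup_sum lookup_single when_def in_keys_iff)

lemma sym_induct [case_names zero single add]:
  fixes s :: "'v sym"
  assumes "P 0" "\<And>m c. P (Poly_Mapping.single m c)" "\<And>s t. P s \<Longrightarrow> P t \<Longrightarrow> P (s + t)"
  shows "P s"
proof -
  have "P (\<Sum>m\<in>K. Poly_Mapping.single m (Poly_Mapping.lookup s m))" for K
    by (induction K rule: infinite_finite_induct) (auto intro: assms)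
  then show ?thesis using poly_mapping_sum_singles[of s] by metis
qed

text \<open>Linear extension of a map on monomials. Homogeneous parts, rescaling, derivatives and
  the group action are all instances, so linearity is proved once, and multiplicativity once for
  multiplicative maps.\<close>

definition linext :: "(('v \<Rightarrow>\<^sub>0 nat) \<Rightarrow> 'v sym) \<Rightarrow> 'v sym \<Rightarrow> 'v sym"
  where "linext \<phi> s = (\<Sum>m\<in>Poly_Mapping.keys s. sconst (Poly_Mapping.lookup s m) * \<phi> m)"

lemma linext_superset:
  assumes "finite K" "Poly_Mapping.keys s \<subseteq> K"
  shows "linext \<phi> s = (\<Sum>m\<in>K. sconst (Poly_Mapping.lookup s m) * \<phi> m)"
  unfolding linext_def
  by (rule sum.mono_neutral_left) (use assms in \<open>auto simp: in_keys_iff\<close>)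

lemma linext_add: "linext \<phi> (s + t) = linext \<phi> s + linext \<phi> t"
proof -
  let ?K = "Poly_Mapping.keys s \<union> Poly_Mapping.keys t"
  show ?thesis
    using linext_superset[of ?K s \<phi>] linext_superset[of ?K t \<phi>] linext_superset[of ?K "s + t" \<phi>] keys_add[of s t]
    by (simp add: lookup_add sconst_add sum.distrib algebra_simps)
qed

lemma linext_zero [simp]: "linext \<phi> 0 = 0"
  by (simp add: linext_def)

lemma linext_single: "linext \<phi> (Poly_Mapping.single m c) = sconst c * \<phi> m"
  by (simp add: linext_def)

lemma linext_sconst: "linext \<phi> (sconst c * s) = sconst c * linext \<phi> s"
  by (induction s rule: sym_induct) 
    (simp_all add: linext_single sconst_mult_single sconst_mult linext_add algebra_simps)

lemma linext_mult:
  assumes "\<And>m n. \<phi> (m + n) = \<phi> m * \<phi> n"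
  shows "linext \<phi> (s * t) = linext \<phi> s * linext \<phi> t"
proof (induction s rule: sym_induct)
  case (single m c)
  show ?case
    by (induction t rule: sym_induct)
      (simp_all add: mult_single linext_single sconst_mult assms linext_add algebra_simps)
qed (simp_all add: linext_add algebra_simps)

definition mdeg :: "('v \<Rightarrow>\<^sub>0 nat) \<Rightarrow> nat"
  where "mdeg m = (\<Sum>b\<in>Poly_Mapping.keys m. Poly_Mapping.lookup m b)"

lemma mdeg_superset: "finite K \<Longrightarrow> Poly_Mapping.keys m \<subseteq> K \<Longrightarrow> mdeg m = (\<Sum>b\<in>K. Poly_Mapping.lookup m b)"
  unfolding mdeg_def by (rule sum.mono_neutral_left) (auto simp: in_keys_iff)

lemma mdeg_add: "mdeg (m + n) = mdeg m + mdeg n"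
proof -
  let ?K = "Poly_Mapping.keys m \<union> Poly_Mapping.keys n"
  show ?thesis
    using mdeg_superset[of ?K m] mdeg_superset[of ?K n] mdeg_superset[of ?K "m + n"] keys_add[of m n]
    by (simp add: lookup_add sum.distrib)
qed

lemma mdeg_simps [simp]: "mdeg 0 = 0" "mdeg (Poly_Mapping.single b k) = k"
  by (simp_all add: mdeg_def)

definition select :: "(('v \<Rightarrow>\<^sub>0 nat) \<Rightarrow> bool) \<Rightarrow> 'v sym \<Rightarrow> 'v sym"
  where "select P = linext (\<lambda>m. if P m then Poly_Mapping.single m 1 else 0)"

lemma lookup_select: "Poly_Mapping.lookup (select P s) m = (if P m then Poly_Mapping.lookup s m else 0)"
  by (induction s rule: sym_induct)
    (auto simp: select_def linext_single linext_add lookup_add lookup_sconst_mult lookup_single when_def)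

lemma select_add: "select P (s + t) = select P s + select P t" and select_zero [simp]: "select P 0 = 0"
  by (simp_all add: select_def linext_add)

lemma select_single: "select P (Poly_Mapping.single m c) = (if P m then Poly_Mapping.single m c else 0)"
  by (simp add: select_def linext_single sconst_mult_single)

definition rescale :: "complex \<Rightarrow> 'v sym \<Rightarrow> 'v sym"
  where "rescale c = linext (\<lambda>m. sconst (c ^ mdeg m) * Poly_Mapping.single m 1)"

lemma lookup_rescale: "Poly_Mapping.lookup (rescale c s) m = c ^ mdeg m * Poly_Mapping.lookup s m"
  by (induction s rule: sym_induct)
    (auto simp: rescale_def linext_single linext_add lookup_add lookup_sconst_mult lookup_single when_def distrib_left)

lemma rescale_mult: "rescale c (s * t) = rescale c s * rescale c t"
  unfolding rescale_def
  by (rule linext_mult) (simp add: mdeg_add power_add mult_single sconst_mult_single)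

lemma rescale_add: "rescale c (s + t) = rescale c s + rescale c t"
  by (simp add: rescale_def linext_add)

lemma rescale_zero [simp]: "rescale c 0 = 0"
  by (simp add: rescale_def)

lemma rescale_sconst [simp]: "rescale c (sconst d) = sconst d"
  by (simp add: rescale_def sconst_def linext_single)

text \<open>If \<open>b\<close> does not occur in \<open>m\<close>, the truncated exponent is masked
  by the coefficient 0.\<close>

definition deriv :: "'v \<Rightarrow> 'v sym \<Rightarrow> 'v sym"
  where "deriv b = linext (\<lambda>m. Poly_Mapping.single (m - Poly_Mapping.single b 1) (of_nat (Poly_Mapping.lookup m b)))"

lemma deriv_add: "deriv b (s + t) = deriv b s + deriv b t"
  by (simp add: deriv_def linext_add)

lemma deriv_zero [simp]: "deriv b 0 = 0"
  by (simp add: deriv_def)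

lemma deriv_single: "deriv b (Poly_Mapping.single m c) = Poly_Mapping.single (m - Poly_Mapping.single b 1) (c * of_nat (Poly_Mapping.lookup m b))"
  by (simp add: deriv_def linext_single sconst_mult_single)

lemma deriv_sconst_mult: "deriv b (sconst c * s) = sconst c * deriv b s"
  by (simp add: deriv_def linext_sconst)

lemma deriv_sconst [simp]: "deriv b (sconst c) = 0"
  by (simp add: sconst_def deriv_single)

lemma deriv_mult: "deriv b (s * t) = deriv b s * t + s * deriv b t"
proof (induction s rule: sym_induct)
  case (single m c)
  show ?case
  proof (induction t rule: sym_induct)
    case (single n d)
    have 1: "Poly_Mapping.lookup m b = 0 \<or> m - Poly_Mapping.single b 1 + n = m + n - Poly_Mapping.single b 1"
      by (auto simp: poly_mapping_eq_iff fun_eq_iff lookup_add lookup_minus lookup_single when_def)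
    have 2: "Poly_Mapping.lookup n b = 0 \<or> m + (n - Poly_Mapping.single b 1) = m + n - Poly_Mapping.single b 1"
      by (auto simp: poly_mapping_eq_iff fun_eq_iff lookup_add lookup_minus lookup_single when_def)
    have "Poly_Mapping.single (m + n - Poly_Mapping.single b 1) (c * d * of_nat (Poly_Mapping.lookup m b + Poly_Mapping.lookup n b))
      = Poly_Mapping.single (m - Poly_Mapping.single b 1 + n) (c * of_nat (Poly_Mapping.lookup m b) * d)
      + Poly_Mapping.single (m + (n - Poly_Mapping.single b 1)) (c * (d * of_nat (Poly_Mapping.lookup n b)))"
      using 1 2 by (auto simp: single_add[symmetric] algebra_simps)
    then show ?case
      by (simp add: mult_single deriv_single lookup_add)
  qed (simp_all add: deriv_add algebra_simps)
qed (simp_all add: deriv_add algebra_simps)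

lemma ascale_lookup: "Poly_Mapping.lookup (ascale c a) g = sconst c * Poly_Mapping.lookup a g"
  by (simp add: ascale_def Poly_Mapping.map.rep_eq when_def)

lemma ascale_vector_space: "vector_space ascale"
  by unfold_locales (auto intro!: poly_mapping_eqI simp: ascale_lookup lookup_add sconst_add sconst_mult algebra_simps)

context finite_group_module
begin

section \<open>The symmetric algebra with its group action, and the skew group algebra\<close>

lemma rep_add: "representation Basis (v + w) b = representation Basis v b + representation Basis w b"
  by (simp add: representation_add[OF independent_Basis] span_Basis)

lemma rep_scale: "representation Basis (scale c v) b = c * representation Basis v b"
  by (simp add: representation_scale[OF independent_Basis] span_Basis)

lemma rep_sum: "(\<Sum>b\<in>Basis. scale (representation Basis v b) b) = v"
  by (rule sum_representation_eq) (simp_all add: independent_Basis span_Basis finite_Basis)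

lemma rep_Basis: "b \<in> Basis \<Longrightarrow> representation Basis b b' = (if b' = b then 1 else 0)"
  by (simp add: representation_basis[OF independent_Basis])

lemma vec_add: "vec (v + w) = vec v + vec w"
  by (simp add: vec_def rep_add single_add sum.distrib)

lemma vec_scale: "vec (scale c v) = sconst c * vec v"
  by (simp add: vec_def rep_scale sum_distrib_left sconst_mult_single)

lemma vec_zero [simp]: "vec 0 = 0"
  using vec_scale[of 0 0] by simp

lemma vec_diff: "vec (v - w) = vec v - vec w"
  using vec_add[of "v - w" w] by (simp add: algebra_simps)

lemma vec_sum: "vec (sum f I) = (\<Sum>i\<in>I. vec (f i))"
  by (induction I rule: infinite_finite_induct) (simp_all add: vec_add)

lemma vec_Basis: "b \<in> Basis \<Longrightarrow> vec b = Poly_Mapping.single (Poly_Mapping.single b 1) 1"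
  using finite_Basis by (simp add: vec_def rep_Basis if_distrib[of "Poly_Mapping.single _"] sum.delta' cong: if_cong)

lemma Sym_zero: "0 \<in> Sym W" and Sym_one: "1 \<in> Sym W"
  using Sym.const[of 0 W] Sym.const[of 1 W] by simp_all

lemma Sym_sum: "(\<And>i. i \<in> I \<Longrightarrow> f i \<in> Sym W) \<Longrightarrow> sum f I \<in> Sym W"
  by (induction I rule: infinite_finite_induct) (auto intro: Sym_zero Sym.add)

lemma Sym_prod: "(\<And>i. i \<in> I \<Longrightarrow> f i \<in> Sym W) \<Longrightarrow> prod f I \<in> Sym W"
  by (induction I rule: infinite_finite_induct) (auto intro: Sym_one Sym.mult)

lemma Sym_power: "s \<in> Sym W \<Longrightarrow> s ^ n \<in> Sym W"
  by (induction n) (auto intro: Sym_one Sym.mult)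

abbreviation "S \<equiv> Sym UNIV"

lemma vec_S [simp]: "vec v \<in> S"
  by (rule Sym.vec) simp

lemma sconst_S [simp]: "sconst c \<in> S"
  by (rule Sym.const)

text \<open>The type \<open>sym\<close> has an indeterminate for every vector. Deleting the
  monomials that involve vectors outside \<open>Basis\<close> projects it onto
  \<open>S(V)\<close>.\<close>

definition rS :: "'v sym \<Rightarrow> 'v sym"
  where "rS = select (\<lambda>m. Poly_Mapping.keys m \<subseteq> Basis)"

lemma rS_add: "rS (s + t) = rS s + rS t" and rS_zero [simp]: "rS 0 = 0"
  by (simp_all add: rS_def select_def linext_add)

lemma rS_sconst_mult: "rS (sconst c * s) = sconst c * rS s"
  by (simp add: rS_def select_def linext_sconst)

lemma monomial_prod:
  "Poly_Mapping.keys m \<subseteq> Basis \<Longrightarrow> Poly_Mapping.single m 1 = (\<Prod>b\<in>Poly_Mapping.keys m. vec b ^ Poly_Mapping.lookup m b)"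
proof -
  assume m: "Poly_Mapping.keys m \<subseteq> Basis"
  have pow: "Poly_Mapping.single (Poly_Mapping.single b 1) (1::complex) ^ k = Poly_Mapping.single (Poly_Mapping.single b k) 1" for b :: 'v and k
    by (induction k) (simp_all add: mult_single single_add[symmetric])
  have "(\<Prod>b\<in>K. Poly_Mapping.single (Poly_Mapping.single b (Poly_Mapping.lookup m b)) (1::complex)) = Poly_Mapping.single (\<Sum>b\<in>K. Poly_Mapping.single b (Poly_Mapping.lookup m b)) 1" for K
    by (induction K rule: infinite_finite_induct) (simp_all add: mult_single)
  from this[of "Poly_Mapping.keys m"]
  have "Poly_Mapping.single m (1::complex) = (\<Prod>b\<in>Poly_Mapping.keys m. Poly_Mapping.single (Poly_Mapping.single b (Poly_Mapping.lookup m b)) 1)"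
    using poly_mapping_sum_singles[of m] by simp
  also have "\<dots> = (\<Prod>b\<in>Poly_Mapping.keys m. vec b ^ Poly_Mapping.lookup m b)"
    by (rule prod.cong) (auto simp: vec_Basis[OF subsetD[OF m]] pow simp del: One_nat_def)
  finally show ?thesis .
qed

lemma rS_S [simp]: "rS s \<in> S"
proof (induction s rule: sym_induct)
  case (single m c)
  have "sconst c * (if Poly_Mapping.keys m \<subseteq> Basis then Poly_Mapping.single m 1 else 0) \<in> S"
    by (auto intro!: Sym.mult Sym_zero Sym_prod Sym_power simp: monomial_prod)
  then show ?case by (simp add: rS_def select_def linext_single)
qed (auto simp: rS_add Sym_zero intro: Sym.add)

lemma rS_id: 
  assumes "s \<in> S" shows "rS s = s"
proof -
  have "Poly_Mapping.keys m \<subseteq> Basis" if "m \<in> Poly_Mapping.keys s" for m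
    using assms that
  proof (induction arbitrary: m rule: Sym.induct)
    case (const c)
    then show ?case by (auto simp: sconst_def split: if_splits)
  next
    case (vec v)
    have "Poly_Mapping.keys (vec v) \<subseteq> (\<Union>b\<in>Basis. Poly_Mapping.keys (Poly_Mapping.single (Poly_Mapping.single b (1::nat)) (representation Basis v b)))"
      unfolding vec_def by (rule keys_sum)
    then show ?case using vec(2) by (auto split: if_splits)
  next
    case (add s t)
    then show ?case using keys_add[of s t] by blast
  next
    case (mult s t)
    then obtain a b where "m = a + b" "a \<in> Poly_Mapping.keys s" "b \<in> Poly_Mapping.keys t" using keys_mult[of s t] by blast
    then show ?case using mult.IH keys_add[of a b] by blast
  qed
  then show ?thesis
    by (intro poly_mapping_eqI) (auto simp: rS_def lookup_select in_keys_iff)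
qed

lemma rS_rS [simp]: "rS (rS s) = rS s"
  by (simp add: rS_id)

lemma act_linext: "act g = linext (\<lambda>m. \<Prod>b\<in>Poly_Mapping.keys m. vec (\<rho> g b) ^ Poly_Mapping.lookup m b)"
  by (rule ext) (simp add: act_def linext_def)

lemma act_add: "act g (s + t) = act g s + act g t" and act_zero [simp]: "act g 0 = 0"
  by (simp_all add: act_linext linext_add)

lemma act_sconst_mult: "act g (sconst c * s) = sconst c * act g s"
  by (simp add: act_linext linext_sconst)

lemma act_mult: "act g (s * t) = act g s * act g t"
  unfolding act_linext
proof (rule linext_mult)
  fix m n :: "'v \<Rightarrow>\<^sub>0 nat"
  let ?K = "Poly_Mapping.keys m \<union> Poly_Mapping.keys n"
  have *: "(\<Prod>b\<in>Poly_Mapping.keys k. vec (\<rho> g b) ^ Poly_Mapping.lookup k b) = (\<Prod>b\<in>?K. vec (\<rho> g b) ^ Poly_Mapping.lookup k b)"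
    if "Poly_Mapping.keys k \<subseteq> ?K" for k
    by (rule prod.mono_neutral_left) (use that in \<open>auto simp: in_keys_iff\<close>)
  show "(\<Prod>b\<in>Poly_Mapping.keys (m + n). vec (\<rho> g b) ^ Poly_Mapping.lookup (m + n) b) =
    (\<Prod>b\<in>Poly_Mapping.keys m. vec (\<rho> g b) ^ Poly_Mapping.lookup m b) * (\<Prod>b\<in>Poly_Mapping.keys n. vec (\<rho> g b) ^ Poly_Mapping.lookup n b)"
    using *[of m] *[of n] *[OF keys_add] by (simp add: lookup_add power_add prod.distrib)
qed

lemma act_sconst [simp]: "act g (sconst c) = sconst c"
  by (simp add: act_linext sconst_def linext_single mult_single)

lemma act_one [simp]: "act g 1 = 1"
  using act_sconst[of g 1] by simp

lemma act_S [simp]: "act g s \<in> S"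
  unfolding act_def by (intro Sym_sum Sym.mult Sym_prod Sym_power) simp_all

lemma act_sum: "act g (sum f I) = (\<Sum>i\<in>I. act g (f i))"
  by (induction I rule: infinite_finite_induct) (simp_all add: act_add)

lemma rho_linear:
  assumes "g \<in> carrier G"
  shows "\<rho> g (v + w) = \<rho> g v + \<rho> g w" "\<rho> g (scale c v) = scale c (\<rho> g v)" "\<rho> g 0 = 0" "\<rho> g (v - w) = \<rho> g v - \<rho> g w"
    "\<rho> g (sum f I) = (\<Sum>i\<in>I. \<rho> g (f i))"
proof -
  interpret l: Vector_Spaces.linear scale scale "\<rho> g" by (rule linear_action[OF assms])
  show "\<rho> g (v + w) = \<rho> g v + \<rho> g w" "\<rho> g (scale c v) = scale c (\<rho> g v)" "\<rho> g 0 = 0" "\<rho> g (v - w) = \<rho> g v - \<rho> g w"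
    "\<rho> g (sum f I) = (\<Sum>i\<in>I. \<rho> g (f i))"
    by (simp_all add: l.add l.scale l.diff l.sum)
qed

lemma act_vec: 
  assumes "g \<in> carrier G" shows "act g (vec v) = vec (\<rho> g v)"
proof -
  have "act g (vec v) = (\<Sum>b\<in>Basis. sconst (representation Basis v b) * vec (\<rho> g b))"
    by (simp add: vec_def[of v] act_sum) (simp add: act_linext linext_single)
  also have "\<dots> = vec (\<rho> g (\<Sum>b\<in>Basis. scale (representation Basis v b) b))"
    by (simp add: rho_linear[OF assms] vec_sum vec_scale)
  finally show ?thesis by (simp add: rep_sum)
qed

sublocale grp: group G
  using group_hom by (simp add: group_hom_def)

lemma rho_rho: 
  assumes "g \<in> carrier G" "h \<in> carrier G" shows "\<rho> g (\<rho> h v) = \<rho> (g \<otimes> h) v"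
  using composition_rule[of v g h] assms by simp

lemma rho_one': "\<rho> \<one> v = v"
  using id_eq_one by (metis UNIV_I restrict_apply')

lemma act_act: "s \<in> S \<Longrightarrow> g \<in> carrier G \<Longrightarrow> h \<in> carrier G \<Longrightarrow> act g (act h s) = act (g \<otimes> h) s"
  by (induction rule: Sym.induct) (simp_all add: act_add act_mult act_vec rho_rho)

lemma act_id: "s \<in> S \<Longrightarrow> act \<one> s = s"
  by (induction rule: Sym.induct) (simp_all add: act_add act_mult act_vec rho_one')

lemma rescale_vec: "rescale c (vec v) = sconst c * vec v"
proof -
  have "rescale c (sum f I) = (\<Sum>i\<in>I. rescale c (f i))" for f :: "'v \<Rightarrow> 'v sym" and I
    by (induction I rule: infinite_finite_induct) (simp_all add: rescale_add)
  moreover have "rescale c (Poly_Mapping.single m d) = Poly_Mapping.single m (c ^ mdeg m * d)" for m :: "'v \<Rightarrow>\<^sub>0 nat" and d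
    by (rule poly_mapping_eqI) (simp add: lookup_rescale lookup_single when_def)
  ultimately show ?thesis
    by (simp add: vec_def sum_distrib_left sconst_mult_single del: One_nat_def)
qed

lemma act_rescale: "s \<in> S \<Longrightarrow> g \<in> carrier G \<Longrightarrow> act g (rescale c s) = rescale c (act g s)"
  by (induction rule: Sym.induct) (simp_all add: act_add act_mult act_vec rescale_add rescale_mult rescale_vec)

lemma deriv_vec: "b \<in> Basis \<Longrightarrow> deriv b (vec v) = sconst (representation Basis v b)"
proof -
  assume b: "b \<in> Basis"
  have "deriv b (sum f I) = (\<Sum>i\<in>I. deriv b (f i))" for f :: "'v \<Rightarrow> 'v sym" and I
    by (induction I rule: infinite_finite_induct) (simp_all add: deriv_add)
  then have "deriv b (vec v) = (\<Sum>b'\<in>Basis. if b' = b then sconst (representation Basis v b) else 0)"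
    by (auto simp: vec_def deriv_single lookup_single sconst_def intro!: sum.cong)
  then show ?thesis using b finite_Basis by simp
qed

lemma deriv_S: "s \<in> S \<Longrightarrow> b \<in> Basis \<Longrightarrow> deriv b s \<in> S"
  by (induction rule: Sym.induct) (simp_all add: deriv_add deriv_mult deriv_vec Sym.add Sym.mult Sym_zero)

definition amap :: "('v sym \<Rightarrow> 'v sym) \<Rightarrow> ('g, 'v) skew \<Rightarrow> ('g, 'v) skew"
  where "amap \<theta> a = (\<Sum>g\<in>carrier G. Poly_Mapping.single g (\<theta> (Poly_Mapping.lookup a g)))"

lemma lookup_amap: "Poly_Mapping.lookup (amap \<theta> a) g = (if g \<in> carrier G then \<theta> (Poly_Mapping.lookup a g) else 0)"
  using finite_carrier by (auto simp: amap_def lookup_sum lookup_single when_def)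

text \<open>
  \<open>amult\<close> is bilinear and associative only on \<open>skew_algebra\<close>; \<open>star\<close> is so on the whole type, because it
  first discards group elements outside the carrier and projects coefficients to \<open>S(V)\<close>.
\<close>

definition star :: "('g, 'v) skew \<Rightarrow> ('g, 'v) skew \<Rightarrow> ('g, 'v) skew"
  where "star a b = (\<Sum>g\<in>carrier G. \<Sum>h\<in>carrier G.
    Poly_Mapping.single (g \<otimes> h) (rS (Poly_Mapping.lookup a g) * act g (rS (Poly_Mapping.lookup b h))))"

lemma lookup_star: 
  "Poly_Mapping.lookup (star a b) k = (if k \<in> carrier G then
    \<Sum>g\<in>carrier G. rS (Poly_Mapping.lookup a g) * act g (rS (Poly_Mapping.lookup b (inv g \<otimes> k))) else 0)"
proof -
  have "Poly_Mapping.lookup (star a b) k = (\<Sum>g\<in>carrier G. \<Sum>h\<in>carrier G.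
    if g \<otimes> h = k then rS (Poly_Mapping.lookup a g) * act g (rS (Poly_Mapping.lookup b h)) else 0)"
    by (simp add: star_def lookup_sum lookup_single when_def)
  also have "\<dots> = (\<Sum>g\<in>carrier G. \<Sum>h\<in>carrier G. 
     if k \<in> carrier G \<and> h = inv g \<otimes> k then rS (Poly_Mapping.lookup a g) * act g (rS (Poly_Mapping.lookup b h)) else 0)"
  proof (intro sum.cong refl)
    fix g h assume "g \<in> carrier G" "h \<in> carrier G"
    then have "g \<otimes> h = k \<longleftrightarrow> k \<in> carrier G \<and> h = inv g \<otimes> k"
      by (metis grp.inv_solve_left grp.m_closed)
    then show "(if g \<otimes> h = k then rS (Poly_Mapping.lookup a g) * act g (rS (Poly_Mapping.lookup b h)) else 0) =
      (if k \<in> carrier G \<and> h = inv g \<otimes> k then rS (Poly_Mapping.lookup a g) * act g (rS (Poly_Mapping.lookup b h)) else 0)"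
      by simp
  qed
  finally show ?thesis using finite_carrier by (cases "k \<in> carrier G") (simp_all add: sum.delta cong: if_cong)
qed

lemma star_single:
  assumes "g \<in> carrier G" "h \<in> carrier G"
  shows "star (Poly_Mapping.single g s) (Poly_Mapping.single h t) = Poly_Mapping.single (g \<otimes> h) (rS s * act g (rS t))"
proof -
  have *: "Poly_Mapping.single (g' \<otimes> h') (rS (Poly_Mapping.lookup (Poly_Mapping.single g s) g') * act g' (rS (Poly_Mapping.lookup (Poly_Mapping.single h t) h')))
    = (if g' = g then if h' = h then Poly_Mapping.single (g \<otimes> h) (rS s * act g (rS t)) else 0 else 0)" for g' h'
    by (auto simp: lookup_single when_def)
  have "star (Poly_Mapping.single g s) (Poly_Mapping.single h t) =
    (\<Sum>g'\<in>carrier G. if g' = g then \<Sum>h'\<in>carrier G. if h' = h then Poly_Mapping.single (g \<otimes> h) (rS s * act g (rS t)) else 0 else 0)"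
    unfolding star_def * by (intro sum.cong refl) auto
  then show ?thesis using finite_carrier assms by simp
qed

lemma skew_algebraI: "(\<And>g. Poly_Mapping.lookup a g \<in> S) \<Longrightarrow> (\<And>g. g \<notin> carrier G \<Longrightarrow> Poly_Mapping.lookup a g = 0) \<Longrightarrow> a \<in> skew_algebra"
  by (auto simp: skew_algebra_def in_keys_iff)

lemma skew_algebraD: 
  assumes "a \<in> skew_algebra" 
  shows "Poly_Mapping.lookup a g \<in> S" "g \<notin> carrier G \<Longrightarrow> Poly_Mapping.lookup a g = 0"
  using assms by (auto simp: skew_algebra_def in_keys_iff)

lemma amult_star:
  assumes a: "a \<in> skew_algebra" and b: "b \<in> skew_algebra"
  shows "a \<bullet> b = star a b"
proof -
  let ?t = "\<lambda>g h. Poly_Mapping.single (g \<otimes> h) (Poly_Mapping.lookup a g * act g (Poly_Mapping.lookup b h))"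
  have k: "Poly_Mapping.keys a \<subseteq> carrier G" "Poly_Mapping.keys b \<subseteq> carrier G"
    using a b by (auto simp: skew_algebra_def)
  have "a \<bullet> b = (\<Sum>g\<in>Poly_Mapping.keys a. \<Sum>h\<in>carrier G. ?t g h)"
    unfolding amult_def
    by (intro sum.cong refl sum.mono_neutral_left) (use k finite_carrier in \<open>auto simp: in_keys_iff\<close>)
  also have "\<dots> = (\<Sum>g\<in>carrier G. \<Sum>h\<in>carrier G. ?t g h)"
    by (intro sum.mono_neutral_left) (use k finite_carrier in \<open>auto simp: in_keys_iff\<close>)
  finally show ?thesis
    by (simp add: star_def rS_id skew_algebraD[OF a] skew_algebraD[OF b])
qed

abbreviation "eA \<equiv> Poly_Mapping.single \<one> (1 :: 'v sym)"

abbreviation "uG g \<equiv> Poly_Mapping.single g (1 :: 'v sym)"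

lemma rS_one [simp]: "rS 1 = 1"
  using rS_id[OF Sym_one] .

text \<open>On the whole type \<open>eA\<close> is not a unit but the projection onto the algebra,
  which is the role of \<open>e\<close> in \<open>koszul_algebra\<close>.\<close>

lemma star_e: "star eA a = amap rS a" and e_star: "star a eA = amap rS a"
proof -
  have *: "inv g \<otimes> k = \<one> \<longleftrightarrow> g = k" if "g \<in> carrier G" "k \<in> carrier G" for g k
    using that by (metis grp.inv_solve_left grp.l_inv grp.one_closed grp.r_one)
  have "rS (Poly_Mapping.lookup eA g) * x = (if g = \<one> then x else 0)" for g x
    by (auto simp: lookup_single when_def)
  then have "Poly_Mapping.lookup (star eA a) k = Poly_Mapping.lookup (amap rS a) k" for k
    using finite_carrier by (auto simp: lookup_star lookup_amap act_id sum.delta cong: if_cong)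
  then show "star eA a = amap rS a" by (rule poly_mapping_eqI)
  have "Poly_Mapping.lookup (star a eA) k = Poly_Mapping.lookup (amap rS a) k" for k
  proof (cases "k \<in> carrier G")
    case True
    have "(\<Sum>g\<in>carrier G. rS (Poly_Mapping.lookup a g) * act g (rS (Poly_Mapping.lookup eA (inv g \<otimes> k))))
      = (\<Sum>g\<in>carrier G. if g = k then rS (Poly_Mapping.lookup a k) else 0)"
      by (intro sum.cong refl) (auto simp: lookup_single when_def * True, use * True in metis)
    then show ?thesis using True finite_carrier by (simp add: lookup_star lookup_amap)
  qed (simp add: lookup_star lookup_amap)
  then show "star a eA = amap rS a" by (rule poly_mapping_eqI)
qed

lemma star_assoc: "star (star a b) c = star a (star b c)"
proof (rule poly_mapping_eqI)
  fix k
  let ?l = Poly_Mapping.lookup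
  show "?l (star (star a b) c) k = ?l (star a (star b c)) k"
  proof (cases "k \<in> carrier G")
    case True
    have rs: "rS (sum f I) = (\<Sum>i\<in>I. rS (f i))" for f :: "'g \<Rightarrow> 'v sym" and I
      by (induction I rule: infinite_finite_induct) (simp_all add: rS_add)
    have rm: "rS (rS s * act g t) = rS s * act g t" for s t g
      by (rule rS_id) (simp add: Sym.mult)
    have "?l (star (star a b) c) k = (\<Sum>g\<in>carrier G. \<Sum>h\<in>carrier G. rS (?l a h) * act h (rS (?l b (inv h \<otimes> g))) * act g (rS (?l c (inv g \<otimes> k))))"
      using True by (simp add: lookup_star rs rm sum_distrib_right cong: sum.cong)
    also have "\<dots> = (\<Sum>h\<in>carrier G. \<Sum>g\<in>carrier G. rS (?l a h) * act h (rS (?l b (inv h \<otimes> g))) * act g (rS (?l c (inv g \<otimes> k))))"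
      by (rule sum.swap)
    also have "\<dots> = (\<Sum>h\<in>carrier G. \<Sum>f\<in>carrier G. rS (?l a h) * act h (rS (?l b f) * act f (rS (?l c (inv f \<otimes> (inv h \<otimes> k))))))"
    proof (rule sum.cong[OF refl])
      fix h assume h: "h \<in> carrier G"
      show "(\<Sum>g\<in>carrier G. rS (?l a h) * act h (rS (?l b (inv h \<otimes> g))) * act g (rS (?l c (inv g \<otimes> k)))) =
        (\<Sum>f\<in>carrier G. rS (?l a h) * act h (rS (?l b f) * act f (rS (?l c (inv f \<otimes> (inv h \<otimes> k))))))"
      \<comment> \<open>The substitution \<open>g = h \<otimes> f\<close> matches the coefficients
        of \<open>k\<close> in the two products.\<close>
      proof (rule sum.reindex_bij_witness[of _ "\<lambda>f. h \<otimes> f" "\<lambda>g. inv h \<otimes> g"])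
        fix g assume g: "g \<in> carrier G"
        have hh: "h \<otimes> (inv h \<otimes> x) = x" "inv h \<otimes> (h \<otimes> x) = x" if "x \<in> carrier G" for x
          using h that by (simp_all add: grp.m_assoc[symmetric])
        show "h \<otimes> (inv h \<otimes> g) = g" "inv h \<otimes> (h \<otimes> g) = g" by (simp_all add: hh g)
        show "inv h \<otimes> g \<in> carrier G" "h \<otimes> g \<in> carrier G" using g h by simp_all
        have "inv (inv h \<otimes> g) \<otimes> (inv h \<otimes> k) = inv g \<otimes> k"
          using g h True by (simp add: grp.inv_mult_group grp.m_assoc hh)
        then show "rS (?l a h) * act h (rS (?l b (inv h \<otimes> g)) * act (inv h \<otimes> g) (rS (?l c (inv (inv h \<otimes> g) \<otimes> (inv h \<otimes> k))))) =
          rS (?l a h) * act h (rS (?l b (inv h \<otimes> g))) * act g (rS (?l c (inv g \<otimes> k)))"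
          using g h by (simp add: act_mult act_act hh mult.assoc)
      qed
    qed
    also have "\<dots> = ?l (star a (star b c)) k"
      using True by (simp add: lookup_star rs rm sum_distrib_left act_sum cong: sum.cong)
    finally show ?thesis .
  qed (simp add: lookup_star)
qed

lemma amap_skew_algebra: "(\<And>s. \<theta> s \<in> S) \<Longrightarrow> amap \<theta> a \<in> skew_algebra"
  by (rule skew_algebraI) (auto simp: lookup_amap Sym_zero)

lemma amap_rS_id: "a \<in> skew_algebra \<Longrightarrow> amap rS a = a"
  by (rule poly_mapping_eqI) (auto simp: lookup_amap skew_algebraD rS_id)

lemma star_vec: "star (avec v) a = amap (\<lambda>s. vec v * rS s) a"
proof (rule poly_mapping_eqI)
  fix k
  have "rS (Poly_Mapping.lookup (avec v) g) * x = (if g = \<one> then vec v * x else 0)" for g x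
    by (auto simp: avec_def lookup_single when_def rS_id)
  then show "Poly_Mapping.lookup (star (avec v) a) k = Poly_Mapping.lookup (amap (\<lambda>s. vec v * rS s) a) k"
    using finite_carrier by (auto simp: lookup_star lookup_amap act_id sum.delta cong: if_cong)
qed

abbreviation "compS k \<equiv> select (\<lambda>m. Poly_Mapping.keys m \<subseteq> Basis \<and> mdeg m = k)"

lemma compS_deriv: "compS k (deriv j (rS s)) = deriv j (rS (compS (Suc k) s))"
proof (induction s rule: sym_induct)
  case (single m c)
  show ?case
  proof (cases "Poly_Mapping.lookup m j = 0")
    case True
    then show ?thesis by (simp add: rS_def select_single deriv_single)
  next
    case False
    let ?n = "m - Poly_Mapping.single j 1"
    have m: "m = ?n + Poly_Mapping.single j 1"
      using False by (auto simp: poly_mapping_eq_iff fun_eq_iff lookup_add lookup_minus lookup_single when_def)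
    have d: "mdeg m = Suc (mdeg ?n)" by (subst m) (simp add: mdeg_add)
    have "Poly_Mapping.keys ?n \<subseteq> Poly_Mapping.keys m"
      by (auto simp: in_keys_iff lookup_minus)
    then show ?thesis using d by (auto simp: rS_def select_single deriv_single)
  qed
qed (simp_all add: select_add rS_add deriv_add)

text \<open>Euler's identity on each homogeneous part, the source of the axioms
  \<open>euler_comp\<close> and \<open>comp_euler\<close>.\<close>

lemma euler_compS: "(\<Sum>j\<in>Basis. vec j * deriv j (compS k s)) = sconst (of_nat k) * compS k s"
proof (induction s rule: sym_induct)
  case (single m c)
  show ?case
  proof (cases "Poly_Mapping.keys m \<subseteq> Basis \<and> mdeg m = k")
    case True
    have c: "compS k (Poly_Mapping.single m c) = Poly_Mapping.single m c"
      using True by (simp add: select_single)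
    have "vec j * deriv j (Poly_Mapping.single m c) = sconst (of_nat (Poly_Mapping.lookup m j)) * Poly_Mapping.single m c" if "j \<in> Basis" for j
    proof (cases "Poly_Mapping.lookup m j = 0")
      case False
      have "Poly_Mapping.single j 1 + (m - Poly_Mapping.single j 1) = m"
        using False by (auto simp: poly_mapping_eq_iff fun_eq_iff lookup_add lookup_minus lookup_single when_def)
      then show ?thesis using that by (simp add: vec_Basis deriv_single mult_single sconst_mult_single mult.commute[of c])
    qed (simp add: deriv_single)
    then have "(\<Sum>j\<in>Basis. vec j * deriv j (Poly_Mapping.single m c)) = (\<Sum>j\<in>Basis. sconst (of_nat (Poly_Mapping.lookup m j))) * Poly_Mapping.single m c"
      by (simp add: sum_distrib_right)
    also have "(\<Sum>j\<in>K. sconst (of_nat (Poly_Mapping.lookup m j))) = sconst (of_nat (\<Sum>j\<in>K. Poly_Mapping.lookup m j))" for K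
      by (induction K rule: infinite_finite_induct) (simp_all add: sconst_add)
    also have "(\<Sum>j\<in>Basis. Poly_Mapping.lookup m j) = k"
      using True mdeg_superset[OF finite_Basis, of m] by simp
    finally show ?thesis unfolding c .
  next
    case False
    then have "compS k (Poly_Mapping.single m c) = 0" by (auto simp: select_single)
    then show ?thesis by simp
  qed
qed (simp_all add: select_add deriv_add sum.distrib algebra_simps)

end

subsection \<open>Comparison with bar cochains and the antisymmetrisation\<close>

context koszul_algebra
begin

text \<open>A copy of the coefficients inside functions on lists, the type that
  \<open>lifts_and_detects\<close> speaks about; evaluation at the empty list carries its
  conclusions back.\<close>

definition cst :: "'a \<Rightarrow> 'a list \<Rightarrow> 'a"
  where "cst a l = (if l = [] then a else 0)"

lemma cst_simps: "cst (a - b) = cst a - cst b" "cst (a + b) = cst a + cst b" "cst 0 = 0" "cst (sc c a) = (\<lambda>l. sc c (cst a l))"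
  "cst a [] = a"
  by (auto simp: cst_def fun_eq_iff)

lemma constants_bimodule: 
  "koszul_bimodule G sc vsc mul e av ug \<rho> J co D comp (\<lambda>c u l. sc c (u l)) (cst ` A)
    (\<lambda>a u l. a \<odot> u l) (\<lambda>b u l. u l \<odot> b)"
proof -
  have cl: "(\<lambda>l. \<phi> (cst m l)) = cst (\<phi> m)" if "\<phi> 0 = 0" for \<phi> m
    using that by (auto simp: cst_def fun_eq_iff)
  show ?thesis
  proof unfold_locales
    show "0 \<in> cst ` A" using A.M_zero by (force simp: cst_simps intro: image_eqI[of _ _ 0])
    fix m n a c
    assume "m \<in> cst ` A"
    then obtain m' where m: "m = cst m'" "m' \<in> A" by blast
    show "(\<lambda>l. sc c (m l)) \<in> cst ` A" unfolding m cst_simps(4)[symmetric] using A.M_sc[OF m(2)] by blast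
    show "(\<lambda>l. a \<odot> m l) \<in> cst ` A" unfolding m cl[of "\<lambda>x. a \<odot> x", OF mul_zero(2)] using A.L_closed[OF m(2)] by blast
    show "(\<lambda>l. m l \<odot> a) \<in> cst ` A" unfolding m cl[of "\<lambda>x. x \<odot> a", OF mul_zero(1)] using A.R_closed[OF m(2)] by blast
    show "(\<lambda>l. e \<odot> m l) = m" unfolding m cl[of "\<lambda>x. e \<odot> x", OF mul_zero(2)] using A.L_e[OF m(2)] by simp
    show "(\<lambda>l. m l \<odot> e) = m" unfolding m cl[of "\<lambda>x. x \<odot> e", OF mul_zero(1)] using A.R_e[OF m(2)] by simp
    assume "n \<in> cst ` A"
    then obtain n' where n: "n = cst n'" "n' \<in> A" by blast
    show "m + n \<in> cst ` A" unfolding m n cst_simps(2)[symmetric] using A.M_add[OF m(2) n(2)] by blast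
  qed (auto simp: fun_eq_iff alg.scale_right_distrib alg.scale_left_distrib mul_add_left mul_add_right mul_sc_left mul_sc_right mul_assoc mult.commute)
qed

theorem algebra_lifts_and_detects: "A.lifts n" "A.detects n"
proof -
  interpret C: koszul_bimodule G sc vsc mul e av ug \<rho> J co D comp "\<lambda>c u l. sc c (u l)" "cst ` A"
    "\<lambda>a u l. a \<odot> u l" "\<lambda>b u l. u l \<odot> b"
    by (rule constants_bimodule)
  have main: "C.lifts n" "C.detects n"
    using lifts_and_detects[OF alg.vector_space_axioms constants_bimodule] by blast+
  have ck: "(\<lambda>vs. cst (F vs)) \<in> C.kcoch" if "F \<in> A.kcoch" for F
    using A.kcochD(1,2,3)[OF that] by (auto simp: C.kcoch_def multilin_def cst_simps)
  have ch: "(\<lambda>vs. cst (F vs)) \<in> C.hcoch" if "F \<in> A.hcoch" for F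
    using A.hcochD(1,2,3)[OF that] by (auto simp: C.hcoch_def multilin_def cst_simps)
  have M: "u [] \<in> A" "u = cst (u [])" if "u \<in> cst ` A" for u
    using that by (auto simp: cst_simps)
  have ek: "(\<lambda>vs. F vs []) \<in> A.kcoch" if "F \<in> C.kcoch" for F
    using C.kcochD(1,2,3)[OF that] M(1) by (auto simp: A.kcoch_def multilin_def)
  have eh: "(\<lambda>vs. F vs []) \<in> A.hcoch" if "F \<in> C.hcoch" for F
    using C.hcochD(1,2,3)[OF that] M(1) by (auto simp: A.hcoch_def multilin_def)
  have kc: "C.kd (\<lambda>vs. cst (F vs)) vs = cst (A.kd F vs)" for F vs
    by (rule kdiff_hom[where \<phi> = cst and F = F]) (auto simp: cst_simps C.ad_def A.ad_def cst_def fun_eq_iff)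
  have ke: "A.kd (\<lambda>vs. F vs []) vs = C.kd F vs []" for F vs
    by (rule kdiff_hom[where \<phi> = "\<lambda>u. u []" and F = F]) (auto simp: C.ad_def A.ad_def)
  have be: "A.bd (\<lambda>vs. f vs []) vs = C.bd f vs []" for f vs
    by (rule bdiff_hom[where \<phi> = "\<lambda>u. u []" and f = f]) auto
  have bc: "C.bd (\<lambda>vs. cst (f vs)) vs = cst (A.bd f vs)" for f vs
    by (rule bdiff_hom[where \<phi> = cst and f = f]) (auto simp: cst_simps cst_def fun_eq_iff)
  have ae: "A.alt (\<lambda>vs. f vs []) vs = C.alt f vs []" for f :: "'a list \<Rightarrow> 'a list \<Rightarrow> 'a" and vs
    by (rule alternate_hom[where \<phi> = "\<lambda>u. u []" and f = f]) auto
  have ac: "C.alt (\<lambda>vs. cst (f vs)) vs = cst (A.alt f vs)" for f vs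
    by (rule alternate_hom[where \<phi> = cst and f = f]) (auto simp: cst_simps)
  show "A.lifts n"
    unfolding A.lifts_def
  proof (intro ballI impI)
    fix F assume F: "F \<in> A.kcoch" "\<forall>vs. length vs \<noteq> n \<longrightarrow> F vs = 0" "\<forall>vs. A.kd F vs = 0"
      and inv: "\<forall>g\<in>carrier G. \<forall>vs. A.conj_coch g F vs = F vs"
    let ?F = "\<lambda>vs. cst (F vs)"
    have 1: "\<forall>vs. length vs \<noteq> n \<longrightarrow> ?F vs = 0" "\<forall>vs. C.kd ?F vs = 0"
      using F by (auto simp: cst_simps kc)
    have 2: "\<forall>g\<in>carrier G. \<forall>vs. C.conj_coch g ?F vs = ?F vs"
    proof (intro ballI allI)
      fix g vs assume "g \<in> carrier G"
      have "C.conj_coch g ?F vs = cst (A.conj_coch g F vs)"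
        by (auto simp: C.conj_coch_def A.conj_coch_def C.conjugation_def A.conjugation_def cst_def fun_eq_iff)
      then show "C.conj_coch g ?F vs = ?F vs" using inv \<open>g \<in> carrier G\<close> by simp
    qed
    obtain f Z where f: "f \<in> C.hcoch" "\<forall>as. length as \<noteq> n \<longrightarrow> f as = 0" "\<forall>as. C.bd f as = 0"
      and Z: "Z \<in> C.kcoch" "\<forall>vs. C.alt f vs = ?F vs + C.kd Z vs"
      using main(1)[unfolded C.lifts_def, THEN bspec, OF ck[OF F(1)], THEN mp, OF 1(1), THEN mp, OF 1(2), THEN mp, OF 2] by blast
    show "\<exists>f\<in>A.hcoch. (\<forall>as. length as \<noteq> n \<longrightarrow> f as = 0) \<and> (\<forall>as. A.bd f as = 0) \<and>
      (\<exists>Z\<in>A.kcoch. \<forall>vs. A.alt f vs = F vs + A.kd Z vs)"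
    proof (intro bexI[OF _ eh[OF f(1)]] conjI bexI[OF _ ek[OF Z(1)]] allI impI)
      show "f as [] = 0" if "length as \<noteq> n" for as using f(2) that by simp
      show "A.bd (\<lambda>vs. f vs []) as = 0" for as using f(3) by (simp add: be)
      show "A.alt (\<lambda>vs. f vs []) vs = F vs + A.kd (\<lambda>vs. Z vs []) vs" for vs
        using Z(2) by (simp add: ae ke cst_simps)
    qed
  qed
  show "A.detects n"
    unfolding A.detects_def
  proof (intro ballI impI)
    fix f assume f: "f \<in> A.hcoch" "\<forall>as. length as \<noteq> n \<longrightarrow> f as = 0" "\<forall>as. A.bd f as = 0"
      and "\<exists>Z\<in>A.kcoch. \<forall>vs. length vs = n \<longrightarrow> A.alt f vs = A.kd Z vs"
    then obtain Z where Z: "Z \<in> A.kcoch" "\<forall>vs. length vs = n \<longrightarrow> A.alt f vs = A.kd Z vs" by blast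
    let ?f = "\<lambda>vs. cst (f vs)"
    have 1: "\<forall>as. length as \<noteq> n \<longrightarrow> ?f as = 0" "\<forall>as. C.bd ?f as = 0" using f by (auto simp: cst_simps bc)
    have 2: "\<exists>Z\<in>C.kcoch. \<forall>vs. length vs = n \<longrightarrow> C.alt ?f vs = C.kd Z vs"
      using Z by (intro bexI[OF _ ck[OF Z(1)]]) (simp add: ac kc)
    obtain h where h: "h \<in> C.hcoch" "\<forall>as. length as = n \<longrightarrow> ?f as = C.bd h as"
      using main(2)[unfolded C.detects_def, THEN bspec, OF ch[OF f(1)], THEN mp, OF 1(1), THEN mp, OF 1(2), THEN mp, OF 2] by blast
    show "\<exists>h\<in>A.hcoch. \<forall>as. length as = n \<longrightarrow> f as = A.bd h as"
    proof (intro bexI[OF _ eh[OF h(1)]] allI impI)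
      fix as :: "'a list" assume "length as = n"
      then have "?f as [] = C.bd h as []" using h(2) by simp
      then show "f as = A.bd (\<lambda>vs. h vs []) as" by (simp add: be cst_simps)
    qed
  qed
qed

end

section \<open>The recursive operations as sums over positions and permutations\<close>

lemma circ_sum:
  assumes "length l + 1 = n + q"
  shows "circ q g F l = (\<Sum>i<n. sg ((q + 1) * i) (F (take i l @ [g (take q (drop i l))] @ drop (i + q) l)))"
  using assms
proof (induction n arbitrary: l F)
  case 0
  then show ?case by (simp add: circ_short)
next
  case (Suc n)
  have sgsum: "sg k (sum t I) = (\<Sum>i\<in>I. sg k (t i))" for k and t :: "nat \<Rightarrow> 'b" and I
    by (induction I rule: infinite_finite_induct) (simp_all add: sg_add)
  show ?case
  proof (cases l)
    case Nil
    then have "n = 0" "q = 0" using Suc.prems by auto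
    then show ?thesis using Nil by simp
  next
    case (Cons a m)
    have "circ q g (\<lambda>k. F (a # k)) m = (\<Sum>i<n. sg ((q + 1) * i) (F (a # take i m @ [g (take q (drop i m))] @ drop (i + q) m)))"
      by (rule Suc.IH) (use Suc.prems Cons in simp)
    then have "circ q g F l = F (g (take q l) # drop q l) +
      (\<Sum>i<n. sg (Suc q + (q + 1) * i) (F (a # take i m @ [g (take q (drop i m))] @ drop (i + q) m)))"
      using Suc.prems Cons by (simp add: sgsum sg_sg)
    then show ?thesis
      unfolding sum.lessThan_Suc_shift by (simp add: Cons)
  qed
qed

lemma insert_alt_sum:
  "insert_alt a f l = (\<Sum>k\<le>length l. sg k (f (take k l @ a # drop k l)))"
proof (induction l arbitrary: f)
  case (Cons b l)
  show ?case
    by (simp add: Cons sum.atMost_Suc_shift sg_def sum_negf[symmetric] del: sum.atMost_Suc)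
      (intro sum.cong refl, simp)
qed simp

text \<open>The permutation that puts letter 0 at position \<open>k\<close> and keeps the order of
  the others. Together with \<open>shift_perm\<close> it records where \<open>insert_alt\<close>
  inserts its letter.\<close>

definition cycle_at :: "nat \<Rightarrow> nat \<Rightarrow> nat"
  where "cycle_at k i = (if i < k then Suc i else if i = k then 0 else i)"

lemma cycle_at_permutes: "k \<le> n \<Longrightarrow> cycle_at k permutes {..<Suc n}" and sign_cycle_at: "sign (cycle_at k) = (-1) ^ k"
proof -
  \<comment> \<open>A cycle of length \<open>k + 1\<close> is a product of \<open>k\<close>
    transpositions of neighbours, which yields the sign.\<close>
  have step: "cycle_at (Suc k) = cycle_at k \<circ> transpose k (Suc k)" for k
    by (auto simp: fun_eq_iff cycle_at_def transpose_def)
  have base: "cycle_at 0 = id" by (auto simp: fun_eq_iff cycle_at_def)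
  show p: "cycle_at k permutes {..<Suc n}" if "k \<le> n" for k n
    using that
  proof (induction k)
    case 0
    show ?case unfolding base by (rule permutes_id)
  next
    case (Suc k)
    then show ?case unfolding step by (intro permutes_compose permutes_swap_id) auto
  qed
  show "sign (cycle_at k) = (-1) ^ k"
  proof (induction k)
    case (Suc k)
    have "permutation (cycle_at k)" using p[of k k] by (auto simp: permutation_permutes)
    then show ?case unfolding step by (simp only: sign_compose sign_swap_id permutation_swap_id Suc) simp
  qed (simp add: base)
qed

definition shift_perm :: "(nat \<Rightarrow> nat) \<Rightarrow> nat \<Rightarrow> nat"
  where "shift_perm \<pi> i = (case i of 0 \<Rightarrow> 0 | Suc j \<Rightarrow> Suc (\<pi> j))"

lemma shift_perm_simps [simp]: "shift_perm \<pi> 0 = 0" "shift_perm \<pi> (Suc j) = Suc (\<pi> j)"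
  by (simp_all add: shift_perm_def)

lemma shift_perm: 
  assumes "\<pi> permutes {..<n}"
  shows "shift_perm \<pi> permutes {..<Suc n} \<and> sign (shift_perm \<pi>) = sign \<pi>"
  using assms finite_lessThan
proof (induction rule: permutes_induct)
  case id
  have "shift_perm id = id" by (auto simp: fun_eq_iff shift_perm_def split: nat.split)
  then show ?case by (simp only: permutes_id)
next
  case (swap a b p)
  have "shift_perm (transpose a b \<circ> p) = transpose (Suc a) (Suc b) \<circ> shift_perm p"
    by (auto simp: fun_eq_iff shift_perm_def transpose_def split: nat.split)
  moreover have "permutation p" "permutation (shift_perm p)"
    using swap by (auto simp: permutation_permutes)
  moreover have "transpose (Suc a) (Suc b) permutes {..<Suc n}"
    using swap by (intro permutes_swap_id) auto
  ultimately show ?case using swap(3) swap.IH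
    by (simp only: sign_compose sign_swap_id permutation_swap_id permutes_compose simp_thms nat.inject)
qed

text \<open>A permutation of \<open>n + 1\<close> letters consists of the position \<open>k\<close>
  of letter 0 and an arrangement of the others. The position is read off as the argument sent to 0;
  surjectivity follows by counting, \<open>(n + 1) n! = (n + 1)!\<close>.\<close>

lemma permutations_insert_first:
  "bij_betw (\<lambda>(k, \<pi>). shift_perm \<pi> \<circ> cycle_at k) ({..n} \<times> {\<pi>. \<pi> permutes {..<n}}) {\<pi>. \<pi> permutes {..<Suc n}}"
proof -
  let ?f = "\<lambda>(k, \<pi>). shift_perm \<pi> \<circ> cycle_at k" and ?A = "{..n} \<times> {\<pi>. \<pi> permutes {..<n}}"
  have sub: "?f ` ?A \<subseteq> {\<pi>. \<pi> permutes {..<Suc n}}"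
    using shift_perm cycle_at_permutes by (fastforce intro: permutes_compose)
  have zero: "(shift_perm \<pi> \<circ> cycle_at k) i = 0 \<longleftrightarrow> i = k" for \<pi> k i
    by (auto simp: shift_perm_def cycle_at_def split: nat.split)
  have inj: "inj_on ?f ?A"
  proof (rule inj_onI, clarsimp)
    fix k \<pi> k' \<pi>'
    assume eq: "shift_perm \<pi> \<circ> cycle_at k = shift_perm \<pi>' \<circ> cycle_at k'"
    then have "k = k'" using zero[of \<pi> k k] zero[of \<pi>' k' k] by simp
    have "surj (cycle_at k)" using cycle_at_permutes[of k k] by (auto dest: permutes_surj)
    then have "shift_perm \<pi> = shift_perm \<pi>'" using eq \<open>k = k'\<close> by (auto simp: fun_eq_iff) (metis surjD)
    then have "\<pi> j = \<pi>' j" for j by (metis shift_perm_simps(2) nat.inject)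
    then show "k = k' \<and> \<pi> = \<pi>'" using \<open>k = k'\<close> by auto
  qed
  have "card (?f ` ?A) = card {\<pi>. \<pi> permutes {..<Suc n}}"
    using card_image[OF inj] by (simp add: card_cartesian_product card_permutations[OF refl] del: permutes_empty)
  then have "?f ` ?A = {\<pi>. \<pi> permutes {..<Suc n}}"
    by (intro card_subset_eq sub finite_permutations) auto
  with inj show ?thesis by (simp add: bij_betw_def)
qed

definition sgi :: "int \<Rightarrow> 'b::ab_group_add \<Rightarrow> 'b"
  where "sgi s x = (if s = 1 then x else - x)"

lemma alternate_permutations:
  fixes f :: "'a list \<Rightarrow> 'b::ab_group_add"
  shows "alternate av f vs = (\<Sum>\<pi> | \<pi> permutes {..<length vs}.
    sgi (sign \<pi>) (f (map (\<lambda>i. av (vs ! \<pi> i)) [0..<length vs])))"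
proof (induction vs arbitrary: f)
  case Nil
  show ?case by (simp add: sgi_def)
next
  case (Cons v vs)
  let ?n = "length vs"
  let ?P = "{\<pi>. \<pi> permutes {..<?n}}"
  let ?l = "\<lambda>\<pi>. map (\<lambda>i. av (vs ! \<pi> i)) [0..<?n]"
  let ?t = "\<lambda>\<pi>. sgi (sign \<pi>) (f (map (\<lambda>i. av ((v # vs) ! \<pi> i)) [0..<Suc ?n]))"
  have t: "?t (shift_perm \<pi> \<circ> cycle_at k) = sgi (sign \<pi>) (sg k (f (take k (?l \<pi>) @ av v # drop k (?l \<pi>))))"
    if "k \<in> {..?n}" "\<pi> \<in> ?P" for k \<pi>
  proof -
    have \<pi>: "\<pi> permutes {..<?n}" using that by simp
    have "permutation (shift_perm \<pi>)" "permutation (cycle_at k)"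
      using shift_perm[OF \<pi>] cycle_at_permutes[of k k] by (auto simp: permutation_permutes)
    then have "sign (shift_perm \<pi> \<circ> cycle_at k) = sign \<pi> * (-1) ^ k"
      using shift_perm[OF \<pi>] by (simp add: sign_compose sign_cycle_at)
    moreover have "map (\<lambda>i. av ((v # vs) ! (shift_perm \<pi> \<circ> cycle_at k) i)) [0..<Suc ?n] = take k (?l \<pi>) @ av v # drop k (?l \<pi>)"
    proof (rule nth_equalityI)
      fix i assume i: "i < length (map (\<lambda>i. av ((v # vs) ! (shift_perm \<pi> \<circ> cycle_at k) i)) [0..<Suc ?n])"
      then have i': "i < Suc ?n" by simp
      then have "map (\<lambda>i. av ((v # vs) ! (shift_perm \<pi> \<circ> cycle_at k) i)) [0..<Suc ?n] ! i = av ((v # vs) ! (shift_perm \<pi> \<circ> cycle_at k) i)"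
        by (simp del: upt_Suc)
      also have "\<dots> = (take k (?l \<pi>) @ av v # drop k (?l \<pi>)) ! i"
        using that i' by (cases "i < k"; cases "i = k") (auto simp: cycle_at_def nth_append nth_Cons' shift_perm_def min_def split: nat.split)
      finally show "map (\<lambda>i. av ((v # vs) ! (shift_perm \<pi> \<circ> cycle_at k) i)) [0..<Suc ?n] ! i = (take k (?l \<pi>) @ av v # drop k (?l \<pi>)) ! i" .
    qed (use that in simp)
    ultimately show ?thesis
      by (cases "even k"; cases \<pi> rule: sign_cases) (simp_all add: sgi_def sg_def)
  qed
  have sgis: "sgi s (sum h I) = (\<Sum>i\<in>I. sgi s (h i))" for s and h :: "nat \<Rightarrow> 'b" and I
    by (simp add: sgi_def sum_negf)
  have "(\<Sum>\<pi> | \<pi> permutes {..<Suc ?n}. ?t \<pi>) = (\<Sum>(k, \<pi>)\<in>{..?n} \<times> ?P. ?t (shift_perm \<pi> \<circ> cycle_at k))"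
    using sum.reindex_bij_betw[OF permutations_insert_first[of ?n], of ?t] by (simp add: case_prod_unfold)
  also have "\<dots> = (\<Sum>\<pi>\<in>?P. \<Sum>k\<le>?n. ?t (shift_perm \<pi> \<circ> cycle_at k))"
    by (subst sum.swap) (rule sum.cartesian_product[symmetric])
  also have "\<dots> = (\<Sum>\<pi>\<in>?P. sgi (sign \<pi>) (insert_alt (av v) f (?l \<pi>)))"
    unfolding insert_alt_sum sgis by (rule sum.cong[OF refl], rule sum.cong, simp, rule t, simp_all)
  also have "\<dots> = alternate av f (v # vs)" by (simp add: Cons)
  finally show ?case by simp
qed

context finite_group_module
begin

text \<open>The instance for \<open>S(V) # G\<close>, with derivatives and homogeneous parts applied
  to the coefficient of each group element. The derivative is put to 0 for \<open>j\<close> outside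
  \<open>Basis\<close>, so that the laws demanded for every \<open>j\<close> hold there at
  once.\<close>

sublocale K: koszul_algebra G ascale scale star eA avec uG \<rho> Basis "\<lambda>j v. representation Basis v j"
  "\<lambda>j. amap (\<lambda>s. if j \<in> Basis then deriv j (rS s) else 0)" "\<lambda>k. amap (compS k)"
proof -
  interpret av: vector_space ascale by (rule ascale_vector_space)
  note lks = lookup_star lookup_amap lookup_add ascale_lookup rS_add rS_sconst_mult act_add act_sconst_mult
  have compS_rS: "compS k (rS s) = compS k s" for k s
    by (rule poly_mapping_eqI) (simp add: rS_def lookup_select)
  have rS_compS: "rS (compS k s) = compS k s" for k s
    by (rule poly_mapping_eqI) (simp add: rS_def lookup_select)
  have sum_amap: "Poly_Mapping.lookup (\<Sum>j\<in>Basis. star (avec j) (amap (\<theta> j) a)) g = (if g \<in> carrier G then (\<Sum>j\<in>Basis. vec j * rS (\<theta> j (Poly_Mapping.lookup a g))) else 0)" for \<theta> a g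
    by (simp add: lookup_sum star_vec lookup_amap)
  have compS_sum: "compS k (sum f I) = (\<Sum>i\<in>I. compS k (f i))" for k and f :: "'v \<Rightarrow> 'v sym" and I
    by (induction I rule: infinite_finite_induct) (simp_all add: select_add)
  have rS_deriv: "rS (deriv j (rS s)) = deriv j (rS s)" if "j \<in> Basis" for j s
    by (rule rS_id) (simp add: deriv_S that)
  have rS_deriv': "rS (deriv j (compS k s)) = deriv j (compS k s)" if "j \<in> Basis" for j k s
    using rS_deriv[OF that, of "compS k s"] by (simp add: rS_compS)
  show "koszul_algebra G ascale scale star eA avec uG \<rho> Basis (\<lambda>j v. representation Basis v j)
    (\<lambda>j. amap (\<lambda>s. if j \<in> Basis then deriv j (rS s) else 0)) (\<lambda>k. amap (compS k))"
  proof unfold_locales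
    fix a b a' :: "('g, 'v) skew" and c :: complex and v w :: 'v and g h :: 'g and j :: 'v and k n :: nat and Q :: "('g, 'v) skew \<Rightarrow> bool"
    show "star (a + b) a' = star a a' + star b a'" "star a (b + a') = star a b + star a a'"
      by (auto intro!: poly_mapping_eqI simp: lks sum.distrib algebra_simps)
    show "star (ascale c a) b = ascale c (star a b)" "star a (ascale c b) = ascale c (star a b)"
      by (auto intro!: poly_mapping_eqI simp: lks sum_distrib_left algebra_simps)
    show "star (star a b) a' = star a (star b a')" by (rule star_assoc)
    show "star eA a = star a eA" by (simp add: star_e e_star)
    show "star eA (star a b) = star a b"
      unfolding star_e 
      by (rule amap_rS_id, rule skew_algebraI) (auto simp: lookup_star intro!: Sym_sum Sym.mult Sym_zero)
    show "avec (v + w) = avec v + avec w" by (simp add: avec_def vec_add single_add)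
    show "avec (scale c v) = ascale c (avec v)"
      by (rule poly_mapping_eqI) (simp add: avec_def vec_scale ascale_lookup lookup_single when_def)
    show "star (avec v) (avec w) = star (avec w) (avec v)"
      by (simp add: avec_def star_single rS_id act_id mult.commute)
    show "finite (carrier G)" by (rule finite_carrier)
    show "(\<Sum>j\<in>Basis. scale (representation Basis v j) j) = v" by (rule rep_sum)
    show "finite Basis" by (rule finite_Basis)
    show "\<rho> \<one> v = v" by (rule rho_one')
    show "uG \<one> = eA" ..
    show "amap (\<lambda>s. if j \<in> Basis then deriv j (rS s) else 0) (a + b) = amap (\<lambda>s. if j \<in> Basis then deriv j (rS s) else 0) a + amap (\<lambda>s. if j \<in> Basis then deriv j (rS s) else 0) b"
      by (rule poly_mapping_eqI) (simp add: lks deriv_add)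
    show "amap (\<lambda>s. if j \<in> Basis then deriv j (rS s) else 0) (ascale c a) = ascale c (amap (\<lambda>s. if j \<in> Basis then deriv j (rS s) else 0) a)"
      by (rule poly_mapping_eqI) (simp add: lks deriv_sconst_mult)
    show "amap (\<lambda>s. if j \<in> Basis then deriv j (rS s) else 0) (star eA a) = star eA (amap (\<lambda>s. if j \<in> Basis then deriv j (rS s) else 0) a)"
      unfolding star_e by (rule poly_mapping_eqI) (simp add: lookup_amap rS_deriv)
    show "amap (compS k) (a + b) = amap (compS k) a + amap (compS k) b"
      by (rule poly_mapping_eqI) (simp add: lks select_add)
    show "amap (compS k) (ascale c a) = ascale c (amap (compS k) a)"
      by (rule poly_mapping_eqI) (simp add: lookup_amap ascale_lookup lookup_select select_def linext_sconst)
    show "amap (compS k) (star eA a) = amap (compS k) a"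
      unfolding star_e by (rule poly_mapping_eqI) (simp add: lookup_amap compS_rS)
    show "amap (compS k) (amap (\<lambda>s. if j \<in> Basis then deriv j (rS s) else 0) a) = amap (\<lambda>s. if j \<in> Basis then deriv j (rS s) else 0) (amap (compS (Suc k)) a)"
      by (rule poly_mapping_eqI) (simp add: lookup_amap compS_deriv)
    show "amap (\<lambda>s. if j \<in> Basis then deriv j (rS s) else 0) (amap (compS 0) a) = 0"
    proof (rule poly_mapping_eqI)
      have "deriv j (compS 0 s) = 0" if "j \<in> Basis" for s
      proof (induction s rule: sym_induct)
        case (single m c)
        have "mdeg m \<noteq> 0" if "Poly_Mapping.lookup m j \<noteq> 0"
          using that by (auto simp: mdeg_def in_keys_iff)
        then show ?case by (cases "Poly_Mapping.lookup m j = 0") (auto simp: select_single deriv_single)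
      qed (simp_all add: select_add deriv_add)
      then show "Poly_Mapping.lookup (amap (\<lambda>s. if j \<in> Basis then deriv j (rS s) else 0) (amap (compS 0) a)) g = Poly_Mapping.lookup 0 g" for g
        by (simp add: lookup_amap rS_compS)
    qed
    show "(\<Sum>j\<in>Basis. star (avec j) (amap (\<lambda>s. if j \<in> Basis then deriv j (rS s) else 0) (amap (compS k) a))) = ascale (of_nat k) (amap (compS k) a)"
      by (rule poly_mapping_eqI) (simp add: sum_amap lookup_amap ascale_lookup rS_deriv' rS_compS euler_compS cong: sum.cong)
    show "amap (compS k) (\<Sum>j\<in>Basis. star (avec j) (amap (\<lambda>s. if j \<in> Basis then deriv j (rS s) else 0) a)) = ascale (of_nat k) (amap (compS k) a)"
    proof -
      have "compS k (vec j * deriv j s) = (case k of 0 \<Rightarrow> 0 | Suc i \<Rightarrow> vec j * compS i (deriv j s))" if "j \<in> Basis" for j s k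
      proof (induction s rule: sym_induct)
        case (single m c)
        have "vec j * Poly_Mapping.single n d = Poly_Mapping.single (Poly_Mapping.single j 1 + n) d" for n d
          by (simp add: vec_Basis[OF that] mult_single)
        moreover have "mdeg (Poly_Mapping.single j 1 + n) = Suc (mdeg n)" for n by (simp add: mdeg_add)
        moreover have "Poly_Mapping.keys (Poly_Mapping.single j 1 + n) = insert j (Poly_Mapping.keys n)" for n :: "'v \<Rightarrow>\<^sub>0 nat"
          by (auto simp: in_keys_iff lookup_add lookup_single when_def split: if_splits)
        ultimately show ?case using that
          by (simp add: deriv_single select_single split: nat.split)
      qed (simp_all add: select_add deriv_add distrib_left split: nat.split)
      then have e: "compS k (\<Sum>j\<in>Basis. vec j * deriv j (rS s)) = sconst (of_nat k) * compS k s" for s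
        using euler_compS[of k s] 
        by (cases k) (simp_all add: compS_sum compS_deriv rS_compS)
      show ?thesis
        by (rule poly_mapping_eqI) (simp add: lookup_amap ascale_lookup sum_amap rS_deriv e cong: sum.cong)
    qed
    show "\<exists>n. \<forall>k>n. amap (compS k) a = 0"
    proof -
      let ?N = "\<Sum>g\<in>carrier G. \<Sum>m\<in>Poly_Mapping.keys (Poly_Mapping.lookup a g). mdeg m"
      have "mdeg m \<le> ?N" if "g \<in> carrier G" "m \<in> Poly_Mapping.keys (Poly_Mapping.lookup a g)" for g m
      proof -
        have "mdeg m \<le> (\<Sum>m\<in>Poly_Mapping.keys (Poly_Mapping.lookup a g). mdeg m)"
          by (rule member_le_sum) (use that in auto)
        also have "\<dots> \<le> ?N" by (rule member_le_sum) (use that finite_carrier in auto)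
        finally show ?thesis .
      qed
      then have "amap (compS k) a = 0" if "k > ?N" for k
        using that by (intro poly_mapping_eqI) (fastforce simp: lookup_amap lookup_select in_keys_iff)
      then show ?thesis by blast
    qed
    show "(\<Sum>k\<le>n. amap (compS k) a) = star eA a" if *: "\<forall>k>n. amap (compS k) a = 0"
    proof (rule poly_mapping_eqI)
      fix g
      show "Poly_Mapping.lookup (\<Sum>k\<le>n. amap (compS k) a) g = Poly_Mapping.lookup (star eA a) g"
      proof (cases "g \<in> carrier G")
        case True
        have "Poly_Mapping.lookup (\<Sum>k\<le>n. compS k (Poly_Mapping.lookup a g)) m = Poly_Mapping.lookup (rS (Poly_Mapping.lookup a g)) m" for m
        proof (cases "mdeg m \<le> n")
          case True
          then show ?thesis by (simp add: lookup_sum lookup_select rS_def)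
        next
          case False
          then have "Poly_Mapping.lookup (amap (compS (mdeg m)) a) g = 0" using * by simp
          then have "Poly_Mapping.lookup (compS (mdeg m) (Poly_Mapping.lookup a g)) m = 0"
            using \<open>g \<in> carrier G\<close> by (simp add: lookup_amap)
          then show ?thesis using False by (simp add: lookup_sum lookup_select rS_def)
        qed
        then show ?thesis using True by (simp add: star_e lookup_sum lookup_amap poly_mapping_eq_iff fun_eq_iff)
      qed (simp add: star_e lookup_sum lookup_amap)
    qed
    show "amap (\<lambda>s. if j \<in> Basis then deriv j (rS s) else 0) (star (avec v) a) = ascale (representation Basis v j) (star eA a) + star (avec v) (amap (\<lambda>s. if j \<in> Basis then deriv j (rS s) else 0) a)"
      if "j \<in> Basis"
    proof -
      have "rS (vec v * rS s) = vec v * rS s" for s by (rule rS_id) (simp add: Sym.mult)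
      then show ?thesis using that
        by (intro poly_mapping_eqI) (simp add: star_vec star_e lookup_amap lookup_add ascale_lookup deriv_mult deriv_vec rS_deriv)
    qed
    show "Q (star eA a)"
      if q: "\<forall>a b. Q a \<longrightarrow> Q b \<longrightarrow> Q (a + b)" "\<forall>a b. Q a \<longrightarrow> Q b \<longrightarrow> Q (star a b)" "\<forall>c a. Q a \<longrightarrow> Q (ascale c a)"
        "\<forall>v. Q (avec v)" "\<forall>g\<in>carrier G. Q (uG g)"
    proof -
      \<comment> \<open>Polynomials at the identity come first, by induction on their generation;
        then single summands, since \<open>s g\<close> is the product of \<open>s\<close> and the
        group element; then finite sums.\<close>
      have s: "Q (Poly_Mapping.single \<one> s)" if "s \<in> S" for s
        using that
      proof (induction rule: Sym.induct)
        case (const c)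
        have "Poly_Mapping.single \<one> (sconst c) = ascale c eA"
          by (rule poly_mapping_eqI) (simp add: ascale_lookup lookup_single when_def)
        then show ?case using q(3,5) by simp
      next
        case (vec v)
        then show ?case using q(4) by (simp add: avec_def)
      next
        case (add s t)
        then show ?case using q(1) by (simp add: single_add)
      next
        case (mult s t)
        then have "Poly_Mapping.single \<one> (s * t) = star (Poly_Mapping.single \<one> s) (Poly_Mapping.single \<one> t)"
          by (simp add: star_single rS_id act_id)
        then show ?case using q(2) mult by simp
      qed
      have "Q (Poly_Mapping.single g (rS s))" if "g \<in> carrier G" for g s
      proof -
        have "Poly_Mapping.single g (rS s) = star (Poly_Mapping.single \<one> (rS s)) (uG g)"
          using that by (simp add: star_single)
        then show ?thesis using q(2,5) s that by simp
      qed
      moreover have "Q 0" using q(3,4) av.scale_zero_left by metis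
      ultimately have "Q (\<Sum>g\<in>I. Poly_Mapping.single g (rS (Poly_Mapping.lookup a g)))" if "I \<subseteq> carrier G" for I
        using that q(1) by (induction I rule: infinite_finite_induct) auto
      then show ?thesis unfolding star_e amap_def by simp
    qed
    assume g: "g \<in> carrier G"
    show "\<rho> g (v + w) = \<rho> g v + \<rho> g w" "\<rho> g (scale c v) = scale c (\<rho> g v)" by (rule rho_linear[OF g])+
    show "star (uG g) (avec v) = star (avec (\<rho> g v)) (uG g)"
      using g by (simp add: avec_def star_single rS_id act_vec)
    assume h: "h \<in> carrier G"
    show "star (uG g) (uG h) = uG (g \<otimes> h)" using g h by (simp add: star_single)
    show "\<rho> g (\<rho> h v) = \<rho> (g \<otimes> h) v" by (rule rho_rho[OF g h])
  qed
qed

section \<open>The defined complexes and brackets as instances of the abstract ones\<close>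

lemma ascale_one: "ascale 1 x = x" and ascale_minus_one: "ascale (-1) x = - x"
  by (rule poly_mapping_eqI, simp add: ascale_lookup sconst_uminus)+

lemma ascale_sign: "ascale ((-1) ^ k) x = sg k x"
  by (cases "even k") (simp_all add: sg_def ascale_one ascale_minus_one)

lemma ascale_sign_perm: "ascale (of_int (sign \<pi>)) x = sgi (sign \<pi>) x"
  by (cases \<pi> rule: sign_cases) (simp_all add: sgi_def ascale_one ascale_minus_one)

lemma A_eq: "K.A = skew_algebra"
proof (intro equalityI subsetI)
  fix a assume "a \<in> K.A"
  then have "a = amap rS a" by (simp add: K.A_def star_e)
  then show "a \<in> skew_algebra" using amap_skew_algebra[of rS a] by simp
qed (simp add: K.A_def star_e amap_rS_id)

lemma avec_skew [simp]: "avec v \<in> skew_algebra"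
  by (rule skew_algebraI) (auto simp: avec_def lookup_single when_def Sym_zero)

lemma star_skew [simp]: "star a b \<in> skew_algebra"
  by (rule skew_algebraI) (auto simp: lookup_star intro!: Sym_sum Sym.mult Sym_zero)

lemma skew_zero [simp]: "0 \<in> skew_algebra"
  using K.A.M_zero by (simp add: A_eq)

lemma multilinear_on_UNIV: "(\<forall>p. multilinear_on UNIV scale ascale p F) \<longleftrightarrow> multilin scale ascale F"
proof
  assume *: "\<forall>p. multilinear_on UNIV scale ascale p F"
  show "multilin scale ascale F"
    unfolding multilin_def
  proof (intro conjI allI)
    fix as bs :: "'v list" and x y c
    from *[THEN spec, of "length (as @ x # bs)", unfolded multilinear_on_def, THEN spec, of "as @ x # bs", THEN spec, of "length as"]
    have m: "F ((as @ x # bs)[length as := u + w]) = F ((as @ x # bs)[length as := u]) + F ((as @ x # bs)[length as := w])"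
      "F ((as @ x # bs)[length as := scale c u]) = ascale c (F ((as @ x # bs)[length as := u]))" for u w c
      by auto
    show "F (as @ (x + y) # bs) = F (as @ x # bs) + F (as @ y # bs)" using m(1)[of x y] by simp
    show "F (as @ scale c x # bs) = ascale c (F (as @ x # bs))" using m(2)[of c x] by simp
  qed
next
  assume "multilin scale ascale F"
  then show "\<forall>p. multilinear_on UNIV scale ascale p F"
    by (auto simp: multilinear_on_def upd_conv_take_nth_drop multilin_def)
qed

text \<open>\<open>Koszul\<close> forbids equal arguments at any two places, \<open>kcoch\<close> at
  neighbouring ones only. Exchanging neighbours changes the sign, so equal arguments can be brought
  together.\<close>

lemma Koszul_eq: "Koszul = K.A.kcoch"
proof (intro equalityI subsetI)
  fix F assume F: "F \<in> Koszul"
  have "F (as @ v # v # bs) = 0" for as v bs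
  proof -
    have "length as < Suc (length as)" "Suc (length as) < length (as @ v # v # bs)"
      "(as @ v # v # bs) ! length as = (as @ v # v # bs) ! Suc (length as)"
      by (simp_all add: nth_append)
    then show ?thesis using F unfolding Koszul_def by blast
  qed
  then show "F \<in> K.A.kcoch"
    unfolding K.A.kcoch_def unfolding A_eq using F multilinear_on_UNIV[of F] by (auto simp: Koszul_def)
next
  fix F assume F: "F \<in> K.A.kcoch"
  have sw: "F (as @ v # w # bs) = - F (as @ w # v # bs)" for as v w bs
  proof -
    have "(\<lambda>ws. F (as @ ws)) \<in> K.A.kcoch" for as
      by (induction as) (use F K.A.kcochD(5) in \<open>auto simp: K.A.kcoch_def multilin_def\<close>, (metis append.assoc)+)
    from K.A.kcoch_swap[OF this] show ?thesis .
  qed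
  have z: "F (as @ v # mid @ v # bs) = 0" for as v mid bs
  proof (induction mid arbitrary: as)
    case Nil
    then show ?case using K.A.kcochD(3)[OF F] by simp
  next
    case (Cons m mid)
    show ?case using sw[of as v m] Cons[of "as @ [m]"] by simp
  qed
  have "F vs = 0" if "i < j" "j < length vs" "vs ! i = vs ! j" for vs i j
  proof -
    have "vs = take i vs @ vs ! i # take (j - Suc i) (drop (Suc i) vs) @ vs ! j # drop (Suc j) vs"
      using that id_take_nth_drop[of i vs] id_take_nth_drop[of "j - Suc i" "drop (Suc i) vs"] by simp
    then show ?thesis using z that(3) by metis
  qed
  then show "F \<in> Koszul"
    using F unfolding K.A.kcoch_def unfolding A_eq using multilinear_on_UNIV[of F] by (auto simp: Koszul_def)
qed

lemma koszul_d_eq: "(\<And>ws. F ws \<in> skew_algebra) \<Longrightarrow> koszul_d F vs = K.A.kd F vs"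
proof (induction vs arbitrary: F)
  case Nil
  then show ?case by (simp add: koszul_d_def)
next
  case (Cons v vs)
  have "koszul_d F (v # vs) = (avec v \<bullet> F vs - F vs \<bullet> avec v) - koszul_d (\<lambda>ws. F (v # ws)) vs"
    unfolding koszul_d_def by (simp add: sum.lessThan_Suc_shift sum_negf Let_def del: sum.lessThan_Suc)
  then show ?case using Cons by (simp add: K.A.ad_def amult_star)
qed

text \<open>
  Extending a bar cochain by zero to all lists makes the cochain identities hold for arbitrary arguments.
\<close>

definition tot :: "nat \<Rightarrow> (('g, 'v) skew list \<Rightarrow> ('g, 'v) skew) \<Rightarrow> ('g, 'v) skew list \<Rightarrow> ('g, 'v) skew"
  where "tot p f l = (if length l = p then f (map (amap rS) l) else 0)"

lemma tot_supported: "supported p (tot p f)"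
  by (simp add: supported_def tot_def)

lemma map_amap_id: "set l \<subseteq> skew_algebra \<Longrightarrow> map (amap rS) l = l"
  by (induction l) (simp_all add: amap_rS_id)

lemma tot_eq: "set l \<subseteq> skew_algebra \<Longrightarrow> length l = p \<Longrightarrow> tot p f l = f l"
  by (simp add: tot_def map_amap_id)

lemma amap_linear: "amap rS (a + b) = amap rS a + amap rS b" "amap rS (ascale c a) = ascale c (amap rS a)" "amap rS (star eA a) = amap rS a"
  "amap rS a \<in> skew_algebra"
  by (rule poly_mapping_eqI, simp add: lookup_amap lookup_add rS_add ascale_lookup rS_sconst_mult star_e)+
    (rule amap_skew_algebra, simp)

lemma tot_hcoch:
  assumes f: "bar_cochain p f" shows "tot p f \<in> K.A.hcoch"
proof -
  have s: "set (map (amap rS) l) \<subseteq> skew_algebra" for l by (auto simp: amap_linear)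
  have "tot p f l \<in> skew_algebra" for l
    using f s[of l] unfolding bar_cochain_def tot_def by auto
  moreover have "multilin ascale ascale (tot p f)"
    unfolding multilin_def
  proof (intro conjI allI)
    fix as bs :: "('g, 'v) skew list" and x y c
    let ?l = "map (amap rS) (as @ x # bs)"
    have m: "length ?l = p \<Longrightarrow> f (?l[length as := amap rS x + amap rS y]) = f (?l[length as := amap rS x]) + f (?l[length as := amap rS y])"
      "length ?l = p \<Longrightarrow> f (?l[length as := ascale c (amap rS x)]) = ascale c (f (?l[length as := amap rS x]))"
      using f s[of "as @ x # bs"] unfolding bar_cochain_def multilinear_on_def by (auto simp: amap_linear)
    show "tot p f (as @ (x + y) # bs) = tot p f (as @ x # bs) + tot p f (as @ y # bs)"
      using m(1) by (simp add: tot_def amap_linear list_update_append)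
    show "tot p f (as @ ascale c x # bs) = ascale c (tot p f (as @ x # bs))"
      using m(2) by (simp add: tot_def amap_linear list_update_append)
  qed
  ultimately show ?thesis unfolding K.A.hcoch_def unfolding A_eq by (simp add: tot_def amap_linear)
qed

lemma hcoch_map: 
  assumes "h \<in> K.A.hcoch" shows "h (map (amap rS) l) = h l"
proof -
  have "h (pre @ map (amap rS) l) = h (pre @ l)" for pre
  proof (induction l arbitrary: pre)
    case (Cons a l)
    have "h (pre @ map (amap rS) (a # l)) = h (pre @ (star eA a) # l)"
      using Cons[of "pre @ [amap rS a]"] by (simp add: star_e)
    then show ?case using K.A.hcochD(3)[OF assms] by simp
  qed simp
  from this[of "[]"] show ?thesis by simp
qed

lemma bar_d_eq:
  assumes f: "bar_cochain p f" and l: "length as = Suc p" "set as \<subseteq> skew_algebra"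
  shows "bar_d p f as = K.A.bd (tot p f) as"
proof -
  have ne: "as \<noteq> []" using l by auto
  have sub: "set (tl as) \<subseteq> skew_algebra" "set (butlast as) \<subseteq> skew_algebra" "hd as \<in> skew_algebra" "last as \<in> skew_algebra"
    using l ne by (auto dest: in_set_butlastD list.set_sel(2))
  have fA: "f m \<in> skew_algebra" if "length m = p" "set m \<subseteq> skew_algebra" for m
    using f that unfolding bar_cochain_def by blast
  have 1: "head_mult star (tot p f) as = hd as \<bullet> f (tl as)"
    using ne sub l fA by (cases as) (auto simp: tot_eq amult_star)
  have 2: "star (tot p f (butlast as)) (last as) = f (butlast as) \<bullet> last as"
    using sub l fA by (simp add: tot_eq amult_star)
  have "circ 2 K.prod2 (tot p f) as = (\<Sum>i<p. sg ((2 + 1) * i) (tot p f (take i as @ [K.prod2 (take 2 (drop i as))] @ drop (i + 2) as)))"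
    by (rule circ_sum) (use l in simp)
  also have "\<dots> = (\<Sum>i<p. sg i (f (take i as @ [as ! i \<bullet> as ! Suc i] @ drop (i + 2) as)))"
  proof (intro sum.cong refl)
    fix i assume "i \<in> {..<p}"
    then have i: "i < p" by simp
    have m: "as ! i \<in> skew_algebra" "as ! Suc i \<in> skew_algebra" using l i by (auto simp: subset_iff)
    have "K.prod2 (take 2 (drop i as)) = as ! i \<bullet> as ! Suc i"
      using i l m by (simp add: K.prod2_def amult_star)
    moreover have "set (take i as @ [as ! i \<bullet> as ! Suc i] @ drop (i + 2) as) \<subseteq> skew_algebra"
      using l(2) m set_take_subset[of i as] set_drop_subset[of "i + 2" as] by (auto simp: amult_star)
    moreover have "length (take i as @ [as ! i \<bullet> as ! Suc i] @ drop (i + 2) as) = p"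
      using l i by simp
    ultimately show "sg ((2 + 1) * i) (tot p f (take i as @ [K.prod2 (take 2 (drop i as))] @ drop (i + 2) as)) = 
      sg i (f (take i as @ [as ! i \<bullet> as ! Suc i] @ drop (i + 2) as))"
      by (simp only: tot_eq) (simp add: sg_def)
  qed
  finally have 3: "circ 2 K.prod2 (tot p f) as = \<dots>" .
  have 4: "(\<Sum>i<p. sg (Suc i) (h i)) = - (\<Sum>i<p. sg i (h i))" for h :: "nat \<Rightarrow> ('g, 'v) skew"
    by (simp add: sum_negf[symmetric] sg_def) (intro sum.cong refl, simp)
  show ?thesis
    unfolding bdiff_def K.tail_diff_circ 1 2 3 bar_d_def ascale_sign 4 using ne l by simp
qed

lemma bar_cocycle_bd:
  assumes "bar_cocycle p f" shows "K.A.bd (tot p f) l = 0"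
proof (cases "length l = Suc p")
  case True
  have c: "bar_cochain p f" using assms by (simp add: bar_cocycle_def)
  have "K.A.bd (tot p f) l = K.A.bd (tot p f) (map (amap rS) l)"
    by (rule hcoch_map[OF K.A.bd_hcoch[OF tot_hcoch[OF c]], symmetric])
  also have "\<dots> = bar_d p f (map (amap rS) l)"
    by (rule bar_d_eq[OF c, symmetric]) (use True in \<open>auto simp: amap_linear\<close>)
  also have "\<dots> = 0"
    using assms True amap_linear(4) unfolding bar_cocycle_def by (simp add: image_subset_iff)
  finally show ?thesis .
next
  case False
  then show ?thesis by (rule K.A.bd_zero_degree[rotated]) (simp add: tot_def)
qed

lemma bar_cocycleI:
  assumes h: "h \<in> K.A.hcoch" and s: "supported p h" and d: "\<And>l. K.A.bd h l = 0"
  shows "bar_cocycle p h" "tot p h = h"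
proof -
  show t: "tot p h = h"
    using s by (auto simp: fun_eq_iff tot_def hcoch_map[OF h] supported_def)
  have c: "bar_cochain p h"
    using K.A.hcochD(1,2)[OF h] unfolding A_eq
    by (auto simp: bar_cochain_def multilinear_on_def upd_conv_take_nth_drop multilin_def)
  show "bar_cocycle p h"
    unfolding bar_cocycle_def using c d bar_d_eq[OF c] t by auto
qed

lemma circle_product_eq:
  assumes f: "bar_cochain p f" and f': "bar_cochain q f'" and l: "length as + 1 = p + q" "set as \<subseteq> skew_algebra"
  shows "circle_product p q f f' as = circ q (tot q f') (tot p f) as"
proof -
  have "tot p f (take i as @ [tot q f' (take q (drop i as))] @ drop (i + q) as) = f (take i as @ [f' (take q (drop i as))] @ drop (i + q) as)"
    if i: "i < p" for i
  proof -
    have s: "set (take q (drop i as)) \<subseteq> skew_algebra" "set (take i as) \<subseteq> skew_algebra" "set (drop (i + q) as) \<subseteq> skew_algebra"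
      using l(2) by (meson order_trans set_take_subset set_drop_subset)+
    have len: "length (take q (drop i as)) = q" using i l(1) by simp
    have "f' (take q (drop i as)) \<in> skew_algebra" using f' s(1) len unfolding bar_cochain_def by blast
    then show ?thesis using s len i l(1) by (subst tot_eq) (auto simp: tot_eq)
  qed
  then show ?thesis
    unfolding circle_product_def circ_sum[OF l(1)] ascale_sign by (intro sum.cong refl) simp
qed

lemma bar_bracket_eq:
  assumes f: "bar_cochain p f" and f': "bar_cochain q f'" and l: "length as + 1 = p + q" "set as \<subseteq> skew_algebra"
  shows "bar_bracket p q f f' as = brk p q (tot p f) (tot q f') as"
proof -
  have "length as + 1 = q + p" using l(1) by simp
  then show ?thesis
    by (simp only: bar_bracket_def brk_def ascale_sign circle_product_eq[OF f f' l] circle_product_eq[OF f' f _ l(2)])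
qed

text \<open>Here \<open>h\<close> will be the extension by zero of a cochain, or a bracket of such
  extensions; it agrees with \<open>f\<close> on algebra elements, and vectors are such
  elements.\<close>

lemma to_koszul_eq: 
  assumes "\<And>m. length m = p \<Longrightarrow> set m \<subseteq> range avec \<Longrightarrow> f m = h m" and "supported p h"
  shows "to_koszul p f vs = alternate avec h vs"
proof (cases "length vs = p")
  case True
  have "f (map (\<lambda>i. avec (vs ! \<pi> i)) [0..<p]) = h (map (\<lambda>i. avec (vs ! \<pi> i)) [0..<p])" for \<pi>
    by (rule assms(1)) auto
  then show ?thesis
    by (simp add: to_koszul_def True alternate_permutations ascale_sign_perm)
next
  case False
  have "alternate avec h vs = alternate avec (\<lambda>m. 0) vs"
    by (rule alternate_cong) (use False assms(2) in \<open>simp add: supported_def\<close>)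
  then show ?thesis using False by (simp add: to_koszul_def)
qed

lemma to_koszul_tot: "to_koszul p f vs = K.A.alt (tot p f) vs"
proof (rule to_koszul_eq)
  show "f m = tot p f m" if "length m = p" "set m \<subseteq> range avec" for m
    by (rule tot_eq[symmetric]) (use that in auto)
qed (rule tot_supported)

lemma to_koszul_bracket:
  assumes "bar_cochain p f" "bar_cochain q f'" "0 < p + q"
  shows "to_koszul (p + q - 1) (bar_bracket p q f f') vs = K.A.alt (brk p q (tot p f) (tot q f')) vs"
proof (rule to_koszul_eq)
  show "bar_bracket p q f f' m = brk p q (tot p f) (tot q f') m" if "length m = p + q - 1" "set m \<subseteq> range avec" for m
    by (rule bar_bracket_eq) (use assms that in auto)
  show "supported (p + q - 1) (brk p q (tot p f) (tot q f'))"
    unfolding supported_def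
  proof (intro allI impI)
    fix m :: "('g, 'v) skew list" assume "length m \<noteq> p + q - 1"
    then have n: "length m + 1 \<noteq> p + q" "length m + 1 \<noteq> q + p" using assms(3) by auto
    show "brk p q (tot p f) (tot q f') m = 0"
      using circ_degree[OF tot_supported n(1)] circ_degree[OF tot_supported n(2)] by (simp add: brk_def)
  qed
qed

subsection \<open>Koszul cohomology of one group component\<close>

lemma subspace_fixed: "g \<in> carrier G \<Longrightarrow> subspace (fixed g)"
  by (rule subspaceI) (simp_all add: fixed_def rho_linear)

lemma subspace_fixed_perp: 
  assumes g: "g \<in> carrier G" shows "subspace (fixed_perp g)"
proof (rule subspaceI)
  show "0 \<in> fixed_perp g" unfolding fixed_perp_def by (rule range_eqI[of _ _ 0]) (simp add: rho_linear g)
next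
  fix x y assume "x \<in> fixed_perp g" "y \<in> fixed_perp g"
  then obtain v w where "x = v - \<rho> g v" "y = w - \<rho> g w" by (auto simp: fixed_perp_def)
  then show "x + y \<in> fixed_perp g" unfolding fixed_perp_def by (intro range_eqI[of _ _ "v + w"]) (simp add: rho_linear g)
next
  fix c x assume "x \<in> fixed_perp g"
  then obtain v where "x = v - \<rho> g v" by (auto simp: fixed_perp_def)
  then show "scale c x \<in> fixed_perp g" unfolding fixed_perp_def 
    by (intro range_eqI[of _ _ "scale c v"]) (simp add: rho_linear g scale_right_diff_distrib)
qed

context
  fixes g assumes g: "g \<in> carrier G"
begin

text \<open>The exponents run up to the order of the whole group. By Lagrange they pass through the
  cyclic group generated by \<open>g\<close> a whole number of times, so the average is the
  projection onto \<open>fixed g\<close>.\<close>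

definition mean :: "'v \<Rightarrow> 'v"
  where "mean v = scale (1 / of_nat (order G)) (\<Sum>i<order G. \<rho> (g [^] i) v)"

definition proj :: "'v \<Rightarrow> 'v"
  where "proj v = v - mean v"

lemma order_nonzero: "of_nat (order G) \<noteq> (0::complex)"
  using grp.order_gt_0_iff_finite finite_carrier by simp

lemma pow_carrier [simp]: "g [^] (i::nat) \<in> carrier G"
  using g by simp

lemma mean_linear: "mean (v + w) = mean v + mean w" "mean (scale c v) = scale c (mean v)" "mean (v - w) = mean v - mean w"
  by (simp_all add: mean_def rho_linear sum.distrib scale_right_distrib scale_right_diff_distrib sum_subtractf scale_sum_right mult.commute)

lemma proj_linear: "proj (v + w) = proj v + proj w" "proj (scale c v) = scale c (proj v)" "proj (v - w) = proj v - proj w"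
  by (simp_all add: proj_def mean_linear scale_right_diff_distrib)

lemma rho_pow_Suc: "\<rho> g (\<rho> (g [^] i) v) = \<rho> (g [^] Suc i) v"
  using g rho_rho[OF g pow_carrier] by (metis grp.nat_pow_Suc2)

lemma mean_fixed: "mean v \<in> fixed g"
proof -
  have "\<rho> g (\<Sum>i<order G. \<rho> (g [^] i) v) = (\<Sum>i<order G. \<rho> (g [^] Suc i) v)"
    by (simp add: rho_linear(5)[OF g] rho_pow_Suc del: grp.nat_pow_Suc)
  \<comment> \<open>Shifting the exponent by one exchanges the first power for the last, and these
    agree because \<open>g\<close> to the order of the group is 1.\<close>
  also have "\<dots> = (\<Sum>i<order G. \<rho> (g [^] i) v)"
    using sum.lessThan_Suc[of "\<lambda>i. \<rho> (g [^] i) v" "order G"] sum.lessThan_Suc_shift[of "\<lambda>i. \<rho> (g [^] i) v" "order G"]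
      grp.pow_order_eq_1[OF g] by (simp add: rho_one' del: grp.nat_pow_Suc)
  finally show ?thesis by (simp add: fixed_def mean_def rho_linear g)
qed

lemma mean_id: "v \<in> fixed g \<Longrightarrow> mean v = v"
proof -
  assume v: "v \<in> fixed g"
  have "\<rho> (g [^] i) v = v" for i :: nat
  proof (induction i)
    case (Suc i)
    then show ?case using rho_pow_Suc[of i v] v by (simp add: fixed_def del: grp.nat_pow_Suc)
  qed (simp add: rho_one')
  moreover have "(\<Sum>i<order G. v) = scale (of_nat (order G)) v"
    by (simp only: sum_constant_scale card_lessThan)
  ultimately show ?thesis using order_nonzero by (simp add: mean_def)
qed

lemma mean_perp: "v \<in> fixed_perp g \<Longrightarrow> mean v = 0"
proof -
  assume "v \<in> fixed_perp g"
  then obtain w where w: "v = w - \<rho> g w" by (auto simp: fixed_perp_def)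
  have "mean (\<rho> g w) = mean w"
  proof -
    have "\<rho> (g [^] i) (\<rho> g w) = \<rho> (g [^] Suc i) w" for i :: nat
      using rho_rho[OF pow_carrier g] by simp
    then have "(\<Sum>i<order G. \<rho> (g [^] i) (\<rho> g w)) = (\<Sum>i<order G. \<rho> (g [^] Suc i) w)" by simp
    also have "\<dots> = (\<Sum>i<order G. \<rho> (g [^] i) w)"
      using sum.lessThan_Suc[of "\<lambda>i. \<rho> (g [^] i) w" "order G"] sum.lessThan_Suc_shift[of "\<lambda>i. \<rho> (g [^] i) w" "order G"]
        grp.pow_order_eq_1[OF g] by (simp add: rho_one' del: grp.nat_pow_Suc)
    finally show ?thesis by (simp add: mean_def)
  qed
  then show ?thesis by (simp add: w mean_linear)
qed

text \<open>Each \<open>v - g^i v\<close> telescopes into elements of the image of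
  \<open>1 - g\<close>, and \<open>proj v\<close> is the average of these differences.\<close>

lemma proj_perp: "proj v \<in> fixed_perp g"
proof -
  have "v - \<rho> (g [^] i) v \<in> fixed_perp g" for i :: nat
  proof (induction i)
    case 0
    show ?case using subspace_0[OF subspace_fixed_perp[OF g]] by (simp add: rho_one')
  next
    case (Suc i)
    have "\<rho> (g [^] i) v - \<rho> (g [^] Suc i) v \<in> fixed_perp g"
      unfolding fixed_perp_def by (rule range_eqI[of _ _ "\<rho> (g [^] i) v"]) (simp add: rho_pow_Suc del: grp.nat_pow_Suc)
    from subspace_add[OF subspace_fixed_perp[OF g] Suc this] show ?case by (simp del: grp.nat_pow_Suc)
  qed
  then have "scale (1 / of_nat (order G)) (\<Sum>i<order G. v - \<rho> (g [^] i) v) \<in> fixed_perp g"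
    by (intro subspace_scale subspace_sum subspace_fixed_perp[OF g])
  moreover have "(\<Sum>i<order G. v) = scale (of_nat (order G)) v"
    by (simp only: sum_constant_scale card_lessThan)
  ultimately show ?thesis
    using order_nonzero by (simp add: proj_def mean_def sum_subtractf scale_right_diff_distrib)
qed

lemma proj_fixed: "v \<in> fixed g \<Longrightarrow> proj v = 0" and proj_id: "v \<in> fixed_perp g \<Longrightarrow> proj v = v"
  by (simp_all add: proj_def mean_id mean_perp)

lemma diff_proj_fixed: "v - proj v \<in> fixed g"
  by (simp add: proj_def mean_fixed)

lemma fixed_Int_perp: "v \<in> fixed g \<Longrightarrow> v \<in> fixed_perp g \<Longrightarrow> v = 0"
  using proj_fixed proj_id by metis

section \<open>A basis adapted to the fixed space, partial derivatives and the grading\<close>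

definition "B1 = (SOME B. B \<subseteq> fixed g \<and> independent B \<and> fixed g \<subseteq> span B \<and> card B = dim (fixed g))"

definition "B2 = (SOME B. B \<subseteq> fixed_perp g \<and> independent B \<and> fixed_perp g \<subseteq> span B \<and> card B = dim (fixed_perp g))"

lemma B1: "B1 \<subseteq> fixed g" "independent B1" "span B1 = fixed g" "finite B1"
proof -
  have "B1 \<subseteq> fixed g \<and> independent B1 \<and> fixed g \<subseteq> span B1 \<and> card B1 = dim (fixed g)"
    unfolding B1_def by (rule someI_ex) (metis basis_exists)
  then show "B1 \<subseteq> fixed g" "independent B1" "span B1 = fixed g" "finite B1"
    using span_minimal[OF _ subspace_fixed[OF g]] finiteI_independent by auto
qed

lemma B2: "B2 \<subseteq> fixed_perp g" "independent B2" "span B2 = fixed_perp g" "finite B2" "card B2 = dim (fixed_perp g)"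
proof -
  have "B2 \<subseteq> fixed_perp g \<and> independent B2 \<and> fixed_perp g \<subseteq> span B2 \<and> card B2 = dim (fixed_perp g)"
    unfolding B2_def by (rule someI_ex) (metis basis_exists)
  then show "B2 \<subseteq> fixed_perp g" "independent B2" "span B2 = fixed_perp g" "finite B2" "card B2 = dim (fixed_perp g)"
    using span_minimal[OF _ subspace_fixed_perp[OF g]] finiteI_independent by auto
qed

lemma B_disjoint: "j \<in> B1 \<Longrightarrow> j \<in> B2 \<Longrightarrow> False"
  using fixed_Int_perp B1 B2 dependent_zero[of B1] by blast

lemma card_B2: "card B2 = codim_fixed g"
proof -
  have "{x + y |x y. x \<in> fixed g \<and> y \<in> fixed_perp g} = UNIV"
  proof -
    have "\<exists>x y. v = x + y \<and> x \<in> fixed g \<and> y \<in> fixed_perp g" for v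
      using diff_proj_fixed[of v] proj_perp[of v] by (intro exI[of _ "v - proj v"] exI[of _ "proj v"]) simp
    then show ?thesis by blast
  qed
  moreover have "fixed g \<inter> fixed_perp g = {0}"
    using fixed_Int_perp subspace_0[OF subspace_fixed[OF g]] subspace_0[OF subspace_fixed_perp[OF g]] by auto
  ultimately have "dim (UNIV :: 'v set) + dim {0::'v} = dim (fixed g) + dim (fixed_perp g)"
    using dim_sums_Int[OF subspace_fixed[OF g] subspace_fixed_perp[OF g]] by simp
  then show ?thesis using B2(5) by (simp add: codim_fixed_def)
qed

definition co :: "'v \<Rightarrow> 'v \<Rightarrow> complex"
  where "co j v = (if j \<in> B1 then representation B1 (v - proj v) j else representation B2 (proj v) j)"

lemma co_linear: "co j (v + w) = co j v + co j w" "co j (scale c v) = c * co j v" "co j 0 = 0"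
proof -
  have *: "v - proj v \<in> span B1" "proj v \<in> span B2" for v
    using diff_proj_fixed proj_perp B1(3) B2(3) by auto
  show a: "co j (v + w) = co j v + co j w"
    using representation_add[OF B1(2) *(1)[of v] *(1)[of w]] representation_add[OF B2(2) *(2)[of v] *(2)[of w]]
    by (simp add: co_def proj_linear algebra_simps)
  show s: "co j (scale c v) = c * co j v" for c v
    using representation_scale[OF B1(2) *(1)[of v], of c] representation_scale[OF B2(2) *(2)[of v], of c]
    by (simp add: co_def proj_linear scale_right_diff_distrib)
  show "co j 0 = 0" using s[of 0 0] by simp
qed

lemma co_B1_sum: "v \<in> fixed g \<Longrightarrow> (\<Sum>j\<in>B1. scale (co j v) j) = v"
  using sum_representation_eq[OF B1(2), of v B1] B1(3,4) by (simp add: co_def proj_fixed)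

lemma co_B2_sum: "v \<in> fixed_perp g \<Longrightarrow> (\<Sum>j\<in>B2. scale (co j v) j) = v"
proof -
  assume v: "v \<in> fixed_perp g"
  have "(\<Sum>j\<in>B2. scale (co j v) j) = (\<Sum>j\<in>B2. scale (representation B2 v j) j)"
    using B_disjoint by (intro sum.cong refl) (auto simp: co_def proj_id[OF v])
  also have "\<dots> = v" by (rule sum_representation_eq[OF B2(2)]) (use v B2 in auto)
  finally show ?thesis .
qed

lemma co_fixed: "v \<in> fixed g \<Longrightarrow> j \<in> B2 \<Longrightarrow> co j v = 0"
  using B_disjoint by (auto simp: co_def proj_fixed representation_zero)

lemma co_perp: "v \<in> fixed_perp g \<Longrightarrow> j \<in> B1 \<Longrightarrow> co j v = 0"
  by (auto simp: co_def proj_id representation_zero)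

abbreviation "BB \<equiv> B1 \<union> B2"

lemma co_sum: "(\<Sum>j\<in>BB. scale (co j v) j) = v"
proof -
  have "(\<Sum>j\<in>BB. scale (co j v) j) = (\<Sum>j\<in>B1. scale (co j v) j) + (\<Sum>j\<in>B2. scale (co j v) j)"
    by (rule sum.union_disjoint) (use B1(4) B2(4) B_disjoint in auto)
  also have "(\<Sum>j\<in>B1. scale (co j v) j) = (\<Sum>j\<in>B1. scale (co j (v - proj v)) j)"
    using co_linear(1)[of _ "v - proj v" "proj v"] by (intro sum.cong refl) (simp add: co_perp proj_perp)
  also have "\<dots> = v - proj v" by (rule co_B1_sum[OF diff_proj_fixed])
  also have "(\<Sum>j\<in>B2. scale (co j v) j) = (\<Sum>j\<in>B2. scale (co j (proj v)) j)"
    using co_linear(1)[of _ "v - proj v" "proj v"] by (intro sum.cong refl) (simp add: co_fixed diff_proj_fixed)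
  also have "\<dots> = proj v" by (rule co_B2_sum[OF proj_perp])
  finally show ?thesis by simp
qed

text \<open>Differentiation along the basis \<open>BB\<close>, obtained by the chain rule from the
  indeterminates in \<open>Basis\<close>.\<close>

definition pd :: "'v \<Rightarrow> 'v sym \<Rightarrow> 'v sym"
  where "pd j s = (\<Sum>b\<in>Basis. sconst (co j b) * deriv b s)"

lemma pd_add: "pd j (s + t) = pd j s + pd j t" and pd_zero [simp]: "pd j 0 = 0" and pd_sconst [simp]: "pd j (sconst c) = 0"
  by (simp_all add: pd_def deriv_add sum.distrib algebra_simps)

lemma pd_sconst_mult: "pd j (sconst c * s) = sconst c * pd j s"
  by (simp add: pd_def deriv_sconst_mult sum_distrib_left mult.left_commute)

lemma pd_diff: "pd j (s - t) = pd j s - pd j t"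
  using pd_add[of j "s - t" t] by (simp add: algebra_simps)

lemma pd_mult: "pd j (s * t) = pd j s * t + s * pd j t"
  by (simp add: pd_def deriv_mult sum_distrib_left sum_distrib_right sum.distrib algebra_simps)

lemma pd_vec: "pd j (vec v) = sconst (co j v)"
proof -
  have "pd j (vec v) = (\<Sum>b\<in>Basis. sconst (representation Basis v b * co j b))"
    by (simp add: pd_def deriv_vec sconst_mult mult.commute)
  also have "\<dots> = sconst (co j (\<Sum>b\<in>K. scale (representation Basis v b) b))" if "K = Basis" for K
  proof -
    have "(\<Sum>b\<in>K. sconst (representation Basis v b * co j b)) = sconst (co j (\<Sum>b\<in>K. scale (representation Basis v b) b))" for K
      by (induction K rule: infinite_finite_induct) (simp_all add: co_linear sconst_add)
    then show ?thesis using that by simp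
  qed
  finally show ?thesis by (simp add: rep_sum)
qed

lemma pd_S: "s \<in> S \<Longrightarrow> pd j s \<in> S"
  unfolding pd_def by (intro Sym_sum Sym.mult) (simp_all add: deriv_S)

text \<open>The Euler operator in the directions of \<open>fixed_perp g\<close> only. It is the
  derivation that extends \<open>proj\<close>, by \<open>euler_vec\<close>.\<close>

definition euler :: "'v sym \<Rightarrow> 'v sym"
  where "euler s = (\<Sum>j\<in>B2. vec j * pd j s)"

lemma euler_add: "euler (s + t) = euler s + euler t" and euler_zero [simp]: "euler 0 = 0" and euler_sconst [simp]: "euler (sconst c) = 0"
  by (simp_all add: euler_def pd_add sum.distrib algebra_simps)

lemma euler_sconst_mult: "euler (sconst c * s) = sconst c * euler s"
  by (simp add: euler_def pd_sconst_mult sum_distrib_left mult.left_commute)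

lemma euler_sum: "euler (sum f I) = (\<Sum>i\<in>I. euler (f i))"
  by (induction I rule: infinite_finite_induct) (simp_all add: euler_add)

lemma euler_mult: "euler (s * t) = euler s * t + s * euler t"
  by (simp add: euler_def pd_mult sum_distrib_left sum_distrib_right sum.distrib algebra_simps)

lemma euler_vec: "euler (vec v) = vec (proj v)"
proof -
  have "euler (vec v) = vec (\<Sum>j\<in>B2. scale (co j v) j)"
    by (simp add: euler_def pd_vec vec_sum vec_scale mult.commute)
  also have "(\<Sum>j\<in>B2. scale (co j v) j) = (\<Sum>j\<in>B2. scale (co j (proj v)) j)"
    using co_linear(1)[of _ "v - proj v" "proj v"] by (intro sum.cong refl) (simp add: co_fixed diff_proj_fixed)
  also have "\<dots> = proj v" by (rule co_B2_sum[OF proj_perp])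
  finally show ?thesis .
qed

lemma euler_Sym_fixed: "s \<in> Sym (fixed g) \<Longrightarrow> euler s = 0"
  by (induction rule: Sym.induct) (simp_all add: euler_add euler_mult euler_vec proj_fixed)

lemma sconst_cancel: 
  assumes "sconst c * s = 0" "c \<noteq> 0" shows "s = 0"
proof -
  have "s = sconst (inverse c * c) * s" using assms(2) by simp
  also have "\<dots> = sconst (inverse c) * (sconst c * s)" by (simp only: sconst_mult mult.assoc)
  finally show ?thesis using assms(1) by simp
qed

text \<open>Applying the operator minus the top eigenvalue removes the last summand and multiplies
  the others by nonzero scalars.\<close>

lemma eigenvectors_independent:
  assumes "\<And>n. n \<le> N \<Longrightarrow> euler (x n) = sconst (of_nat n) * x n" "(\<Sum>n\<le>N. x n) = 0" "n \<le> N"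
  shows "x n = 0"
  using assms
proof (induction N arbitrary: x n)
  case (Suc N)
  let ?y = "\<lambda>n. sconst (of_nat n - of_nat (Suc N)) * x n"
  have y: "?y n = 0" if "n \<le> N" for n
  proof (rule Suc.IH[OF _ _ that])
    show "euler (?y n) = sconst (of_nat n) * ?y n" if "n \<le> N" for n
      by (simp only: euler_sconst_mult Suc.prems(1)[OF le_SucI[OF that]] mult.left_commute)
    have "(\<Sum>n\<le>Suc N. sconst (of_nat n) * x n) = euler (\<Sum>n\<le>Suc N. x n)"
      using Suc.prems(1) by (simp add: euler_sum del: sum.atMost_Suc)
    also have "\<dots> = 0" using Suc.prems(2) by simp
    finally have "(\<Sum>n\<le>Suc N. sconst (of_nat n) * x n) - sconst (of_nat (Suc N)) * (\<Sum>n\<le>Suc N. x n) = 0"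
      using Suc.prems(2) by (simp del: sum.atMost_Suc)
    then have "(\<Sum>n\<le>Suc N. ?y n) = 0"
      by (simp add: sum_distrib_left sum_subtractf[symmetric] sconst_add[of _ "- _", simplified] sconst_uminus algebra_simps del: sum.atMost_Suc of_nat_Suc)
    then show "(\<Sum>n\<le>N. ?y n) = 0" by simp
  qed
  have z: "x n = 0" if "n \<le> N" for n
    by (rule sconst_cancel[OF y[OF that]]) (use that in \<open>simp del: of_nat_Suc\<close>)
  then have "x (Suc N) = 0" using Suc.prems(2) by simp
  then show ?case using z Suc.prems(3) le_Suc_eq by metis
qed simp

text \<open>
  Decomposition of a polynomial by degree in the directions of \<open>fixed_perp g\<close>, that is into
  eigenvectors of the partial Euler operator.
\<close>

definition graded_sum :: "nat \<Rightarrow> (nat \<Rightarrow> 'v sym) \<Rightarrow> 'v sym \<Rightarrow> bool"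
  where "graded_sum N x s \<longleftrightarrow> s = (\<Sum>n\<le>N. x n) \<and> (\<forall>n. x n \<in> S \<and> euler (x n) = sconst (of_nat n) * x n) \<and>
    x 0 \<in> Sym (fixed g) \<and> (\<forall>n>N. x n = 0)"

lemma graded_sum_mono: "graded_sum N x s \<Longrightarrow> N \<le> N' \<Longrightarrow> graded_sum N' x s"
proof -
  assume "graded_sum N x s" "N \<le> N'"
  moreover from this have "sum x {..N} = sum x {..N'}"
    by (intro sum.mono_neutral_left) (auto simp: graded_sum_def)
  ultimately show ?thesis by (simp add: graded_sum_def)
qed

lemma graded_sum_add: "graded_sum N x s \<Longrightarrow> graded_sum N y t \<Longrightarrow> graded_sum N (\<lambda>n. x n + y n) (s + t)"
  unfolding graded_sum_def by (auto simp: sum.distrib euler_add algebra_simps intro: Sym.add)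

text \<open>The Euler operator is a derivation, so degrees add and the parts of a product are
  convolutions. The part of degree 0 is the product of the parts of degree 0 and stays in
  \<open>Sym (fixed g)\<close>.\<close>

lemma graded_sum_mult: 
  assumes "graded_sum N x s" "graded_sum M y t"
  shows "graded_sum (N + M) (\<lambda>n. \<Sum>i\<le>n. x i * y (n - i)) (s * t)"
proof -
  have x: "s = (\<Sum>n\<le>N. x n)" "\<And>n. x n \<in> S" "\<And>n. euler (x n) = sconst (of_nat n) * x n" "x 0 \<in> Sym (fixed g)" "\<And>n. n > N \<Longrightarrow> x n = 0"
    and y: "t = (\<Sum>n\<le>M. y n)" "\<And>n. y n \<in> S" "\<And>n. euler (y n) = sconst (of_nat n) * y n" "y 0 \<in> Sym (fixed g)" "\<And>n. n > M \<Longrightarrow> y n = 0"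
    using assms by (auto simp: graded_sum_def)
  have "(\<Sum>n\<le>N + M. \<Sum>i\<le>n. x i * y (n - i)) = s * t"
  proof -
    have "s * t = (\<Sum>i\<le>N + M. \<Sum>j\<le>N + M. x i * y j)"
    proof -
      have "s = (\<Sum>n\<le>N + M. x n)" "t = (\<Sum>n\<le>N + M. y n)"
        unfolding x(1) y(1) by (rule sum.mono_neutral_left; use x(5) y(5) in auto)+
      then show ?thesis by (simp add: sum_product)
    qed
    also have "\<dots> = (\<Sum>(i, j)\<in>{..N + M} \<times> {..N + M}. x i * y j)"
      by (rule sum.cartesian_product)
    also have "\<dots> = (\<Sum>(i, j) | i + j \<le> N + M. x i * y j)"
    proof -
      have "x i * y j = 0" if "\<not> i + j \<le> N + M" for i j
        using that x(5)[of i] y(5)[of j] by (cases "i > N") auto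
      then show ?thesis by (intro sum.mono_neutral_right) auto
    qed
    also have "\<dots> = (\<Sum>n\<le>N + M. \<Sum>i\<le>n. x i * y (n - i))"
      by (rule sum.triangle_reindex_eq)
    finally show ?thesis by simp
  qed
  moreover have "euler (\<Sum>i\<le>n. x i * y (n - i)) = sconst (of_nat n) * (\<Sum>i\<le>n. x i * y (n - i))" for n
  proof -
    have "euler (x i * y (n - i)) = sconst (of_nat n) * (x i * y (n - i))" if "i \<le> n" for i
    proof -
      have "(of_nat n :: complex) = of_nat i + of_nat (n - i)" using that by simp
      then have "sconst (of_nat n) = sconst (of_nat i) + (sconst (of_nat (n - i)) :: 'v sym)" by (simp only: sconst_add)
      then show ?thesis by (simp add: euler_mult x(3) y(3) algebra_simps)
    qed
    then show ?thesis by (simp add: euler_sum sum_distrib_left)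
  qed
  moreover have "x i * y (n - i) = 0" if "n > N + M" for n i
    using x(5)[of i] y(5)[of "n - i"] that by (cases "i > N") auto
  moreover have "(\<Sum>i\<le>n. x i * y (n - i)) \<in> S" for n
    by (intro Sym_sum Sym.mult x y)
  ultimately show ?thesis
    unfolding graded_sum_def using x(4) y(4) by (auto intro: Sym.mult)
qed

text \<open>A vector \<open>v\<close> splits into \<open>v - proj v\<close> of degree 0 and
  \<open>proj v\<close> of degree 1; sums and products of vectors inherit a decomposition.\<close>

lemma graded_sum_exists: "s \<in> S \<Longrightarrow> \<exists>N x. graded_sum N x s"
proof (induction rule: Sym.induct)
  case (const c)
  have "graded_sum 0 (\<lambda>n. if n = 0 then sconst c else 0) (sconst c)"
    by (auto simp: graded_sum_def Sym_zero intro: Sym.const)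
  then show ?case by blast
next
  case (vec v)
  have "graded_sum 1 (\<lambda>n. if n = 0 then vec (v - proj v) else if n = 1 then vec (proj v) else 0) (vec v)"
    using diff_proj_fixed proj_perp
    by (auto simp: graded_sum_def Sym_zero euler_vec vec_diff[symmetric] vec_add[symmetric] proj_fixed proj_id intro: Sym.vec)
  then show ?case by blast
next
  case (add s t)
  then obtain N M x y where "graded_sum N x s" "graded_sum M y t" by blast
  then have "graded_sum (max N M) (\<lambda>n. x n + y n) (s + t)"
    by (intro graded_sum_add) (auto intro: graded_sum_mono)
  then show ?case by blast
next
  case (mult s t)
  then show ?case using graded_sum_mult by blast
qed

text \<open>The ideal of \<open>S(V)\<close> generated by \<open>fixed_perp g\<close>, described
  through the grading as the polynomials without a part of degree 0 in these directions.\<close>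

definition perp_ideal :: "'v sym \<Rightarrow> bool"
  where "perp_ideal s \<longleftrightarrow> (\<exists>N x. graded_sum N x s \<and> x 0 = 0)"

lemma perp_ideal_zero: "perp_ideal 0"
  unfolding perp_ideal_def by (intro exI[of _ 0] exI[of _ "\<lambda>_. 0"]) (simp add: graded_sum_def Sym_zero)

lemma perp_ideal_add: "perp_ideal s \<Longrightarrow> perp_ideal t \<Longrightarrow> perp_ideal (s + t)"
proof -
  assume "perp_ideal s" "perp_ideal t"
  then obtain N M x y where *: "graded_sum N x s" "x 0 = 0" "graded_sum M y t" "y 0 = 0" unfolding perp_ideal_def by blast
  have "graded_sum (max N M) (\<lambda>n. x n + y n) (s + t)"
    using * by (intro graded_sum_add) (auto intro: graded_sum_mono)
  then show ?thesis unfolding perp_ideal_def using * by (intro exI[of _ "max N M"] exI[of _ "\<lambda>n. x n + y n"]) simp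
qed

lemma perp_ideal_mult: "perp_ideal s \<Longrightarrow> t \<in> S \<Longrightarrow> perp_ideal (s * t)"
proof -
  assume "perp_ideal s" "t \<in> S"
  then obtain N M x y where *: "graded_sum N x s" "x 0 = 0" "graded_sum M y t" unfolding perp_ideal_def using graded_sum_exists by metis
  from graded_sum_mult[OF this(1,3)] show ?thesis
    unfolding perp_ideal_def using *(2) by (intro exI[of _ "N + M"] exI[of _ "\<lambda>n. \<Sum>i\<le>n. x i * y (n - i)"]) simp
qed

lemma perp_ideal_uminus: "perp_ideal s \<Longrightarrow> perp_ideal (- s)"
  using perp_ideal_mult[of s "sconst (-1)", OF _ sconst_S] by (simp add: sconst_uminus)

lemma perp_ideal_vec: "v \<in> fixed_perp g \<Longrightarrow> perp_ideal (vec v)"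
  unfolding perp_ideal_def
  by (intro exI[of _ 1] exI[of _ "\<lambda>n. if n = 1 then vec v else 0"]) (auto simp: graded_sum_def Sym_zero euler_vec proj_id)

text \<open>The Euler operator kills \<open>Sym (fixed g)\<close>, so by independence of
  eigenvectors every part of positive degree vanishes.\<close>

lemma perp_ideal_Sym_fixed: 
  assumes "perp_ideal s" "s \<in> Sym (fixed g)" shows "s = 0"
proof -
  obtain N x where x: "graded_sum N x s" "x 0 = 0" using assms(1) unfolding perp_ideal_def by blast
  then have e: "\<And>n. euler (x n) = sconst (of_nat n) * x n" and s: "s = (\<Sum>n\<le>N. x n)" by (auto simp: graded_sum_def)
  have "sconst (of_nat n) * x n = 0" if "n \<le> N" for n
  proof (rule eigenvectors_independent[OF _ _ that])
    show "(\<Sum>n\<le>N. sconst (of_nat n) * x n) = 0"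
      using euler_Sym_fixed[OF assms(2)] by (simp add: s euler_sum e)
  qed (simp add: euler_sconst_mult e)
  then have "x n = 0" if "n \<le> N" for n
    using that x(2) sconst_cancel[of "of_nat n" "x n"] by (cases "n = 0") auto
  then show ?thesis by (simp add: s)
qed

end

context
  fixes g assumes g: "g \<in> carrier G"
begin

section \<open>Koszul cochains with coefficients in the component of one group element\<close>

definition kc :: "('v list \<Rightarrow> 'v sym) set"
  where "kc = {\<Phi>. (\<forall>vs. \<Phi> vs \<in> S) \<and> multilin scale (\<lambda>c s. sconst c * s) \<Phi> \<and> (\<forall>as v bs. \<Phi> (as @ v # v # bs) = 0)}"

text \<open>The commutator with \<open>v\<close> on the summand \<open>s g\<close> is multiplication
  of \<open>s\<close> by \<open>v - g v\<close>, because moving \<open>v\<close> to the left across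
  \<open>g\<close> replaces it by its image; see \<open>lookup_ad\<close>.\<close>

definition adg :: "'v \<Rightarrow> 'v sym \<Rightarrow> 'v sym"
  where "adg v s = vec (v - \<rho> g v) * s"

abbreviation "dg \<equiv> kdiff adg"

lemma kc_single: "\<Phi> \<in> kc \<Longrightarrow> (\<lambda>vs. Poly_Mapping.single g (\<Phi> vs)) \<in> K.A.kcoch"
proof -
  assume \<Phi>: "\<Phi> \<in> kc"
  have "Poly_Mapping.single g (sconst c * s) = ascale c (Poly_Mapping.single g s)" for c and s :: "'v sym"
    by (rule poly_mapping_eqI) (simp add: ascale_lookup lookup_single when_def)
  moreover have "Poly_Mapping.single g s \<in> skew_algebra" if "s \<in> S" for s
    by (rule skew_algebraI) (use that g in \<open>auto simp: lookup_single when_def Sym_zero\<close>)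
  ultimately show ?thesis using \<Phi> unfolding K.A.kcoch_def unfolding A_eq
    by (auto simp: kc_def multilin_def single_add)
qed

lemma kc_component: "F \<in> K.A.kcoch \<Longrightarrow> (\<lambda>vs. Poly_Mapping.lookup (F vs) g) \<in> kc"
  unfolding K.A.kcoch_def unfolding A_eq
  by (auto simp: kc_def multilin_def lookup_add ascale_lookup skew_algebraD)

lemma lookup_ad:
  assumes "a \<in> skew_algebra"
  shows "Poly_Mapping.lookup (K.A.ad v a) g = adg v (Poly_Mapping.lookup a g)"
proof -
  have 1: "Poly_Mapping.lookup (star (avec v) a) g = vec v * Poly_Mapping.lookup a g"
    using g assms by (simp add: star_vec lookup_amap rS_id skew_algebraD)
  have *: "inv h \<otimes> g = \<one> \<longleftrightarrow> h = g" "\<one> = inv h \<otimes> g \<longleftrightarrow> h = g" if "h \<in> carrier G" for h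
    using that g by (metis grp.inv_solve_left grp.one_closed grp.r_one)+
  have "Poly_Mapping.lookup (star a (avec v)) g = (\<Sum>h\<in>carrier G. if h = g then Poly_Mapping.lookup a g * vec (\<rho> g v) else 0)"
    using g assms
    by (auto simp: lookup_star avec_def lookup_single when_def * rS_id skew_algebraD act_vec intro!: sum.cong)
  then have "Poly_Mapping.lookup (star a (avec v)) g = vec (\<rho> g v) * Poly_Mapping.lookup a g"
    using g finite_carrier by (simp add: mult.commute)
  with 1 show ?thesis by (simp add: K.A.ad_def adg_def lookup_minus vec_diff algebra_simps)
qed

lemma lookup_kd: 
  assumes "\<And>vs. F vs \<in> skew_algebra"
  shows "Poly_Mapping.lookup (K.A.kd F vs) g = dg (\<lambda>vs. Poly_Mapping.lookup (F vs) g) vs"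
  by (rule kdiff_hom[where \<phi> = "\<lambda>a. Poly_Mapping.lookup a g" and F = F, symmetric])
    (simp_all add: lookup_minus lookup_ad assms)

lemma dg_single: "\<Phi> \<in> kc \<Longrightarrow> dg \<Phi> = (\<lambda>vs. Poly_Mapping.lookup (K.A.kd (\<lambda>vs. Poly_Mapping.single g (\<Phi> vs)) vs) g)"
  using lookup_kd[of "\<lambda>vs. Poly_Mapping.single g (\<Phi> vs)"] K.A.kcochD(1)[OF kc_single] by (auto simp: A_eq)

lemma kc_dg: "\<Phi> \<in> kc \<Longrightarrow> dg \<Phi> \<in> kc"
  using kc_component[OF K.A.kd_kcoch[OF kc_single]] dg_single by simp

lemma dg_dg: 
  assumes "\<Phi> \<in> kc" shows "dg (dg \<Phi>) vs = 0"
proof -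
  let ?F = "\<lambda>vs. Poly_Mapping.single g (\<Phi> vs)"
  note F = kc_single[OF assms]
  have "dg (dg \<Phi>) vs = Poly_Mapping.lookup (K.A.kd (K.A.kd ?F) vs) g"
    unfolding dg_single[OF assms] using lookup_kd[of "K.A.kd ?F"] K.A.kcochD(1)[OF K.A.kd_kcoch[OF F]] by (simp add: A_eq)
  then show ?thesis by (simp add: K.A.kd_kd[OF F])
qed

lemma kcD:
  assumes "\<Phi> \<in> kc"
  shows "\<Phi> vs \<in> S" "multilin scale (\<lambda>c s. sconst c * s) \<Phi>" "\<Phi> (as @ v # v # bs) = 0" "\<Phi> (v # v # bs) = 0" "(\<lambda>ws. \<Phi> (v # ws)) \<in> kc"
    "\<Phi> (v # w # bs) = - \<Phi> (w # v # bs)" "\<Phi> (0 # bs) = 0"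
proof -
  show a: "\<Phi> vs \<in> S" "multilin scale (\<lambda>c s. sconst c * s) \<Phi>" "\<Phi> (as @ v # v # bs) = 0" for as v bs vs
    using assms by (auto simp: kc_def)
  show "\<Phi> (v # v # bs) = 0" using a(3)[of "[]"] by simp
  have "\<Phi> (v # as @ w # w # bs) = 0" for as w bs using a(3)[of "v # as"] by simp
  then show "(\<lambda>ws. \<Phi> (v # ws)) \<in> kc" using a(1) multilin_Cons[OF a(2)] by (auto simp: kc_def)
  have "Poly_Mapping.single g (\<Phi> (v # w # bs)) = - Poly_Mapping.single g (\<Phi> (w # v # bs))"
    by (rule K.A.kcoch_swap[OF kc_single[OF assms]])
  then show "\<Phi> (v # w # bs) = - \<Phi> (w # v # bs)" by (metis lookup_single_eq lookup_uminus)
  show "\<Phi> (0 # bs) = 0" using multilin_Cons_scale[OF a(2), of 0 0 bs] by simp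
qed

lemma kc_add: "\<Phi> \<in> kc \<Longrightarrow> \<Psi> \<in> kc \<Longrightarrow> (\<lambda>ws. \<Phi> ws + \<Psi> ws) \<in> kc"
  by (auto simp: kc_def multilin_def algebra_simps intro: Sym.add)

lemma kc_scale: "\<Phi> \<in> kc \<Longrightarrow> (\<lambda>ws. sconst c * \<Phi> ws) \<in> kc"
  by (auto simp: kc_def multilin_def algebra_simps intro: Sym.mult)

lemma kc_zero: "(\<lambda>ws. 0) \<in> kc"
  by (simp add: kc_def multilin_def Sym_zero)

lemma kc_uminus: "\<Phi> \<in> kc \<Longrightarrow> (\<lambda>ws. - \<Phi> ws) \<in> kc"
  using kc_scale[of \<Phi> "-1"] by (simp add: sconst_uminus)

lemma kc_diff: "\<Phi> \<in> kc \<Longrightarrow> \<Psi> \<in> kc \<Longrightarrow> (\<lambda>ws. \<Phi> ws - \<Psi> ws) \<in> kc"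
  using kc_add[of \<Phi> "\<lambda>ws. - \<Psi> ws"] kc_uminus[of \<Psi>] by simp

lemma kc_sum: "(\<And>i. i \<in> I \<Longrightarrow> \<Phi> i \<in> kc) \<Longrightarrow> (\<lambda>ws. \<Sum>i\<in>I. \<Phi> i ws) \<in> kc"
  by (induction I rule: infinite_finite_induct) (auto intro: kc_zero kc_add)

lemma dg_add: "dg (\<lambda>ws. \<Phi> ws + \<Psi> ws) vs = dg \<Phi> vs + dg \<Psi> vs"
  by (rule kdiff_add) (simp add: adg_def algebra_simps)

lemma dg_scale: "dg (\<lambda>ws. sconst c * \<Phi> ws) vs = sconst c * dg \<Phi> vs"
  by (rule kdiff_hom[where \<phi> = "\<lambda>s. sconst c * s" and F = \<Phi>]) (simp_all add: adg_def algebra_simps)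

lemma dg_zero [simp]: "dg (\<lambda>ws. 0) vs = 0"
  by (rule kdiff_zero) (simp_all add: adg_def)

lemma dg_sum: "dg (\<lambda>ws. \<Sum>i\<in>I. \<Phi> i ws) vs = (\<Sum>i\<in>I. dg (\<Phi> i) vs)"
  by (induction I rule: infinite_finite_induct) (auto simp: dg_add)

lemma dg_diff: "dg (\<lambda>ws. \<Phi> ws - \<Psi> ws) vs = dg \<Phi> vs - dg \<Psi> vs"
  using dg_add[of "\<lambda>ws. \<Phi> ws - \<Psi> ws" \<Psi> vs] by simp

lemma kc_expand:
  assumes "\<Phi> \<in> kc" shows "\<Phi> (as @ v # bs) = (\<Sum>j\<in>BB g. sconst (co g j v) * \<Phi> (as @ j # bs))"
proof -
  note m = multilin_add[OF kcD(2)[OF assms]] multilin_scale[OF kcD(2)[OF assms]]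
  have z: "\<Phi> (as @ 0 # bs) = 0" using m(2)[of as 0 0 bs] by simp
  have "\<Phi> (as @ sum f I # bs) = (\<Sum>i\<in>I. \<Phi> (as @ f i # bs))" for f :: "'v \<Rightarrow> 'v" and I
    by (induction I rule: infinite_finite_induct) (simp_all add: m z)
  from this[of "\<lambda>j. scale (co g j v) j" "BB g"] show ?thesis
    by (simp add: co_sum[OF g] m)
qed

lemma kc_zero_on_basis:
  assumes "\<Phi> \<in> kc" "\<And>ws. set ws \<subseteq> BB g \<Longrightarrow> \<Phi> ws = 0" shows "\<Phi> vs = 0"
proof -
  have "set as \<subseteq> BB g \<Longrightarrow> \<Phi> (as @ vs) = 0" for as
  proof (induction vs arbitrary: as)
    case Nil
    then show ?case using assms(2) by simp
  next
    case (Cons v vs)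
    have "\<Phi> (as @ j # vs) = 0" if "j \<in> BB g" for j
      using Cons.IH[of "as @ [j]"] Cons.prems that by simp
    then show ?case unfolding kc_expand[OF assms(1), of as v] by simp
  qed
  from this[of "[]"] show ?thesis by simp
qed

lemma kc_nondistinct:
  assumes "\<Phi> \<in> kc" "\<not> distinct ws" shows "\<Phi> ws = 0"
proof -
  obtain as bs cs v where "ws = as @ [v] @ bs @ [v] @ cs" using not_distinct_decomp[OF assms(2)] by blast
  moreover have "(\<lambda>vs. Poly_Mapping.single g (\<Phi> vs)) \<in> Koszul"
    using kc_single[OF assms(1)] by (simp add: Koszul_eq)
  ultimately have "Poly_Mapping.single g (\<Phi> ws) = 0"
    unfolding Koszul_def by (elim CollectE conjE allE[of _ ws] allE[of _ "length as"] allE[of _ "length as + 1 + length bs"]) (auto simp: nth_append)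
  then show ?thesis by (metis lookup_single_eq lookup_zero)
qed

text \<open>The inverse of \<open>1 - g\<close> on \<open>fixed_perp g\<close>, which this map sends
  bijectively to itself.\<close>

definition lift :: "'v \<Rightarrow> 'v"
  where "lift j = (SOME w. w \<in> fixed_perp g \<and> w - \<rho> g w = j)"

lemma lift: 
  assumes "j \<in> B2 g" shows "lift j \<in> fixed_perp g" "lift j - \<rho> g (lift j) = j"
proof -
  have "j \<in> fixed_perp g" using B2(1)[OF g] assms by blast
  then obtain w where w: "j = w - \<rho> g w" by (auto simp: fixed_perp_def)
  \<comment> \<open>A preimage may be changed by fixed vectors, so its projection to
    \<open>fixed_perp g\<close> is a preimage as well.\<close>
  have "\<rho> g (w - proj g w) = w - proj g w" using diff_proj_fixed[OF g, of w] by (simp add: fixed_def)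
  then have "\<rho> g w = w + \<rho> g (proj g w) - proj g w" by (simp add: rho_linear g algebra_simps)
  then have "proj g w - \<rho> g (proj g w) = j" using w by simp
  then have "\<exists>w. w \<in> fixed_perp g \<and> w - \<rho> g w = j" using proj_perp[OF g] by blast
  from someI_ex[OF this] show "lift j \<in> fixed_perp g" "lift j - \<rho> g (lift j) = j" unfolding lift_def by auto
qed

text \<open>Both sides lie in \<open>fixed_perp g\<close> and have the same image under
  \<open>1 - g\<close>, which is injective there.\<close>

lemma lift_sum: "(\<Sum>j\<in>B2 g. scale (co g j (v - \<rho> g v)) (lift j)) = proj g v"
proof -
  let ?x = "\<Sum>j\<in>B2 g. scale (co g j (v - \<rho> g v)) (lift j)"
  have xp: "?x \<in> fixed_perp g"
    by (intro subspace_sum subspace_scale subspace_fixed_perp g lift)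
  have "?x - \<rho> g ?x = (\<Sum>j\<in>B2 g. scale (co g j (v - \<rho> g v)) (lift j - \<rho> g (lift j)))"
    by (simp add: rho_linear g scale_right_diff_distrib sum_subtractf)
  also have "\<dots> = (\<Sum>j\<in>B2 g. scale (co g j (v - \<rho> g v)) j)"
    by (intro sum.cong refl) (simp add: lift)
  also have "\<dots> = v - \<rho> g v" by (rule co_B2_sum[OF g]) (auto simp: fixed_perp_def)
  also have "\<dots> = proj g v - \<rho> g (proj g v)"
    using diff_proj_fixed[OF g, of v] by (simp add: fixed_def rho_linear g algebra_simps)
  finally have "?x - proj g v \<in> fixed g" by (simp add: fixed_def rho_linear g algebra_simps)
  then have "?x - proj g v = 0"
    by (rule fixed_Int_perp[OF g]) (intro subspace_diff subspace_fixed_perp g xp proj_perp)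
  then show ?thesis by simp
qed

text \<open>The action of \<open>proj\<close> on the arguments as a derivation. On a list from
  \<open>BB\<close> it multiplies by the number of entries in \<open>B2\<close>, as
  \<open>proj_count_basis\<close> shows.\<close>

primrec proj_count :: "('v list \<Rightarrow> 'v sym) \<Rightarrow> 'v list \<Rightarrow> 'v sym"
  where
    "proj_count \<Phi> [] = 0"
  | "proj_count \<Phi> (v # vs) = \<Phi> (proj g v # vs) + proj_count (\<lambda>ws. \<Phi> (v # ws)) vs"

text \<open>
  Contraction with \<open>lift j\<close> and differentiation along \<open>j\<close> is a homotopy for which the Laplacian \<open>lap\<close>
  is diagonal in the basis \<open>BB\<close>, with eigenvalue the number of missing directions of \<open>fixed_perp g\<close>
  plus the polynomial degree in these directions.
\<close>

definition contr :: "('v list \<Rightarrow> 'v sym) \<Rightarrow> 'v list \<Rightarrow> 'v sym"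
  where "contr \<Phi> vs = (\<Sum>j\<in>B2 g. pd g j (\<Phi> (lift j # vs)))"

definition lap :: "('v list \<Rightarrow> 'v sym) \<Rightarrow> 'v list \<Rightarrow> 'v sym"
  where "lap \<Phi> vs = dg (contr \<Phi>) vs + contr (dg \<Phi>) vs"

lemma contr_kc: 
  assumes "\<Phi> \<in> kc" shows "contr \<Phi> \<in> kc"
proof -
  have "(\<lambda>ws. pd g j (\<Phi> (lift j # ws))) \<in> kc" for j
    using kcD(1,2,3)[OF kcD(5)[OF assms, of "lift j"]]
    by (auto simp: kc_def multilin_def pd_add[OF g] pd_sconst_mult[OF g] pd_S[OF g] pd_zero[OF g])
  then show ?thesis unfolding contr_def[abs_def] by (intro kc_sum)
qed

lemma lap_kc: "\<Phi> \<in> kc \<Longrightarrow> lap \<Phi> \<in> kc"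
  unfolding lap_def[abs_def] by (intro kc_add kc_dg contr_kc)

lemma proj_count_uminus: "proj_count (\<lambda>ws. - \<Phi> ws) vs = - proj_count \<Phi> vs"
  by (induction vs arbitrary: \<Phi>) simp_all

text \<open>As in \<open>kd_derivation_commutator\<close>, the product rule leaves a coefficient,
  here that of \<open>j\<close> in \<open>v - g v\<close>. Summed over \<open>j\<close>, it replaces
  \<open>lift j\<close> by \<open>proj v\<close>, by \<open>lift_sum\<close>; over all positions
  this is \<open>proj_count\<close>.\<close>

lemma pd_commutator:
  assumes "\<Phi> \<in> kc"
  shows "(\<Sum>j\<in>B2 g. dg (\<lambda>ws. pd g j (\<Phi> (lift j # ws))) vs - pd g j (dg (\<lambda>ws. \<Phi> (lift j # ws)) vs)) = - proj_count \<Phi> vs"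
  using assms
proof (induction vs arbitrary: \<Phi>)
  case Nil
  show ?case by (simp add: pd_zero[OF g])
next
  case (Cons v vs)
  let ?\<Phi>' = "\<lambda>ws. - \<Phi> (v # ws)"
  have \<Phi>': "?\<Phi>' \<in> kc" by (intro kc_uminus kcD(5) Cons.prems)
  have sw: "\<Phi> (lift j # v # ws) = ?\<Phi>' (lift j # ws)" for j ws by (rule kcD(6)[OF Cons.prems])
  have "dg (\<lambda>ws. pd g j (\<Phi> (lift j # ws))) (v # vs) - pd g j (dg (\<lambda>ws. \<Phi> (lift j # ws)) (v # vs))
    = - (sconst (co g j (v - \<rho> g v)) * \<Phi> (lift j # vs)) - (dg (\<lambda>ws. pd g j (?\<Phi>' (lift j # ws))) vs - pd g j (dg (\<lambda>ws. ?\<Phi>' (lift j # ws)) vs))" for j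
    unfolding kdiff.simps(2) sw adg_def by (simp add: pd_diff[OF g] pd_mult[OF g] pd_vec[OF g] algebra_simps)
  then have "(\<Sum>j\<in>B2 g. dg (\<lambda>ws. pd g j (\<Phi> (lift j # ws))) (v # vs) - pd g j (dg (\<lambda>ws. \<Phi> (lift j # ws)) (v # vs)))
    = - (\<Sum>j\<in>B2 g. sconst (co g j (v - \<rho> g v)) * \<Phi> (lift j # vs)) - (- proj_count ?\<Phi>' vs)"
    using Cons.IH[OF \<Phi>'] by (simp only: sum_subtractf sum_negf)
  also have "(\<Sum>j\<in>B2 g. sconst (co g j (v - \<rho> g v)) * \<Phi> (lift j # vs)) = \<Phi> (proj g v # vs)"
  proof -
    note m = multilin_Cons_add[OF kcD(2)[OF Cons.prems]] multilin_Cons_scale[OF kcD(2)[OF Cons.prems]]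
    have "\<Phi> (sum f I # vs) = (\<Sum>i\<in>I. \<Phi> (f i # vs))" for f :: "'v \<Rightarrow> 'v" and I
      by (induction I rule: infinite_finite_induct) (simp_all add: m kcD(7)[OF Cons.prems])
    from this[of "\<lambda>j. scale (co g j (v - \<rho> g v)) (lift j)" "B2 g"] show ?thesis
      by (simp add: m lift_sum)
  qed
  finally show ?case by (simp add: proj_count_uminus)
qed

text \<open>The codimension is the sum of the derivatives of the vectors \<open>j\<close> of
  \<open>B2\<close> along themselves, each equal to 1; the other half of the product rule gives the
  Euler term.\<close>

lemma lap_eq:
  assumes "\<Phi> \<in> kc"
  shows "lap \<Phi> vs = sconst (of_nat (codim_fixed g)) * \<Phi> vs + euler g (\<Phi> vs) - proj_count \<Phi> vs"
proof -
  have "contr (dg \<Phi>) vs = (\<Sum>j\<in>B2 g. (\<Phi> vs + vec j * pd g j (\<Phi> vs)) - pd g j (dg (\<lambda>ws. \<Phi> (lift j # ws)) vs))"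
    unfolding contr_def
  proof (intro sum.cong refl)
    fix j assume j: "j \<in> B2 g"
    have "co g j j = 1" using B_disjoint[OF g _ j] j B2(1)[OF g] 
      by (auto simp: co_def[OF g] proj_id[OF g] representation_basis[OF B2(2)[OF g]])
    then show "pd g j (dg \<Phi> (lift j # vs)) = \<Phi> vs + vec j * pd g j (\<Phi> vs) - pd g j (dg (\<lambda>ws. \<Phi> (lift j # ws)) vs)"
      by (simp add: adg_def lift[OF j] pd_diff[OF g] pd_mult[OF g] pd_vec[OF g])
  qed
  moreover have "dg (contr \<Phi>) vs = (\<Sum>j\<in>B2 g. dg (\<lambda>ws. pd g j (\<Phi> (lift j # ws))) vs)"
    unfolding contr_def[abs_def] by (rule dg_sum)
  ultimately have "lap \<Phi> vs = (\<Sum>j\<in>B2 g. \<Phi> vs) + euler g (\<Phi> vs) +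
    (\<Sum>j\<in>B2 g. dg (\<lambda>ws. pd g j (\<Phi> (lift j # ws))) vs - pd g j (dg (\<lambda>ws. \<Phi> (lift j # ws)) vs))"
    unfolding lap_def by (simp add: sum.distrib sum_subtractf euler_def[OF g])
  moreover have "(\<Sum>j\<in>B2 g. \<Phi> vs) = sconst (of_nat (codim_fixed g)) * \<Phi> vs"
  proof -
    have "(of_nat n :: 'v sym) = sconst (of_nat n)" for n
      by (induction n) (simp_all add: sconst_add)
    then show ?thesis by (simp add: card_B2[OF g])
  qed
  ultimately show ?thesis unfolding pd_commutator[OF assms] by simp
qed

section \<open>Spectrum of the Laplacian and splitting of cocycles\<close>

lemma proj_count_basis:
  assumes "\<Phi> \<in> kc" "set ws \<subseteq> BB g"
  shows "proj_count \<Phi> ws = sconst (of_nat (length (filter (\<lambda>w. w \<in> B2 g) ws))) * \<Phi> ws"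
  using assms
proof (induction ws arbitrary: \<Phi>)
  case (Cons w ws)
  have "proj_count (\<lambda>vs. \<Phi> (w # vs)) ws = sconst (of_nat (length (filter (\<lambda>w. w \<in> B2 g) ws))) * \<Phi> (w # ws)"
    by (rule Cons.IH[OF kcD(5)[OF Cons.prems(1)]]) (use Cons.prems in simp)
  moreover have "\<Phi> (proj g w # ws) = (if w \<in> B2 g then \<Phi> (w # ws) else 0)"
    using Cons.prems(2) B1(1)[OF g] B2(1)[OF g] 
    by (auto simp: proj_id[OF g] proj_fixed[OF g] kcD(7)[OF Cons.prems(1)] subset_iff)
  ultimately show ?case by (simp add: sconst_add algebra_simps)
qed simp

lemma count_B2_le:
  assumes "distinct ws" shows "length (filter (\<lambda>w. w \<in> B2 g) ws) \<le> codim_fixed g"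
proof -
  have "length (filter (\<lambda>w. w \<in> B2 g) ws) = card (set (filter (\<lambda>w. w \<in> B2 g) ws))"
    using distinct_card[OF distinct_filter[OF assms]] by simp
  also have "\<dots> \<le> card (B2 g)" by (rule card_mono) (auto simp: B2(4)[OF g])
  finally show ?thesis by (simp add: card_B2[OF g])
qed

lemma lap_basis:
  assumes "\<Phi> \<in> kc" "set ws \<subseteq> BB g" "distinct ws"
  shows "lap \<Phi> ws = sconst (of_nat (codim_fixed g - length (filter (\<lambda>w. w \<in> B2 g) ws))) * \<Phi> ws + euler g (\<Phi> ws)"
  using count_B2_le[OF assms(3)] unfolding lap_eq[OF assms(1)] proj_count_basis[OF assms(1,2)]
  by (simp add: of_nat_diff sconst_add[of _ "- _", simplified] sconst_uminus algebra_simps)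

text \<open>The product \<open>lap (lap - 1) ... (lap - N)\<close> kills the cochain.\<close>

primrec annihilated :: "nat \<Rightarrow> ('v list \<Rightarrow> 'v sym) \<Rightarrow> bool"
  where
    "annihilated 0 \<Phi> \<longleftrightarrow> (\<forall>vs. lap \<Phi> vs = 0)"
  | "annihilated (Suc N) \<Phi> \<longleftrightarrow> annihilated N (\<lambda>vs. lap \<Phi> vs - sconst (of_nat (Suc N)) * \<Phi> vs)"

text \<open>On a cocycle the Laplacian is the coboundary of the contraction. Solving
  \<open>lap \<Phi> - c \<Phi> = \<Phi>'\<close> for \<open>\<Phi>\<close> thus expresses it through
  \<open>\<Phi>'\<close> and a coboundary, and \<open>\<Phi>'\<close> is killed by a product with
  one factor less.\<close>

lemma annihilated_splits:
  assumes "annihilated N \<Phi>" "\<Phi> \<in> kc" "\<And>vs. dg \<Phi> vs = 0"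
  shows "\<exists>\<gamma>\<in>kc. \<exists>Z\<in>kc. (\<forall>vs. lap \<gamma> vs = 0) \<and> (\<forall>vs. \<Phi> vs = \<gamma> vs + dg Z vs)"
  using assms
proof (induction N arbitrary: \<Phi>)
  case 0
  then show ?case using kc_zero by (intro bexI[of _ \<Phi>] bexI[of _ "\<lambda>_. 0"]) auto
next
  case (Suc N)
  let ?c = "of_nat (Suc N) :: complex"
  let ?\<Phi>' = "\<lambda>vs. lap \<Phi> vs - sconst ?c * \<Phi> vs"
  have l: "lap \<Phi> = dg (contr \<Phi>)" using Suc.prems(3) by (auto simp: lap_def contr_def pd_zero[OF g] fun_eq_iff simp del: kdiff.simps)
  have k: "contr \<Phi> \<in> kc" by (rule contr_kc[OF Suc.prems(2)])
  have "dg ?\<Phi>' vs = 0" for vs unfolding l dg_diff dg_scale dg_dg[OF k] Suc.prems(3) by simp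
  moreover have "?\<Phi>' \<in> kc" by (intro kc_diff kc_scale lap_kc Suc.prems)
  ultimately obtain \<gamma> Z where \<gamma>: "\<gamma> \<in> kc" "Z \<in> kc" "\<And>vs. lap \<gamma> vs = 0" "\<And>vs. ?\<Phi>' vs = \<gamma> vs + dg Z vs"
    using Suc.IH[of ?\<Phi>'] Suc.prems(1) by auto
  \<comment> \<open>The coefficient of \<open>\<Phi>'\<close> after dividing
    \<open>c \<Phi> = lap \<Phi> - \<Phi>'\<close> by \<open>c\<close>.\<close>
  let ?i = "- (1 / ?c)"
  have c: "?i * ?c = -1" by (simp del: of_nat_Suc)
  have sm: "lap (\<lambda>vs. sconst ?i * \<gamma> vs) vs = sconst ?i * lap \<gamma> vs" for vs
  proof -
    have "proj_count (\<lambda>vs. sconst b * \<gamma> vs) vs = sconst b * proj_count \<gamma> vs" for b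
    proof (induction vs arbitrary: \<gamma>)
      case (Cons a vs)
      show ?case using Cons.IH[of "\<lambda>ws. \<gamma> (a # ws)"] by (simp add: distrib_left)
    qed simp
    then show ?thesis unfolding lap_eq[OF kc_scale[OF \<gamma>(1)]] lap_eq[OF \<gamma>(1)] euler_sconst_mult[OF g]
      by (simp only: right_diff_distrib distrib_left mult.left_commute)
  qed
  have eq: "\<Phi> vs = sconst ?i * \<gamma> vs + dg (\<lambda>vs. sconst ?i * (Z vs - contr \<Phi> vs)) vs" for vs
  proof -
    have "- \<Phi> vs = sconst ?i * (sconst ?c * \<Phi> vs)"
      unfolding mult.assoc[symmetric] sconst_mult[symmetric] c by (simp add: sconst_uminus)
    also have "sconst ?c * \<Phi> vs = dg (contr \<Phi>) vs - \<gamma> vs - dg Z vs"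
      using \<gamma>(4)[of vs] unfolding l by (simp add: algebra_simps)
    finally show ?thesis unfolding dg_scale dg_diff by (simp add: algebra_simps)
  qed
  show ?case
    by (intro bexI[of _ "\<lambda>vs. sconst ?i * \<gamma> vs"] bexI[of _ "\<lambda>vs. sconst ?i * (Z vs - contr \<Phi> vs)"] conjI allI eq kc_scale kc_diff \<gamma> k)
      (simp only: sm \<gamma>(3) mult_zero_right)
qed

text \<open>Here \<open>d\<close> stands for the defect of a list of basis vectors, on whose value
  the Laplacian acts as \<open>d\<close> plus the Euler operator. The value \<open>s\<close> is a
  sum of eigenvectors with eigenvalues from 0 to \<open>K\<close>.\<close>

definition lap_spectrum :: "nat \<Rightarrow> nat \<Rightarrow> 'v sym \<Rightarrow> bool"
  where "lap_spectrum K d s \<longleftrightarrow> (\<exists>x. s = (\<Sum>a\<le>K. x a) \<and> (\<forall>a. sconst (of_nat d) * x a + euler g (x a) = sconst (of_nat a) * x a))"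

lemma lap_spectrum_mono: "lap_spectrum K d s \<Longrightarrow> K \<le> K' \<Longrightarrow> lap_spectrum K' d s"
proof -
  assume "lap_spectrum K d s" "K \<le> K'"
  then obtain x where x: "s = (\<Sum>a\<le>K. x a)" "\<And>a. sconst (of_nat d) * x a + euler g (x a) = sconst (of_nat a) * x a"
    unfolding lap_spectrum_def by blast
  have "s = (\<Sum>a\<le>K'. if a \<le> K then x a else 0)"
    unfolding x(1) by (rule sum.mono_neutral_cong_left) (use \<open>K \<le> K'\<close> in auto)
  then show ?thesis unfolding lap_spectrum_def using x(2)
    by (intro exI[of _ "\<lambda>a. if a \<le> K then x a else 0"]) (auto simp: euler_zero[OF g])
qed

lemma lap_spectrum_exists:
  assumes "s \<in> S" shows "\<exists>K. lap_spectrum K d s"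
proof -
  obtain N x where "graded_sum g N x s" using graded_sum_exists[OF g assms] by blast
  then have x: "s = (\<Sum>n\<le>N. x n)" "\<And>n. euler g (x n) = sconst (of_nat n) * x n"
    by (auto simp: graded_sum_def[OF g])
  let ?y = "\<lambda>a. if d \<le> a then x (a - d) else 0"
  have "(\<Sum>a\<le>N + d. ?y a) = (\<Sum>a\<in>{d..N + d}. x (a - d))"
    by (rule sum.mono_neutral_cong_right) auto
  also have "\<dots> = (\<Sum>n\<le>N. x n)"
    by (rule sum.reindex_bij_witness[of _ "\<lambda>n. n + d" "\<lambda>a. a - d"]) auto
  finally have "s = (\<Sum>a\<le>N + d. ?y a)" using x(1) by simp
  moreover have "sconst (of_nat d) * ?y a + euler g (?y a) = sconst (of_nat a) * ?y a" for a
  proof (cases "d \<le> a")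
    case True
    then have "(of_nat a :: complex) = of_nat d + of_nat (a - d)" by simp
    then have "sconst (of_nat a) = sconst (of_nat d) + (sconst (of_nat (a - d)) :: 'v sym)" by (simp only: sconst_add)
    then show ?thesis using True by (simp add: x(2) algebra_simps)
  qed (simp add: euler_zero[OF g])
  ultimately show ?thesis unfolding lap_spectrum_def by blast
qed

abbreviation "defect ws \<equiv> codim_fixed g - length (filter (\<lambda>w. w \<in> B2 g) ws)"

text \<open>Each factor removes the largest eigenvalue and multiplies the remaining eigenvectors by
  scalars.\<close>

lemma spectrum_annihilated:
  assumes "\<Phi> \<in> kc" "\<And>ws. set ws \<subseteq> BB g \<Longrightarrow> distinct ws \<Longrightarrow> lap_spectrum K (defect ws) (\<Phi> ws)"
  shows "annihilated K \<Phi>"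
  using assms
proof (induction K arbitrary: \<Phi>)
  case 0
  have "lap \<Phi> ws = 0" if "set ws \<subseteq> BB g" for ws
  proof (cases "distinct ws")
    case True
    then show ?thesis using 0(2)[OF that True] unfolding lap_basis[OF 0(1) that True] by (auto simp: lap_spectrum_def)
  qed (rule kc_nondistinct[OF lap_kc[OF 0(1)]])
  then show ?case using kc_zero_on_basis[OF lap_kc[OF 0(1)]] by simp
next
  case (Suc K)
  let ?\<Phi>' = "\<lambda>vs. lap \<Phi> vs - sconst (of_nat (Suc K)) * \<Phi> vs"
  have "annihilated K ?\<Phi>'"
  proof (rule Suc.IH)
    show "?\<Phi>' \<in> kc" by (intro kc_diff kc_scale lap_kc Suc.prems)
    fix ws assume ws: "set ws \<subseteq> BB g" "distinct ws"
    obtain x where x: "\<Phi> ws = (\<Sum>a\<le>Suc K. x a)" "\<And>a. sconst (of_nat (defect ws)) * x a + euler g (x a) = sconst (of_nat a) * x a"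
      using Suc.prems(2)[OF ws] unfolding lap_spectrum_def by blast
    let ?y = "\<lambda>a. sconst (of_nat a - of_nat (Suc K)) * x a"
    have ya: "?y a = sconst (of_nat a) * x a - sconst (of_nat (Suc K)) * x a" for a
      by (simp add: sconst_add[of _ "- _", simplified] sconst_uminus algebra_simps del: of_nat_Suc)
    have "?\<Phi>' ws = (\<Sum>a\<le>Suc K. ?y a)"
      unfolding lap_basis[OF Suc.prems(1) ws] x(1) euler_sum[OF g] ya
      by (simp add: sum_distrib_left sum_subtractf x(2)[symmetric] sum.distrib del: sum.atMost_Suc of_nat_Suc)
    also have "\<dots> = (\<Sum>a\<le>K. ?y a)" by simp
    finally have "?\<Phi>' ws = (\<Sum>a\<le>K. ?y a)" .
    moreover have "sconst (of_nat (defect ws)) * ?y a + euler g (?y a) = sconst (of_nat a) * ?y a" for a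
      unfolding euler_sconst_mult[OF g] mult.left_commute[of "sconst (of_nat _)"] distrib_left[symmetric] x(2) ..
    ultimately show "lap_spectrum K (defect ws) (?\<Phi>' ws)" unfolding lap_spectrum_def by blast
  qed
  then show ?case by simp
qed

text \<open>Only lists of distinct basis vectors matter. There are finitely many of them, so one
  bound on the eigenvalues serves all values.\<close>

lemma annihilated_exists: 
  assumes "\<Phi> \<in> kc" shows "\<exists>K. annihilated K \<Phi>"
proof -
  let ?W = "{ws. set ws \<subseteq> BB g \<and> distinct ws}"
  have fin: "finite ?W"
    using finite_subset_distinct[of "BB g"] B1(4)[OF g] B2(4)[OF g] by simp
  have "\<forall>ws. \<exists>K. lap_spectrum K (defect ws) (\<Phi> ws)" using lap_spectrum_exists kcD(1)[OF assms] by blast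
  then obtain K where K: "\<And>ws. lap_spectrum (K ws) (defect ws) (\<Phi> ws)" by metis
  have "lap_spectrum (\<Sum>ws\<in>?W. K ws) (defect ws) (\<Phi> ws)" if "ws \<in> ?W" for ws
    by (rule lap_spectrum_mono[OF K]) (rule member_le_sum, use that fin in auto)
  then show ?thesis using spectrum_annihilated[OF assms] by blast
qed

text \<open>
  The \<open>g\<close>-component of \<open>H\<close> without wedge products: for a multiple of the volume form of \<open>fixed_perp g\<close>,
  at most \<open>p - codim_fixed g\<close> of the \<open>p\<close> arguments can lie in \<open>fixed g\<close>.
\<close>

definition harmonic :: "('v list \<Rightarrow> 'v sym) \<Rightarrow> bool"
  where "harmonic \<Phi> \<longleftrightarrow> (\<forall>vs. \<Phi> vs \<in> Sym (fixed g)) \<and>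
    (\<forall>vs. length vs < length (filter (\<lambda>v. v \<in> fixed g) vs) + codim_fixed g \<longrightarrow> \<Phi> vs = 0)"

lemma basis_counts:
  assumes "set ws \<subseteq> BB g" 
  shows "length (filter (\<lambda>v. v \<in> fixed g) ws) + length (filter (\<lambda>w. w \<in> B2 g) ws) = length ws"
proof -
  have "w \<in> fixed g \<longleftrightarrow> w \<notin> B2 g" if "w \<in> BB g" for w
    using that B1(1)[OF g] B2(1)[OF g] fixed_Int_perp[OF g, of w] dependent_zero[of "B2 g"] B2(2)[OF g] by blast
  then have "filter (\<lambda>v. v \<in> fixed g) ws = filter (\<lambda>w. w \<notin> B2 g) ws"
    using assms by (intro filter_cong) auto
  then show ?thesis using sum_length_filter_compl[of "\<lambda>w. w \<in> B2 g" ws] by simp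
qed

lemma harmonic_from_basis:
  assumes \<Phi>: "\<Phi> \<in> kc" and b: "\<And>ws. set ws \<subseteq> BB g \<Longrightarrow> \<Phi> ws \<in> Sym (fixed g)"
    and z: "\<And>ws. set ws \<subseteq> BB g \<Longrightarrow> length (filter (\<lambda>w. w \<in> B2 g) ws) < codim_fixed g \<Longrightarrow> \<Phi> ws = 0"
  shows "harmonic \<Phi>"
proof -
  have 1: "set as \<subseteq> BB g \<Longrightarrow> \<Phi> (as @ vs) \<in> Sym (fixed g)" for as vs
  proof (induction vs arbitrary: as)
    case (Cons v vs)
    have "\<Phi> (as @ j # vs) \<in> Sym (fixed g)" if "j \<in> BB g" for j
      using Cons.IH[of "as @ [j]"] Cons.prems that by simp
    then show ?case unfolding kc_expand[OF \<Phi>, of as v] by (intro Sym_sum Sym.mult Sym.const)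
  qed (simp add: b)
  have 2: "set as \<subseteq> BB g \<Longrightarrow> length (as @ vs) < length (filter (\<lambda>v. v \<in> fixed g) (as @ vs)) + codim_fixed g \<Longrightarrow> \<Phi> (as @ vs) = 0" for as vs
  proof (induction vs arbitrary: as)
    case Nil
    then show ?case using z[of as] basis_counts[of as] by simp
  next
    case (Cons v vs)
    \<comment> \<open>An argument in \<open>fixed g\<close> expands in \<open>B1\<close> alone, so
      no surviving term has fewer arguments in \<open>fixed g\<close> than before.\<close>
    have "sconst (co g j v) * \<Phi> (as @ j # vs) = 0" if j: "j \<in> BB g" for j
    proof (cases "v \<in> fixed g \<and> j \<in> B2 g")
      case True
      then show ?thesis by (simp add: co_fixed[OF g])
    next
      case False
      then have "v \<in> fixed g \<Longrightarrow> j \<in> fixed g" using j B1(1)[OF g] by blast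
      then have "\<Phi> ((as @ [j]) @ vs) = 0"
        by (intro Cons.IH) (use Cons.prems j in \<open>auto split: if_splits\<close>)
      then show ?thesis by simp
    qed
    then show ?case unfolding kc_expand[OF \<Phi>, of as v] by (intro sum.neutral ballI) simp
  qed
  show ?thesis unfolding harmonic_def using 1[of "[]"] 2[of "[]"] by simp
qed

text \<open>An eigenvalue is the defect plus the degree in the directions of
  \<open>fixed_perp g\<close>. Both are nonnegative, so eigenvalue 0 forces a full set of arguments
  from \<open>B2\<close> and a coefficient in \<open>Sym (fixed g)\<close>.\<close>

lemma lap_zero_harmonic:
  assumes \<Phi>: "\<Phi> \<in> kc" and l: "\<And>vs. lap \<Phi> vs = 0" shows "harmonic \<Phi>"
proof -
  have main: "(defect ws = 0 \<longrightarrow> \<Phi> ws \<in> Sym (fixed g)) \<and> (defect ws \<noteq> 0 \<longrightarrow> \<Phi> ws = 0)" if ws: "set ws \<subseteq> BB g" "distinct ws" for ws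
  proof -
    let ?d = "defect ws"
    obtain N x where "graded_sum g N x (\<Phi> ws)" using graded_sum_exists[OF g kcD(1)[OF \<Phi>]] by blast
    then have x: "\<Phi> ws = (\<Sum>n\<le>N. x n)" "\<And>n. euler g (x n) = sconst (of_nat n) * x n" "x 0 \<in> Sym (fixed g)"
      by (auto simp: graded_sum_def[OF g])
    have "sconst (of_nat ?d + of_nat n) * x n = 0" if "n \<le> N" for n
    proof (rule eigenvectors_independent[OF g _ _ that])
      show "(\<Sum>n\<le>N. sconst (of_nat ?d + of_nat n) * x n) = 0"
        using l[of ws] unfolding lap_basis[OF \<Phi> ws] x(1) euler_sum[OF g] x(2)
        by (simp add: sconst_add sum.distrib sum_distrib_left distrib_right)
    qed (simp add: euler_sconst_mult[OF g] x(2) mult.left_commute)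
    then have e: "sconst (of_nat (?d + n)) * x n = 0" if "n \<le> N" for n
      using that by (simp only: of_nat_add)
    have z: "x n = 0" if "n \<le> N" "n \<noteq> 0 \<or> ?d \<noteq> 0" for n
    proof (rule sconst_cancel[OF g e[OF that(1)]])
      show "of_nat (?d + n) \<noteq> (0::complex)" using that(2) unfolding of_nat_eq_0_iff add_is_0 by blast
    qed
    show ?thesis
    proof (cases "?d = 0")
      case True
      have "\<Phi> ws = x 0" unfolding x(1) using z by (subst sum.remove[of _ 0]) auto
      then show ?thesis using True x(3) by simp
    next
      case False
      then show ?thesis unfolding x(1) using z by simp
    qed
  qed
  show ?thesis
  proof (rule harmonic_from_basis[OF \<Phi>])
    fix ws assume ws: "set ws \<subseteq> BB g"
    show "\<Phi> ws \<in> Sym (fixed g)"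
      using main[OF ws] kc_nondistinct[OF \<Phi>] Sym_zero by (cases "distinct ws"; cases "defect ws = 0") auto
    show "\<Phi> ws = 0" if "length (filter (\<lambda>w. w \<in> B2 g) ws) < codim_fixed g"
      using main[OF ws] kc_nondistinct[OF \<Phi>] that by (cases "distinct ws") auto
  qed
qed

theorem cocycle_splits:
  assumes "\<Phi> \<in> kc" "\<And>vs. dg \<Phi> vs = 0"
  shows "\<exists>\<gamma>\<in>kc. \<exists>Z\<in>kc. harmonic \<gamma> \<and> (\<forall>vs. \<Phi> vs = \<gamma> vs + dg Z vs)"
proof -
  obtain K where "annihilated K \<Phi>" using annihilated_exists[OF assms(1)] by blast
  from annihilated_splits[OF this assms] show ?thesis using lap_zero_harmonic by blast
qed

text \<open>Every term of a coboundary has a factor \<open>v - g v\<close>, hence lies in the ideal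
  of \<open>fixed_perp g\<close>, and this ideal meets \<open>Sym (fixed g)\<close> only in
  0.\<close>

theorem harmonic_boundary:
  assumes "Z \<in> kc" "harmonic \<gamma>" "\<And>vs. \<gamma> vs = dg Z vs"
  shows "\<gamma> vs = 0"
proof -
  have "perp_ideal g (dg Z vs)" if "\<And>vs. Z vs \<in> S" for Z vs
    using that
  proof (induction vs arbitrary: Z)
    case (Cons v vs)
    have "perp_ideal g (adg v (Z vs))" unfolding adg_def
      by (intro perp_ideal_mult[OF g] perp_ideal_vec[OF g] Cons.prems) (auto simp: fixed_perp_def)
    then show ?case using perp_ideal_add[OF g] perp_ideal_uminus[OF g Cons.IH[of "\<lambda>ws. Z (v # ws)"]] Cons.prems by fastforce
  qed (simp add: perp_ideal_zero[OF g])
  then have "perp_ideal g (\<gamma> vs)" using kcD(1)[OF assms(1)] by (simp add: assms(3))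
  then show ?thesis using perp_ideal_Sym_fixed[OF g] assms(2) unfolding harmonic_def by blast
qed

text \<open>On distinct basis vectors, dropping an argument \<open>w\<close> from \<open>B1\<close>
  gives the factor \<open>w - g w = 0\<close>, and dropping one from \<open>B2\<close> leaves too
  few arguments from \<open>B2\<close> for a nonzero value.\<close>

theorem harmonic_cocycle:
  assumes \<Phi>: "\<Phi> \<in> kc" and h: "harmonic \<Phi>" shows "dg \<Phi> vs = 0"
proof (rule kc_zero_on_basis[OF kc_dg[OF \<Phi>]])
  fix ws assume ws: "set ws \<subseteq> BB g"
  show "dg \<Phi> ws = 0"
  proof (cases "distinct ws")
    case True
    have "dg \<Psi> us = 0" if "\<And>as w bs. us = as @ w # bs \<Longrightarrow> w \<in> fixed g \<or> \<Psi> (as @ bs) = 0" for \<Psi> us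
      using that
    proof (induction us arbitrary: \<Psi>)
      case (Cons u us)
      have "adg u (\<Psi> us) = 0" using Cons.prems[of "[]" u us] by (auto simp: adg_def fixed_def)
      moreover have "dg (\<lambda>ws. \<Psi> (u # ws)) us = 0"
        by (rule Cons.IH) (use Cons.prems[of "u # _"] in simp)
      ultimately show ?case by simp
    qed simp
    moreover have "w \<in> fixed g \<or> \<Phi> (as @ bs) = 0" if "ws = as @ w # bs" for as w bs
    proof (cases "w \<in> B2 g")
      case True
      have "length (filter (\<lambda>w. w \<in> B2 g) (as @ bs)) < codim_fixed g"
        using count_B2_le[OF \<open>distinct ws\<close>] that True by simp
      then have "length (as @ bs) < length (filter (\<lambda>v. v \<in> fixed g) (as @ bs)) + codim_fixed g"
        using basis_counts[of "as @ bs"] ws that by simp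
      then show ?thesis using h unfolding harmonic_def by blast
    next
      case False
      then show ?thesis using ws that B1(1)[OF g] by auto
    qed
    ultimately show ?thesis by blast
  qed (rule kc_nondistinct[OF kc_dg[OF \<Phi>]])
qed

end

end

section \<open>Wedge products, and \<open>H\<close> as the harmonic cochains\<close>

lemma wedge_permute:
  assumes \<sigma>: "\<sigma> permutes {..<length \<zeta>s}"
  shows "wedge (permute_list \<sigma> \<zeta>s) vs = of_int (sign \<sigma>) * wedge \<zeta>s vs"
proof -
  let ?n = "length \<zeta>s" let ?P = "{\<pi>. \<pi> permutes {..<?n}}"
  let ?t = "\<lambda>\<pi>. of_int (sign \<pi>) * (\<Prod>i<?n. (\<zeta>s ! \<sigma> i) (vs ! \<pi> i)) :: complex"
  have "wedge (permute_list \<sigma> \<zeta>s) vs = sum ?t ?P"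
    unfolding wedge_def length_permute_list
    by (intro sum.cong refl arg_cong2[where f = "(*)"] prod.cong) (simp add: permute_list_nth[OF \<sigma>])
  also have "\<dots> = (\<Sum>\<pi>\<in>?P. ?t (\<pi> \<circ> \<sigma>))" by (rule sum_permutations_compose_right[OF \<sigma>])
  also have "\<dots> = (\<Sum>\<pi>\<in>?P. of_int (sign \<sigma>) * (of_int (sign \<pi>) * (\<Prod>i<?n. (\<zeta>s ! i) (vs ! \<pi> i))))"
  proof (intro sum.cong refl)
    fix \<pi> assume "\<pi> \<in> ?P"
    then have "sign (\<pi> \<circ> \<sigma>) = sign \<pi> * sign \<sigma>"
      using \<sigma> by (intro sign_compose) (auto simp: permutation_permutes)
    moreover have "(\<Prod>i<?n. (\<zeta>s ! i) (vs ! \<pi> i)) = (\<Prod>i<?n. (\<zeta>s ! \<sigma> i) (vs ! \<pi> (\<sigma> i)))"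
      by (subst prod.permute[OF \<sigma>]) (simp add: o_def)
    ultimately show "?t (\<pi> \<circ> \<sigma>) = of_int (sign \<sigma>) * (of_int (sign \<pi>) * (\<Prod>i<?n. (\<zeta>s ! i) (vs ! \<pi> i)))"
      by simp
  qed
  finally show ?thesis by (simp add: wedge_def sum_distrib_left)
qed

text \<open>More than \<open>length \<xi>s\<close> arguments lie in \<open>W\<close>, so in every
  product of the determinant some entry of \<open>\<eta>s\<close> is evaluated on one of
  them.\<close>

lemma wedge_eq_0:
  assumes len: "length vs = length \<xi>s + length \<eta>s"
    and \<eta>: "\<And>\<eta> v. \<eta> \<in> set \<eta>s \<Longrightarrow> v \<in> W \<Longrightarrow> \<eta> v = 0"
    and many: "length \<xi>s < length (filter (\<lambda>v. v \<in> W) vs)"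
  shows "wedge (\<xi>s @ \<eta>s) vs = 0"
proof -
  let ?n = "length (\<xi>s @ \<eta>s)" let ?I = "{length \<xi>s..<?n}" let ?K = "{k. k < length vs \<and> vs ! k \<in> W}"
  have "(\<Prod>i<?n. ((\<xi>s @ \<eta>s) ! i) (vs ! \<pi> i)) = 0" if \<pi>: "\<pi> permutes {..<?n}" for \<pi>
  proof -
    have "\<exists>i\<in>?I. vs ! \<pi> i \<in> W"
    proof (rule ccontr)
      assume "\<not> ?thesis"
      then have sub: "?K \<subseteq> {..<?n} - \<pi> ` ?I" using len by auto
      have "?I \<subseteq> {..<?n}" by auto
      then have "\<pi> ` ?I \<subseteq> {..<?n}" by (metis image_mono permutes_image[OF \<pi>])
      moreover have "card (\<pi> ` ?I) = length \<eta>s"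
        using card_image[OF inj_on_subset[OF permutes_inj[OF \<pi>]], of ?I] by simp
      ultimately have "card ({..<?n} - \<pi> ` ?I) = length \<xi>s"
        by (subst card_Diff_subset) auto
      then have "card ?K \<le> length \<xi>s" using card_mono[OF _ sub] by simp
      then show False using many by (simp add: length_filter_conv_card)
    qed
    then obtain i where i: "i \<in> ?I" "vs ! \<pi> i \<in> W" by blast
    then have "((\<xi>s @ \<eta>s) ! i) (vs ! \<pi> i) = 0"
      by (intro \<eta>) (auto simp: nth_append)
    then show ?thesis using i(1) by (intro prod_zero) auto
  qed
  then show ?thesis unfolding wedge_def by (intro sum.neutral ballI) simp
qed

lemma single_sum: "Poly_Mapping.single g (sum f I) = (\<Sum>i\<in>I. Poly_Mapping.single g (f i))"
  by (induction I rule: infinite_finite_induct) (simp_all add: single_add)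

context finite_group_module
begin

context
  fixes g assumes g: "g \<in> carrier G"
begin

text \<open>For an alternating cochain every position of the inserted letter contributes the same
  value.\<close>

lemma insert_alt_kc:
  assumes "\<Phi> \<in> kc" shows "insert_alt v \<Phi> l = sconst (of_nat (length l + 1)) * \<Phi> (v # l)"
  using assms
proof (induction l arbitrary: \<Phi>)
  case (Cons b l)
  have "insert_alt v (\<lambda>m. \<Phi> (b # m)) l = - (sconst (of_nat (length l + 1)) * \<Phi> (v # b # l))"
    using Cons.IH[OF kcD(5)[OF g Cons.prems, of b]] kcD(6)[OF g Cons.prems, of b v l] by simp
  moreover have "sconst (of_nat (length (b # l) + 1)) = 1 + (sconst (of_nat (length l + 1)) :: 'v sym)"
    using sconst_add[of 1 "of_nat (length l + 1)"] by simp
  ultimately show ?case by (simp only: insert_alt.simps distrib_right mult_1_left diff_minus_eq_add)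
qed simp

lemma alternate_kc:
  assumes "\<Phi> \<in> kc" shows "alternate (\<lambda>v. v) \<Phi> vs = sconst (fact (length vs)) * \<Phi> vs"
  using assms
proof (induction vs arbitrary: \<Phi>)
  case (Cons v vs)
  have "alternate (\<lambda>v. v) (insert_alt v \<Phi>) vs = alternate (\<lambda>v. v) (\<lambda>l. sconst (of_nat (length vs + 1)) * \<Phi> (v # l)) vs"
    by (rule alternate_cong) (simp add: insert_alt_kc[OF Cons.prems])
  also have "\<dots> = sconst (of_nat (length vs + 1)) * alternate (\<lambda>v. v) (\<lambda>l. \<Phi> (v # l)) vs"
    by (rule alternate_hom[where \<phi> = "\<lambda>x. sconst (of_nat (length vs + 1)) * x" and f = "\<lambda>l. \<Phi> (v # l)"]) (simp add: right_diff_distrib)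
  also have "\<dots> = sconst (fact (length (v # vs))) * \<Phi> (v # vs)"
    unfolding Cons.IH[OF kcD(5)[OF g Cons.prems]] by (simp add: sconst_mult mult.assoc del: of_nat_Suc)
  finally show ?case by simp
qed simp

lemma kc_expand_list:
  assumes "\<Phi> \<in> kc"
  shows "\<Phi> vs = (\<Sum>ws | set ws \<subseteq> BB g \<and> length ws = length vs. sconst (\<Prod>i<length vs. co g (ws ! i) (vs ! i)) * \<Phi> ws)"
  using assms
proof (induction vs arbitrary: \<Phi>)
  case Nil
  have "{ws. set ws \<subseteq> BB g \<and> length ws = length []} = {[]}" by auto
  then show ?case by simp
next
  case (Cons v vs)
  let ?W = "{ws. set ws \<subseteq> BB g \<and> length ws = length vs}"
  let ?c = "\<lambda>ws. sconst (\<Prod>i<length vs. co g (ws ! i) (vs ! i))"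
  have "(\<Sum>ws | set ws \<subseteq> BB g \<and> length ws = length (v # vs). sconst (\<Prod>i<length (v # vs). co g (ws ! i) ((v # vs) ! i)) * \<Phi> ws)
    = (\<Sum>(ws, j)\<in>?W \<times> BB g. sconst (co g j v) * (?c ws * \<Phi> (j # ws)))"
    unfolding length_Cons lists_length_Suc_eq
    by (subst sum.reindex) (auto simp: inj_on_def prod.lessThan_Suc_shift sconst_mult mult.assoc o_def case_prod_unfold intro!: sum.cong simp del: prod.lessThan_Suc)
  also have "\<dots> = (\<Sum>j\<in>BB g. \<Sum>ws\<in>?W. sconst (co g j v) * (?c ws * \<Phi> (j # ws)))"
    by (subst sum.cartesian_product[symmetric], subst sum.swap) (rule refl)
  also have "\<dots> = (\<Sum>j\<in>BB g. sconst (co g j v) * \<Phi> (j # vs))"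
    unfolding sum_distrib_left[symmetric] Cons.IH[OF kcD(5)[OF g Cons.prems], symmetric] ..
  also have "\<dots> = \<Phi> (v # vs)"
    using kc_expand[OF g Cons.prems, of "[]" v vs] by simp
  finally show ?case by simp
qed

text \<open>Summing over all lists of basis vectors counts each wedge product once per ordering.
  This accounts for the factorial and spares an order on the basis.\<close>

lemma kc_wedge:
  assumes "\<Phi> \<in> kc"
  shows "sconst (fact (length vs)) * \<Phi> vs =
    (\<Sum>ws | set ws \<subseteq> BB g \<and> length ws = length vs. sconst (wedge (map (co g) ws) vs) * \<Phi> ws)"
proof -
  let ?n = "length vs" let ?W = "{ws. set ws \<subseteq> BB g \<and> length ws = ?n}" let ?P = "{\<pi>. \<pi> permutes {..<?n}}"
  let ?t = "\<lambda>\<pi> ws. \<Prod>i<?n. co g (ws ! i) (vs ! \<pi> i)"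
  have sg: "sgi (sign \<pi>) x = sconst (of_int (sign \<pi>)) * x" for \<pi> and x :: "'v sym"
    by (cases \<pi> rule: sign_cases) (simp_all add: sgi_def sconst_uminus)
  have "sconst (fact ?n) * \<Phi> vs = (\<Sum>\<pi>\<in>?P. sgi (sign \<pi>) (\<Phi> (map (\<lambda>i. vs ! \<pi> i) [0..<?n])))"
    unfolding alternate_kc[OF assms, symmetric] by (rule alternate_permutations)
  also have "\<dots> = (\<Sum>\<pi>\<in>?P. \<Sum>ws\<in>?W. sconst (of_int (sign \<pi>) * ?t \<pi> ws) * \<Phi> ws)"
    unfolding sg by (subst kc_expand_list[OF assms]) (simp add: sum_distrib_left sconst_mult mult.assoc)
  also have "\<dots> = (\<Sum>ws\<in>?W. \<Sum>\<pi>\<in>?P. sconst (of_int (sign \<pi>) * ?t \<pi> ws) * \<Phi> ws)" by (rule sum.swap)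
  also have "\<dots> = (\<Sum>ws\<in>?W. sconst (wedge (map (co g) ws) vs) * \<Phi> ws)"
  proof (intro sum.cong refl)
    fix ws assume "ws \<in> ?W"
    then have "wedge (map (co g) ws) vs = (\<Sum>\<pi>\<in>?P. of_int (sign \<pi>) * ?t \<pi> ws)"
      unfolding wedge_def by (intro sum.cong arg_cong2[where f = "(*)"] prod.cong) auto
    moreover have "sconst (sum h I) = (\<Sum>i\<in>I. sconst (h i) :: 'v sym)" for h :: "(nat \<Rightarrow> nat) \<Rightarrow> complex" and I
      by (induction I rule: infinite_finite_induct) (simp_all add: sconst_add)
    ultimately show "(\<Sum>\<pi>\<in>?P. sconst (of_int (sign \<pi>) * ?t \<pi> ws) * \<Phi> ws) = sconst (wedge (map (co g) ws) vs) * \<Phi> ws"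
      by (simp add: sum_distrib_right)
  qed
  finally show ?thesis .
qed

lemma H_summand_add: 
  assumes "F' \<in> H_summand p g" "F \<in> H_summand p g" shows "(\<lambda>vs. F vs + F' vs) \<in> H_summand p g"
  using assms
proof induction
  case (add F' s \<xi>s \<eta>s)
  show ?case using H_summand.add[OF add.IH[OF add.prems] add.hyps(2-6)] by (simp add: add.assoc)
qed simp

lemma H_summand_sum: "(\<And>i. i \<in> I \<Longrightarrow> F i \<in> H_summand p g) \<Longrightarrow> (\<lambda>vs. \<Sum>i\<in>I. F i vs) \<in> H_summand p g"
  by (induction I rule: infinite_finite_induct) (auto intro: H_summand.zero H_summand_add)

lemma H_summand_harmonic:
  assumes "F \<in> H_summand p g"
  shows "harmonic g (\<lambda>vs. Poly_Mapping.lookup (F vs) g)"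
  using assms
proof induction
  case zero
  then show ?case by (simp add: harmonic_def[OF g] Sym_zero)
next
  case (add F s \<xi>s \<eta>s)
  have "wedge (\<xi>s @ \<eta>s) vs = 0" if "length vs < length (filter (\<lambda>v. v \<in> fixed g) vs) + codim_fixed g" "length vs = p" for vs
    by (rule wedge_eq_0[where W = "fixed g"]) (use that add.hyps in \<open>auto simp: annihilator_def\<close>)
  then show ?case using add.IH add.hyps(2) unfolding harmonic_def[OF g] decomposable_def
    by (auto simp: lookup_add intro!: Sym.add Sym.mult Sym.const Sym_zero)
qed

text \<open>\<open>H_summand\<close> wants the functionals on \<open>fixed g\<close> first. Sorting
  the entries from \<open>B2\<close> to the end changes the wedge product by a sign, which moves
  into the coefficient.\<close>

lemma basis_decomposable:
  assumes ws: "set ws \<subseteq> BB g" and len: "length ws = p" and s: "s \<in> Sym (fixed g)"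
    and n: "length (filter (\<lambda>w. w \<in> B2 g) ws) = codim_fixed g"
  shows "(\<lambda>vs. if length vs = p then Poly_Mapping.single g (sconst (wedge (map (co g) ws) vs) * s) else 0) \<in> H_summand p g"
proof -
  let ?a = "filter (\<lambda>w. w \<notin> B2 g) ws" let ?b = "filter (\<lambda>w. w \<in> B2 g) ws"
  have "mset ws = mset (?a @ ?b)" 
    unfolding mset_append mset_filter by (rule trans[OF multiset_partition[of "mset ws" "\<lambda>w. w \<in> B2 g"] add.commute])
  then obtain \<sigma> where \<sigma>: "\<sigma> permutes {..<length (?a @ ?b)}" "permute_list \<sigma> (?a @ ?b) = ws"
    by (rule mset_eq_permutation)
  let ?\<xi> = "map (co g) ?a" let ?\<eta> = "map (co g) ?b"
  have "map (co g) ws = permute_list \<sigma> (?\<xi> @ ?\<eta>)"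
    using permute_list_map[OF \<sigma>(1), of "co g"] \<sigma>(2) by simp
  then have w: "wedge (map (co g) ws) vs = of_int (sign \<sigma>) * wedge (?\<xi> @ ?\<eta>) vs" for vs
    using wedge_permute[of \<sigma> "?\<xi> @ ?\<eta>"] \<sigma>(1) by simp
  have lin: "Vector_Spaces.linear scale (*) (co g j)" for j
    by unfold_locales (simp_all add: co_linear[OF g] algebra_simps)
  have "(\<lambda>vs. 0 + decomposable p g (sconst (of_int (sign \<sigma>)) * s) (?\<xi> @ ?\<eta>) vs) \<in> H_summand p g"
  proof (rule H_summand.add[OF H_summand.zero])
    show "sconst (of_int (sign \<sigma>)) * s \<in> Sym (fixed g)" by (intro Sym.mult Sym.const s)
    show "length ?\<xi> + codim_fixed g = p" "length ?\<eta> = codim_fixed g"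
      using n len sum_length_filter_compl[of "\<lambda>w. w \<in> B2 g" ws] by auto
    show "set ?\<xi> \<subseteq> annihilator (fixed_perp g)" "set ?\<eta> \<subseteq> annihilator (fixed g)"
      using ws by (auto simp: annihilator_def lin co_perp[OF g] co_fixed[OF g])
  qed
  then show ?thesis unfolding w by (simp add: decomposable_def[abs_def] sconst_mult mult_ac cong: if_cong)
qed

text \<open>In the expansion \<open>kc_wedge\<close>, harmonicity leaves only lists with a full set
  of entries from \<open>B2\<close>, and these are decomposable.\<close>

lemma harmonic_H_summand:
  assumes \<Phi>: "\<Phi> \<in> kc" and h: "harmonic g \<Phi>"
  shows "(\<lambda>vs. if length vs = p then Poly_Mapping.single g (\<Phi> vs) else 0) \<in> H_summand p g"
proof -
  let ?W = "{ws. set ws \<subseteq> BB g \<and> length ws = p}"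
  \<comment> \<open>The factor \<open>1 / fact p\<close> undoes the factorial of
    \<open>kc_wedge\<close>.\<close>
  let ?D = "\<lambda>ws vs. if length vs = p then Poly_Mapping.single g (sconst (wedge (map (co g) ws) vs) * (sconst (1 / fact p) * \<Phi> ws)) else 0"
  have "?D ws \<in> H_summand p g" if "ws \<in> ?W" for ws
  proof (cases "distinct ws \<and> \<not> length (filter (\<lambda>w. w \<in> B2 g) ws) < codim_fixed g")
    case True
    then show ?thesis using that h count_B2_le[OF g, of ws]
      by (intro basis_decomposable) (auto simp: harmonic_def[OF g] intro: Sym.mult Sym.const)
  next
    case False
    have "\<Phi> ws = 0"
    proof (cases "distinct ws")
      case True
      then show ?thesis using False basis_counts[OF g, of ws] that h by (auto simp: harmonic_def[OF g])
    qed (rule kc_nondistinct[OF g \<Phi>])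
    then have "?D ws = (\<lambda>_. 0)" by (auto simp: fun_eq_iff)
    then show ?thesis by (simp add: H_summand.zero)
  qed
  then have "(\<lambda>vs. \<Sum>ws\<in>?W. ?D ws vs) \<in> H_summand p g" by (rule H_summand_sum)
  moreover have "(\<Sum>ws\<in>?W. ?D ws vs) = (if length vs = p then Poly_Mapping.single g (\<Phi> vs) else 0)" for vs
  proof (cases "length vs = p")
    case True
    have "(\<Sum>ws\<in>?W. Poly_Mapping.single g (sconst (wedge (map (co g) ws) vs) * (sconst (1 / fact p) * \<Phi> ws)))
      = Poly_Mapping.single g (\<Sum>ws\<in>?W. sconst (wedge (map (co g) ws) vs) * (sconst (1 / fact p) * \<Phi> ws))"
      by (rule single_sum[symmetric])
    also have "(\<Sum>ws\<in>?W. sconst (wedge (map (co g) ws) vs) * (sconst (1 / fact p) * \<Phi> ws)) = sconst (1 / fact p) * (sconst (fact p) * \<Phi> vs)"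
      using kc_wedge[OF \<Phi>, of vs] True by (simp add: sum_distrib_left mult.left_commute)
    also have "\<dots> = \<Phi> vs" by (simp add: mult.assoc[symmetric] sconst_mult[symmetric])
    finally show ?thesis using True by simp
  qed simp
  ultimately show ?thesis by simp
qed

end

text \<open>In this description, without wedge products, sums, rescalings and conjugates of elements
  of \<open>H\<close> are readily seen to lie in \<open>H\<close> again.\<close>

theorem H_iff: "F \<in> H \<longleftrightarrow> F \<in> Koszul \<and> (\<forall>g\<in>carrier G. harmonic g (\<lambda>vs. Poly_Mapping.lookup (F vs) g))"
proof -
  have eq: "degree_part p (group_part g F) = (\<lambda>vs. if length vs = p then Poly_Mapping.single g (Poly_Mapping.lookup (F vs) g) else 0)" for p g
    by (auto simp: degree_part_def group_part_def)
  have "harmonic g (\<lambda>vs. Poly_Mapping.lookup (F vs) g)" 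
    if g: "g \<in> carrier G" and *: "\<forall>p. degree_part p (group_part g F) \<in> H_summand p g" for g
  proof -
    \<comment> \<open>The value at \<open>vs\<close> is seen by the part of degree
      \<open>length vs\<close>.\<close>
    have "harmonic g (\<lambda>us. Poly_Mapping.lookup (degree_part (length vs) (group_part g F) us) g)" for vs :: "'v list"
      by (rule H_summand_harmonic[OF g]) (use * in blast)
    note h = this[unfolded eq harmonic_def[OF g]]
    show ?thesis unfolding harmonic_def[OF g]
      using h[THEN conjunct1, THEN spec, of vs vs for vs] h[THEN conjunct2, THEN spec, of vs vs for vs] by simp
  qed
  moreover have "degree_part p (group_part g F) \<in> H_summand p g"
    if g: "g \<in> carrier G" and "F \<in> Koszul" "harmonic g (\<lambda>vs. Poly_Mapping.lookup (F vs) g)" for p g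
    unfolding eq using harmonic_H_summand[OF g kc_component[OF g]] that by (simp add: Koszul_eq)
  ultimately show ?thesis unfolding H_def by blast
qed

end

section \<open>Transport of cochains along the rescaling automorphism\<close>

lemma tail_diff_map:
  assumes "\<And>a b. \<theta> (mul a b) = mul (\<theta> a) (\<theta> b)" "\<And>x y. \<phi> (x - y) = \<phi> x - \<phi> y" "\<And>a x. R a (\<phi> x) = \<phi> (R (\<theta> a) x)"
  shows "tail_diff mul R (\<lambda>m. \<phi> (f (map \<theta> m))) l = \<phi> (tail_diff mul R f (map \<theta> l))"
proof -
  have z: "\<phi> 0 = 0" using assms(2)[of 0 0] by simp
  have n: "\<phi> (- x) = - \<phi> x" for x using assms(2)[of 0 x] z by simp
  show ?thesis
  proof (induction l arbitrary: f)
    case (Cons a l)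
    have "merge_head mul R a (\<lambda>m. \<phi> (f (map \<theta> m))) l = \<phi> (merge_head mul R (\<theta> a) f (map \<theta> l))"
      by (cases l) (simp_all add: assms(1,3))
    then show ?case using Cons.IH[of "\<lambda>m. f (\<theta> a # m)"] by (simp add: assms(2) n)
  qed (simp add: z)
qed

lemma bdiff_map:
  assumes "\<And>a b. \<theta> (mul a b) = mul (\<theta> a) (\<theta> b)" "\<And>x y. \<phi> (x - y) = \<phi> x - \<phi> y"
    "\<And>a x. R a (\<phi> x) = \<phi> (R (\<theta> a) x)" "\<And>a x. L a (\<phi> x) = \<phi> (L (\<theta> a) x)"
  shows "bdiff mul L R (\<lambda>m. \<phi> (f (map \<theta> m))) l = \<phi> (bdiff mul L R f (map \<theta> l))"
proof -
  have z: "\<phi> 0 = 0" using assms(2)[of 0 0] by simp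
  have p: "\<phi> (x + y) = \<phi> x + \<phi> y" for x y using assms(2)[of "x + y" y] by (simp add: algebra_simps)
  have "head_mult L (\<lambda>m. \<phi> (f (map \<theta> m))) l = \<phi> (head_mult L f (map \<theta> l))"
    by (cases l) (simp_all add: z assms(4))
  moreover have "tail_diff mul R (\<lambda>m. \<phi> (f (map \<theta> m))) l = \<phi> (tail_diff mul R f (map \<theta> l))"
    by (rule tail_diff_map) (rule assms)+
  ultimately show ?thesis by (simp add: bdiff_def p)
qed

lemma kdiff_map:
  assumes "\<And>x y. \<phi> (x - y) = \<phi> x - \<phi> y" "\<And>v x. ad v (\<phi> x) = \<phi> (ad (\<theta> v) x)"
  shows "kdiff ad (\<lambda>m. \<phi> (F (map \<theta> m))) vs = \<phi> (kdiff ad F (map \<theta> vs))"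
proof (induction vs arbitrary: F)
  case Nil
  show ?case using assms(1)[of 0 0] by simp
next
  case (Cons v vs)
  show ?case using Cons[of "\<lambda>m. F (\<theta> v # m)"] by (simp add: assms)
qed

lemma insert_alt_map: "insert_alt a (\<lambda>m. f (map \<theta> m)) l = insert_alt (\<theta> a) f (map \<theta> l)"
proof (induction l arbitrary: f)
  case (Cons b l)
  show ?case using Cons[of "\<lambda>m. f (\<theta> b # m)"] by simp
qed simp

lemma alternate_map:
  assumes "\<And>v. \<theta> (av v) = av (s v)"
  shows "alternate av (\<lambda>m. f (map \<theta> m)) vs = alternate av f (map s vs)"
proof (induction vs arbitrary: f)
  case (Cons v vs)
  have "insert_alt (av v) (\<lambda>m. f (map \<theta> m)) = (\<lambda>m. insert_alt (av (s v)) f (map \<theta> m))"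
    by (rule ext) (simp add: insert_alt_map assms)
  then show ?case using Cons by simp
qed simp

text \<open>The result of the inner cochain is carried forward by \<open>\<phi>\<close> and back by
  \<open>\<theta>\<close>. The cancellation is asked on values of \<open>g\<close> only, since the
  maps used below are mutually inverse on the algebra and not on the whole type.\<close>

lemma circ_map:
  fixes \<phi> :: "'a \<Rightarrow> 'a" and F :: "'a list \<Rightarrow> 'b::ab_group_add"
  assumes "\<And>x y. \<psi> (x + y) = \<psi> x + \<psi> y" "\<And>m. \<theta> (\<phi> (g m)) = g m"
  shows "circ q (\<lambda>m. \<phi> (g (map \<theta> m))) (\<lambda>m. \<psi> (F (map \<theta> m))) l = \<psi> (circ q g F (map \<theta> l))"
proof -
  have z: "\<psi> 0 = 0" using assms(1)[of 0 0] by simp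
  have n: "\<psi> (- x) = - \<psi> x" for x using assms(1)[of x "- x"] z by (simp add: minus_unique)
  show ?thesis
  proof (induction l arbitrary: F)
    case (Cons a l)
    show ?case using Cons[of "\<lambda>m. F (\<theta> a # m)"]
      by (simp add: assms z n sg_def take_map[symmetric] drop_map[symmetric])
  qed (simp add: assms z)
qed

lemma circ_inner_hom:
  assumes "\<And>as x bs. F (as @ \<phi> x # bs) = \<psi> (F (as @ x # bs))" "\<And>x y. \<psi> (x + y) = \<psi> x + \<psi> y"
  shows "circ q (\<lambda>m. \<phi> (g m)) F l = \<psi> (circ q g F l)"
proof -
  have z: "\<psi> 0 = 0" using assms(2)[of 0 0] by simp
  have n: "\<psi> (- x) = - \<psi> x" for x using assms(2)[of x "- x"] z by (simp add: minus_unique)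
  show ?thesis using assms(1)
  proof (induction l arbitrary: F)
    case Nil
    then show ?case using Nil.prems[of "[]"] by (simp add: z)
  next
    case (Cons a l)
    have "circ q (\<lambda>m. \<phi> (g m)) (\<lambda>m. F (a # m)) l = \<psi> (circ q g (\<lambda>m. F (a # m)) l)"
      by (rule Cons.IH) (use Cons.prems[of "a # _"] in simp)
    then show ?case using Cons.prems[of "[]"] by (simp add: z n sg_def assms(2))
  qed
qed

lemma brk_diff_left:
  assumes "slot_additive g"
  shows "brk p q (\<lambda>m. f m - f' m) g l = brk p q f g l - brk p q f' g l"
  by (simp add: brk_def circ_diff circ_inner_diff[OF assms] sg_diff)

lemma brk_diff_right:
  assumes "slot_additive f"
  shows "brk p q f (\<lambda>m. g m - g' m) l = brk p q f g l - brk p q f g' l"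
  by (simp add: brk_def circ_diff circ_inner_diff[OF assms] sg_diff)

lemma brk_zero_left: "slot_additive g \<Longrightarrow> brk p q (\<lambda>m. 0) g l = 0"
  using brk_diff_left[of g p q "\<lambda>_. 0" "\<lambda>_. 0" l] by simp

lemma brk_zero_right: "slot_additive f \<Longrightarrow> brk p q f (\<lambda>m. 0) l = 0"
  using brk_diff_right[of f p q "\<lambda>_. 0" "\<lambda>_. 0" l] by simp

lemma ascale_sg: "ascale c (sg n x) = sg n (ascale c x)"
proof -
  interpret vector_space ascale by (rule ascale_vector_space)
  show ?thesis by (simp add: sg_def)
qed

lemma brk_ascale:
  assumes "multilin ascale ascale f" "multilin ascale ascale g"
  shows "brk p q (\<lambda>m. ascale c (f m)) g l = ascale c (brk p q f g l)"
    "brk p q f (\<lambda>m. ascale c (g m)) l = ascale c (brk p q f g l)"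
proof -
  interpret vector_space ascale by (rule ascale_vector_space)
  have 1: "circ n (\<lambda>m. ascale c (h m)) k l = ascale c (circ n h k l)" if "multilin ascale ascale k" for n h k
    by (rule circ_inner_hom[where \<phi> = "ascale c" and \<psi> = "ascale c"]) (simp_all add: multilin_scale[OF that] scale_right_distrib)
  have 2: "circ n h (\<lambda>m. ascale c (k m)) l = ascale c (circ n h k l)" for n h k
    by (rule circ_additive) (rule scale_right_distrib)
  show "brk p q (\<lambda>m. ascale c (f m)) g l = ascale c (brk p q f g l)"
    "brk p q f (\<lambda>m. ascale c (g m)) l = ascale c (brk p q f g l)"
    by (simp_all add: brk_def 1 2 assms scale_right_diff_distrib ascale_sg)
qed

lemma rescale_rescale: "rescale c (rescale d s) = rescale (c * d) s"
  by (rule poly_mapping_eqI) (simp add: lookup_rescale power_mult_distrib)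

lemma rescale_one: "rescale 1 s = s"
  by (rule poly_mapping_eqI) (simp add: lookup_rescale)

context finite_group_module
begin

lemma rescale_Sym: "s \<in> Sym W \<Longrightarrow> rescale c s \<in> Sym W"
  by (induction rule: Sym.induct) (simp_all add: rescale_add rescale_mult rescale_vec Sym.add Sym.mult Sym.const Sym.vec)

lemma rescale_sconst_mult: "rescale c (sconst d * s) = sconst d * rescale c s"
  by (simp add: rescale_mult)

text \<open>The rescaling is preceded by the projection onto the algebra, so for nonzero
  \<open>c\<close> the composite of \<open>tau c\<close> and \<open>tau (1 / c)\<close> is that
  projection, by \<open>tau_tau\<close> and \<open>tau_one\<close>.\<close>

definition tau :: "complex \<Rightarrow> ('g, 'v) skew \<Rightarrow> ('g, 'v) skew"
  where "tau c = amap (\<lambda>s. rescale c (rS s))"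

lemma tau_lookup: "Poly_Mapping.lookup (tau c a) g = (if g \<in> carrier G then rescale c (rS (Poly_Mapping.lookup a g)) else 0)"
  by (simp add: tau_def lookup_amap)

lemma tau_skew [simp]: "tau c a \<in> skew_algebra"
  unfolding tau_def by (rule amap_skew_algebra) (simp add: rescale_Sym)

lemma tau_add: "tau c (a + b) = tau c a + tau c b"
  and tau_ascale: "tau c (ascale d a) = ascale d (tau c a)"
  and tau_zero [simp]: "tau c 0 = 0"
  by (rule poly_mapping_eqI, simp add: tau_lookup lookup_add ascale_lookup rS_add rescale_add rS_sconst_mult rescale_sconst_mult)+

lemma tau_diff: "tau c (a - b) = tau c a - tau c b"
  using tau_add[of c "a - b" b] by (simp add: algebra_simps)

lemma rS_rescale: "rS (rescale c (rS s)) = rescale c (rS s)"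
  by (simp add: rS_id rescale_Sym)

lemma tau_star: "tau c (star a b) = star (tau c a) (tau c b)"
proof (rule poly_mapping_eqI)
  fix k
  have sum: "rescale c (sum f I) = (\<Sum>i\<in>I. rescale c (f i))" for f :: "'g \<Rightarrow> 'v sym" and I
    by (induction I rule: infinite_finite_induct) (simp_all add: rescale_add)
  have "rS (\<Sum>g\<in>carrier G. rS (Poly_Mapping.lookup a g) * act g (rS (Poly_Mapping.lookup b (inv g \<otimes> k))))
    = (\<Sum>g\<in>carrier G. rS (Poly_Mapping.lookup a g) * act g (rS (Poly_Mapping.lookup b (inv g \<otimes> k))))"
    by (intro rS_id Sym_sum Sym.mult) simp_all
  then show "Poly_Mapping.lookup (tau c (star a b)) k = Poly_Mapping.lookup (star (tau c a) (tau c b)) k"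
    by (auto simp: tau_lookup lookup_star sum rescale_mult rS_rescale act_rescale intro!: sum.cong)
qed

lemma tau_rS: "tau c (amap rS a) = tau c a"
  by (rule poly_mapping_eqI) (simp add: tau_lookup lookup_amap)

lemma tau_tau: "tau c (tau d a) = tau (c * d) a"
  by (rule poly_mapping_eqI) (simp add: tau_lookup rS_rescale rescale_rescale)

lemma tau_one: "tau 1 a = amap rS a"
  by (rule poly_mapping_eqI) (simp add: tau_lookup lookup_amap rescale_one)

lemma tau_avec: "tau c (avec v) = avec (scale c v)"
  by (rule poly_mapping_eqI) (auto simp: tau_lookup avec_def lookup_single when_def rS_id rescale_vec vec_scale)

lemma star_rS: "star (amap rS a) b = star a b" "star a (amap rS b) = star a b"
  by (rule poly_mapping_eqI, auto simp: lookup_star lookup_amap intro!: sum.cong)+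

context
  fixes c :: complex assumes c: "c \<noteq> 0"
begin

text \<open>The actions of the automorphism \<open>v \<mapsto> c v\<close> of the algebra on bar and Koszul cochains.\<close>

definition twist :: "(('g, 'v) skew list \<Rightarrow> ('g, 'v) skew) \<Rightarrow> ('g, 'v) skew list \<Rightarrow> ('g, 'v) skew"
  where "twist f l = tau c (f (map (tau (1 / c)) l))"

definition ktwist :: "('v list \<Rightarrow> ('g, 'v) skew) \<Rightarrow> 'v list \<Rightarrow> ('g, 'v) skew"
  where "ktwist F vs = tau c (F (map (scale (1 / c)) vs))"

lemma star_tau: "star a (tau c x) = tau c (star (tau (1 / c) a) x)" "star (tau c x) a = tau c (star x (tau (1 / c) a))"
  using c by (simp_all add: tau_star tau_tau tau_one star_rS)

lemma twist_hcoch: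
  assumes f: "f \<in> K.A.hcoch" shows "twist f \<in> K.A.hcoch"
proof -
  note fm = K.A.hcochD(2)[OF f]
  have "tau (1 / c) (star eA a) = tau (1 / c) a" for a by (simp add: star_e tau_rS)
  then show ?thesis
    unfolding K.A.hcoch_def by (simp add: A_eq multilin_def twist_def tau_add tau_ascale multilin_add[OF fm] multilin_scale[OF fm])
qed

lemma ktwist_kcoch: 
  assumes F: "F \<in> K.A.kcoch" shows "ktwist F \<in> K.A.kcoch"
proof -
  note Fm = K.A.kcochD(2)[OF F]
  have e: "scale (1 / c) (scale d v) = scale d (scale (1 / c) v)" for d v by (simp add: mult.commute)
  show ?thesis
    unfolding K.A.kcoch_def 
    by (simp add: A_eq multilin_def ktwist_def tau_add tau_ascale multilin_add[OF Fm] multilin_scale[OF Fm] K.A.kcochD(3)[OF F] scale_right_distrib e del: scale_scale)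
qed

lemma bd_twist: "K.A.bd (twist f) l = twist (K.A.bd f) l"
  unfolding twist_def[abs_def]
  by (rule bdiff_map) (rule tau_star tau_diff star_tau)+

lemma kd_ktwist: "K.A.kd (ktwist F) vs = ktwist (K.A.kd F) vs"
  unfolding ktwist_def[abs_def]
  by (rule kdiff_map) (simp_all only: K.A.ad_def tau_diff star_tau tau_avec)

lemma alt_twist: "K.A.alt (twist f) vs = ktwist (K.A.alt f) vs"
proof -
  have "K.A.alt (twist f) vs = tau c (K.A.alt (\<lambda>m. f (map (tau (1 / c)) m)) vs)"
    unfolding twist_def[abs_def] by (rule alternate_hom) (rule tau_diff)
  then show ?thesis by (simp add: ktwist_def alternate_map[where \<theta> = "tau (1 / c)" and av = avec and s = "scale (1 / c)", OF tau_avec])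
qed

lemma brk_twist:
  assumes f: "f \<in> K.A.hcoch" and g: "g \<in> K.A.hcoch"
  shows "brk p q (twist f) (twist g) l = twist (brk p q f g) l"
proof -
  have *: "tau (1 / c) (tau c (h m)) = h m" if "h \<in> K.A.hcoch" for h m
    using c K.A.hcochD(1)[OF that, of m] by (simp add: tau_tau tau_one A_eq amap_rS_id)
  have "circ n (twist h) (twist k) l = tau c (circ n h k (map (tau (1 / c)) l))" if "h \<in> K.A.hcoch" for n h k
    unfolding twist_def[abs_def] by (rule circ_map) (simp_all add: tau_add *[OF that])
  moreover have "tau c (sg n x) = sg n (tau c x)" for n x
    using tau_diff[of c 0 x] by (simp add: sg_def)
  ultimately show ?thesis using f g by (simp add: brk_def twist_def tau_diff)
qed

lemma multilin_map_scale:
  fixes F :: "'v list \<Rightarrow> ('g, 'v) skew"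
  assumes "multilin scale ascale F" shows "F (map (scale d) vs) = ascale (d ^ length vs) (F vs)"
proof -
  have "F (as @ map (scale d) vs) = ascale (d ^ length vs) (F (as @ vs))" for as
  proof (induction vs arbitrary: as)
    case Nil
    show ?case by (simp add: ascale_one)
  next
    case (Cons v vs)
    show ?case using Cons[of "as @ [scale d v]"]
      by (simp add: multilin_scale[OF assms] mult.commute)
  qed
  from this[of "[]"] show ?thesis by simp
qed

lemma ktwist_eq: "F \<in> K.A.kcoch \<Longrightarrow> ktwist F vs = ascale ((1 / c) ^ length vs) (tau c (F vs))"
  by (simp add: ktwist_def multilin_map_scale[OF K.A.kcochD(2)] tau_ascale)

lemma tau_constant: 
  assumes "a \<in> skew_algebra" "\<And>g. \<exists>d. Poly_Mapping.lookup a g = sconst d" shows "tau c a = a"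
proof (rule poly_mapping_eqI)
  fix g
  obtain d where "Poly_Mapping.lookup a g = sconst d" using assms(2) by blast
  then show "Poly_Mapping.lookup (tau c a) g = Poly_Mapping.lookup a g"
    using skew_algebraD[OF assms(1), of g] by (auto simp: tau_lookup rS_id)
qed

end

section \<open>Coboundaries, and how the bracket of constant classes scales\<close>

definition exact_in_degree :: "nat \<Rightarrow> (('g, 'v) skew list \<Rightarrow> ('g, 'v) skew) \<Rightarrow> bool"
  where "exact_in_degree p x \<longleftrightarrow> (case p of 0 \<Rightarrow> x = (\<lambda>_. 0) |
    Suc m \<Rightarrow> \<exists>h\<in>K.A.hcoch. supported m h \<and> x = K.A.bd h)"

text \<open>A primitive known only in degree \<open>p\<close> is cut down to degree
  \<open>p - 1\<close>, because \<open>bd_brk\<close> asks for cochains supported in one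
  degree.\<close>

lemma exact_in_degreeI:
  assumes x: "supported p x" and h: "h \<in> K.A.hcoch" "\<And>as. length as = p \<Longrightarrow> x as = K.A.bd h as"
  shows "exact_in_degree p x"
proof (cases p)
  case 0
  have "x as = 0" for as
    using h(2)[of as] x 0 by (cases "as = []") (auto simp: supported_def bdiff_def)
  then show ?thesis using 0 by (auto simp: exact_in_degree_def)
next
  case (Suc m)
  let ?h = "\<lambda>ws. if length ws = m then h ws else 0"
  have "K.A.bd ?h as = x as" for as
  proof (cases "length as = p")
    case True
    have "K.A.bd ?h as = K.A.bd h as" by (rule bdiff_cong) (use True Suc in auto)
    then show ?thesis using h(2)[OF True] by simp
  next
    case False
    then show ?thesis using Suc x by (subst K.A.bd_zero_degree[where n = m]) (auto simp: supported_def)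
  qed
  then show ?thesis using Suc K.A.hcoch_degree[OF h(1), of m]
    by (auto simp: exact_in_degree_def supported_def fun_eq_iff intro!: bexI[of _ ?h])
qed

definition kexact :: "('v list \<Rightarrow> ('g, 'v) skew) \<Rightarrow> bool"
  where "kexact F \<longleftrightarrow> (\<exists>Y\<in>K.A.kcoch. \<forall>vs. F vs = K.A.kd Y vs)"

lemma kexactI: "Y \<in> K.A.kcoch \<Longrightarrow> (\<And>vs. F vs = K.A.kd Y vs) \<Longrightarrow> kexact F"
  unfolding kexact_def by blast

lemma kexactE:
  assumes "kexact F" obtains Y where "Y \<in> K.A.kcoch" "\<And>vs. F vs = K.A.kd Y vs"
  using assms unfolding kexact_def by blast

lemma kexact_zero: "kexact (\<lambda>_. 0)"
  by (rule kexactI[OF K.A.kcoch_zero]) simp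

lemma kexact_add: "kexact F \<Longrightarrow> kexact E \<Longrightarrow> kexact (\<lambda>vs. F vs + E vs)"
  by (elim kexactE, rule kexactI[OF K.A.kcoch_add]) (auto simp: K.A.kd_add)

lemma kexact_ascale: "kexact F \<Longrightarrow> kexact (\<lambda>vs. ascale d (F vs))"
  by (elim kexactE, rule kexactI[OF K.A.kcoch_scale]) (auto simp: K.A.kd_scale)

lemma kexact_diff: "kexact F \<Longrightarrow> kexact E \<Longrightarrow> kexact (\<lambda>vs. F vs - E vs)"
  by (elim kexactE, rule kexactI[OF K.A.kcoch_diff]) (auto simp: K.A.kd_diff)

lemma hcoch_additive: "f \<in> K.A.hcoch \<Longrightarrow> slot_additive f"
  by (rule multilin_slot_additive) (rule K.A.hcochD(2))

text \<open>By the derivation property, the bracket of a coboundary with a cocycle is, up to sign,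
  the coboundary of the bracket with the primitive; antisymmetrisation is a chain map.\<close>

lemma bd_brk_exact_left:
  assumes x: "exact_in_degree p x" and g: "g \<in> K.A.hcoch" "supported q g" "\<And>l. K.A.bd g l = 0"
  shows "kexact (K.A.alt (brk p q x g))"
proof (cases p)
  case 0
  then have "brk p q x g = (\<lambda>_. 0)"
    using x by (auto simp: exact_in_degree_def brk_zero_left[OF hcoch_additive[OF g(1)]])
  moreover have "K.A.alt (\<lambda>_. 0) = (\<lambda>_. 0 :: ('g, 'v) skew)" by (rule ext) (rule alternate_zero)
  ultimately show ?thesis using kexact_zero by simp
next
  case (Suc m)
  then obtain h where h: "h \<in> K.A.hcoch" "supported m h" "x = K.A.bd h"
    using x by (auto simp: exact_in_degree_def)
  have "K.A.bd g = (\<lambda>_. 0)" using g(3) by blast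
  then have "K.A.bd (brk m q h g) l = sg (q + 1) (brk p q x g l)" for l
    using K.bd_brk[OF h(2) hcoch_additive[OF h(1)] g(2) hcoch_additive[OF g(1)], of l]
    by (simp add: brk_zero_right[OF hcoch_additive[OF h(1)]] h(3) Suc)
  then have "brk p q x g l = sg (q + 1) (K.A.bd (brk m q h g) l)" for l
    by (simp add: sg_sg) (simp add: sg_def)
  then have "brk p q x g = (\<lambda>l. ascale ((-1) ^ (q + 1)) (K.A.bd (brk m q h g) l))"
    unfolding ascale_sign by (rule ext)
  then have "K.A.alt (brk p q x g) vs = ascale ((-1) ^ (q + 1)) (K.A.kd (K.A.alt (brk m q h g)) vs)" for vs
    by (simp only: K.A.alt_scale K.A.alt_bd[OF K.brk_hcoch[OF h(1) g(1)]])
  then show ?thesis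
    unfolding K.A.kd_scale[symmetric]
    by (rule kexactI[OF K.A.kcoch_scale[OF K.A.alt_kcoch[OF K.brk_hcoch[OF h(1) g(1)]]]])
qed

lemma bd_brk_exact_right:
  assumes x: "exact_in_degree q x" and f: "f \<in> K.A.hcoch" "supported p f" "\<And>l. K.A.bd f l = 0"
  shows "kexact (K.A.alt (brk p q f x))"
proof (cases q)
  case 0
  then have "brk p q f x = (\<lambda>_. 0)"
    using x by (auto simp: exact_in_degree_def brk_zero_right[OF hcoch_additive[OF f(1)]])
  moreover have "K.A.alt (\<lambda>_. 0) = (\<lambda>_. 0 :: ('g, 'v) skew)" by (rule ext) (rule alternate_zero)
  ultimately show ?thesis using kexact_zero by simp
next
  case (Suc m)
  then obtain h where h: "h \<in> K.A.hcoch" "supported m h" "x = K.A.bd h"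
    using x by (auto simp: exact_in_degree_def)
  have "K.A.bd f = (\<lambda>_. 0)" using f(3) by blast
  then have "brk p q f x = K.A.bd (brk p m f h)"
    using K.bd_brk[OF f(2) hcoch_additive[OF f(1)] h(2) hcoch_additive[OF h(1)]]
    by (auto simp: brk_zero_left[OF hcoch_additive[OF h(1)]] h(3) Suc)
  then show ?thesis
    by (intro kexactI[OF K.A.alt_kcoch[OF K.brk_hcoch[OF f(1) h(1), of p m]]]) (simp add: K.A.alt_bd[OF K.brk_hcoch[OF f(1) h(1)]])
qed

text \<open>Fixes \<open>f\<close> only up to coboundaries, so that results about it apply to
  whichever cocycle \<open>H_to_HH\<close> chooses.\<close>

definition represents :: "nat \<Rightarrow> (('g, 'v) skew list \<Rightarrow> ('g, 'v) skew) \<Rightarrow> ('v list \<Rightarrow> ('g, 'v) skew) \<Rightarrow> bool"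
  where "represents p f \<alpha> \<longleftrightarrow> f \<in> K.A.hcoch \<and> supported p f \<and> (\<forall>l. K.A.bd f l = 0) \<and>
    \<alpha> \<in> K.A.kcoch \<and> kexact (\<lambda>vs. K.A.alt f vs - \<alpha> vs)"

text \<open>The twist fixes the constant values of \<open>\<alpha>\<close> and multiplies each of
  its \<open>p\<close> arguments by \<open>1 / c\<close>, so the difference antisymmetrises to a
  Koszul coboundary. Injectivity of the comparison then gives a bar primitive.\<close>

lemma twist_exact:
  assumes c: "c \<noteq> 0" and f: "represents p f \<alpha>"
    and \<alpha>: "\<And>vs g. \<exists>d. Poly_Mapping.lookup (\<alpha> vs) g = sconst d" "\<And>vs. length vs \<noteq> p \<Longrightarrow> \<alpha> vs = 0"
  shows "exact_in_degree p (\<lambda>l. twist c f l - ascale ((1 / c) ^ p) (f l))"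
proof -
  let ?s = "(1 / c) ^ p" let ?x = "\<lambda>l. twist c f l - ascale ?s (f l)"
  have h: "f \<in> K.A.hcoch" and sup: "supported p f" and d: "K.A.bd f l = 0" and k: "\<alpha> \<in> K.A.kcoch" for l
    using f by (auto simp: represents_def)
  obtain Z where Z: "Z \<in> K.A.kcoch" "\<And>vs. K.A.alt f vs - \<alpha> vs = K.A.kd Z vs"
    using f by (auto simp: represents_def kexact_def)
  have a: "K.A.alt f vs = \<alpha> vs + K.A.kd Z vs" for vs using Z(2)[of vs] by (simp add: algebra_simps)
  have x: "?x \<in> K.A.hcoch" by (intro K.A.hcoch_diff K.A.hcoch_scale twist_hcoch c h)
  have sx: "supported p ?x" using sup K.alg.scale_zero_right by (auto simp: supported_def twist_def[OF c])
  have dx: "K.A.bd ?x l = 0" for l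
    unfolding K.A.bd_diff K.A.bd_scale bd_twist[OF c] by (simp add: twist_def[OF c] d K.alg.scale_zero_right)
  have t\<alpha>: "ktwist c \<alpha> vs = ascale ?s (\<alpha> vs)" for vs
  proof (cases "length vs = p")
    case True
    have "\<alpha> vs \<in> skew_algebra" using K.A.kcochD(1)[OF k] by (simp add: A_eq)
    then have "tau c (\<alpha> vs) = \<alpha> vs" by (rule tau_constant[OF c]) (rule \<alpha>(1))
    then show ?thesis by (simp add: ktwist_eq[OF c k] True)
  qed (simp add: ktwist_eq[OF c k] \<alpha>(2) K.alg.scale_zero_right)
  have "K.A.alt ?x vs = K.A.kd (\<lambda>vs. ktwist c Z vs - ascale ?s (Z vs)) vs" for vs
  proof -
    have "K.A.alt ?x vs = ktwist c (K.A.alt f) vs - ascale ?s (K.A.alt f vs)"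
      unfolding alternate_diff K.A.alt_scale alt_twist[OF c] ..
    also have "ktwist c (K.A.alt f) vs = ktwist c \<alpha> vs + ktwist c (K.A.kd Z) vs"
      by (simp add: ktwist_def[OF c] a tau_add)
    also have "\<dots> - ascale ?s (K.A.alt f vs) = ktwist c (K.A.kd Z) vs - ascale ?s (K.A.kd Z vs)"
      unfolding t\<alpha> a K.alg.scale_right_distrib by simp
    finally show ?thesis unfolding K.A.kd_diff K.A.kd_scale kd_ktwist[OF c] .
  qed
  moreover have "(\<lambda>vs. ktwist c Z vs - ascale ?s (Z vs)) \<in> K.A.kcoch"
    by (intro K.A.kcoch_diff K.A.kcoch_scale ktwist_kcoch c Z)
  ultimately have ex: "\<exists>Z\<in>K.A.kcoch. \<forall>vs. length vs = p \<longrightarrow> K.A.alt ?x vs = K.A.kd Z vs"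
    by (intro bexI[of _ "\<lambda>vs. ktwist c Z vs - ascale ?s (Z vs)"]) (rule allI, rule impI)
  have "\<exists>h\<in>K.A.hcoch. \<forall>as. length as = p \<longrightarrow> ?x as = K.A.bd h as"
    by (rule K.algebra_lifts_and_detects(2)[of p, unfolded K.A.detects_def, THEN bspec, OF x, THEN mp, OF sx[unfolded supported_def],
          THEN mp, OF allI[OF dx], THEN mp, OF ex])
  then show ?thesis using exact_in_degreeI[OF sx] by blast
qed

text \<open>The two twisted cocycles are replaced by scalar multiples of the original ones, one
  after the other; each exchange costs the bracket of a coboundary with a cocycle.\<close>

theorem bracket_scales:
  assumes c: "c \<noteq> 0" and f: "represents p f \<alpha>" and f': "represents q f' \<beta>"
    and \<alpha>: "\<And>vs g. \<exists>d. Poly_Mapping.lookup (\<alpha> vs) g = sconst d" "\<And>vs. length vs \<noteq> p \<Longrightarrow> \<alpha> vs = 0"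
    and \<beta>: "\<And>vs g. \<exists>d. Poly_Mapping.lookup (\<beta> vs) g = sconst d" "\<And>vs. length vs \<noteq> q \<Longrightarrow> \<beta> vs = 0"
  shows "kexact (\<lambda>vs. ktwist c (K.A.alt (brk p q f f')) vs - ascale ((1 / c) ^ (p + q)) (K.A.alt (brk p q f f') vs))"
proof -
  let ?s = "(1 / c) ^ p" let ?s' = "(1 / c) ^ q"
  let ?x = "\<lambda>l. twist c f l - ascale ?s (f l)" let ?y = "\<lambda>l. twist c f' l - ascale ?s' (f' l)"
  have h: "f \<in> K.A.hcoch" "supported p f" "\<And>l. K.A.bd f l = 0"
    and h': "f' \<in> K.A.hcoch" "supported q f'" "\<And>l. K.A.bd f' l = 0"
    using f f' by (auto simp: represents_def)
  have t': "twist c f' \<in> K.A.hcoch" "supported q (twist c f')" "\<And>l. K.A.bd (twist c f') l = 0"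
    using h' by (simp_all add: twist_hcoch[OF c] bd_twist[OF c]) (simp_all add: supported_def twist_def[OF c])
  have x: "exact_in_degree p ?x" by (rule twist_exact[OF c f]) (rule \<alpha>, erule \<alpha>(2))
  have y: "exact_in_degree q ?y" by (rule twist_exact[OF c f']) (rule \<beta>, erule \<beta>(2))
  have 1: "kexact (K.A.alt (brk p q ?x (twist c f')))" by (rule bd_brk_exact_left[OF x]) (rule t')+
  have 2: "kexact (K.A.alt (brk p q f ?y))" by (rule bd_brk_exact_right[OF y]) (rule h)+
  have m: "multilin ascale ascale f" "multilin ascale ascale f'" "multilin ascale ascale (twist c f')"
    using h(1) h'(1) t'(1) K.A.hcochD(2) by auto
  have e: "twist c (brk p q f f') = (\<lambda>l. brk p q ?x (twist c f') l + ascale ?s (brk p q f ?y l + ascale ?s' (brk p q f f' l)))"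
    unfolding brk_diff_left[OF hcoch_additive[OF t'(1)]] brk_diff_right[OF hcoch_additive[OF h(1)]] brk_ascale[OF m(1) m(3)] brk_ascale[OF m(1) m(2)]
      brk_twist[OF c h(1) h'(1)] by (rule ext) simp
  have "ktwist c (K.A.alt (brk p q f f')) vs = K.A.alt (brk p q ?x (twist c f')) vs +
      ascale ?s (K.A.alt (brk p q f ?y) vs + ascale ?s' (K.A.alt (brk p q f f') vs))" for vs
    unfolding alt_twist[OF c, symmetric] e alternate_add K.A.alt_scale ..
  then have "ktwist c (K.A.alt (brk p q f f')) vs - ascale ((1 / c) ^ (p + q)) (K.A.alt (brk p q f f') vs) =
      K.A.alt (brk p q ?x (twist c f')) vs + ascale ?s (K.A.alt (brk p q f ?y) vs)" for vs
    by (simp add: K.alg.scale_right_distrib power_add K.alg.scale_scale)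
  then show ?thesis using kexact_add[OF 1 kexact_ascale[OF 2, of ?s]] by simp
qed

section \<open>Unique representatives in \<open>H\<close>, and the vanishing of the bracket\<close>

lemma harmonic_add: "g \<in> carrier G \<Longrightarrow> harmonic g \<Phi> \<Longrightarrow> harmonic g \<Psi> \<Longrightarrow> harmonic g (\<lambda>vs. \<Phi> vs + \<Psi> vs)"
  by (auto simp: harmonic_def intro: Sym.add)

lemma harmonic_sconst: "g \<in> carrier G \<Longrightarrow> harmonic g \<Phi> \<Longrightarrow> harmonic g (\<lambda>vs. sconst (d vs) * \<Phi> vs)"
  by (auto simp: harmonic_def intro: Sym.mult Sym.const)

lemma harmonic_sum:
  "g \<in> carrier G \<Longrightarrow> (\<And>i. i \<in> I \<Longrightarrow> harmonic g (\<Phi> i)) \<Longrightarrow> harmonic g (\<lambda>vs. \<Sum>i\<in>I. \<Phi> i vs)"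
  by (induction I rule: infinite_finite_induct) (auto intro: harmonic_add simp: harmonic_def[of g "\<lambda>vs. 0"] Sym_zero)

lemma H_iff_kcoch: "F \<in> H \<longleftrightarrow> F \<in> K.A.kcoch \<and> (\<forall>g\<in>carrier G. harmonic g (\<lambda>vs. Poly_Mapping.lookup (F vs) g))"
  by (simp add: H_iff Koszul_eq)

lemma kcoch_skew: "F \<in> K.A.kcoch \<Longrightarrow> F vs \<in> skew_algebra"
  using K.A.kcochD(1) by (simp add: A_eq)

lemma H_add: "F \<in> H \<Longrightarrow> E \<in> H \<Longrightarrow> (\<lambda>vs. F vs + E vs) \<in> H"
  by (auto simp: H_iff_kcoch lookup_add intro: K.A.kcoch_add harmonic_add)

lemma H_ascale: "F \<in> H \<Longrightarrow> (\<lambda>vs. ascale d (F vs)) \<in> H"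
  by (auto simp: H_iff_kcoch ascale_lookup intro: K.A.kcoch_scale harmonic_sconst)

lemma H_diff: "F \<in> H \<Longrightarrow> E \<in> H \<Longrightarrow> (\<lambda>vs. F vs - E vs) \<in> H"
  using H_add[of F "\<lambda>vs. ascale (-1) (E vs)"] H_ascale[of E "-1"] by (simp add: ascale_minus_one)

lemma H_degree_part: 
  assumes "F \<in> H" shows "degree_part p F \<in> H_degree p"
proof -
  have "harmonic g (\<lambda>vs. Poly_Mapping.lookup (degree_part p F vs) g)" if "g \<in> carrier G" for g
    using assms that by (auto simp: H_iff_kcoch harmonic_def degree_part_def Sym_zero)
  moreover have "degree_part p F \<in> K.A.kcoch"
    using K.A.kcoch_degree[of F p] assms by (simp add: H_iff_kcoch degree_part_def[abs_def])
  ultimately show ?thesis by (auto simp: H_iff_kcoch H_degree_def degree_part_def)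
qed

lemma H_degreeD: "F \<in> H_degree p \<Longrightarrow> F \<in> H" "F \<in> H_degree p \<Longrightarrow> length vs \<noteq> p \<Longrightarrow> F vs = 0"
  by (auto simp: H_degree_def degree_part_def dest: fun_cong[of _ _ vs])

lemma skew_eqI:
  assumes "a \<in> skew_algebra" "b \<in> skew_algebra" "\<And>g. g \<in> carrier G \<Longrightarrow> Poly_Mapping.lookup a g = Poly_Mapping.lookup b g"
  shows "a = b"
proof (rule poly_mapping_eqI)
  fix g
  show "Poly_Mapping.lookup a g = Poly_Mapping.lookup b g"
    using assms skew_algebraD(2)[of _ g] by (cases "g \<in> carrier G") auto
qed

lemma H_exact_zero:
  assumes \<gamma>: "\<gamma> \<in> H" and e: "kexact \<gamma>" shows "\<gamma> vs = 0"
proof (rule skew_eqI)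
  show "\<gamma> vs \<in> skew_algebra" using \<gamma> by (simp add: H_iff_kcoch kcoch_skew)
  fix g assume g: "g \<in> carrier G"
  obtain Y where Y: "Y \<in> K.A.kcoch" "\<And>vs. \<gamma> vs = K.A.kd Y vs" using e unfolding kexact_def by blast
  have "Poly_Mapping.lookup (\<gamma> vs) g = 0"
  proof (rule harmonic_boundary[OF g kc_component[OF g Y(1)]])
    show "harmonic g (\<lambda>vs. Poly_Mapping.lookup (\<gamma> vs) g)" using \<gamma> g by (simp add: H_iff_kcoch)
    show "Poly_Mapping.lookup (\<gamma> vs) g = dg g (\<lambda>vs. Poly_Mapping.lookup (Y vs) g) vs" for vs
      unfolding Y(2) by (rule lookup_kd[OF g kcoch_skew[OF Y(1)]])
  qed
  then show "Poly_Mapping.lookup (\<gamma> vs) g = Poly_Mapping.lookup 0 g" by simp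
qed simp

lemma H_cocycle:
  assumes \<gamma>: "\<gamma> \<in> H" shows "K.A.kd \<gamma> vs = 0"
proof (rule skew_eqI)
  have k: "\<gamma> \<in> K.A.kcoch" using \<gamma> by (simp add: H_iff_kcoch)
  show "K.A.kd \<gamma> vs \<in> skew_algebra" by (rule kcoch_skew[OF K.A.kd_kcoch[OF k]])
  fix g assume g: "g \<in> carrier G"
  show "Poly_Mapping.lookup (K.A.kd \<gamma> vs) g = Poly_Mapping.lookup 0 g"
    unfolding lookup_kd[OF g kcoch_skew[OF k]] lookup_zero
    by (rule harmonic_cocycle[OF g kc_component[OF g k]]) (use \<gamma> g in \<open>simp add: H_iff_kcoch\<close>)
qed simp

lemma H_splits:
  assumes F: "F \<in> K.A.kcoch" and d: "\<And>vs. K.A.kd F vs = 0"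
  shows "\<exists>\<gamma>\<in>H. kexact (\<lambda>vs. F vs - \<gamma> vs)"
proof -
  have "\<exists>\<gamma> Z. \<gamma> \<in> kc \<and> Z \<in> kc \<and> harmonic g \<gamma> \<and> (\<forall>vs. Poly_Mapping.lookup (F vs) g = \<gamma> vs + dg g Z vs)" if g: "g \<in> carrier G" for g
    using cocycle_splits[OF g kc_component[OF g F]] lookup_kd[OF g kcoch_skew[OF F], symmetric] d by auto
  then obtain \<gamma> Z where *: "\<And>g. g \<in> carrier G \<Longrightarrow> \<gamma> g \<in> kc \<and> Z g \<in> kc \<and> harmonic g (\<gamma> g) \<and> (\<forall>vs. Poly_Mapping.lookup (F vs) g = \<gamma> g vs + dg g (Z g) vs)"
    by metis
  define total where "total = (\<lambda>\<Phi> (vs :: 'v list). \<Sum>g\<in>carrier G. Poly_Mapping.single g (\<Phi> g vs :: 'v sym))"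
  have lk: "Poly_Mapping.lookup (total \<Phi> vs) g = \<Phi> g vs" if "g \<in> carrier G" for \<Phi> g vs
    using that finite_carrier by (auto simp: total_def lookup_sum lookup_single when_def)
  have k: "total \<Phi> \<in> K.A.kcoch" if "\<And>g. g \<in> carrier G \<Longrightarrow> \<Phi> g \<in> kc" for \<Phi>
    unfolding total_def using that by (intro K.A.kcoch_sum kc_single)
  have \<gamma>: "total \<gamma> \<in> K.A.kcoch" and Z: "total Z \<in> K.A.kcoch" using * k by blast+
  have "total \<gamma> \<in> H" using \<gamma> * by (simp add: H_iff_kcoch lk)
  moreover have "F vs - total \<gamma> vs = K.A.kd (total Z) vs" for vs
  proof (rule skew_eqI)
    show "F vs - total \<gamma> vs \<in> skew_algebra" "K.A.kd (total Z) vs \<in> skew_algebra"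
      using kcoch_skew[OF K.A.kcoch_diff[OF F \<gamma>]] kcoch_skew[OF K.A.kd_kcoch[OF Z]] by auto
    show "Poly_Mapping.lookup (F vs - total \<gamma> vs) g = Poly_Mapping.lookup (K.A.kd (total Z) vs) g" if g: "g \<in> carrier G" for g
      using *[OF g] by (simp add: lookup_kd[OF g kcoch_skew[OF Z]] lk[OF g] lookup_minus)
  qed
  ultimately show ?thesis by (intro bexI[of _ "total \<gamma>"] kexactI[OF Z])
qed

lemma kexact_degree_part: 
  assumes "kexact F" shows "kexact (degree_part p F)"
proof -
  obtain Y where Y: "Y \<in> K.A.kcoch" "\<And>vs. F vs = K.A.kd Y vs" using assms unfolding kexact_def by blast
  show ?thesis
  proof (cases p)
    case 0
    then have "degree_part p F = (\<lambda>_. 0)" by (auto simp: degree_part_def Y(2))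
    then show ?thesis using kexact_zero by simp
  next
    case (Suc m)
    show ?thesis
      by (rule kexactI[OF K.A.kcoch_degree[OF Y(1), of m]], rule K.A.kd_truncate[symmetric])
        (auto simp: degree_part_def Y(2) Suc)
  qed
qed

lemma koszul_image: "F \<in> koszul_d ` Koszul \<longleftrightarrow> kexact F"
proof -
  have "koszul_d Y = K.A.kd Y" if "Y \<in> K.A.kcoch" for Y
    by (rule ext) (rule koszul_d_eq[OF kcoch_skew[OF that]])
  then show ?thesis unfolding kexact_def Koszul_eq by (auto simp: fun_eq_iff image_iff)
qed

text \<open>Two candidates differ by an exact element of \<open>H\<close>, which is 0, so the
  definite description has the value \<open>\<gamma>\<close>.\<close>

lemma HH_to_H_eq:
  assumes "\<gamma> \<in> H_degree p" "kexact (\<lambda>vs. to_koszul p f vs - \<gamma> vs)"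
  shows "HH_to_H p f = \<gamma>"
  unfolding HH_to_H_def koszul_image
proof (rule the_equality)
  fix \<gamma>' assume \<gamma>': "\<gamma>' \<in> H_degree p \<and> kexact (\<lambda>vs. to_koszul p f vs - \<gamma>' vs)"
  have e: "kexact (\<lambda>vs. \<gamma>' vs - \<gamma> vs)"
    using kexact_diff[OF assms(2) conjunct2[OF \<gamma>']] by simp
  have m: "(\<lambda>vs. \<gamma>' vs - \<gamma> vs) \<in> H" using assms(1) \<gamma>' by (intro H_diff) (auto dest: H_degreeD)
  show "\<gamma>' = \<gamma>"
  proof (rule ext)
    fix vs
    show "\<gamma>' vs = \<gamma> vs" using H_exact_zero[OF m e, of vs] by simp
  qed
qed (use assms in simp)

lemma H_degree_splits:
  assumes F: "F \<in> K.A.kcoch" and d: "\<And>vs. K.A.kd F vs = 0" and s: "\<And>vs. length vs \<noteq> p \<Longrightarrow> F vs = 0"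
  shows "\<exists>\<gamma>\<in>H_degree p. kexact (\<lambda>vs. F vs - \<gamma> vs)"
proof -
  obtain \<gamma> where \<gamma>: "\<gamma> \<in> H" "kexact (\<lambda>vs. F vs - \<gamma> vs)" using H_splits[OF F d] by blast
  have "degree_part p (\<lambda>vs. F vs - \<gamma> vs) = (\<lambda>vs. F vs - degree_part p \<gamma> vs)"
    using s by (auto simp: degree_part_def)
  then show ?thesis using kexact_degree_part[OF \<gamma>(2), of p] H_degree_part[OF \<gamma>(1), of p] by auto
qed

lemma alt_cocycle:
  assumes "f \<in> K.A.hcoch" "supported p f" "\<And>l. K.A.bd f l = 0"
  shows "K.A.alt f \<in> K.A.kcoch" "K.A.kd (K.A.alt f) vs = 0" "length vs \<noteq> p \<Longrightarrow> K.A.alt f vs = 0"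
proof -
  show "K.A.alt f \<in> K.A.kcoch" by (rule K.A.alt_kcoch[OF assms(1)])
  have "K.A.bd f = (\<lambda>_. 0)" using assms(3) by blast
  then show "K.A.kd (K.A.alt f) vs = 0" using K.A.alt_bd[OF assms(1), of vs] by simp
  assume "length vs \<noteq> p"
  then have "K.A.alt f vs = K.A.alt (\<lambda>_. 0) vs" using assms(2) by (intro alternate_cong) (auto simp: supported_def)
  then show "K.A.alt f vs = 0" by simp
qed

text \<open>Surjectivity of the comparison provides a cocycle that the choice in
  \<open>H_to_HH\<close> can pick.\<close>

lemma H_to_HH_represents:
  assumes \<alpha>: "\<alpha> \<in> H_degree p" and inv: "\<And>g vs. g \<in> carrier G \<Longrightarrow> K.A.conj_coch g \<alpha> vs = \<alpha> vs"
  shows "bar_cocycle p (H_to_HH p \<alpha>) \<and> represents p (tot p (H_to_HH p \<alpha>)) \<alpha>"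
proof -
  have k: "\<alpha> \<in> K.A.kcoch" using H_degreeD(1)[OF \<alpha>] by (simp add: H_iff_kcoch)
  have a: "\<forall>vs. length vs \<noteq> p \<longrightarrow> \<alpha> vs = 0" "\<forall>vs. K.A.kd \<alpha> vs = 0" "\<forall>g\<in>carrier G. \<forall>vs. K.A.conj_coch g \<alpha> vs = \<alpha> vs"
    using H_degreeD(2)[OF \<alpha>] H_cocycle[OF H_degreeD(1)[OF \<alpha>]] inv by blast+
  have "\<exists>h\<in>K.A.hcoch. (\<forall>as. length as \<noteq> p \<longrightarrow> h as = 0) \<and> (\<forall>as. K.A.bd h as = 0) \<and>
      (\<exists>Z\<in>K.A.kcoch. \<forall>vs. K.A.alt h vs = \<alpha> vs + K.A.kd Z vs)"
    by (rule K.algebra_lifts_and_detects(1)[of p, unfolded K.A.lifts_def, THEN bspec, OF k, THEN mp, OF a(1), THEN mp, OF a(2), THEN mp, OF a(3)])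
  then obtain h Z where h: "h \<in> K.A.hcoch" "supported p h" "\<And>l. K.A.bd h l = 0"
    and Z: "Z \<in> K.A.kcoch" "\<And>vs. K.A.alt h vs = \<alpha> vs + K.A.kd Z vs"
    unfolding supported_def by blast
  note b = bar_cocycleI[OF h]
  have "kexact (\<lambda>vs. to_koszul p h vs - \<alpha> vs)"
    by (rule kexactI[OF Z(1)]) (simp add: to_koszul_tot b(2) Z(2))
  then have "HH_to_H p h = \<alpha>" by (rule HH_to_H_eq[OF \<alpha>])
  then have "bar_cocycle p h \<and> HH_to_H p h = \<alpha>" using b(1) by blast
  then have "bar_cocycle p (H_to_HH p \<alpha>) \<and> HH_to_H p (H_to_HH p \<alpha>) = \<alpha>"
    unfolding H_to_HH_def by (rule someI[where P = "\<lambda>f. bar_cocycle p f \<and> HH_to_H p f = \<alpha>"])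
  then have f: "bar_cocycle p (H_to_HH p \<alpha>)" "HH_to_H p (H_to_HH p \<alpha>) = \<alpha>" by auto
  let ?f = "tot p (H_to_HH p \<alpha>)"
  have t: "?f \<in> K.A.hcoch" "supported p ?f" "\<And>l. K.A.bd ?f l = 0"
    using f(1) tot_hcoch tot_supported bar_cocycle_bd by (auto simp: bar_cocycle_def)
  \<comment> \<open>\<open>HH_to_H\<close> is a definite description, so its value says something
    about the chosen cocycle only once a representative in \<open>H\<close> is known to
    exist.\<close>
  obtain \<gamma> where \<gamma>: "\<gamma> \<in> H_degree p" "kexact (\<lambda>vs. K.A.alt ?f vs - \<gamma> vs)"
    using H_degree_splits[of "K.A.alt ?f" p] alt_cocycle[OF t] by blast
  then have "HH_to_H p (H_to_HH p \<alpha>) = \<gamma>" by (intro HH_to_H_eq) (simp_all add: to_koszul_tot)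
  then show ?thesis using f \<gamma>(2) t k by (auto simp: represents_def)
qed

lemma kexact_ktwist: "c \<noteq> 0 \<Longrightarrow> kexact F \<Longrightarrow> kexact (ktwist c F)"
proof -
  assume c: "c \<noteq> 0" and "kexact F"
  then obtain Y where Y: "Y \<in> K.A.kcoch" "\<And>vs. F vs = K.A.kd Y vs" by (auto elim: kexactE)
  then have "F = K.A.kd Y" by blast
  then show ?thesis by (intro kexactI[OF ktwist_kcoch[OF c Y(1)]]) (simp add: kd_ktwist[OF c])
qed

lemma H_ktwist: 
  assumes c: "c \<noteq> 0" and \<gamma>: "\<gamma> \<in> H" shows "ktwist c \<gamma> \<in> H"
proof -
  have k: "\<gamma> \<in> K.A.kcoch" using \<gamma> by (simp add: H_iff_kcoch)
  have "harmonic g (\<lambda>vs. sconst ((1 / c) ^ length vs) * rescale c (Poly_Mapping.lookup (\<gamma> vs) g))" if g: "g \<in> carrier G" for g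
  proof -
    have "harmonic g (\<lambda>vs. Poly_Mapping.lookup (\<gamma> vs) g)" using \<gamma> g by (simp add: H_iff_kcoch)
    then have "harmonic g (\<lambda>vs. rescale c (Poly_Mapping.lookup (\<gamma> vs) g))"
      unfolding harmonic_def[OF g] by (auto intro: rescale_Sym)
    then show ?thesis by (rule harmonic_sconst[OF g])
  qed
  then show ?thesis using ktwist_kcoch[OF c k]
    by (simp add: H_iff_kcoch ktwist_eq[OF c k] ascale_lookup tau_lookup rS_id skew_algebraD(1)[OF kcoch_skew[OF k]])
qed

lemma HH_to_H_zero:
  assumes "kexact (to_koszul p f)" shows "HH_to_H p f = (\<lambda>_. 0)"
proof (rule HH_to_H_eq)
  have "(\<lambda>_. 0) \<in> H" by (simp add: H_iff_kcoch K.A.kcoch_zero harmonic_def Sym_zero)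
  then show "(\<lambda>_. 0) \<in> H_degree p" by (auto simp: H_degree_def degree_part_def)
qed (use assms in simp)

theorem bar_bracket_vanishes:
  assumes f: "bar_cocycle p f" "represents p (tot p f) \<alpha>" and f': "bar_cocycle q f'" "represents q (tot q f') \<beta>"
    and \<alpha>: "\<And>vs g. \<exists>d. Poly_Mapping.lookup (\<alpha> vs) g = sconst d" "\<And>vs. length vs \<noteq> p \<Longrightarrow> \<alpha> vs = 0"
    and \<beta>: "\<And>vs g. \<exists>d. Poly_Mapping.lookup (\<beta> vs) g = sconst d" "\<And>vs. length vs \<noteq> q \<Longrightarrow> \<beta> vs = 0"
  shows "HH_to_H (p + q - 1) (bar_bracket p q f f') = (\<lambda>_. 0)"
proof (cases "p + q = 0")
  case True
  \<comment> \<open>For \<open>p = q = 0\<close> both circle products are empty sums, and the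
    truncated degree is 0.\<close>
  have "to_koszul (p + q - 1) (bar_bracket p q f f') = (\<lambda>_. 0)"
    using True by (auto simp: to_koszul_def bar_bracket_def circle_product_def)
  then show ?thesis by (intro HH_to_H_zero) (simp add: kexact_zero)
next
  case False
  let ?n = "p + q - 1" let ?B = "brk p q (tot p f) (tot q f')" let ?C = "K.A.alt ?B"
  have h: "tot p f \<in> K.A.hcoch" "supported p (tot p f)" "K.A.bd (tot p f) = (\<lambda>_. 0)"
    and h': "tot q f' \<in> K.A.hcoch" "supported q (tot q f')" "K.A.bd (tot q f') = (\<lambda>_. 0)"
    using f(2) f'(2) by (auto simp: represents_def)
  have "?B \<in> K.A.hcoch" by (rule K.brk_hcoch[OF h(1) h'(1)])
  moreover have "supported ?n ?B"
    unfolding supported_def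
  proof (intro allI impI)
    fix l :: "('g, 'v) skew list" assume "length l \<noteq> ?n"
    then have "length l + 1 \<noteq> p + q" "length l + 1 \<noteq> q + p" using False by auto
    then show "?B l = 0" by (simp add: brk_def circ_degree[OF h(2)] circ_degree[OF h'(2)])
  qed
  moreover have "K.A.bd ?B l = 0" for l
    using K.bd_brk[OF h(2) hcoch_additive[OF h(1)] h'(2) hcoch_additive[OF h'(1)], of l]
    by (simp add: h(3) h'(3) brk_zero_left[OF hcoch_additive[OF h'(1)]] brk_zero_right[OF hcoch_additive[OF h(1)]])
  ultimately obtain \<gamma> where \<gamma>: "\<gamma> \<in> H_degree ?n" "kexact (\<lambda>vs. ?C vs - \<gamma> vs)"
    using H_degree_splits[of ?C ?n] alt_cocycle[of ?B ?n] by blast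
  have \<gamma>H: "\<gamma> \<in> H" by (rule H_degreeD(1)[OF \<gamma>(1)])
  have k: "\<gamma> \<in> K.A.kcoch" using \<gamma>H by (simp add: H_iff_kcoch)
  let ?s = "(1 / 2 :: complex) ^ (p + q)"
  let ?\<delta> = "\<lambda>vs. ktwist 2 \<gamma> vs - ascale ?s (\<gamma> vs)"
  have "kexact (\<lambda>vs. ktwist 2 ?C vs - ascale ?s (?C vs))"
    by (rule bracket_scales[OF _ f(2) f'(2)]) (simp, rule \<alpha>, erule \<alpha>(2), rule \<beta>, erule \<beta>(2))
  moreover have "kexact (\<lambda>vs. ktwist 2 (\<lambda>vs. ?C vs - \<gamma> vs) vs - ascale ?s (?C vs - \<gamma> vs))"
    by (rule kexact_diff[OF kexact_ktwist[OF _ \<gamma>(2)] kexact_ascale[OF \<gamma>(2)]]) simp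
  ultimately have "kexact (\<lambda>vs. (ktwist 2 ?C vs - ascale ?s (?C vs)) - (ktwist 2 (\<lambda>vs. ?C vs - \<gamma> vs) vs - ascale ?s (?C vs - \<gamma> vs)))"
    by (rule kexact_diff)
  moreover have "(ktwist 2 ?C vs - ascale ?s (?C vs)) - (ktwist 2 (\<lambda>vs. ?C vs - \<gamma> vs) vs - ascale ?s (?C vs - \<gamma> vs)) = ?\<delta> vs" for vs
    by (simp add: ktwist_def tau_diff K.alg.scale_right_diff_distrib)
  ultimately have e: "kexact ?\<delta>" by simp
  have m: "?\<delta> \<in> H" by (intro H_diff H_ascale H_ktwist \<gamma>H) simp
  have \<delta>: "?\<delta> vs = 0" for vs by (rule H_exact_zero[OF m e])
  have "\<gamma> vs = 0" for vs
  proof (cases "length vs = ?n")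
    case True
    show ?thesis
    proof (intro poly_mapping_eqI)
      fix g m
      let ?x = "Poly_Mapping.lookup (Poly_Mapping.lookup (\<gamma> vs) g) m"
      have "Poly_Mapping.lookup (Poly_Mapping.lookup (ktwist 2 \<gamma> vs) g) m = Poly_Mapping.lookup (Poly_Mapping.lookup (ascale ?s (\<gamma> vs)) g) m"
        using \<delta>[of vs] by simp
      moreover have "rescale 2 (rS (Poly_Mapping.lookup (\<gamma> vs) g)) = rescale 2 (Poly_Mapping.lookup (\<gamma> vs) g)" "g \<notin> carrier G \<Longrightarrow> Poly_Mapping.lookup (\<gamma> vs) g = 0"
        using skew_algebraD[OF kcoch_skew[OF k]] by (simp_all add: rS_id)
      ultimately have "(1 / 2) ^ ?n * (2 ^ mdeg m * ?x) = ?s * ?x"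
        by (cases "g \<in> carrier G") (simp_all add: ktwist_eq[OF _ k] True ascale_lookup lookup_sconst_mult tau_lookup lookup_rescale)
      \<comment> \<open>The extra factor \<open>1 / 2\<close> is the drop in degree: the two
        cocycles scale by \<open>p + q\<close> together, but their bracket has only
        \<open>p + q - 1\<close> arguments.\<close>
      moreover have "?s = (1 / 2) ^ ?n * (1 / 2)" using False by (cases "p + q") simp_all
      ultimately have "(1 / 2) ^ ?n * (2 ^ mdeg m * ?x) = (1 / 2) ^ ?n * (1 / 2 * ?x)" by simp
      then have "2 ^ mdeg m * ?x = 1 / 2 * ?x" by simp
      then have "(2 ^ Suc (mdeg m) - 1) * ?x = 0" by (simp add: algebra_simps)
      moreover have "(2::complex) ^ Suc (mdeg m) \<noteq> 1"
      proof
        assume "(2::complex) ^ Suc (mdeg m) = 1"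
        then have "of_nat (2 ^ Suc (mdeg m)) = (of_nat 1 :: complex)" by simp
        then have "2 ^ Suc (mdeg m) = (1::nat)" unfolding of_nat_eq_iff .
        then show False by simp
      qed
      ultimately show "?x = Poly_Mapping.lookup (Poly_Mapping.lookup 0 g) m" by simp
    qed
  qed (rule H_degreeD(2)[OF \<gamma>(1)])
  then have "kexact ?C" using \<gamma>(2) by simp
  moreover have "to_koszul ?n (bar_bracket p q f f') vs = ?C vs" for vs
    using to_koszul_bracket[of p f q f' vs] f(1) f'(1) False by (simp add: bar_cocycle_def)
  then have "to_koszul ?n (bar_bracket p q f f') = ?C" by (rule ext)
  ultimately show ?thesis by (intro HH_to_H_zero) simp
qed

subsection \<open>Averages of elements of \<open>H\<close>\<close>

lemma average_eq: 
  assumes "\<And>vs. F vs \<in> skew_algebra" shows "average F = K.A.avg F"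
proof -
  have u: "uG g \<in> skew_algebra" if "g \<in> carrier G" for g
    by (rule skew_algebraI) (use that in \<open>auto simp: lookup_single when_def Sym_one Sym_zero\<close>)
  have "conjugate g a = K.A.conjugation g a" if "g \<in> carrier G" "a \<in> skew_algebra" for g a
    using that u by (simp add: conjugate_def K.A.conjugation_def amult_star star_assoc)
  then show ?thesis using assms
    by (auto simp: average_def K.A.avg_def K.A.conj_coch_def fun_eq_iff intro!: arg_cong[where f = "ascale _"] sum.cong)
qed

lemma lookup_conj_coch:
  assumes F: "\<And>vs. F vs \<in> skew_algebra" and k: "k \<in> carrier G" and h: "h \<in> carrier G"
  shows "Poly_Mapping.lookup (K.A.conj_coch k F vs) h = act k (Poly_Mapping.lookup (F (map (\<rho> (inv k)) vs)) (inv k \<otimes> h \<otimes> k))"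
proof -
  let ?a = "F (map (\<rho> (inv k)) vs)"
  have rS_u: "rS (Poly_Mapping.lookup (uG x) y) = (if y = x then 1 else 0)" for x y
    by (simp add: lookup_single when_def)
  have "Poly_Mapping.lookup (K.A.conj_coch k F vs) h = act k (rS (Poly_Mapping.lookup (star ?a (uG (inv k))) (inv k \<otimes> h)))"
    using k h finite_carrier
    by (simp add: K.A.conj_coch_def K.A.conjugation_def lookup_star[of "uG k"] rS_u if_distrib[of "\<lambda>x. x * _"] sum.delta cong: if_cong)
  also have "rS (Poly_Mapping.lookup (star ?a (uG (inv k))) (inv k \<otimes> h)) = Poly_Mapping.lookup (star ?a (uG (inv k))) (inv k \<otimes> h)"
    using skew_algebraD(1)[OF star_skew] by (rule rS_id)
  also have "\<dots> = (\<Sum>x\<in>carrier G. if x = inv k \<otimes> h \<otimes> k then Poly_Mapping.lookup ?a x else 0)"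
  proof -
    have "inv x \<otimes> (inv k \<otimes> h) = inv k \<longleftrightarrow> x = inv k \<otimes> h \<otimes> k" if x: "x \<in> carrier G" for x
    proof -
      have "inv x \<otimes> (inv k \<otimes> h) = inv k \<longleftrightarrow> x \<otimes> inv k = inv k \<otimes> h"
        using x k h by (metis grp.inv_closed grp.inv_solve_left grp.m_closed)
      also have "\<dots> \<longleftrightarrow> x = inv k \<otimes> h \<otimes> k"
        using x k h by (metis grp.inv_closed grp.inv_inv grp.inv_solve_right grp.m_closed)
      finally show ?thesis .
    qed
    then show ?thesis
      using k h F skew_algebraD(1)[OF F] by (auto simp: lookup_star[of ?a] rS_u rS_id intro!: sum.cong)
  qed
  also have "\<dots> = Poly_Mapping.lookup ?a (inv k \<otimes> h \<otimes> k)"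
    using k h finite_carrier by simp
  finally show ?thesis .
qed

lemma fixed_conj:
  assumes k: "k \<in> carrier G" and h: "h \<in> carrier G"
  shows "v \<in> fixed h \<longleftrightarrow> \<rho> (inv k) v \<in> fixed (inv k \<otimes> h \<otimes> k)"
proof -
  let ?h = "inv k \<otimes> h \<otimes> k"
  have c: "?h \<in> carrier G" using k h by simp
  have "?h \<otimes> inv k = inv k \<otimes> h" using k h by (simp add: grp.m_assoc)
  then have "\<rho> ?h (\<rho> (inv k) v) = \<rho> (inv k) (\<rho> h v)"
    using k h c by (simp add: rho_rho)
  moreover have "\<rho> (inv k) x = \<rho> (inv k) y \<longleftrightarrow> x = y" for x y
    using k by (metis K.A.rho_inv(1))
  ultimately show ?thesis by (simp add: fixed_def)
qed

lemma fixed_conj_image: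
  assumes k: "k \<in> carrier G" and h: "h \<in> carrier G"
  shows "fixed h = \<rho> k ` fixed (inv k \<otimes> h \<otimes> k)"
proof (intro equalityI subsetI)
  fix v assume "v \<in> fixed h"
  then show "v \<in> \<rho> k ` fixed (inv k \<otimes> h \<otimes> k)"
    using fixed_conj[OF k h, of v] K.A.rho_inv(1)[OF k, of v] by (metis image_eqI)
next
  fix v assume "v \<in> \<rho> k ` fixed (inv k \<otimes> h \<otimes> k)"
  then show "v \<in> fixed h" using fixed_conj[OF k h, of v] K.A.rho_inv(2)[OF k] by auto
qed

lemma codim_fixed_conj:
  assumes k: "k \<in> carrier G" and h: "h \<in> carrier G"
  shows "codim_fixed (inv k \<otimes> h \<otimes> k) = codim_fixed h"
proof -
  interpret pair: finite_dimensional_vector_space_pair scale Basis scale Basis ..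
  have "inj (\<rho> k)" using K.A.rho_inv(2)[OF k] by (metis injI)
  then have "dim (\<rho> k ` fixed (inv k \<otimes> h \<otimes> k)) = dim (fixed (inv k \<otimes> h \<otimes> k))"
    by (intro pair.dim_image_eq linear_action[OF k]) (auto intro: inj_on_subset)
  then show ?thesis by (simp add: codim_fixed_def fixed_conj_image[OF k h])
qed

text \<open>Conjugation by \<open>k\<close> carries the component of
  \<open>inv k \<otimes> h \<otimes> k\<close> to that of \<open>h\<close>. It matches the two fixed
  spaces, hence preserves the condition on coefficients and the count of fixed arguments.\<close>

lemma harmonic_conj_coch:
  assumes F: "F \<in> H" and k: "k \<in> carrier G" and h: "h \<in> carrier G"
  shows "harmonic h (\<lambda>vs. Poly_Mapping.lookup (K.A.conj_coch k F vs) h)"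
proof -
  let ?h = "inv k \<otimes> h \<otimes> k"
  have c: "?h \<in> carrier G" using k h by simp
  have Fs: "F vs \<in> skew_algebra" for vs using F by (simp add: H_iff_kcoch kcoch_skew)
  have hF: "harmonic ?h (\<lambda>vs. Poly_Mapping.lookup (F vs) ?h)" using F c by (simp add: H_iff_kcoch)
  have a: "act k s \<in> Sym (fixed h)" if "s \<in> Sym (fixed ?h)" for s
    using that by induction (auto simp: act_add act_mult act_vec[OF k] fixed_conj_image[OF k h] intro: Sym.intros)
  have n: "length (filter (\<lambda>v. v \<in> fixed ?h) (map (\<rho> (inv k)) vs)) = length (filter (\<lambda>v. v \<in> fixed h) vs)" for vs
    by (simp add: filter_map o_def fixed_conj[OF k h, symmetric])
  show ?thesis
    unfolding harmonic_def[OF h] lookup_conj_coch[OF Fs k h]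
  proof (intro conjI allI impI)
    fix vs
    show "act k (Poly_Mapping.lookup (F (map (\<rho> (inv k)) vs)) ?h) \<in> Sym (fixed h)"
      using hF by (intro a) (simp add: harmonic_def[OF c])
    assume "length vs < length (filter (\<lambda>v. v \<in> fixed h) vs) + codim_fixed h"
    then have "Poly_Mapping.lookup (F (map (\<rho> (inv k)) vs)) ?h = 0"
      using hF n[of vs] codim_fixed_conj[OF k h] unfolding harmonic_def[OF c] by (metis length_map)
    then show "act k (Poly_Mapping.lookup (F (map (\<rho> (inv k)) vs)) ?h) = 0" by simp
  qed
qed

lemma average_H:
  assumes "F \<in> H" shows "average F \<in> H"
proof -
  have k: "F \<in> K.A.kcoch" using assms by (simp add: H_iff_kcoch)
  have "harmonic h (\<lambda>vs. Poly_Mapping.lookup (K.A.avg F vs) h)" if h: "h \<in> carrier G" for h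
    unfolding K.A.avg_def ascale_lookup lookup_sum
    by (intro harmonic_sconst harmonic_sum h harmonic_conj_coch assms)
  then show ?thesis using K.A.avg_kcoch[OF k] by (simp add: H_iff_kcoch average_eq[OF kcoch_skew[OF k]])
qed

lemma average_constant:
  assumes F: "F \<in> K.A.kcoch" and c: "\<And>vs g. \<exists>d. Poly_Mapping.lookup (F vs) g = sconst d"
  shows "\<exists>d. Poly_Mapping.lookup (average F vs) h = sconst d"
proof (cases "h \<in> carrier G")
  case True
  have "\<exists>d. Poly_Mapping.lookup (K.A.conj_coch k F vs) h = sconst d" if "k \<in> carrier G" for k
    unfolding lookup_conj_coch[OF kcoch_skew[OF F] that True]
    using c[of "map (\<rho> (inv k)) vs" "inv k \<otimes> h \<otimes> k"] by auto
  then obtain d where d: "\<And>k. k \<in> carrier G \<Longrightarrow> Poly_Mapping.lookup (K.A.conj_coch k F vs) h = sconst (d k)" by metis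
  have "(\<Sum>k\<in>I. sconst (d k)) = (sconst (sum d I) :: 'v sym)" for I
    by (induction I rule: infinite_finite_induct) (simp_all add: sconst_add)
  then have "Poly_Mapping.lookup (average F vs) h = sconst (1 / of_nat (card (carrier G)) * (\<Sum>k\<in>carrier G. d k))"
    by (simp add: average_eq[OF kcoch_skew[OF F]] K.A.avg_def ascale_lookup lookup_sum d sconst_mult[symmetric])
  then show ?thesis by blast
next
  case False
  have "average F vs \<in> skew_algebra"
    using kcoch_skew[OF K.A.avg_kcoch[OF F]] by (simp add: average_eq[OF kcoch_skew[OF F]])
  then show ?thesis using skew_algebraD(2)[OF _ False] by (intro exI[of _ 0]) simp
qed

theorem bracket_degree_constant:
  assumes \<alpha>: "\<alpha> \<in> H" "is_constant \<alpha>" and \<beta>: "\<beta> \<in> H" "is_constant \<beta>"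
  shows "bracket_degree p q (degree_part p (average \<alpha>)) (degree_part q (average \<beta>)) = (\<lambda>_. 0)"
proof -
  have r: "bar_cocycle p (H_to_HH p (degree_part p (average F))) \<and> represents p (tot p (H_to_HH p (degree_part p (average F)))) (degree_part p (average F))"
    and c: "\<exists>d. Poly_Mapping.lookup (degree_part p (average F) vs) g = sconst d"
    if F: "F \<in> H" "is_constant F" for F p vs g
  proof -
    have k: "F \<in> K.A.kcoch" using F(1) by (simp add: H_iff_kcoch)
    note e = average_eq[OF kcoch_skew[OF k]]
    show "bar_cocycle p (H_to_HH p (degree_part p (average F))) \<and> represents p (tot p (H_to_HH p (degree_part p (average F)))) (degree_part p (average F))"
    proof (rule H_to_HH_represents)
      show "degree_part p (average F) \<in> H_degree p" by (intro H_degree_part average_H F)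
      fix g vs assume g: "g \<in> carrier G"
      have "K.A.conj_coch g (K.A.avg F) vs = K.A.avg F vs"
        by (rule K.A.conj_coch_avg[OF g K.A.kcochD(1)[OF k]])
      then show "K.A.conj_coch g (degree_part p (average F)) vs = degree_part p (average F) vs"
        by (simp add: e degree_part_def K.A.conj_coch_def)
    qed
    have "\<exists>d. Poly_Mapping.lookup (average F vs) g = sconst d"
      by (rule average_constant[OF k]) (use F(2) in \<open>simp add: is_constant_def\<close>)
    moreover have "Poly_Mapping.lookup 0 g = (sconst 0 :: 'v sym)" by simp
    ultimately show "\<exists>d. Poly_Mapping.lookup (degree_part p (average F) vs) g = sconst d"
      by (cases "length vs = p") (auto simp: degree_part_def intro: exI[of _ 0])
  qed
  show ?thesis unfolding bracket_degree_def
    by (rule bar_bracket_vanishes[OF conjunct1[OF r[OF \<alpha>]] conjunct2[OF r[OF \<alpha>]] conjunct1[OF r[OF \<beta>]] conjunct2[OF r[OF \<beta>]]])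
      (rule c[OF \<alpha>], simp add: degree_part_def, rule c[OF \<beta>], simp add: degree_part_def)
qed

end

theorem theorem8p1:
  fixes G :: "('g, 'm) monoid_scheme"
    and scale :: "complex \<Rightarrow> 'v::ab_group_add \<Rightarrow> 'v"
    and Basis :: "'v set"
    and \<rho> :: "'g \<Rightarrow> 'v \<Rightarrow> 'v"
    and \<alpha> \<beta> :: "'v list \<Rightarrow> ('g, 'v) skew"
  assumes "finite_group_module G scale Basis \<rho>"
    and "\<alpha> \<in> finite_group_module.H G scale Basis \<rho>"
    and "\<beta> \<in> finite_group_module.H G scale Basis \<rho>"
    and "finite_group_module.is_constant G scale Basis \<alpha>"
    and "finite_group_module.is_constant G scale Basis \<beta>"
  shows "finite_group_module.bracket G scale Basis \<rho> \<alpha> \<beta> = (\<lambda>_. 0)"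
proof -
  interpret finite_group_module G scale Basis \<rho> by (rule assms(1))
  have "bracket_degree p q (degree_part p (average \<alpha>)) (degree_part q (average \<beta>)) = (\<lambda>_. 0)" for p q
    by (rule bracket_degree_constant[OF assms(2,4,3,5)])
  then show ?thesis by (simp add: bracket_def[abs_def])
qed

end
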